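(* Let $f:\mathbb{R}\to\mathbb{R}$ be a normalized stationary centered Gaussian process of class $\mathcal{C}^2$ and let $\kappa$ denote its correlation function. Assume that $\kappa$ and $\kappa''$ are square-integrable on $\mathbb{R}$ and that $\|\kappa\|_{2,\eta}\to 0$ as $\eta\to+\infty$. For $R>0$ let $\nu_R$ be the counting measure of $\{x\in\mathbb{R}\mid f(Rx)=0\}$. Then there exists $\sigma>0$ such that, for any test-functions $\phi_1$ and $\phi_2$, $$m_2(\nu_R)(\phi_1,\phi_2) = R\,\sigma^2\int_{-\infty}^{+\infty}\phi_1(x)\phi_2(x)\,dx + o(R)\qquad\text{as } R\to+\infty.$$ Moreover, $$\sigma^2=\frac1\pi+\frac{2}{\pi^2}\int_0^{+\infty}\left(\frac{1-\kappa(t)^2-\kappa'(t)^2}{(1-\kappa(t)^2)^{3/2}}\left(\sqrt{1-a(t)^2}+a(t)\arcsin(a(t))\right)-1\right)dt,$$ where $a:(0,+\infty)\to[-1,1]$ is the map defined, for all $t>0$, by $a(t)=\dfrac{\kappa(t)\kappa'(t)^2-\kappa(t)^2\kappa''(t)+\kappa''(t)}{1-\kappa(t)^2-\kappa'(t)^2}$.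
   Context: A process is of class $\mathcal{C}^p$ if its trajectories are almost surely $\mathcal{C}^p$. The correlation function is $\kappa(x)=\mathbb{E}[f(0)f(x)]$; a stationary centered Gaussian process of class at least $\mathcal{C}^1$ is normalized if $\kappa(0)=1=-\kappa''(0)$. $\|\kappa\|_{2,\eta}=\sup\{|\kappa^{(l)}(x)|: 0\le l\le 2,\ |x|\ge\eta\}$. $\langle\nu_R,\phi\rangle=\sum_{x:f(Rx)=0}\phi(x)$ (the zero set of $f$ is almost surely closed and discrete). A test-function is a measurable function $\phi:\mathbb{R}\to\mathbb{R}$ that is Lebesgue-integrable, essentially bounded and continuous almost everywhere. $m_2(\nu_R)(\phi_1,\phi_2)=\mathbb{E}\left[\prod_{i=1}^2\left(\langle\nu_R,\phi_i\rangle-\mathbb{E}[\langle\nu_R,\phi_i\rangle]\right)\right]$. *)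

theory Defs
  imports "HOL-Probability.Probability"
begin

text \<open>Processes are families \<open>X t \<omega>\<close> of real random variables indexed by the real time \<open>t\<close>.\<close>

text \<open>Almost surely constant variables are Gaussian, with variance zero.\<close>

definition gaussian_variable :: "'a measure \<Rightarrow> ('a \<Rightarrow> real) \<Rightarrow> bool" where
  "gaussian_variable M Y \<longleftrightarrow>
     Y \<in> borel_measurable M \<and>
     ((\<exists>\<mu>. AE \<omega> in M. Y \<omega> = \<mu>) \<or>
      (\<exists>\<mu> \<sigma>. 0 < \<sigma> \<and> distributed M lborel Y (normal_density \<mu> \<sigma>)))"

definition gaussian_process :: "'a measure \<Rightarrow> (real \<Rightarrow> 'a \<Rightarrow> real) \<Rightarrow> bool" where
  "gaussian_process M X \<longleftrightarrow>
     (\<forall>I c. finite I \<longrightarrow> gaussian_variable M (\<lambda>\<omega>. \<Sum>t\<in>I. c t * X t \<omega>))"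

definition centered_process :: "'a measure \<Rightarrow> (real \<Rightarrow> 'a \<Rightarrow> real) \<Rightarrow> bool" where
  "centered_process M X \<longleftrightarrow> (\<forall>t. integrable M (X t) \<and> (LINT \<omega>|M. X t \<omega>) = 0)"

definition stationary_process :: "'a measure \<Rightarrow> (real \<Rightarrow> 'a \<Rightarrow> real) \<Rightarrow> bool" where
  "stationary_process M X \<longleftrightarrow>
     (\<forall>h I. finite I \<longrightarrow>
        distr M (PiM I (\<lambda>_. borel)) (\<lambda>\<omega>. \<lambda>t\<in>I. X (t + h) \<omega>) =
        distr M (PiM I (\<lambda>_. borel)) (\<lambda>\<omega>. \<lambda>t\<in>I. X t \<omega>))"

definition C_k :: "nat \<Rightarrow> (real \<Rightarrow> real) \<Rightarrow> bool" where
  "C_k p g \<longleftrightarrow>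
     (\<forall>i<p. \<forall>x. (deriv ^^ i) g differentiable (at x)) \<and>
     continuous_on UNIV ((deriv ^^ p) g)"

definition class_C :: "'a measure \<Rightarrow> nat \<Rightarrow> (real \<Rightarrow> 'a \<Rightarrow> real) \<Rightarrow> bool" where
  "class_C M p X \<longleftrightarrow> (AE \<omega> in M. C_k p (\<lambda>t. X t \<omega>))"

definition correlation_function :: "'a measure \<Rightarrow> (real \<Rightarrow> 'a \<Rightarrow> real) \<Rightarrow> real \<Rightarrow> real" where
  "correlation_function M X x = (LINT \<omega>|M. X 0 \<omega> * X x \<omega>)"

definition normalized :: "(real \<Rightarrow> real) \<Rightarrow> bool" where
  "normalized \<kappa> \<longleftrightarrow> \<kappa> 0 = 1 \<and> - (deriv ^^ 2) \<kappa> 0 = 1"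

text \<open>The tail norm takes values in the extended reals, so that the supremum always exists.\<close>

definition tail_norm :: "(real \<Rightarrow> real) \<Rightarrow> nat \<Rightarrow> real \<Rightarrow> ereal" where
  "tail_norm \<kappa> p \<eta> = Sup {ereal \<bar>(deriv ^^ l) \<kappa> x\<bar> | l x. l \<le> p \<and> \<eta> \<le> \<bar>x\<bar>}"

definition test_function :: "(real \<Rightarrow> real) \<Rightarrow> bool" where
  "test_function \<phi> \<longleftrightarrow>
     integrable lebesgue \<phi> \<and>
     (\<exists>C. AE x in lebesgue. \<bar>\<phi> x\<bar> \<le> C) \<and>
     (AE x in lebesgue. isCont \<phi> x)"

definition zero_measure :: "(real \<Rightarrow> 'a \<Rightarrow> real) \<Rightarrow> real \<Rightarrow> 'a \<Rightarrow> real measure" where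
  "zero_measure X R \<omega> = count_space {x. X (R * x) \<omega> = 0}"

text \<open>For \<open>\<nu> = zero_measure X R\<close> the integral below is the sum of \<open>\<phi>\<close> over the
  set of \<open>x\<close> with \<open>X (R * x) \<omega> = 0\<close>, as made explicit by the lemma that follows.\<close>

definition linear_statistic :: "('a \<Rightarrow> real measure) \<Rightarrow> (real \<Rightarrow> real) \<Rightarrow> 'a \<Rightarrow> real" where
  "linear_statistic \<nu> \<phi> \<omega> = (LINT x|\<nu> \<omega>. \<phi> x)"

lemma linear_statistic_zero_measure:
  assumes "integrable (zero_measure X R \<omega>) \<phi>"
  shows "linear_statistic (zero_measure X R) \<phi> \<omega> = (\<Sum>\<^sub>\<infinity>x | X (R * x) \<omega> = 0. \<phi> x)"
  using infsetsum_infsum[of \<phi> "{x. X (R * x) \<omega> = 0}"] assms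
  by (simp add: linear_statistic_def zero_measure_def infsetsum_def abs_summable_on_def)

text \<open>Expectations are taken in the completion of the probability space: the trajectories are
  regular only almost surely and test functions are only Lebesgue measurable, so linear
  statistics need not be measurable before completion.\<close>

definition mean_statistic :: "'a measure \<Rightarrow> ('a \<Rightarrow> real measure) \<Rightarrow> (real \<Rightarrow> real) \<Rightarrow> real" where
  "mean_statistic M \<nu> \<phi> = (LINT \<omega>|completion M. linear_statistic \<nu> \<phi> \<omega>)"

definition m2 ::
  "'a measure \<Rightarrow> ('a \<Rightarrow> real measure) \<Rightarrow> (real \<Rightarrow> real) \<Rightarrow> (real \<Rightarrow> real) \<Rightarrow> real" where
  "m2 M \<nu> \<phi>1 \<phi>2 =
     (LINT \<omega>|completion M.
        (linear_statistic \<nu> \<phi>1 \<omega> - mean_statistic M \<nu> \<phi>1) *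
        (linear_statistic \<nu> \<phi>2 \<omega> - mean_statistic M \<nu> \<phi>2))"

text \<open>All sums and expectations entering \<open>m2\<close> converge absolutely; otherwise they would take
  the default value 0.\<close>

definition m2_well_defined ::
  "'a measure \<Rightarrow> ('a \<Rightarrow> real measure) \<Rightarrow> (real \<Rightarrow> real) \<Rightarrow> (real \<Rightarrow> real) \<Rightarrow> bool" where
  "m2_well_defined M \<nu> \<phi>1 \<phi>2 \<longleftrightarrow>
     (\<forall>\<phi>\<in>{\<phi>1, \<phi>2}. (AE \<omega> in M. integrable (\<nu> \<omega>) \<phi>) \<and>
                  integrable (completion M) (linear_statistic \<nu> \<phi>)) \<and>
     integrable (completion M)
       (\<lambda>\<omega>. (linear_statistic \<nu> \<phi>1 \<omega> - mean_statistic M \<nu> \<phi>1) *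
             (linear_statistic \<nu> \<phi>2 \<omega> - mean_statistic M \<nu> \<phi>2))"

definition a_fun :: "(real \<Rightarrow> real) \<Rightarrow> real \<Rightarrow> real" where
  "a_fun \<kappa> t =
     (\<kappa> t * (deriv \<kappa> t)\<^sup>2 - (\<kappa> t)\<^sup>2 * (deriv ^^ 2) \<kappa> t + (deriv ^^ 2) \<kappa> t) /
     (1 - (\<kappa> t)\<^sup>2 - (deriv \<kappa> t)\<^sup>2)"

definition sigma_integrand :: "(real \<Rightarrow> real) \<Rightarrow> real \<Rightarrow> real" where
  "sigma_integrand \<kappa> t =
     (1 - (\<kappa> t)\<^sup>2 - (deriv \<kappa> t)\<^sup>2) / (1 - (\<kappa> t)\<^sup>2) powr (3 / 2) *
     (sqrt (1 - (a_fun \<kappa> t)\<^sup>2) + a_fun \<kappa> t * arcsin (a_fun \<kappa> t)) - 1"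

end

theory Submission
  imports Defs "HOL-Real_Asymp.Real_Asymp"
begin

text \<open>The Kac--Rice densities of the zeros are obtained as Palm formulas. Locally the value
  \<open>X t\<^sub>0\<close> is split off from the process; for a fixed value of the remaining independent part the
  zeros are level points of a deterministic function, which the area formula integrates, and an
  exponential tilt identifies the result as the conditional law given \<open>X t = 0\<close>. Applied once this
  gives the intensity \<open>1 / \<pi>\<close>, applied twice (the second time to the process conditioned on a zero) it
  gives the pair density \<open>(1 + F) / \<pi>\<^sup>2\<close>, where \<open>F\<close> is the integrand in the formula for \<open>\<sigma>\<^sup>2\<close>. Hence
  the covariance of two linear statistics is the diagonal term \<open>(1 / \<pi>) \<integral> \<phi>\<^sub>1 \<phi>\<^sub>2\<close> plus a double
  integral against \<open>F (y - x) / \<pi>\<^sup>2\<close>. As \<open>F\<close> is bounded near \<open>0\<close> and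
  \<open>O(\<kappa>\<^sup>2 + \<kappa>'\<^sup>2 + \<kappa>''\<^sup>2)\<close> at infinity, it is integrable, and rescaling gives the asymptotics with
  \<open>\<sigma>\<^sup>2 = 1 / \<pi> + (1 / \<pi>\<^sup>2) \<integral> F\<close>. Positivity: with \<open>Z = \<integral> (f\<^sup>2 - f'\<^sup>2)\<close> over \<open>[0, R]\<close> and \<open>N\<close> the number of
  zeros there, \<open>Var (N + Z / (2 \<pi>)) \<ge> 0\<close> bounds \<open>Var N / R\<close> from below by a quantity converging to
  \<open>\<integral> (\<kappa> + \<kappa>'')\<^sup>2 / (2 \<pi>\<^sup>2) > 0\<close>.\<close>

section \<open>Uniqueness of characteristic functions\<close>

text \<open>Independence and conditioning are nowhere expressed by conditional laws. In a linear
  family of centred Gaussian variables they are identities between characteristic functions, hence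
  between covariances; this covers degenerate vectors and infinite families alike. Conditioning on a
  zero at \<open>s\<close> keeps the probability space and replaces every variable by its regression
  residual, which is why the Palm formula can be iterated: the conditioned process is again
  Gaussian, with positive variance away from \<open>s\<close>. Moments are first computed as
  integrals in \<open>ennreal\<close>, and finiteness is read off from the resulting densities. Two
  points resist. At the origin the kernel \<open>F\<close> is of the form 0/0; its boundedness rests
  on the second difference quotients of the paths at 0, whose variances stay bounded because
  pathwise convergence of Gaussian variables forces convergence of their variances. And positivity
  is not visible in the formula: \<open>Z\<close> is chosen since its covariance with
  \<open>N\<close> and its own variance are \<open>- 1 / pi\<close> times and twice the same
  integral, so that \<open>1 / (2 * pi)\<close> is the minimiser of a quadratic polynomial.\<close>

lemma char_eq_cos_sin:
  assumes "real_distribution N"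
  shows "char N a = Complex (LINT x|N. cos (a * x)) (LINT x|N. sin (a * x))"
proof -
  interpret real_distribution N by fact
  have i: "complex_integrable N (\<lambda>x. iexp (a * x))"
    by (rule integrable_iexp) auto
  show ?thesis
    unfolding char_def complex_eq_iff
    using integral_Re[OF i] integral_Im[OF i] by (simp add: Re_exp Im_exp)
qed

text \<open>Levy's theorem concerns probability measures. The cosine identity at
  \<open>a = 0\<close> equates the total masses, so both measures can be divided by the same number
  \<open>m\<close>; mass 0 is treated apart.\<close>

lemma finite_borel_measure_eqI:
  fixes N N' :: "real measure"
  assumes "finite_measure N" "finite_measure N'" and s: "sets N = sets borel" "sets N' = sets borel"
    and c: "\<And>a. (LINT x|N. cos (a * x)) = (LINT x|N'. cos (a * x))"
    and d: "\<And>a. (LINT x|N. sin (a * x)) = (LINT x|N'. sin (a * x))"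
  shows "N = N'"
proof -
  interpret N: finite_measure N by fact
  interpret N': finite_measure N' by fact
  define m where "m = measure N UNIV"
  have sp: "space N = UNIV" "space N' = UNIV" using sets_eq_imp_space_eq[OF s(1)] sets_eq_imp_space_eq[OF s(2)] by auto
  have m': "m = measure N' UNIV" using c[of 0] by (simp add: m_def sp)
  have m0: "m \<ge> 0" by (simp add: m_def)
  have eN: "emeasure N UNIV = ennreal m" "emeasure N' UNIV = ennreal m"
    using N.emeasure_eq_measure N'.emeasure_eq_measure m' by (auto simp: m_def)
  show ?thesis
  proof (cases "m = 0")
    case True
    then have z: "emeasure N UNIV = 0" "emeasure N' UNIV = 0" using eN by auto
    show ?thesis
    proof (rule measure_eqI)
      fix A assume A: "A \<in> sets N"
      have "emeasure N A \<le> emeasure N UNIV" "emeasure N' A \<le> emeasure N' UNIV"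
        by (intro emeasure_mono; use s in auto)+
      then show "emeasure N A = emeasure N' A" using z by simp
    qed (simp add: s)
  next
    case False
    with m0 have mp: "m > 0" by simp
    have rd: "real_distribution (density K (\<lambda>_. ennreal (1/m)))"
      if "sets K = sets borel" "emeasure K UNIV = ennreal m" "space K = UNIV" for K :: "real measure"
    proof -
      have "prob_space (density K (\<lambda>_. ennreal (1/m)))"
        by (rule prob_spaceI) (use that mp in \<open>simp add: emeasure_density ennreal_mult'[symmetric]\<close>)
      then show ?thesis
        by (auto simp: real_distribution_def real_distribution_axioms_def that)
    qed
    have meas[simp]: "borel_measurable N = borel_measurable borel" "borel_measurable N' = borel_measurable borel"
      by (rule measurable_cong_sets[OF s(1) refl], rule measurable_cong_sets[OF s(2) refl])
    have "char (density N (\<lambda>_. ennreal (1/m))) a = char (density N' (\<lambda>_. ennreal (1/m))) a" for a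
      unfolding char_eq_cos_sin[OF rd[OF s(1) eN(1) sp(1)]] char_eq_cos_sin[OF rd[OF s(2) eN(2) sp(2)]]
      using mp m0 by (simp add: integral_density c d)
    then have eq: "density N (\<lambda>_. ennreal (1/m)) = density N' (\<lambda>_. ennreal (1/m))"
      by (intro Levy_uniqueness rd s eN sp ext)
    have inv: "density (density K (\<lambda>_. ennreal (1/m))) (\<lambda>_. ennreal m) = K" for K :: "real measure"
      by (subst density_density_eq) (use mp in \<open>auto simp: ennreal_mult'[symmetric] density_1\<close>)
    show ?thesis using inv[of N] inv[of N'] unfolding eq by (rule subst)
  qed
qed

lemma (in sigma_algebra) sets_Collect_finite_All'':
  assumes "\<And>i. i \<in> S \<Longrightarrow> {x\<in>\<Omega>. P i x} \<in> M" "finite S"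
  shows "{x\<in>\<Omega>. \<forall>i\<in>S. P i x} \<in> M"
  using sets_Collect_finite_All'[OF assms] by (cases "S = {}") auto

text \<open>A set \<open>R\<close> of pairs of random variables with equal characteristic functions, closed under linear
  combinations: conditioning both measures on the event that the two members of a pair lie in a Borel
  set preserves the equality, because the weights \<open>1 + cos Y\<close> and \<open>1 + sin Y\<close> are nonnegative and
  reduce the claim to one-dimensional uniqueness.\<close>

definition same_char :: "'a measure \<Rightarrow> 'b measure \<Rightarrow> (('a \<Rightarrow> real) \<times> ('b \<Rightarrow> real)) set \<Rightarrow> bool" where
  "same_char M M' R \<longleftrightarrow> (\<forall>(Y, Y')\<in>R.
     (LINT w|M. cos (Y w)) = (LINT w|M'. cos (Y' w)) \<and> (LINT w|M. sin (Y w)) = (LINT w|M'. sin (Y' w)))"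

text \<open>The densities \<open>1 + q (Z w)\<close> and \<open>1 + q (Z' w)\<close> define finite
  measures, and the images of these under \<open>Y0\<close> and \<open>Y0'\<close> have the same
  cosine and sine integrals by the product formulas. One-dimensional uniqueness then gives equality
  on every Borel set.\<close>

lemma same_char_distr:
  assumes fin: "finite_measure M" "finite_measure M'"
    and meas: "\<And>Y Y'. (Y, Y') \<in> R \<Longrightarrow> Y \<in> borel_measurable M \<and> Y' \<in> borel_measurable M'"
    and lin: "\<And>Y Y' Z Z' a b. (Y, Y') \<in> R \<Longrightarrow> (Z, Z') \<in> R \<Longrightarrow>
       (\<lambda>w. a * Y w + b * Z w, \<lambda>w. a * Y' w + b * Z' w) \<in> R"
    and sc: "same_char M M' R" and Y0: "(Y0, Y0') \<in> R" and Z: "(Z, Z') \<in> R"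
    and q: "q \<in> {cos, sin}" and B: "B \<in> sets borel"
  shows "(LINT w|M. indicator B (Y0 w) * (1 + q (Z w))) = (LINT w|M'. indicator B (Y0' w) * (1 + q (Z' w)))"
proof -
  interpret M: finite_measure M by fact
  interpret M': finite_measure M' by fact
  have [measurable]: "Y0 \<in> borel_measurable M" "Y0' \<in> borel_measurable M'" "Z \<in> borel_measurable M" "Z' \<in> borel_measurable M'"
    using meas Y0 Z by auto
  have q2: "q = cos \<or> q = sin" using q by auto
  have [measurable]: "q \<in> borel_measurable borel" using q2 by auto
  have qa: "\<bar>q x\<bar> \<le> 1" for x
    using q2 by auto
  have qb: "\<bar>q x\<bar> \<le> 1" "0 \<le> 1 + q x" for x
    using qa[of x] by linarith+
  have ib: "integrable M f" if "f \<in> borel_measurable M" "\<And>x. \<bar>f x\<bar> \<le> 2" for f :: "'a \<Rightarrow> real"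
    by (rule M.integrable_const_bound[of _ 2]) (simp_all add: that)
  have ib': "integrable M' f" if "f \<in> borel_measurable M'" "\<And>x. \<bar>f x\<bar> \<le> 2" for f :: "'b \<Rightarrow> real"
    by (rule M'.integrable_const_bound[of _ 2]) (simp_all add: that)
  let ?D = "density M (\<lambda>w. ennreal (1 + q (Z w)))" and ?D' = "density M' (\<lambda>w. ennreal (1 + q (Z' w)))"
  let ?N = "distr ?D borel Y0" and ?N' = "distr ?D' borel Y0'"
  have ab: "\<bar>1 + q x\<bar> \<le> 2" for x using qb[of x] by auto
  have i1: "integrable M (\<lambda>w. 1 + q (Z w))" "integrable M' (\<lambda>w. 1 + q (Z' w))"
    by (intro ib ib' ab; measurable)+
  have fD: "finite_measure ?D" "finite_measure ?D'"
    by (rule finite_measureI, simp add: emeasure_density nn_integral_eq_integral[OF i1(1)] nn_integral_eq_integral[OF i1(2)] qb)+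
  have fN: "finite_measure ?N" "finite_measure ?N'"
    by (intro finite_measure.finite_measure_distr fD; simp)+
  have int1: "(LINT x|?N. g x) = (LINT w|M. g (Y0 w) * (1 + q (Z w)))" if [measurable]: "g \<in> borel_measurable borel" for g :: "real \<Rightarrow> real"
    by (subst integral_distr, simp, simp, subst integral_real_density) (auto simp: qb mult.commute)
  have int2: "(LINT x|?N'. g x) = (LINT w|M'. g (Y0' w) * (1 + q (Z' w)))" if [measurable]: "g \<in> borel_measurable borel" for g :: "real \<Rightarrow> real"
    by (subst integral_distr, simp, simp, subst integral_real_density) (auto simp: qb mult.commute)
  have RR: "(\<lambda>w. a * Y0 w + b * Z w, \<lambda>w. a * Y0' w + b * Z' w) \<in> R" for a b
    by (rule lin[OF Y0 Z])
  have C: "(LINT w|M. cos (a * Y0 w + b * Z w)) = (LINT w|M'. cos (a * Y0' w + b * Z' w))"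
    and S: "(LINT w|M. sin (a * Y0 w + b * Z w)) = (LINT w|M'. sin (a * Y0' w + b * Z' w))" for a b
    using sc RR[of a b] unfolding same_char_def by auto
  have c2: "\<bar>cos x\<bar> \<le> 2" "\<bar>sin x\<bar> \<le> 2" for x :: real
    using abs_cos_le_one[of x] abs_sin_le_one[of x] by linarith+
  have I: "integrable M (\<lambda>w. cos (a * Y0 w + b * Z w))" "integrable M (\<lambda>w. sin (a * Y0 w + b * Z w))" for a b
    by (rule ib, measurable, rule c2)+
  have I': "integrable M' (\<lambda>w. cos (a * Y0' w + b * Z' w))" "integrable M' (\<lambda>w. sin (a * Y0' w + b * Z' w))" for a b
    by (rule ib', measurable, rule c2)+
  \<comment> \<open>The factors 0, 1 and -1 bring all terms to the form \<open>x + b * z\<close>,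
    the shape for which \<open>lin\<close> and \<open>same_char\<close> provide equality.\<close>
  have prods: "cos x * (1 + cos z) = cos (x + 0 * z) + (cos (x + 1 * z) + cos (x + (-1) * z)) / 2"
    "sin x * (1 + cos z) = sin (x + 0 * z) + (sin (x + 1 * z) + sin (x + (-1) * z)) / 2"
    "cos x * (1 + sin z) = cos (x + 0 * z) + (sin (x + 1 * z) - sin (x + (-1) * z)) / 2"
    "sin x * (1 + sin z) = sin (x + 0 * z) + (cos (x + (-1) * z) - cos (x + 1 * z)) / 2" for x z :: real
    by (simp_all add: cos_add sin_add cos_diff sin_diff field_simps)
  have ce: "(LINT x|?N. cos (a * x)) = (LINT x|?N'. cos (a * x))" for a
  proof -
    have m: "(\<lambda>x. cos (a * x)) \<in> borel_measurable borel" by simp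
    show ?thesis unfolding int1[OF m] int2[OF m]
      using q2 by (elim disjE) (simp_all only: prods Bochner_Integration.integral_add Bochner_Integration.integral_diff
        integral_divide_zero Bochner_Integration.integrable_add Bochner_Integration.integrable_diff integrable_divide_zero I I' C S)
  qed
  have se: "(LINT x|?N. sin (a * x)) = (LINT x|?N'. sin (a * x))" for a
  proof -
    have m: "(\<lambda>x. sin (a * x)) \<in> borel_measurable borel" by simp
    show ?thesis unfolding int1[OF m] int2[OF m]
      using q2 by (elim disjE) (simp_all only: prods Bochner_Integration.integral_add Bochner_Integration.integral_diff
        integral_divide_zero Bochner_Integration.integrable_add Bochner_Integration.integrable_diff integrable_divide_zero I I' C S)
  qed
  have "?N = ?N'" by (rule finite_borel_measure_eqI[OF fN _ _ ce se]) auto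
  then have "(LINT x|?N. indicator B x) = (LINT x|?N'. indicator B x :: real)" by simp
  then show ?thesis using B by (simp only: int1 int2 borel_measurable_indicator)
qed

lemma same_char_restrict:
  assumes fin: "finite_measure M" "finite_measure M'"
    and meas: "\<And>Y Y'. (Y, Y') \<in> R \<Longrightarrow> Y \<in> borel_measurable M \<and> Y' \<in> borel_measurable M'"
    and lin: "\<And>Y Y' Z Z' a b. (Y, Y') \<in> R \<Longrightarrow> (Z, Z') \<in> R \<Longrightarrow>
       (\<lambda>w. a * Y w + b * Z w, \<lambda>w. a * Y' w + b * Z' w) \<in> R"
    and sc: "same_char M M' R" and Y0: "(Y0, Y0') \<in> R" and B: "B \<in> sets borel"
  shows "same_char (density M (\<lambda>w. indicator B (Y0 w))) (density M' (\<lambda>w. indicator B (Y0' w))) R"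
proof -
  interpret M: finite_measure M by fact
  interpret M': finite_measure M' by fact
  have [measurable]: "Y0 \<in> borel_measurable M" "Y0' \<in> borel_measurable M'" using meas Y0 by auto
  have ind: "(\<lambda>w. indicator B (Y w) :: ennreal) = (\<lambda>w. ennreal (indicator B (Y w)))" for Y :: "'c \<Rightarrow> real"
    by (auto simp: indicator_def)
  have key: "(LINT w|density M (\<lambda>w. indicator B (Y0 w)). q (Z w)) = (LINT w|density M' (\<lambda>w. indicator B (Y0' w)). q (Z' w))"
    if Z: "(Z, Z') \<in> R" and q: "q \<in> {cos, sin :: real \<Rightarrow> real}" for Z Z' q
  proof -
    have [measurable]: "Z \<in> borel_measurable M" "Z' \<in> borel_measurable M'" using meas Z by auto
    have q2: "q = cos \<or> q = sin" using q by auto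
    have [measurable]: "q \<in> borel_measurable borel" using q2 by auto
    have qb: "\<bar>q x\<bar> \<le> 1" for x using q2 by auto
    have [measurable]: "B \<in> sets borel" by fact
    have i: "integrable M (\<lambda>w. indicator B (Y0 w) * q (Z w))" "integrable M (\<lambda>w. indicator B (Y0 w) :: real)"
      by (intro M.integrable_const_bound[of _ 1]; auto simp: abs_mult indicator_def qb)+
    have i': "integrable M' (\<lambda>w. indicator B (Y0' w) * q (Z' w))" "integrable M' (\<lambda>w. indicator B (Y0' w) :: real)"
      by (intro M'.integrable_const_bound[of _ 1]; auto simp: abs_mult indicator_def qb)+
    have 1: "(LINT w|M. indicator B (Y0 w) * (1 + q (Z w))) = (LINT w|M'. indicator B (Y0' w) * (1 + q (Z' w)))"
      by (rule same_char_distr[OF fin meas lin sc Y0 Z q B])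
    \<comment> \<open>The zero variable belongs to the class, and its weight
      \<open>1 + sin 0\<close> is 1. This yields the unweighted mass of the event, to be subtracted
      from the weighted one.\<close>
    have zero: "(\<lambda>w. 0 * Z w + 0 * Z w, \<lambda>w. 0 * Z' w + 0 * Z' w) \<in> R" by (rule lin[OF Z Z])
    have 2: "(LINT w|M. indicator B (Y0 w) :: real) = (LINT w|M'. indicator B (Y0' w))"
    proof -
      have sn: "sin \<in> {cos, sin :: real \<Rightarrow> real}" by simp
      have "(LINT w|M. indicator B (Y0 w) * (1 + sin (0 * Z w + 0 * Z w))) = (LINT w|M'. indicator B (Y0' w) * (1 + sin (0 * Z' w + 0 * Z' w)))"
        by (rule same_char_distr[OF fin meas lin sc Y0 zero sn B])
      then show ?thesis
        unfolding mult_zero_left add_0_right sin_zero mult_1_right .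
    qed
    have 3: "(LINT w|density M (\<lambda>w. indicator B (Y0 w)). q (Z w)) = (LINT w|M. indicator B (Y0 w) * q (Z w))"
      unfolding ind by (rule integral_real_density) auto
    have 4: "(LINT w|density M' (\<lambda>w. indicator B (Y0' w)). q (Z' w)) = (LINT w|M'. indicator B (Y0' w) * q (Z' w))"
      unfolding ind by (rule integral_real_density) auto
    have "(LINT w|M. indicator B (Y0 w) * (1 + q (Z w))) = (LINT w|M. indicator B (Y0 w)) + (LINT w|M. indicator B (Y0 w) * q (Z w))"
      unfolding distrib_left mult_1_right by (rule Bochner_Integration.integral_add[OF i(2) i(1)])
    moreover have "(LINT w|M'. indicator B (Y0' w) * (1 + q (Z' w))) = (LINT w|M'. indicator B (Y0' w)) + (LINT w|M'. indicator B (Y0' w) * q (Z' w))"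
      unfolding distrib_left mult_1_right by (rule Bochner_Integration.integral_add[OF i'(2) i'(1)])
    ultimately show ?thesis using 1 2 3 4 by linarith
  qed
  show ?thesis unfolding same_char_def
  proof (clarify, intro conjI)
    fix Z Z' assume "(Z, Z') \<in> R"
    then show "(LINT w|density M (\<lambda>w. indicator B (Y0 w)). cos (Z w)) = (LINT w|density M' (\<lambda>w. indicator B (Y0' w)). cos (Z' w))"
      "(LINT w|density M (\<lambda>w. indicator B (Y0 w)). sin (Z w)) = (LINT w|density M' (\<lambda>w. indicator B (Y0' w)). sin (Z' w))"
      by (rule key, simp)+
  qed
qed

text \<open>Induction on the number of constraints. Imposing \<open>X j w \<in> A j\<close> amounts
  to passing to restricted measures, which again satisfy \<open>same_char\<close>; hence both
  measures are generalised in the induction.\<close>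

lemma same_char_finite:
  assumes fin: "finite_measure M" "finite_measure M'"
    and meas: "\<And>Y Y'. (Y, Y') \<in> R \<Longrightarrow> Y \<in> borel_measurable M \<and> Y' \<in> borel_measurable M'"
    and lin: "\<And>Y Y' Z Z' a b. (Y, Y') \<in> R \<Longrightarrow> (Z, Z') \<in> R \<Longrightarrow>
       (\<lambda>w. a * Y w + b * Z w, \<lambda>w. a * Y' w + b * Z' w) \<in> R"
    and sc: "same_char M M' R" and ne: "R \<noteq> {}"
    and "finite J" and "\<And>j. j \<in> J \<Longrightarrow> (X j, X' j) \<in> R" and "\<And>j. j \<in> J \<Longrightarrow> A j \<in> sets borel"
  shows "emeasure M {w\<in>space M. \<forall>j\<in>J. X j w \<in> A j} = emeasure M' {w\<in>space M'. \<forall>j\<in>J. X' j w \<in> A j}"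
  using \<open>finite J\<close> assms(8-9) fin sc meas
proof (induction J arbitrary: M M' rule: finite_induct)
  case empty
  interpret M: finite_measure M by fact
  interpret M': finite_measure M' by fact
  obtain Z Z' where Z: "(Z, Z') \<in> R" using ne by auto
  have "(\<lambda>w. 0 * Z w + 0 * Z w, \<lambda>w. 0 * Z' w + 0 * Z' w) \<in> R" by (rule lin[OF Z Z])
  then have "measure M (space M) = measure M' (space M')"
    using empty(5) unfolding same_char_def by fastforce
  then show ?case by (simp add: M.emeasure_eq_measure M'.emeasure_eq_measure)
next
  case (insert j J)
  interpret M: finite_measure M by fact
  interpret M': finite_measure M' by fact
  have j: "(X j, X' j) \<in> R" "A j \<in> sets borel" using insert by auto
  have XR: "\<And>i. i \<in> insert j J \<Longrightarrow> (X i, X' i) \<in> R" by (rule insert.prems(1))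
  have Xm[measurable]: "\<And>i. i \<in> insert j J \<Longrightarrow> X i \<in> borel_measurable M" "\<And>i. i \<in> insert j J \<Longrightarrow> X' i \<in> borel_measurable M'"
    using insert.prems(6)[OF XR] by blast+
  have Am[measurable]: "\<And>i. i \<in> insert j J \<Longrightarrow> A i \<in> sets borel" using insert.prems by blast
  have fJ: "finite J" by fact
  let ?D = "density M (\<lambda>w. indicator (A j) (X j w))" and ?D' = "density M' (\<lambda>w. indicator (A j) (X' j w))"
  have "(\<integral>\<^sup>+ w. indicator (A j) (X j w) \<partial>M) \<le> (\<integral>\<^sup>+ w. 1 \<partial>M)" "(\<integral>\<^sup>+ w. indicator (A j) (X' j w) \<partial>M') \<le> (\<integral>\<^sup>+ w. 1 \<partial>M')"
    by (intro nn_integral_mono; auto simp: indicator_def)+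
  moreover have "emeasure M (space M) < \<infinity>" "emeasure M' (space M') < \<infinity>"
    using M.emeasure_finite[of "space M"] M'.emeasure_finite[of "space M'"] unfolding infinity_ennreal_def by (metis top.not_eq_extremum)+
  ultimately have f: "finite_measure ?D" "finite_measure ?D'"
    by (intro finite_measureI; simp add: emeasure_density; fastforce)+
  have IH: "emeasure ?D {w\<in>space ?D. \<forall>j\<in>J. X j w \<in> A j} = emeasure ?D' {w\<in>space ?D'. \<forall>j\<in>J. X' j w \<in> A j}"
  proof (rule insert.IH)
    show "same_char ?D ?D' R" by (rule same_char_restrict[OF insert.prems(3,4) insert.prems(6) lin insert.prems(5) j])
  next
    fix i assume i: "i \<in> J"
    show "(X i, X' i) \<in> R" "A i \<in> sets borel" by (rule insert.prems; simp add: i)+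
  next
    fix Y Y' assume "(Y, Y') \<in> R"
    then show "Y \<in> borel_measurable ?D \<and> Y' \<in> borel_measurable ?D'" using insert.prems(6)[of Y Y'] by simp
  qed (fact f)+
  have e1: "emeasure ?D {w\<in>space ?D. \<forall>j\<in>J. X j w \<in> A j} = emeasure M {w\<in>space M. \<forall>j\<in>insert j J. X j w \<in> A j}"
  proof -
    have "{w\<in>space M. \<forall>j\<in>J. X j w \<in> A j} \<in> sets M"
      by (intro sets.sets_Collect_finite_All'' fJ) (use Xm Am in auto)
    moreover have "{w\<in>space M. \<forall>j\<in>insert j J. X j w \<in> A j} \<in> sets M"
      by (intro sets.sets_Collect_finite_All'' finite.insertI fJ) (use Xm Am in auto)
    ultimately show ?thesis
      by (subst emeasure_density)
        (auto simp: indicator_def simp flip: nn_integral_indicator intro!: nn_integral_cong)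
  qed
  have e2: "emeasure ?D' {w\<in>space ?D'. \<forall>j\<in>J. X' j w \<in> A j} = emeasure M' {w\<in>space M'. \<forall>j\<in>insert j J. X' j w \<in> A j}"
  proof -
    have "{w\<in>space M'. \<forall>j\<in>J. X' j w \<in> A j} \<in> sets M'"
      by (intro sets.sets_Collect_finite_All'' fJ) (use Xm Am in auto)
    moreover have "{w\<in>space M'. \<forall>j\<in>insert j J. X' j w \<in> A j} \<in> sets M'"
      by (intro sets.sets_Collect_finite_All'' finite.insertI fJ) (use Xm Am in auto)
    ultimately show ?thesis
      by (subst emeasure_density)
        (auto simp: indicator_def simp flip: nn_integral_indicator intro!: nn_integral_cong)
  qed
  show ?case using IH e1 e2 by simp
qed

lemma sum_comb_closed:
  fixes X :: "'i \<Rightarrow> 'a \<Rightarrow> real"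
  assumes "finite I" "finite J"
  shows "a * (\<Sum>i\<in>I. c i * X i w) + b * (\<Sum>i\<in>J. d i * X i w) =
    (\<Sum>i\<in>I \<union> J. (a * (if i \<in> I then c i else 0) + b * (if i \<in> J then d i else 0)) * X i w)"
proof -
  have "(\<Sum>i\<in>I. c i * X i w) = (\<Sum>i\<in>I \<union> J. (if i \<in> I then c i else 0) * X i w)"
    by (rule sum.mono_neutral_cong_left) (use assms in auto)
  moreover have "(\<Sum>i\<in>J. d i * X i w) = (\<Sum>i\<in>I \<union> J. (if i \<in> J then d i else 0) * X i w)"
    by (rule sum.mono_neutral_cong_left) (use assms in auto)
  moreover have "(\<Sum>i\<in>I \<union> J. (a * (if i \<in> I then c i else 0) + b * (if i \<in> J then d i else 0)) * X i w) =
      (\<Sum>i\<in>I \<union> J. a * ((if i \<in> I then c i else 0) * X i w) + b * ((if i \<in> J then d i else 0) * X i w))"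
    by (rule sum.cong) (auto simp: algebra_simps)
  ultimately show ?thesis
    by (simp only: sum_distrib_left sum.distrib)
qed

theorem distr_PiM_eqI_char:
  fixes X :: "'i \<Rightarrow> 'a \<Rightarrow> real" and X' :: "'i \<Rightarrow> 'b \<Rightarrow> real"
  assumes fin: "finite_measure M" "finite_measure M'"
    and meas: "\<And>i. X i \<in> borel_measurable M" "\<And>i. X' i \<in> borel_measurable M'"
    and c: "\<And>I c. finite I \<Longrightarrow> (LINT w|M. cos (\<Sum>i\<in>I. c i * X i w)) = (LINT w|M'. cos (\<Sum>i\<in>I. c i * X' i w))"
    and s: "\<And>I c. finite I \<Longrightarrow> (LINT w|M. sin (\<Sum>i\<in>I. c i * X i w)) = (LINT w|M'. sin (\<Sum>i\<in>I. c i * X' i w))"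
  shows "distr M (PiM UNIV (\<lambda>_. borel)) (\<lambda>w i. X i w) = distr M' (PiM UNIV (\<lambda>_. borel)) (\<lambda>w i. X' i w)"
proof -
  let ?P = "PiM UNIV (\<lambda>_::'i. borel :: real measure)"
  define R where "R = {(\<lambda>w. \<Sum>i\<in>I. c i * X i w, \<lambda>w. \<Sum>i\<in>I. c i * X' i w) | I c. finite I}"
  have mX: "(\<lambda>w i. X i w) \<in> M \<rightarrow>\<^sub>M ?P" "(\<lambda>w i. X' i w) \<in> M' \<rightarrow>\<^sub>M ?P"
    by (rule measurable_PiM_single'; simp add: meas)+
  have RI: "(\<lambda>w. \<Sum>i\<in>I. c i * X i w, \<lambda>w. \<Sum>i\<in>I. c i * X' i w) \<in> R" if "finite I" for I c
    unfolding R_def by (rule CollectI, rule exI[of _ I], rule exI[of _ c]) (simp add: that)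
  have RE: thesis if "(Y, Y') \<in> R"
    "\<And>I c. finite I \<Longrightarrow> Y = (\<lambda>w. \<Sum>i\<in>I. c i * X i w) \<Longrightarrow> Y' = (\<lambda>w. \<Sum>i\<in>I. c i * X' i w) \<Longrightarrow> thesis" for Y Y' thesis
    using that(1) unfolding R_def by (elim CollectE exE conjE Pair_inject) (rule that(2))
  have Rm: "Y \<in> borel_measurable M \<and> Y' \<in> borel_measurable M'" if "(Y, Y') \<in> R" for Y Y'
    by (rule RE[OF that]) (use meas in \<open>simp add: borel_measurable_sum borel_measurable_times\<close>)
  have lin: "(\<lambda>w. a * Y w + b * Z w, \<lambda>w. a * Y' w + b * Z' w) \<in> R"
    if YR: "(Y, Y') \<in> R" and ZR: "(Z, Z') \<in> R" for Y Y' Z Z' a b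
  proof -
    obtain I c where I: "finite I" "Y = (\<lambda>w. \<Sum>i\<in>I. c i * X i w)" "Y' = (\<lambda>w. \<Sum>i\<in>I. c i * X' i w)"
      by (rule RE[OF YR])
    obtain J d where J: "finite J" "Z = (\<lambda>w. \<Sum>i\<in>J. d i * X i w)" "Z' = (\<lambda>w. \<Sum>i\<in>J. d i * X' i w)"
      by (rule RE[OF ZR])
    have "finite (I \<union> J)" using I J by simp
    then show ?thesis unfolding I(2,3) J(2,3) sum_comb_closed[OF I(1) J(1)]
      by (rule RI[where c="\<lambda>i. a * (if i \<in> I then c i else 0) + b * (if i \<in> J then d i else 0)"])
  qed
  have sc: "same_char M M' R"
    unfolding same_char_def
  proof clarify
    fix Y Y' assume "(Y, Y') \<in> R"
    then show "(LINT w|M. cos (Y w)) = (LINT w|M'. cos (Y' w)) \<and> (LINT w|M. sin (Y w)) = (LINT w|M'. sin (Y' w))"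
      by (rule RE) (simp only: c s)
  qed
  have single: "(X j, X' j) \<in> R" for j
    using RI[of "{j}" "\<lambda>_. 1"] by simp
  then have ne: "R \<noteq> {}" by blast
  show ?thesis
  proof (rule measure_eqI_PiM_infinite)
    fix A :: "'i \<Rightarrow> real set" and J :: "'i set" assume J: "finite J" "J \<subseteq> UNIV" "\<And>i. i \<in> J \<Longrightarrow> A i \<in> sets borel"
    let ?E = "prod_emb UNIV (\<lambda>_. borel) J (Pi\<^sub>E J A)"
    have E: "?E \<in> sets ?P" by (rule sets_PiM_I) (use J in simp_all)
    have e: "(\<lambda>w i. X i w) -` ?E \<inter> space M = {w\<in>space M. \<forall>j\<in>J. X j w \<in> A j}"
      "(\<lambda>w i. X' i w) -` ?E \<inter> space M' = {w\<in>space M'. \<forall>j\<in>J. X' j w \<in> A j}"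
      by (auto simp: prod_emb_def PiE_iff)
    show "emeasure (distr M ?P (\<lambda>w i. X i w)) ?E = emeasure (distr M' ?P (\<lambda>w i. X' i w)) ?E"
      unfolding emeasure_distr[OF mX(1) E] emeasure_distr[OF mX(2) E] e
      by (rule same_char_finite[OF fin Rm lin sc ne J(1) single J(3)])
  next
    show "finite_measure (distr M ?P (\<lambda>w i. X i w))" by (rule finite_measure.finite_measure_distr[OF fin(1) mX(1)])
  qed simp_all
qed

section \<open>The area formula\<close>

abbreviation ncard :: "'a set \<Rightarrow> ennreal" where
  "ncard \<equiv> emeasure (count_space UNIV)"

definition dyadic_pt :: "real \<Rightarrow> real \<Rightarrow> nat \<Rightarrow> nat \<Rightarrow> real" where
  "dyadic_pt a b n k = a + (b - a) * (real k / 2 ^ n)"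

text \<open>Half-open pieces partition \<open>{a..<b}\<close> exactly, so that no point is counted
  twice at a dyadic endpoint.\<close>

definition dyadic_piece :: "real \<Rightarrow> real \<Rightarrow> nat \<Rightarrow> nat \<Rightarrow> real set" where
  "dyadic_piece a b n k = {dyadic_pt a b n k ..< dyadic_pt a b n (Suc k)}"

definition dyadic_index :: "real \<Rightarrow> real \<Rightarrow> nat \<Rightarrow> real \<Rightarrow> nat" where
  "dyadic_index a b n x = nat \<lfloor>2 ^ n * ((x - a) / (b - a))\<rfloor>"

lemma dyadic_piece_iff:
  assumes "a < b" "a \<le> x"
  shows "x \<in> dyadic_piece a b n k \<longleftrightarrow> dyadic_index a b n x = k"
proof -
  define u where "u = (x - a) / (b - a)"
  have u: "0 \<le> u" "x = a + (b - a) * u" using assms by (auto simp: u_def)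
  have "x \<in> dyadic_piece a b n k \<longleftrightarrow> real k \<le> 2 ^ n * u \<and> 2 ^ n * u < real (Suc k)"
    using assms(1) by (simp add: dyadic_piece_def dyadic_pt_def u(2) pos_divide_le_eq pos_less_divide_eq mult.commute)
  also have "\<dots> \<longleftrightarrow> \<lfloor>2 ^ n * u\<rfloor> = int k"
    by (subst floor_eq_iff) auto
  also have "\<dots> \<longleftrightarrow> dyadic_index a b n x = k"
    using u(1) unfolding dyadic_index_def u_def[symmetric]
    by (smt (verit) nat_int int_nat_eq mult_nonneg_nonneg zero_le_power zero_le_floor)
  finally show ?thesis .
qed

lemma dyadic_index_less:
  assumes "a < b" "x \<in> {a..<b}"
  shows "dyadic_index a b n x < 2 ^ n"
proof -
  have "2 ^ n * ((x - a) / (b - a)) < 2 ^ n" using assms by (simp add: field_simps)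
  then have "\<lfloor>2 ^ n * ((x - a) / (b - a))\<rfloor> < int (2 ^ n)" by (subst floor_less_iff) simp
  then show ?thesis unfolding dyadic_index_def by (simp add: zless_nat_conj nat_less_iff)
qed

lemma dyadic_index_Suc:
  assumes "a < b" "a \<le> x"
  shows "dyadic_index a b n x = dyadic_index a b (Suc n) x div 2"
proof -
  have halve: "2 ^ Suc n * z / real_of_int 2 = 2 ^ n * z" for z :: real by simp
  have "2 ^ n * ((x - a) / (b - a)) = 2 ^ Suc n * ((x - a) / (b - a)) / real_of_int 2"
    by (rule halve[symmetric])
  then have "\<lfloor>2 ^ n * ((x - a) / (b - a))\<rfloor> = \<lfloor>2 ^ Suc n * ((x - a) / (b - a)) / real_of_int 2\<rfloor>" by (rule arg_cong)
  also have "\<dots> = \<lfloor>2 ^ Suc n * ((x - a) / (b - a))\<rfloor> div 2" by (rule floor_divide_real_eq_div) simp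
  finally show ?thesis unfolding dyadic_index_def
    using assms by (simp add: nat_div_distrib)
qed

text \<open>Two points at relative distance \<open>d\<close> have different indices as soon as
  \<open>2 ^ n * d \<ge> 1\<close>; for a finite set there are only finitely many pairs to
  separate.\<close>

lemma dyadic_index_inj:
  assumes "a < b" "finite F" "F \<subseteq> {a..<b}"
  shows "\<exists>n. inj_on (dyadic_index a b n) F"
proof -
  have 1: "\<forall>\<^sub>F n in sequentially. dyadic_index a b n x \<noteq> dyadic_index a b n y" if "x < y" "a \<le> x" for x y
  proof -
    define d where "d = (y - x) / (b - a)"
    have d: "d > 0" using that assms by (simp add: d_def)
    have "filterlim (\<lambda>n. 2 ^ n * d) at_top sequentially"
      using d by real_asymp
    then have "\<forall>\<^sub>F n in sequentially. 2 ^ n * d \<ge> 1" by (simp add: filterlim_at_top)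
    then show ?thesis
    proof eventually_elim
      case (elim n)
      let ?u = "2 ^ n * ((x - a) / (b - a))" and ?v = "2 ^ n * ((y - a) / (b - a))"
      have "(y - a) / (b - a) = (x - a) / (b - a) + d" by (simp add: d_def diff_divide_distrib)
      then have "?v = ?u + 2 ^ n * d" by (simp only: distrib_left)
      then have "?v \<ge> ?u + 1" using elim by linarith
      then have "\<lfloor>?u\<rfloor> < \<lfloor>?v\<rfloor>" by linarith
      moreover have "0 \<le> \<lfloor>?u\<rfloor>" using that assms by simp
      ultimately show ?case unfolding dyadic_index_def by linarith
    qed
  qed
  have "\<forall>\<^sub>F n in sequentially. \<forall>x\<in>F. \<forall>y\<in>F. x < y \<longrightarrow> dyadic_index a b n x \<noteq> dyadic_index a b n y"
  proof (rule eventually_ball_finite[OF assms(2)], rule ballI, rule eventually_ball_finite[OF assms(2)], rule ballI)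
    fix x y assume "x \<in> F" "y \<in> F"
    then show "\<forall>\<^sub>F n in sequentially. x < y \<longrightarrow> dyadic_index a b n x \<noteq> dyadic_index a b n y"
      using 1[of x y] assms(3) by (cases "x < y") auto
  qed
  then obtain n where n: "\<forall>x\<in>F. \<forall>y\<in>F. x < y \<longrightarrow> dyadic_index a b n x \<noteq> dyadic_index a b n y"
    by (auto simp: eventually_sequentially)
  have "inj_on (dyadic_index a b n) F"
  proof (rule inj_onI, rule ccontr)
    fix x y assume "x \<in> F" "y \<in> F" "dyadic_index a b n x = dyadic_index a b n y" "x \<noteq> y"
    then show False using n by (metis linorder_neq_iff)
  qed
  then show ?thesis ..
qed

text \<open>A lower approximation of the cardinality that depends only on which pieces are met. For
  a level set of \<open>h\<close> it is measurable in the level: a piece is met exactly if the level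
  lies in its image under \<open>h\<close>.\<close>

definition dyadic_count :: "real \<Rightarrow> real \<Rightarrow> nat \<Rightarrow> real set \<Rightarrow> ennreal" where
  "dyadic_count a b n S = (\<Sum>k<2 ^ n. if S \<inter> dyadic_piece a b n k = {} then 0 else 1)"

lemma dyadic_count_eq:
  assumes "a < b" "S \<subseteq> {a..<b}"
  shows "dyadic_count a b n S = of_nat (card (dyadic_index a b n ` S))"
proof -
  have "dyadic_count a b n S = (\<Sum>k<2 ^ n. if k \<in> dyadic_index a b n ` S then 1 else 0)"
    unfolding dyadic_count_def
  proof (rule sum.cong)
    fix k
    have "x \<in> dyadic_piece a b n k \<longleftrightarrow> dyadic_index a b n x = k" if "x \<in> S" for x
      by (rule dyadic_piece_iff[OF assms(1)]) (use that assms(2) in auto)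
    then have "(S \<inter> dyadic_piece a b n k = {}) = (k \<notin> dyadic_index a b n ` S)" by blast
    then show "(if S \<inter> dyadic_piece a b n k = {} then 0 else 1::ennreal) = (if k \<in> dyadic_index a b n ` S then 1 else 0)" by simp
  qed simp
  also have "\<dots> = of_nat (card ({..<2 ^ n} \<inter> dyadic_index a b n ` S))"
    by (simp add: sum.If_cases)
  also have "{..<2 ^ n} \<inter> dyadic_index a b n ` S = dyadic_index a b n ` S"
    using dyadic_index_less[OF assms(1)] assms(2) by auto
  finally show ?thesis .
qed

lemma dyadic_index_finite:
  assumes "a < b" "S \<subseteq> {a..<b}"
  shows "finite (dyadic_index a b n ` S)"
  by (rule finite_subset[of _ "{..<2^n}"]) (use dyadic_index_less[OF assms(1)] assms(2) in auto)

lemma dyadic_count_incseq: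
  assumes "a < b" "S \<subseteq> {a..<b}"
  shows "incseq (\<lambda>n. dyadic_count a b n S)"
proof (rule incseq_SucI)
  fix n
  have "dyadic_index a b n ` S = (\<lambda>i. i div 2) ` dyadic_index a b (Suc n) ` S"
    unfolding image_image by (intro image_cong refl dyadic_index_Suc[OF assms(1)]) (use assms(2) in auto)
  then have "card (dyadic_index a b n ` S) \<le> card (dyadic_index a b (Suc n) ` S)"
    using card_image_le[OF dyadic_index_finite[OF assms]] by simp
  then show "dyadic_count a b n S \<le> dyadic_count a b (Suc n) S"
    unfolding dyadic_count_eq[OF assms] by simp
qed

text \<open>A finite subset is eventually separated by the pieces, and an infinite set contains
  finite subsets of every size.\<close>

lemma dyadic_count_SUP:
  assumes "a < b" "S \<subseteq> {a..<b}"
  shows "(SUP n. dyadic_count a b n S) = ncard S"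
proof (rule antisym)
  show "(SUP n. dyadic_count a b n S) \<le> ncard S"
  proof (rule SUP_least)
    fix n show "dyadic_count a b n S \<le> ncard S"
      unfolding dyadic_count_eq[OF assms] by (cases "finite S") (auto simp: emeasure_count_space card_image_le)
  qed
  have ge: "of_nat (card F) \<le> (SUP n. dyadic_count a b n S)" if F: "finite F" "F \<subseteq> S" for F
  proof -
    obtain n where n: "inj_on (dyadic_index a b n) F" using dyadic_index_inj[OF assms(1) F(1)] F assms by auto
    have "card F = card (dyadic_index a b n ` F)" using n by (simp add: card_image)
    also have "\<dots> \<le> card (dyadic_index a b n ` S)" by (rule card_mono[OF dyadic_index_finite[OF assms]]) (use F in auto)
    finally have "of_nat (card F) \<le> dyadic_count a b n S" unfolding dyadic_count_eq[OF assms] by simp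
    also have "\<dots> \<le> (SUP n. dyadic_count a b n S)" by (rule SUP_upper) simp
    finally show ?thesis .
  qed
  show "ncard S \<le> (SUP n. dyadic_count a b n S)"
  proof (cases "finite S")
    case True then show ?thesis using ge[of S] by (simp add: emeasure_count_space)
  next
    case False
    have "of_nat m \<le> (SUP n. dyadic_count a b n S)" for m
      using infinite_arbitrarily_large[OF False, of m] ge by auto
    then have "(SUP m. of_nat m :: ennreal) \<le> (SUP n. dyadic_count a b n S)" by (intro SUP_least)
    then have "(SUP n. dyadic_count a b n S) = top"
      unfolding ennreal_SUP_of_nat_eq_top by (rule top.extremum_uniqueI)
    then show ?thesis by (simp only: top_greatest)
  qed
qed

text \<open>A half-open interval is a countable union of compact intervals, whose continuous images
  are compact.\<close>

lemma piece_image_measurable: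
  fixes h :: "real \<Rightarrow> real"
  assumes "continuous_on {c..d} h"
  shows "h ` {c..<d} \<in> sets borel"
proof -
  have "{c..<d} = (\<Union>m. {c..d - (d - c) / (real m + 1)})" if "c < d"
  proof (intro set_eqI iffI)
    fix x assume x: "x \<in> {c..<d}"
    obtain m where m: "(d - c) / (d - x) < real m" using reals_Archimedean2 by blast
    have "(d - c) / (d - x) \<le> real m + 1" using m by linarith
    then have "(d - c) / (real m + 1) \<le> d - x" using x by (simp add: field_simps)
    then show "x \<in> (\<Union>m. {c..d - (d - c) / (real m + 1)})" using x by (intro UN_I[of m]) auto
  next
    fix x assume "x \<in> (\<Union>m. {c..d - (d - c) / (real m + 1)})"
    then obtain m where "c \<le> x" "x \<le> d - (d - c) / (real m + 1)" by auto
    moreover have "(d - c) / (real m + 1) > 0" using that by simp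
    ultimately show "x \<in> {c..<d}" by auto
  qed
  then have "c < d \<Longrightarrow> h ` {c..<d} = (\<Union>m. h ` {c..d - (d - c) / (real m + 1)})" by (simp only: image_UN)
  moreover have "h ` {c..d - (d - c) / (real m + 1)} \<in> sets borel" if "c < d" for m
  proof -
    have "(d - c) / (real m + 1) \<ge> 0" using that by simp
    then have "continuous_on {c..d - (d - c) / (real m + 1)} h"
      by (intro continuous_on_subset[OF assms]) auto
    then show ?thesis by (intro borel_closed compact_imp_closed compact_continuous_image) auto
  qed
  ultimately have "h ` {c..<d} \<in> sets borel" if "c < d"
    using that by (simp only: sets.countable_UN image_subset_iff ball_UNIV simp_thms)
  then show ?thesis by (cases "c < d") simp_all
qed

text \<open>The image of the piece is \<open>{h c..h d}\<close> up to the single point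
  \<open>h d\<close>, so this is integration by substitution. Flat stretches are harmless: they
  carry derivative 0 and a single value of \<open>u\<close>.\<close>

lemma piece_monotone:
  fixes h :: "real \<Rightarrow> real" and w :: "real \<Rightarrow> real"
  assumes "c < d" and der: "\<And>t. t \<in> {c..d} \<Longrightarrow> (h has_real_derivative h' t) (at t)"
    and cont: "continuous_on {c..d} h'" and w: "w \<in> borel_measurable borel" and pos: "\<And>t. t \<in> {c..d} \<Longrightarrow> 0 \<le> h' t"
  shows "(\<integral>\<^sup>+u. ennreal (w u) * indicator (h ` {c..<d}) u \<partial>lborel) = (\<integral>\<^sup>+t. ennreal \<bar>h' t\<bar> * ennreal (w (h t)) * indicator {c..<d} t \<partial>lborel)"
proof -
  have ch: "continuous_on {c..d} h" by (rule DERIV_continuous_on[OF has_field_derivative_at_within[OF der]])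
  have mono: "h x \<le> h y" if "c \<le> x" "x \<le> y" "y \<le> d" for x y
  proof (rule DERIV_nonneg_imp_nondecreasing[OF that(2)])
    fix t assume "x \<le> t" "t \<le> y"
    then have "t \<in> {c..d}" using that by simp
    then show "\<exists>y. DERIV h t :> y \<and> 0 \<le> y" using der pos by blast
  qed
  have ivt: "{h c..<h d} \<subseteq> h ` {c..<d}"
  proof
    fix u assume u: "u \<in> {h c..<h d}"
    then obtain x where x: "c \<le> x" "x \<le> d" "h x = u" using IVT'[of h c u d] ch assms(1) by auto
    then have "x \<noteq> d" using u by auto
    then show "u \<in> h ` {c..<d}" using x by auto
  qed
  have 1: "(\<integral>\<^sup>+u. ennreal (w u) * indicator (h ` {c..<d}) u \<partial>lborel) = (\<integral>\<^sup>+u. ennreal (w u) * indicator {h c..h d} u \<partial>lborel)"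
  proof (rule nn_integral_cong_AE)
    have "AE u in lborel. u \<noteq> h d" by (rule AE_lborel_singleton)
    then show "AE u in lborel. ennreal (w u) * indicator (h ` {c..<d}) u = ennreal (w u) * indicator {h c..h d} u"
    proof eventually_elim
      case (elim u)
      have "u \<in> h ` {c..<d}" if "u \<in> {h c..h d}" using ivt elim that by (auto simp: subset_iff)
      moreover have "u \<in> {h c..h d}" if "u \<in> h ` {c..<d}"
      proof -
        from that obtain t where "u = h t" "c \<le> t" "t < d" by auto
        then show ?thesis using mono[of c t] mono[of t d] by simp
      qed
      ultimately have "u \<in> h ` {c..<d} \<longleftrightarrow> u \<in> {h c..h d}" by blast
      then show ?case by (simp add: indicator_def)
    qed
  qed
  have 2: "\<dots> = (\<integral>\<^sup>+t. ennreal (w (h t)) * ennreal (h' t) * indicator {c..d} t \<partial>lborel)"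
    by (rule nn_integral_substitution_aux) (use assms in simp_all)
  have 3: "\<dots> = (\<integral>\<^sup>+t. ennreal \<bar>h' t\<bar> * ennreal (w (h t)) * indicator {c..<d} t \<partial>lborel)"
  proof (rule nn_integral_cong_AE)
    have "AE u in lborel. u \<noteq> d" by (rule AE_lborel_singleton)
    then show "AE t in lborel. ennreal (w (h t)) * ennreal (h' t) * indicator {c..d} t = ennreal \<bar>h' t\<bar> * ennreal (w (h t)) * indicator {c..<d} t"
      by eventually_elim (use pos in \<open>auto simp: indicator_def mult.commute\<close>)
  qed
  show ?thesis using 1 2 3 by simp
qed

text \<open>Reflection of the \<open>u\<close>-axis reduces this to the increasing function
  \<open>- h t\<close>.\<close>

lemma piece_antimonotone:
  fixes h :: "real \<Rightarrow> real" and w :: "real \<Rightarrow> real"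
  assumes "c < d" and der: "\<And>t. t \<in> {c..d} \<Longrightarrow> (h has_real_derivative h' t) (at t)"
    and cont: "continuous_on {c..d} h'" and w[measurable]: "w \<in> borel_measurable borel" and neg: "\<And>t. t \<in> {c..d} \<Longrightarrow> h' t \<le> 0"
  shows "(\<integral>\<^sup>+u. ennreal (w u) * indicator (h ` {c..<d}) u \<partial>lborel) = (\<integral>\<^sup>+t. ennreal \<bar>h' t\<bar> * ennreal (w (h t)) * indicator {c..<d} t \<partial>lborel)"
proof -
  have ch: "continuous_on {c..d} h" by (rule DERIV_continuous_on[OF has_field_derivative_at_within[OF der]])
  have [measurable]: "h ` {c..<d} \<in> sets borel" by (rule piece_image_measurable[OF ch])
  have "(\<integral>\<^sup>+u. ennreal (w u) * indicator (h ` {c..<d}) u \<partial>lborel) = (\<integral>\<^sup>+u. ennreal (w (-u)) * indicator (h ` {c..<d}) (-u) \<partial>lborel)"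
    by (subst nn_integral_real_affine[of _ "-1" 0]) auto
  also have "\<dots> = (\<integral>\<^sup>+u. ennreal (w (-u)) * indicator ((\<lambda>t. - h t) ` {c..<d}) u \<partial>lborel)"
    by (intro nn_integral_cong) (auto simp: indicator_def image_iff)
  also have "\<dots> = (\<integral>\<^sup>+t. ennreal \<bar>- h' t\<bar> * ennreal (w (- (- h t))) * indicator {c..<d} t \<partial>lborel)"
    by (rule piece_monotone[OF assms(1)]) (use der cont neg in \<open>auto intro!: derivative_eq_intros continuous_intros\<close>)
  finally show ?thesis by simp
qed

text \<open>Where \<open>h'\<close> changes sign inside a short piece, it is small there by uniform continuity, so both
  sides of the area formula are negligible.\<close>

lemma piece_small:
  fixes h :: "real \<Rightarrow> real" and w :: "real \<Rightarrow> real"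
  assumes cd: "c < d" and der: "\<And>t. t \<in> {c..d} \<Longrightarrow> (h has_real_derivative h' t) (at t)"
    and w[measurable]: "w \<in> borel_measurable borel" and m: "h' \<in> borel_measurable borel"
    and small: "\<And>t. t \<in> {c..d} \<Longrightarrow> \<bar>h' t\<bar> \<le> \<epsilon>" and C: "\<And>u. w u \<le> C" "0 \<le> C" "0 \<le> \<epsilon>"
  shows "(\<integral>\<^sup>+u. ennreal (w u) * indicator (h ` {c..<d}) u \<partial>lborel) \<le> ennreal (2 * C * \<epsilon> * (d - c))"
    and "(\<integral>\<^sup>+t. ennreal \<bar>h' t\<bar> * ennreal (w (h t)) * indicator {c..<d} t \<partial>lborel) \<le> ennreal (2 * C * \<epsilon> * (d - c))"
proof -
  have sub: "h t \<in> {h c - \<epsilon> * (d - c) .. h c + \<epsilon> * (d - c)}" if t: "t \<in> {c..<d}" for t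
  proof (cases "t = c")
    case False
    then have "c < t" using t by auto
    then obtain z where z: "c < z" "z < t" "h t - h c = (t - c) * h' z"
      using MVT2[of c t h h'] der t by auto
    have "\<bar>h t - h c\<bar> = \<bar>t - c\<bar> * \<bar>h' z\<bar>" by (simp add: z(3) abs_mult)
    also have "\<dots> \<le> (d - c) * \<epsilon>" by (intro mult_mono) (use t z small[of z] C in auto)
    finally show ?thesis by (auto simp: abs_le_iff algebra_simps)
  qed (use C cd in auto)
  have "(\<integral>\<^sup>+u. ennreal (w u) * indicator (h ` {c..<d}) u \<partial>lborel) \<le> (\<integral>\<^sup>+u. ennreal C * indicator {h c - \<epsilon> * (d - c) .. h c + \<epsilon> * (d - c)} u \<partial>lborel)"
    by (intro nn_integral_mono) (use sub C in \<open>auto simp: indicator_def intro!: ennreal_leI\<close>)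
  also have "\<dots> = ennreal C * ennreal (2 * (\<epsilon> * (d - c)))"
  proof -
    have "0 \<le> \<epsilon> * (d - c)" using C cd by simp
    then show ?thesis by (simp add: nn_integral_cmult_indicator)
  qed
  also have "\<dots> = ennreal (2 * C * \<epsilon> * (d - c))"
    using C cd by (simp add: ennreal_mult'[symmetric] mult_ac)
  finally show "(\<integral>\<^sup>+u. ennreal (w u) * indicator (h ` {c..<d}) u \<partial>lborel) \<le> ennreal (2 * C * \<epsilon> * (d - c))" .
  have "(\<integral>\<^sup>+t. ennreal \<bar>h' t\<bar> * ennreal (w (h t)) * indicator {c..<d} t \<partial>lborel) \<le> (\<integral>\<^sup>+t. ennreal (\<epsilon> * C) * indicator {c..<d} t \<partial>lborel)"
  proof (rule nn_integral_mono)
    fix t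
    show "ennreal \<bar>h' t\<bar> * ennreal (w (h t)) * indicator {c..<d} t \<le> ennreal (\<epsilon> * C) * indicator {c..<d} t"
    proof (cases "t \<in> {c..<d}")
      case True
      then have "ennreal \<bar>h' t\<bar> * ennreal (w (h t)) \<le> ennreal \<epsilon> * ennreal C"
        by (intro mult_mono ennreal_leI small C) auto
      then show ?thesis using True C by (simp add: ennreal_mult')
    qed simp
  qed
  also have "\<dots> = ennreal (C * \<epsilon> * (d - c))"
    using C cd by (simp add: nn_integral_cmult_indicator ennreal_mult'[symmetric] algebra_simps)
  also have "\<dots> \<le> ennreal (2 * C * \<epsilon> * (d - c))"
  proof (rule ennreal_leI)
    have "0 \<le> C * \<epsilon> * (d - c)" using C cd by simp
    then show "C * \<epsilon> * (d - c) \<le> 2 * C * \<epsilon> * (d - c)" by linarith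
  qed
  finally show "(\<integral>\<^sup>+t. ennreal \<bar>h' t\<bar> * ennreal (w (h t)) * indicator {c..<d} t \<partial>lborel) \<le> ennreal (2 * C * \<epsilon> * (d - c))" .
qed

lemma dyadic_pt_mono: "a < b \<Longrightarrow> dyadic_pt a b n k < dyadic_pt a b n (Suc k)"
  by (simp add: dyadic_pt_def field_simps)

lemma dyadic_pt_diff: "dyadic_pt a b n (Suc k) - dyadic_pt a b n k = (b - a) / 2 ^ n"
  by (simp add: dyadic_pt_def field_simps)

lemma dyadic_pt_bounds:
  assumes "a < b" "k < 2 ^ n"
  shows "a \<le> dyadic_pt a b n k" "dyadic_pt a b n (Suc k) \<le> b"
proof -
  have "real (Suc k) \<le> 2 ^ n" using assms(2) by (metis Suc_leI of_nat_le_iff of_nat_numeral of_nat_power)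
  then have "(b - a) * (real (Suc k) / 2 ^ n) \<le> (b - a) * 1" using assms by (intro mult_left_mono) auto
  then show "dyadic_pt a b n (Suc k) \<le> b" by (simp add: dyadic_pt_def)
  show "a \<le> dyadic_pt a b n k" using assms by (simp add: dyadic_pt_def)
qed

lemma dyadic_piece_subset:
  assumes "a < b" "k < 2 ^ n"
  shows "dyadic_piece a b n k \<subseteq> {a..<b}"
  using dyadic_pt_bounds[OF assms] by (auto simp: dyadic_piece_def)

lemma dyadic_count_level:
  assumes "a < b"
  shows "dyadic_count a b n {t\<in>{a..<b}. h t = u} = (\<Sum>k<2 ^ n. indicator (h ` dyadic_piece a b n k) u)"
  unfolding dyadic_count_def
proof (rule sum.cong)
  fix k :: nat assume "k \<in> {..<2 ^ n}"
  then have "({t\<in>{a..<b}. h t = u} \<inter> dyadic_piece a b n k = {}) = (u \<notin> h ` dyadic_piece a b n k)"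
    using dyadic_piece_subset[OF assms, of k n] by blast
  then show "(if {t\<in>{a..<b}. h t = u} \<inter> dyadic_piece a b n k = {} then 0 else 1) = (indicator (h ` dyadic_piece a b n k) u :: ennreal)"
    by (simp add: indicator_def)
qed simp

lemma dyadic_pieces_sum:
  assumes "a < b"
  shows "(\<Sum>k<2 ^ n. indicator (dyadic_piece a b n k) x) = (indicator {a..<b} x :: ennreal)"
proof -
  have "dyadic_count a b n ({x} \<inter> {a..<b}) = indicator {a..<b} x"
    using dyadic_count_eq[OF assms, of "{x} \<inter> {a..<b}" n] by (auto simp: indicator_def)
  moreover have "(if {x} \<inter> {a..<b} \<inter> dyadic_piece a b n k = {} then 0 else 1) = (indicator (dyadic_piece a b n k) x :: ennreal)"
    if "k < 2 ^ n" for k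
    using dyadic_pt_bounds[OF assms that] by (auto simp: indicator_def dyadic_piece_def)
  ultimately show ?thesis unfolding dyadic_count_def by simp
qed

text \<open>The number of solutions of \<open>h t = u\<close> is the increasing limit of the number
  of dyadic pieces whose image contains \<open>u\<close>. Where \<open>h'\<close> keeps its sign on
  a piece, both sides agree exactly; on the other pieces \<open>\<bar>h'\<bar>\<close> is at most
  \<open>\<epsilon>\<close>, and these errors add up to at most
  \<open>2 * C * \<epsilon> * (b - a)\<close>.\<close>

lemma area_formula_bounded:
  fixes h :: "real \<Rightarrow> real" and w :: "real \<Rightarrow> real"
  assumes ab: "a < b" and der: "\<And>t. t \<in> {a..b} \<Longrightarrow> (h has_real_derivative h' t) (at t)"
    and cont: "continuous_on {a..b} h'" and w[measurable]: "w \<in> borel_measurable borel"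
    and m[measurable]: "h' \<in> borel_measurable borel" "h \<in> borel_measurable borel"
    and C: "\<And>u. w u \<le> C" "0 \<le> C"
  shows "(\<integral>\<^sup>+u. ennreal (w u) * ncard {t\<in>{a..<b}. h t = u} \<partial>lborel) = (\<integral>\<^sup>+t. ennreal \<bar>h' t\<bar> * ennreal (w (h t)) * indicator {a..<b} t \<partial>lborel)"
proof -
  let ?P = "dyadic_piece a b"
  define I where "I n k = (\<integral>\<^sup>+u. ennreal (w u) * indicator (h ` ?P n k) u \<partial>lborel)" for n k
  define J where "J n k = (\<integral>\<^sup>+t. ennreal \<bar>h' t\<bar> * ennreal (w (h t)) * indicator (?P n k) t \<partial>lborel)" for n k
  define JJ where "JJ = (\<integral>\<^sup>+t. ennreal \<bar>h' t\<bar> * ennreal (w (h t)) * indicator {a..<b} t \<partial>lborel)"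
  have ch: "continuous_on {a..b} h" by (rule DERIV_continuous_on[OF has_field_derivative_at_within[OF der]])
  have Pm[measurable]: "?P n k \<in> sets borel" for n k by (simp add: dyadic_piece_def)
  have hm: "h ` ?P n k \<in> sets borel" if "k < 2 ^ n" for n k
    unfolding dyadic_piece_def by (rule piece_image_measurable, rule continuous_on_subset[OF ch])
      (use dyadic_pt_bounds[OF ab that] in auto)
  have J: "(\<Sum>k<2 ^ n. J n k) = JJ" for n
  proof -
    have "(\<Sum>k<2 ^ n. J n k) = (\<integral>\<^sup>+t. ennreal \<bar>h' t\<bar> * ennreal (w (h t)) * (\<Sum>k<2 ^ n. indicator (?P n k) t) \<partial>lborel)"
      unfolding J_def by (subst nn_integral_sum[symmetric]) (auto simp: sum_distrib_left)
    then show ?thesis unfolding dyadic_pieces_sum[OF ab] JJ_def .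
  qed
  have cnt: "ncard {t\<in>{a..<b}. h t = u} = (SUP n. \<Sum>k<2 ^ n. indicator (h ` ?P n k) u)"
    and inc: "incseq (\<lambda>n. \<Sum>k<2 ^ n. indicator (h ` ?P n k) u :: ennreal)" for u
  proof -
    have S: "{t\<in>{a..<b}. h t = u} \<subseteq> {a..<b}" by auto
    have "dyadic_count a b n {t\<in>{a..<b}. h t = u} = (\<Sum>k<2 ^ n. indicator (h ` ?P n k) u)" for n
      by (rule dyadic_count_level[OF ab])
    then show "ncard {t\<in>{a..<b}. h t = u} = (SUP n. \<Sum>k<2 ^ n. indicator (h ` ?P n k) u)" "incseq (\<lambda>n. \<Sum>k<2 ^ n. indicator (h ` ?P n k) u :: ennreal)"
      using dyadic_count_SUP[OF ab S] dyadic_count_incseq[OF ab S] by simp_all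
  qed
  have IM: "(\<lambda>u. ennreal (w u) * indicator (h ` ?P n k) u) \<in> borel_measurable borel" if "k < 2 ^ n" for n k
    by (intro borel_measurable_times_ennreal borel_measurable_indicator measurable_compose[OF w measurable_ennreal] hm that)
  define L where "L = (\<integral>\<^sup>+u. ennreal (w u) * ncard {t\<in>{a..<b}. h t = u} \<partial>lborel)"
  have L: "L = (SUP n. \<Sum>k<2 ^ n. I n k)" and Linc: "incseq (\<lambda>n. \<Sum>k<2 ^ n. I n k)"
  proof -
    have sumI: "(\<Sum>k<2 ^ n. I n k) = (\<integral>\<^sup>+u. ennreal (w u) * (\<Sum>k<2 ^ n. indicator (h ` ?P n k) u) \<partial>lborel)" for n
      unfolding I_def sum_distrib_left by (rule nn_integral_sum[symmetric], unfold measurable_lborel2, rule IM) simp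
    have inc2: "incseq (\<lambda>n u. ennreal (w u) * (\<Sum>k<2 ^ n. indicator (h ` ?P n k) u))"
      by (rule incseq_SucI, rule le_funI, rule mult_left_mono[OF incseq_SucD[OF inc]]) simp
    have "L = (\<integral>\<^sup>+u. (SUP n. ennreal (w u) * (\<Sum>k<2 ^ n. indicator (h ` ?P n k) u)) \<partial>lborel)"
      unfolding L_def cnt SUP_mult_left_ennreal ..
    also have "\<dots> = (SUP n. \<integral>\<^sup>+u. ennreal (w u) * (\<Sum>k<2 ^ n. indicator (h ` ?P n k) u) \<partial>lborel)"
    proof (rule nn_integral_monotone_convergence_SUP[OF inc2])
      fix n
      show "(\<lambda>u. ennreal (w u) * (\<Sum>k<2 ^ n. indicator (h ` ?P n k) u)) \<in> borel_measurable lborel"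
        unfolding sum_distrib_left measurable_lborel2 by (rule borel_measurable_sum, rule IM) simp
    qed
    finally show "L = (SUP n. \<Sum>k<2 ^ n. I n k)" unfolding sumI .
    show "incseq (\<lambda>n. \<Sum>k<2 ^ n. I n k)" unfolding sumI
    proof (rule incseq_SucI, rule nn_integral_mono)
      fix n u
      show "ennreal (w u) * (\<Sum>k<2 ^ n. indicator (h ` ?P n k) u) \<le> ennreal (w u) * (\<Sum>k<2 ^ Suc n. indicator (h ` ?P (Suc n) k) u)"
        by (rule mult_left_mono[OF incseq_SucD[OF inc]]) simp
    qed
  qed
  have key: "\<exists>N. \<forall>n\<ge>N. (\<Sum>k<2 ^ n. I n k) \<le> JJ + ennreal e \<and> JJ \<le> (\<Sum>k<2 ^ n. I n k) + ennreal e" if e: "e > 0" for e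
  proof -
    \<comment> \<open>\<open>C + 1\<close> instead of \<open>C\<close> keeps the quotient meaningful
      for \<open>C = 0\<close>; with this choice the total error is at most
      \<open>e\<close>.\<close>
    define \<epsilon> where "\<epsilon> = e / (2 * (C + 1)) / (b - a)"
    have \<epsilon>: "\<epsilon> > 0" using e ab C by (simp add: \<epsilon>_def)
    have "\<epsilon> * (b - a) = e / (2 * (C + 1))" using ab by (simp add: \<epsilon>_def)
    then have "2 * C * \<epsilon> * (b - a) = 2 * C * (e / (2 * (C + 1)))" by (simp only: mult.assoc)
    also have "\<dots> \<le> e" using e C(2) by (simp add: field_simps)
    finally have le: "2 * C * \<epsilon> * (b - a) \<le> e" .
    have "uniformly_continuous_on {a..b} h'" by (rule compact_uniformly_continuous[OF cont]) simp
    then obtain \<delta> where \<delta>: "\<delta> > 0" "\<And>s t. s \<in> {a..b} \<Longrightarrow> t \<in> {a..b} \<Longrightarrow> \<bar>t - s\<bar> < \<delta> \<Longrightarrow> \<bar>h' t - h' s\<bar> < \<epsilon>"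
      unfolding uniformly_continuous_on_def using \<epsilon> by (auto simp: dist_real_def) 
    have "(\<lambda>n. (b - a) / 2 ^ n) \<longlonglongrightarrow> 0" by real_asymp
    then have "\<forall>\<^sub>F n in sequentially. (b - a) / 2 ^ n < \<delta>" using \<delta>(1) by (rule order_tendstoD)
    then obtain N where N: "\<And>n. n \<ge> N \<Longrightarrow> (b - a) / 2 ^ n < \<delta>" by (auto simp: eventually_sequentially)
    have IJ: "I n k \<le> J n k + ennreal (2 * C * \<epsilon> * ((b - a) / 2 ^ n)) \<and> J n k \<le> I n k + ennreal (2 * C * \<epsilon> * ((b - a) / 2 ^ n))"
      if n: "n \<ge> N" and k: "k < 2 ^ n" for n k
    proof -
      let ?c = "dyadic_pt a b n k" and ?d = "dyadic_pt a b n (Suc k)"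
      have cd: "?c < ?d" by (rule dyadic_pt_mono[OF ab])
      have bd: "a \<le> ?c" "?d \<le> b" using dyadic_pt_bounds[OF ab k] .
      have der': "\<And>t. t \<in> {?c..?d} \<Longrightarrow> (h has_real_derivative h' t) (at t)" using der bd by auto
      have cont': "continuous_on {?c..?d} h'" by (rule continuous_on_subset[OF cont]) (use bd in auto)
      consider "\<forall>t\<in>{?c..?d}. 0 \<le> h' t" | "\<forall>t\<in>{?c..?d}. h' t \<le> 0" | s s' where "s \<in> {?c..?d}" "h' s < 0" "s' \<in> {?c..?d}" "0 < h' s'"
        by (metis not_le)
      then show ?thesis
      proof cases
        case 1
        then have "I n k = J n k" unfolding I_def J_def dyadic_piece_def by (intro piece_monotone cd der' cont' w) auto
        then show ?thesis by simp
      next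
        case 2
        then have "I n k = J n k" unfolding I_def J_def dyadic_piece_def by (intro piece_antimonotone cd der' cont' w) auto
        then show ?thesis by simp
      next
        case 3
        have small: "\<bar>h' t\<bar> \<le> \<epsilon>" if t: "t \<in> {?c..?d}" for t
        proof -
          have dd: "?d - ?c < \<delta>" unfolding dyadic_pt_diff using N[OF n] .
          have "\<bar>h' t - h' s\<bar> < \<epsilon>" by (rule \<delta>(2)) (use 3 t bd dd in auto)
          moreover have "\<bar>h' t - h' s'\<bar> < \<epsilon>" by (rule \<delta>(2)) (use 3 t bd dd in auto)
          ultimately show ?thesis using 3 by auto
        qed
        have le: "I n k \<le> ennreal (2 * C * \<epsilon> * ((b - a) / 2 ^ n))" "J n k \<le> ennreal (2 * C * \<epsilon> * ((b - a) / 2 ^ n))"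
          using piece_small[OF cd der' w m(1) small C] \<epsilon> unfolding I_def J_def dyadic_piece_def dyadic_pt_diff by auto
        show ?thesis using le by (auto intro: add_increasing)
      qed
    qed
    have tot: "(\<Sum>k<(2::nat) ^ n. ennreal (2 * C * \<epsilon> * ((b - a) / 2 ^ n))) \<le> ennreal e" for n :: nat
    proof -
      have "(\<Sum>k<(2::nat) ^ n. ennreal (2 * C * \<epsilon> * ((b - a) / 2 ^ n))) = ennreal (\<Sum>k<(2::nat) ^ n. 2 * C * \<epsilon> * ((b - a) / 2 ^ n))"
        by (rule sum_ennreal) (use C \<epsilon> ab in auto)
      also have "(\<Sum>k<(2::nat) ^ n. 2 * C * \<epsilon> * ((b - a) / 2 ^ n)) = 2 * C * \<epsilon> * (b - a)" by simp
      also have "ennreal \<dots> \<le> ennreal e" by (rule ennreal_leI[OF le])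
      finally show ?thesis .
    qed
    show ?thesis
    proof (intro exI[of _ N] allI impI conjI)
      fix n assume n: "n \<ge> N"
      have "(\<Sum>k<2 ^ n. I n k) \<le> (\<Sum>k<2 ^ n. J n k + ennreal (2 * C * \<epsilon> * ((b - a) / 2 ^ n)))"
        by (rule sum_mono) (use IJ[OF n] in auto)
      also have "\<dots> \<le> JJ + ennreal e" unfolding sum.distrib J by (intro add_left_mono tot)
      finally show "(\<Sum>k<2 ^ n. I n k) \<le> JJ + ennreal e" .
      have "JJ = (\<Sum>k<2 ^ n. J n k)" by (rule J[symmetric])
      also have "\<dots> \<le> (\<Sum>k<2 ^ n. I n k + ennreal (2 * C * \<epsilon> * ((b - a) / 2 ^ n)))"
        by (rule sum_mono) (use IJ[OF n] in auto)
      also have "\<dots> \<le> (\<Sum>k<2 ^ n. I n k) + ennreal e" unfolding sum.distrib by (intro add_left_mono tot)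
      finally show "JJ \<le> (\<Sum>k<2 ^ n. I n k) + ennreal e" .
    qed
  qed
  have "L \<le> JJ"
  proof (rule ennreal_le_epsilon)
    fix e :: real assume "0 < e"
    then obtain N where N: "\<forall>n\<ge>N. (\<Sum>k<2 ^ n. I n k) \<le> JJ + ennreal e" using key by blast
    \<comment> \<open>The estimate is available only from \<open>N\<close> on, but the sums increase
      with \<open>n\<close>.\<close>
    have "(\<Sum>k<2 ^ n. I n k) \<le> JJ + ennreal e" for n
    proof -
      have "(\<Sum>k<2 ^ n. I n k) \<le> (\<Sum>k<2 ^ max n N. I (max n N) k)" by (rule incseqD[OF Linc]) simp
      also have "\<dots> \<le> JJ + ennreal e" using N by simp
      finally show ?thesis .
    qed
    then show "L \<le> JJ + ennreal e" unfolding L by (rule SUP_least)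
  qed
  moreover have "JJ \<le> L"
  proof (rule ennreal_le_epsilon)
    fix e :: real assume "0 < e"
    then obtain N where N: "\<forall>n\<ge>N. JJ \<le> (\<Sum>k<2 ^ n. I n k) + ennreal e" using key by blast
    have "JJ \<le> (\<Sum>k<2 ^ N. I N k) + ennreal e" using N by simp
    also have "\<dots> \<le> L + ennreal e" unfolding L by (intro add_right_mono SUP_upper) simp
    finally show "JJ \<le> L + ennreal e" .
  qed
  ultimately show ?thesis unfolding L_def JJ_def by simp
qed

text \<open>Truncation of the weight at \<open>n\<close> and monotone convergence on both sides.
  Weights with values in \<open>ennreal\<close> are wanted because in the iterated Palm formula the
  weight contains a number of zeros.\<close>

theorem area_formula:
  fixes h :: "real \<Rightarrow> real" and w :: "real \<Rightarrow> ennreal"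
  assumes ab: "a < b" and der: "\<And>t. t \<in> {a..b} \<Longrightarrow> (h has_real_derivative h' t) (at t)"
    and cont: "continuous_on {a..b} h'" and w[measurable]: "w \<in> borel_measurable borel"
    and m[measurable]: "h' \<in> borel_measurable borel" "h \<in> borel_measurable borel"
  shows "(\<integral>\<^sup>+u. w u * ncard {t\<in>{a..<b}. h t = u} \<partial>lborel) = (\<integral>\<^sup>+t. ennreal \<bar>h' t\<bar> * w (h t) * indicator {a..<b} t \<partial>lborel)"
proof -
  define v where "v n u = enn2real (min (w u) (of_nat n))" for n u
  have v: "ennreal (v n u) = min (w u) (of_nat n)" for n u
    unfolding v_def by (intro ennreal_enn2real) (simp add: min_less_iff_disj of_nat_less_top)
  have vm[measurable]: "v n \<in> borel_measurable borel" for n unfolding v_def by measurable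
  have vC: "v n u \<le> real n" for n u
    unfolding v_def by (rule enn2real_leI) (simp_all add: ennreal_of_nat_eq_real_of_nat)
  have inc: "incseq (\<lambda>n. ennreal (v n u))" for u
    unfolding v by (rule incseq_SucI, rule min.mono[OF order_refl], rule of_nat_mono) simp
  have sup: "(SUP n. ennreal (v n u)) = w u" for u
  proof -
    have "(SUP n. ennreal (v n u)) = (SUP n. inf (w u) (of_nat n))" by (simp add: v inf_min)
    also have "\<dots> = inf (w u) (SUP n. of_nat n)" by (rule inf_SUP[symmetric])
    finally show ?thesis unfolding ennreal_SUP_of_nat_eq_top by simp
  qed
  let ?N = "\<lambda>u. ncard {t\<in>{a..<b}. h t = u}"
  have ch: "continuous_on {a..b} h" by (rule DERIV_continuous_on[OF has_field_derivative_at_within[OF der]])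
  have Nm[measurable]: "?N \<in> borel_measurable borel"
  proof -
    have "?N u = (SUP n. \<Sum>k<2 ^ n. indicator (h ` dyadic_piece a b n k) u)" for u
    proof -
      have S: "{t\<in>{a..<b}. h t = u} \<subseteq> {a..<b}" by auto
      have "dyadic_count a b n {t\<in>{a..<b}. h t = u} = (\<Sum>k<2 ^ n. indicator (h ` dyadic_piece a b n k) u)" for n
        by (rule dyadic_count_level[OF ab])
      then show ?thesis using dyadic_count_SUP[OF ab S] by simp
    qed
    moreover have "h ` dyadic_piece a b n k \<in> sets borel" if "k < 2 ^ n" for n k
      unfolding dyadic_piece_def by (rule piece_image_measurable, rule continuous_on_subset[OF ch])
        (use dyadic_pt_bounds[OF ab that] in auto)
    moreover have "(\<lambda>u. SUP n. \<Sum>k<2 ^ n. indicator (h ` dyadic_piece a b n k) u :: ennreal) \<in> borel_measurable borel"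
      if "\<And>k n. k < 2 ^ n \<Longrightarrow> h ` dyadic_piece a b n k \<in> sets borel"
    proof (rule borel_measurable_SUP)
      fix n
      show "(\<lambda>u. \<Sum>k<2 ^ n. indicator (h ` dyadic_piece a b n k) u :: ennreal) \<in> borel_measurable borel"
        by (rule borel_measurable_sum, rule borel_measurable_indicator, rule that) simp
    qed simp
    ultimately show ?thesis by (simp only:)
  qed
  have "(\<integral>\<^sup>+u. w u * ?N u \<partial>lborel) = (\<integral>\<^sup>+u. (SUP n. ennreal (v n u) * ?N u) \<partial>lborel)"
    by (simp only: SUP_mult_right_ennreal[symmetric] sup)
  also have "\<dots> = (SUP n. \<integral>\<^sup>+u. ennreal (v n u) * ?N u \<partial>lborel)"
  proof (rule nn_integral_monotone_convergence_SUP)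
    show "incseq (\<lambda>n u. ennreal (v n u) * ?N u)" using inc by (auto simp: incseq_def le_fun_def intro!: mult_right_mono)
  qed measurable
  also have "\<dots> = (SUP n. \<integral>\<^sup>+t. ennreal \<bar>h' t\<bar> * ennreal (v n (h t)) * indicator {a..<b} t \<partial>lborel)"
    by (intro SUP_cong refl area_formula_bounded[OF ab der cont vm m vC]) auto
  also have "\<dots> = (\<integral>\<^sup>+t. (SUP n. ennreal \<bar>h' t\<bar> * ennreal (v n (h t)) * indicator {a..<b} t) \<partial>lborel)"
  proof (rule nn_integral_monotone_convergence_SUP[symmetric])
    show "incseq (\<lambda>n t. ennreal \<bar>h' t\<bar> * ennreal (v n (h t)) * indicator {a..<b} t)" using inc by (auto simp: incseq_def le_fun_def intro!: mult_right_mono mult_left_mono)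
  qed measurable
  also have "\<dots> = (\<integral>\<^sup>+t. ennreal \<bar>h' t\<bar> * w (h t) * indicator {a..<b} t \<partial>lborel)"
    by (simp only: SUP_mult_right_ennreal[symmetric] SUP_mult_left_ennreal[symmetric] sup)
  finally show ?thesis .
qed

section \<open>Gaussian spaces\<close>

lemma normal_density_zero_mean_scale:
  assumes "0 < \<sigma>"
  shows "normal_density 0 \<sigma> (\<sigma> * y) = std_normal_density y / \<sigma>"
  using assms by (simp add: normal_density_def power_mult_distrib real_sqrt_mult)

lemma normal_density_cos_sin:
  assumes s: "0 < \<sigma>"
  shows "(LINT x|lborel. normal_density 0 \<sigma> x * cos (a * x)) = exp (- (\<sigma>\<^sup>2 * a\<^sup>2) / 2)"
    and "(LINT x|lborel. normal_density 0 \<sigma> x * sin (a * x)) = 0"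
proof -
  have std: "(LINT x|std_normal_distribution. cos (b * x)) = exp (- (b\<^sup>2) / 2) \<and> (LINT x|std_normal_distribution. sin (b * x)) = 0" for b
  proof -
    have "Complex (LINT x|std_normal_distribution. cos (b * x)) (LINT x|std_normal_distribution. sin (b * x)) = complex_of_real (exp (- (b\<^sup>2) / 2))"
      using char_eq_cos_sin[OF real_dist_normal_dist, of b] unfolding char_std_normal_distribution by simp
    then show ?thesis by (simp add: complex_eq_iff)
  qed
  have d: "(LINT x|std_normal_distribution. g x) = (LINT x|lborel. std_normal_density x * g x)"
    if "g \<in> borel_measurable borel" for g :: "real \<Rightarrow> real"
    by (rule integral_real_density) (use that in auto)
  have sub: "(LINT x|lborel. normal_density 0 \<sigma> x * q (a * x)) = (LINT x|lborel. std_normal_density x * q (a * \<sigma> * x))" for q :: "real \<Rightarrow> real"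
    using s by (subst lborel_integral_real_affine[where c=\<sigma> and t=0])
      (simp_all add: normal_density_zero_mean_scale mult.assoc)
  show "(LINT x|lborel. normal_density 0 \<sigma> x * cos (a * x)) = exp (- (\<sigma>\<^sup>2 * a\<^sup>2) / 2)"
    unfolding sub using std[of "a * \<sigma>"] d[of "\<lambda>x. cos (a * \<sigma> * x)"] by (simp add: power_mult_distrib mult.commute)
  show "(LINT x|lborel. normal_density 0 \<sigma> x * sin (a * x)) = 0"
    unfolding sub using std[of "a * \<sigma>"] d[of "\<lambda>x. sin (a * \<sigma> * x)"] by simp
qed

text \<open>Completing the square: the integrand is a multiple of the normal density of mean
  \<open>- k / A\<close> and variance \<open>1 / A\<close>.\<close>

lemma gaussian_integral_linear:
  fixes A k u :: real
  assumes A: "0 < A"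
  shows "has_bochner_integral lborel (\<lambda>z. exp (- (A * z\<^sup>2 + 2 * z * k + u) / 2)) (sqrt (2 * pi / A) * exp (k\<^sup>2 / (2 * A) - u / 2))"
proof -
  define \<mu> \<sigma> where "\<mu> = - k / A" and "\<sigma> = 1 / sqrt A"
  have s: "\<sigma> > 0" "\<sigma>\<^sup>2 = 1 / A" using A by (auto simp: \<sigma>_def power_divide)
  have "has_bochner_integral lborel (\<lambda>z. (sqrt (2 * pi / A) * exp (k\<^sup>2 / (2 * A) - u / 2)) * normal_density \<mu> \<sigma> z)
     ((sqrt (2 * pi / A) * exp (k\<^sup>2 / (2 * A) - u / 2)) * 1)"
    by (rule has_bochner_integral_mult_right)
      (metis has_bochner_integral_integrable integrable_normal_density integral_normal_density s(1))
  moreover have "(sqrt (2 * pi / A) * exp (k\<^sup>2 / (2 * A) - u / 2)) * normal_density \<mu> \<sigma> z = exp (- (A * z\<^sup>2 + 2 * z * k + u) / 2)" for z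
  proof -
    have e: "k\<^sup>2 / (2 * A) - u / 2 + (- (z - \<mu>)\<^sup>2 / (2 * \<sigma>\<^sup>2)) = - (A * z\<^sup>2 + 2 * z * k + u) / 2"
      unfolding s(2) \<mu>_def using A by (simp add: field_simps power2_eq_square)
    have "normal_density \<mu> \<sigma> z = 1 / sqrt (2 * pi / A) * exp (- (z - \<mu>)\<^sup>2 / (2 * \<sigma>\<^sup>2))"
      unfolding normal_density_def s(2) by simp
    then have "(sqrt (2 * pi / A) * exp (k\<^sup>2 / (2 * A) - u / 2)) * normal_density \<mu> \<sigma> z
       = exp (k\<^sup>2 / (2 * A) - u / 2) * exp (- (z - \<mu>)\<^sup>2 / (2 * \<sigma>\<^sup>2))"
      using A by simp
    also have "\<dots> = exp (- (A * z\<^sup>2 + 2 * z * k + u) / 2)" unfolding exp_add[symmetric] e ..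
    finally show ?thesis .
  qed
  ultimately show ?thesis by simp
qed

text \<open>Centred Gaussian law of variance \<open>v\<close>, encoded by its characteristic
  function. This includes the degenerate case \<open>v = 0\<close> and is stable under almost sure
  limits; a density exists only for \<open>0 < v\<close>.\<close>

definition gauss_rv :: "'a measure \<Rightarrow> ('a \<Rightarrow> real) \<Rightarrow> real \<Rightarrow> bool" where
  "gauss_rv M Y v \<longleftrightarrow> Y \<in> borel_measurable M \<and> 0 \<le> v \<and>
     (\<forall>a. (LINT w|M. cos (a * Y w)) = exp (- (v * a\<^sup>2) / 2) \<and> (LINT w|M. sin (a * Y w)) = 0)"

context prob_space
begin

lemma gauss_rv_AE_cong:
  assumes "gauss_rv M Y v" "AE w in M. Y w = Z w" "Z \<in> borel_measurable M"
  shows "gauss_rv M Z v"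
proof -
  have m: "Y \<in> borel_measurable M" using assms by (simp add: gauss_rv_def)
  have "(LINT w|M. q (a * Y w)) = (LINT w|M. q (a * Z w))" if "q \<in> borel_measurable borel" for q :: "real \<Rightarrow> real" and a
    by (rule integral_cong_AE) (use m assms that in auto)
  from this[of cos] this[of sin] show ?thesis using assms by (simp add: gauss_rv_def)
qed

lemma normal_imp_gauss_rv:
  assumes "distributed M lborel Y (normal_density 0 \<sigma>)" "0 < \<sigma>"
  shows "gauss_rv M Y (\<sigma>\<^sup>2)"
proof -
  have m: "Y \<in> borel_measurable M" using distributed_measurable[OF assms(1)] by simp
  have "(LINT w|M. q (a * Y w)) = (LINT x|lborel. normal_density 0 \<sigma> x * q (a * x))" if "q \<in> borel_measurable borel" for q :: "real \<Rightarrow> real" and a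
    by (rule distributed_integral[OF assms(1), symmetric]) (use that in auto)
  from this[of cos] this[of sin] show ?thesis using m assms(2) by (simp add: gauss_rv_def normal_density_cos_sin)
qed

lemma zero_imp_gauss_rv: "gauss_rv M (\<lambda>_. 0) 0"
  by (simp add: gauss_rv_def prob_space)

lemma gauss_rv_AE_zero:
  assumes "gauss_rv M Y 0"
  shows "AE w in M. Y w = 0"
proof -
  have m[measurable]: "Y \<in> borel_measurable M" using assms by (simp add: gauss_rv_def)
  have eq: "distr M borel Y = return borel 0"
  proof (rule finite_borel_measure_eqI)
    show "finite_measure (distr M borel Y)" by (rule finite_measure_distr[OF m])
    show "finite_measure (return borel (0::real))" by (rule prob_space.finite_measure, rule prob_space_return) simp
    show "(LINT x|distr M borel Y. cos (a * x)) = (LINT x|return borel 0. cos (a * x))" for a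
      using assms by (subst integral_distr) (auto simp: gauss_rv_def integral_return)
    show "(LINT x|distr M borel Y. sin (a * x)) = (LINT x|return borel 0. sin (a * x))" for a
      using assms by (subst integral_distr) (auto simp: gauss_rv_def integral_return)
  qed auto
  have "AE x in return borel 0. x = (0::real)" by (subst AE_return) auto
  then have "AE x in distr M borel Y. x = 0" unfolding eq .
  then show ?thesis by (subst (asm) AE_distr_iff) auto
qed

lemma gauss_rv_distributed:
  assumes "gauss_rv M Y v" "0 < v"
  shows "distributed M lborel Y (normal_density 0 (sqrt v))"
proof -
  have m[measurable]: "Y \<in> borel_measurable M" using assms by (simp add: gauss_rv_def)
  let ?D = "density lborel (\<lambda>x. ennreal (normal_density 0 (sqrt v) x))"
  have D: "(LINT x|?D. g x) = (LINT x|lborel. normal_density 0 (sqrt v) x * g x)"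
    if "g \<in> borel_measurable borel" for g :: "real \<Rightarrow> real"
    by (rule integral_real_density) (use that in auto)
  have "distr M borel Y = ?D"
  proof (rule finite_borel_measure_eqI)
    show "finite_measure (distr M borel Y)" by (rule finite_measure_distr[OF m])
    show "finite_measure ?D" by (rule prob_space.finite_measure, rule prob_space_normal_density) (use assms in simp)
    show "(LINT x|distr M borel Y. cos (a * x)) = (LINT x|?D. cos (a * x))" for a
      using assms by (subst integral_distr) (auto simp: gauss_rv_def D normal_density_cos_sin)
    show "(LINT x|distr M borel Y. sin (a * x)) = (LINT x|?D. sin (a * x))" for a
      using assms by (subst integral_distr) (auto simp: gauss_rv_def D normal_density_cos_sin)
  qed auto
  moreover have "distr M lborel Y = distr M borel Y" by (rule distr_cong) auto
  ultimately show ?thesis unfolding distributed_def by auto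
qed

lemma gauss_rv_moments:
  assumes g: "gauss_rv M Y v"
  shows "integrable M (\<lambda>w. Y w ^ k)" "integrable M (\<lambda>w. \<bar>Y w\<bar> ^ k)"
    and "(LINT w|M. Y w) = 0" and "(LINT w|M. (Y w)\<^sup>2) = v" and "(LINT w|M. Y w ^ 4) = 3 * v\<^sup>2"
    and "(LINT w|M. \<bar>Y w\<bar>) = sqrt (2 * v / pi)" and "(LINT w|M. \<bar>Y w\<bar> ^ 3) = 2 * v * sqrt (2 * v / pi)"
proof -
  have m[measurable]: "Y \<in> borel_measurable M" using g by (simp add: gauss_rv_def)
  have v: "0 \<le> v" using g by (simp add: gauss_rv_def)
  have "integrable M (\<lambda>w. Y w ^ k) \<and> integrable M (\<lambda>w. \<bar>Y w\<bar> ^ k) \<and>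
    (LINT w|M. Y w) = 0 \<and> (LINT w|M. (Y w)\<^sup>2) = v \<and> (LINT w|M. Y w ^ 4) = 3 * v\<^sup>2 \<and>
    (LINT w|M. \<bar>Y w\<bar>) = sqrt (2 * v / pi) \<and> (LINT w|M. \<bar>Y w\<bar> ^ 3) = 2 * v * sqrt (2 * v / pi)"
  proof (cases "v = 0")
    case True
    have z: "AE w in M. Y w = 0" using gauss_rv_AE_zero g True by simp
    have i: "integrable M (\<lambda>w. q (Y w)) \<and> (LINT w|M. q (Y w)) = q 0" if [measurable]: "q \<in> borel_measurable borel" for q :: "real \<Rightarrow> real"
    proof -
      have ae: "AE w in M. q (Y w) = q 0" using z by eventually_elim simp
      have "integrable M (\<lambda>w. q (Y w)) \<longleftrightarrow> integrable M (\<lambda>w. q 0)" by (rule integrable_cong_AE) (use ae in auto)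
      moreover have "(LINT w|M. q (Y w)) = (LINT w|M. q 0)" by (rule integral_cong_AE) (use ae in auto)
      ultimately show ?thesis by (simp add: prob_space)
    qed
    show ?thesis using i[of "\<lambda>x. x ^ k"] i[of "\<lambda>x. \<bar>x\<bar> ^ k"] i[of "\<lambda>x. x"] i[of "\<lambda>x. x\<^sup>2"] i[of "\<lambda>x. x ^ 4"] i[of "\<lambda>x. \<bar>x\<bar>"] i[of "\<lambda>x. \<bar>x\<bar> ^ 3"] True
      by simp
  next
    case False
    define s where "s = sqrt v"
    have s: "s > 0" "s\<^sup>2 = v" using False v by (auto simp: s_def)
    have d: "distributed M lborel Y (normal_density 0 s)" unfolding s_def using g False v by (intro gauss_rv_distributed) auto
    have I: "integrable M (\<lambda>w. q (Y w)) = integrable lborel (\<lambda>x. normal_density 0 s x * q x)" if [measurable]: "q \<in> borel_measurable borel" for q :: "real \<Rightarrow> real"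
      by (rule distributed_integrable[OF d, symmetric]) auto
    have E: "(LINT w|M. q (Y w)) = (LINT x|lborel. normal_density 0 s x * q x)" if [measurable]: "q \<in> borel_measurable borel" for q :: "real \<Rightarrow> real"
      by (rule distributed_integral[OF d, symmetric]) auto
    have 1: "integrable M (\<lambda>w. Y w ^ k)" using I[of "\<lambda>x. x ^ k"] integrable_normal_moment[OF s(1), of 0 k] by simp
    have 2: "integrable M (\<lambda>w. \<bar>Y w\<bar> ^ k)" using I[of "\<lambda>x. \<bar>x\<bar> ^ k"] integrable_normal_moment_abs[OF s(1), of 0 k] by simp
    have 3: "(LINT w|M. Y w) = 0" using E[of "\<lambda>x. x"] integral_normal_moment_odd[OF s(1), of 0 0] by simp
    have 4: "(LINT w|M. (Y w)\<^sup>2) = v" using E[of "\<lambda>x. x\<^sup>2"] integral_normal_moment_even[OF s(1), of 0 1] s by (simp add: fact_numeral)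
    have 5: "(LINT w|M. Y w ^ 4) = 3 * v\<^sup>2" using E[of "\<lambda>x. x ^ 4"] integral_normal_moment_even[OF s(1), of 0 2] s by (simp add: fact_numeral field_simps)
    have sq: "s * sqrt (2 / pi) = sqrt (2 * v / pi)" unfolding s_def real_sqrt_mult[symmetric] by (simp add: mult.commute)
    have 6: "(LINT w|M. \<bar>Y w\<bar>) = sqrt (2 * v / pi)" using E[of "\<lambda>x. \<bar>x\<bar>"] integral_normal_moment_abs_odd[OF s(1), of 0 0] sq by simp
    have "(LINT w|M. \<bar>Y w\<bar> ^ 3) = 2 * s ^ 3 * sqrt (2 / pi)" using E[of "\<lambda>x. \<bar>x\<bar> ^ 3"] integral_normal_moment_abs_odd[OF s(1), of 0 1] by (simp add: numeral_3_eq_3)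
    also have "\<dots> = 2 * s\<^sup>2 * (s * sqrt (2 / pi))" by (simp add: power2_eq_square power3_eq_cube)
    finally have 7: "(LINT w|M. \<bar>Y w\<bar> ^ 3) = 2 * v * sqrt (2 * v / pi)" unfolding sq s(2) .
    show ?thesis using 1 2 3 4 5 6 7 by simp
  qed
  then show "integrable M (\<lambda>w. Y w ^ k)" "integrable M (\<lambda>w. \<bar>Y w\<bar> ^ k)"
    "(LINT w|M. Y w) = 0" "(LINT w|M. (Y w)\<^sup>2) = v" "(LINT w|M. Y w ^ 4) = 3 * v\<^sup>2"
    "(LINT w|M. \<bar>Y w\<bar>) = sqrt (2 * v / pi)" "(LINT w|M. \<bar>Y w\<bar> ^ 3) = 2 * v * sqrt (2 * v / pi)"
    by blast+
qed

text \<open>Bounded convergence passes to the limit in the characteristic functions. The limit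
  \<open>C a\<close> is positive for some \<open>a > 0\<close>, since it tends to 1 as
  \<open>a\<close> tends to 0, and there a logarithm turns convergence of
  \<open>exp (- (v n * a\<^sup>2) / 2)\<close> into convergence of the variances. So almost sure
  convergence alone controls second moments, without domination.\<close>

lemma gauss_rv_limit:
  assumes g: "\<And>n. gauss_rv M (Y n) (v n)" and lim: "AE u in M. (\<lambda>n. Y n u) \<longlonglongrightarrow> Z u" and Z[measurable]: "Z \<in> borel_measurable M"
  shows "\<exists>w. gauss_rv M Z w \<and> v \<longlonglongrightarrow> w"
proof -
  have [measurable]: "Y n \<in> borel_measurable M" for n using g by (simp add: gauss_rv_def)
  have v: "0 \<le> v n" for n using g[of n] by (simp add: gauss_rv_def)
  have conv: "(\<lambda>n. LINT u|M. q (a * Y n u)) \<longlonglongrightarrow> (LINT u|M. q (a * Z u))" if q: "q = cos \<or> q = sin" for q :: "real \<Rightarrow> real" and a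
  proof (rule integral_dominated_convergence[where w="\<lambda>_. 1"])
    have [measurable]: "q \<in> borel_measurable borel" using q by auto
    show "(\<lambda>u. q (a * Z u)) \<in> borel_measurable M" "(\<lambda>u. q (a * Y n u)) \<in> borel_measurable M" for n by measurable
    have qc: "isCont q x" for x using q by auto
    show "AE u in M. (\<lambda>n. q (a * Y n u)) \<longlonglongrightarrow> q (a * Z u)" using lim
    proof eventually_elim
      case (elim u)
      show ?case by (rule isCont_tendsto_compose[OF qc]) (intro tendsto_intros elim)
    qed
    show "AE u in M. norm (q (a * Y n u)) \<le> 1" for n using q by (intro AE_I2) auto
  qed simp
  define C where "C a = (LINT u|M. cos (a * Z u))" for a
  have c: "(\<lambda>n. exp (- (v n * a\<^sup>2) / 2)) \<longlonglongrightarrow> C a" for a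
    using conv[of cos a] g unfolding C_def gauss_rv_def by simp
  have s: "(LINT u|M. sin (a * Z u)) = 0" for a
  proof -
    have "(\<lambda>n. 0::real) \<longlonglongrightarrow> (LINT u|M. sin (a * Z u))" using conv[of sin a] g unfolding gauss_rv_def by simp
    then show ?thesis by (simp add: LIMSEQ_const_iff)
  qed
  have "(\<lambda>m. C (1 / real (Suc m))) \<longlonglongrightarrow> (LINT u|M. 1)" unfolding C_def
  proof (rule integral_dominated_convergence[where w="\<lambda>_. 1"])
    show "AE u in M. (\<lambda>m. cos (1 / real (Suc m) * Z u)) \<longlonglongrightarrow> 1"
    proof (rule AE_I2)
      fix u
      have z: "(\<lambda>m. 1 / real (Suc m) * Z u) \<longlonglongrightarrow> 0 * Z u"
        using LIMSEQ_inverse_real_of_nat unfolding inverse_eq_divide by (rule tendsto_mult_right)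
      have "isCont cos (0 * Z u)" by simp
      from isCont_tendsto_compose[OF this z] show "(\<lambda>m. cos (1 / real (Suc m) * Z u)) \<longlonglongrightarrow> 1" by simp
    qed
  qed auto
  then have "(\<lambda>m. C (1 / real (Suc m))) \<longlonglongrightarrow> 1" by (simp add: prob_space)
  then have "\<forall>\<^sub>F m in sequentially. C (1 / real (Suc m)) > 0" by (rule order_tendstoD) simp
  then obtain m where m: "C (1 / real (Suc m)) > 0" by (auto simp: eventually_sequentially)
  define a where "a = 1 / real (Suc m)"
  have a: "a > 0" "C a > 0" using m by (auto simp: a_def)
  have "(\<lambda>n. ln (exp (- (v n * a\<^sup>2) / 2))) \<longlonglongrightarrow> ln (C a)" by (rule tendsto_ln[OF c]) (use a in simp)
  then have "(\<lambda>n. - (v n * a\<^sup>2) / 2) \<longlonglongrightarrow> ln (C a)" by simp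
  then have "(\<lambda>n. (-2 / a\<^sup>2) * (- (v n * a\<^sup>2) / 2)) \<longlonglongrightarrow> (-2 / a\<^sup>2) * ln (C a)" by (rule tendsto_mult_left)
  moreover have "(-2 / a\<^sup>2) * (- (v n * a\<^sup>2) / 2) = v n" for n using a by simp
  ultimately obtain w where w: "v \<longlonglongrightarrow> w" by auto
  have "C b = exp (- (w * b\<^sup>2) / 2)" for b
  proof (rule LIMSEQ_unique[OF c])
    show "(\<lambda>n. exp (- (v n * b\<^sup>2) / 2)) \<longlonglongrightarrow> exp (- (w * b\<^sup>2) / 2)" by (intro tendsto_intros w) simp
  qed
  moreover have "w \<ge> 0" by (rule LIMSEQ_le_const[OF w]) (use v in auto)
  ultimately have "gauss_rv M Z w" using s Z unfolding gauss_rv_def C_def by blast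
  then show ?thesis using w by blast
qed

end

text \<open>Joint Gaussianity is encoded by closure under linear combinations: each combination has
  a one-dimensional Gaussian law, so covariances determine all joint laws.\<close>

locale gauss_space = prob_space M for M :: "'a measure" +
  fixes H :: "('a \<Rightarrow> real) set"
  assumes ex_gauss: "\<And>Y. Y \<in> H \<Longrightarrow> \<exists>v. gauss_rv M Y v"
    and lin_comb: "\<And>Y Z a b. Y \<in> H \<Longrightarrow> Z \<in> H \<Longrightarrow> (\<lambda>w. a * Y w + b * Z w) \<in> H"
begin

definition cov :: "('a \<Rightarrow> real) \<Rightarrow> ('a \<Rightarrow> real) \<Rightarrow> real" where
  "cov Y Z = (LINT w|M. Y w * Z w)"

lemma gauss: "Y \<in> H \<Longrightarrow> gauss_rv M Y (cov Y Y)"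
  using ex_gauss[of Y] gauss_rv_moments(4)[of Y] by (auto simp: cov_def power2_eq_square)

lemma meas_H: "Y \<in> H \<Longrightarrow> Y \<in> borel_measurable M"
  using ex_gauss[of Y] by (auto simp: gauss_rv_def)

lemma cov_nonneg: "0 \<le> cov Y Y"
  by (simp add: cov_def)

lemma cov_commute: "cov Y Z = cov Z Y"
  by (simp add: cov_def mult.commute)

lemma scale_H: "Y \<in> H \<Longrightarrow> (\<lambda>w. a * Y w) \<in> H"
  using lin_comb[of Y Y a 0] by simp

lemma diff_scale_H: "Y \<in> H \<Longrightarrow> Z \<in> H \<Longrightarrow> (\<lambda>w. Y w - b * Z w) \<in> H"
  using lin_comb[of Y Z 1 "- b"] by simp

lemma sum_H:
  assumes "finite I" "Y0 \<in> H" "\<And>i. i \<in> I \<Longrightarrow> Y i \<in> H"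
  shows "(\<lambda>w. \<Sum>i\<in>I. c i * Y i w) \<in> H"
  using assms(1,3)
proof (induction I rule: finite_induct)
  case empty
  then show ?case using scale_H[OF assms(2), of 0] by simp
next
  case (insert i I)
  have "(\<lambda>w. c i * Y i w + 1 * (\<Sum>i\<in>I. c i * Y i w)) \<in> H" by (rule lin_comb) (use insert in auto)
  then show ?case using insert by simp
qed

lemma integrable_prod: "Y \<in> H \<Longrightarrow> Z \<in> H \<Longrightarrow> integrable M (\<lambda>w. Y w * Z w)"
proof -
  assume YZ: "Y \<in> H" "Z \<in> H"
  have "integrable M (\<lambda>w. (Y w)\<^sup>2 + (Z w)\<^sup>2)"
    by (intro Bochner_Integration.integrable_add gauss_rv_moments(1)[OF gauss[OF YZ(1)]] gauss_rv_moments(1)[OF gauss[OF YZ(2)]])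
  then show ?thesis
  proof (rule Bochner_Integration.integrable_bound)
    show "(\<lambda>w. Y w * Z w) \<in> borel_measurable M" using YZ[THEN meas_H] by measurable
    have "\<bar>y * z\<bar> \<le> y\<^sup>2 + z\<^sup>2" for y z :: real
    proof -
      have "0 \<le> (\<bar>y\<bar> - \<bar>z\<bar>)\<^sup>2" by simp
      then have "2 * (\<bar>y\<bar> * \<bar>z\<bar>) \<le> y\<^sup>2 + z\<^sup>2" by (simp add: power2_diff)
      moreover have "0 \<le> \<bar>y\<bar> * \<bar>z\<bar>" by simp
      ultimately show ?thesis unfolding abs_mult by linarith
    qed
    then show "AE w in M. norm (Y w * Z w) \<le> norm ((Y w)\<^sup>2 + (Z w)\<^sup>2)" by (intro AE_I2) simp
  qed
qed

lemma cov_lin: "Y \<in> H \<Longrightarrow> Z \<in> H \<Longrightarrow> W \<in> H \<Longrightarrow> cov (\<lambda>w. a * Y w + b * Z w) W = a * cov Y W + b * cov Z W"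
  unfolding cov_def by (simp add: distrib_right mult.assoc integrable_prod)

lemma cov_lin_right: "Y \<in> H \<Longrightarrow> Z \<in> H \<Longrightarrow> W \<in> H \<Longrightarrow> cov W (\<lambda>w. a * Y w + b * Z w) = a * cov W Y + b * cov W Z"
  using cov_lin[of Y Z W a b] by (simp add: cov_commute)

lemma cov_diff: "Y \<in> H \<Longrightarrow> Z \<in> H \<Longrightarrow> W \<in> H \<Longrightarrow> cov (\<lambda>w. Y w - b * Z w) W = cov Y W - b * cov Z W"
  using cov_lin[of Y Z W 1 "- b"] by simp

lemma cov_diff_right: "Y \<in> H \<Longrightarrow> Z \<in> H \<Longrightarrow> W \<in> H \<Longrightarrow> cov W (\<lambda>w. Y w - b * Z w) = cov W Y - b * cov W Z"
  using cov_diff[of Y Z W b] by (simp add: cov_commute)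

lemma cov_scale: "cov (\<lambda>w. b * Z w) W = b * cov Z W"
  by (simp add: cov_def mult.assoc)

lemma cov_sum:
  assumes "finite I" "\<And>i. i \<in> I \<Longrightarrow> Y i \<in> H" "W \<in> H"
  shows "cov (\<lambda>w. \<Sum>i\<in>I. c i * Y i w) W = (\<Sum>i\<in>I. c i * cov (Y i) W)"
  unfolding cov_def using assms by (simp add: sum_distrib_right mult.assoc integrable_prod)

lemma cauchy_schwarz:
  assumes "Y \<in> H" "Z \<in> H"
  shows "(cov Y Z)\<^sup>2 \<le> cov Y Y * cov Z Z"
proof -
  have L: "(\<lambda>w. a * Y w + b * Z w) \<in> H" for a b by (rule lin_comb[OF assms])
  have q: "0 \<le> a\<^sup>2 * cov Y Y + 2 * a * b * cov Y Z + b\<^sup>2 * cov Z Z" for a b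
  proof -
    have "cov (\<lambda>w. a * Y w + b * Z w) (\<lambda>w. a * Y w + b * Z w) = a\<^sup>2 * cov Y Y + 2 * a * b * cov Y Z + b\<^sup>2 * cov Z Z"
      unfolding cov_lin[OF assms L] cov_lin_right[OF assms assms(1)] cov_lin_right[OF assms assms(2)] cov_commute[of Z Y]
      by (simp add: algebra_simps power2_eq_square)
    then show ?thesis using cov_nonneg by metis
  qed
  show ?thesis
  proof (cases "cov Z Z = 0")
    case True
    have "0 \<le> cov Y Y + 2 * b * cov Y Z" for b using q[of 1 b] True by simp
    \<comment> \<open>If \<open>cov Y Z\<close> were nonzero, the nonnegative expression would equal
      -1 at this value of \<open>b\<close>.\<close>
    from this[of "- (cov Y Y + 1) / (2 * cov Y Z)"] have "cov Y Z = 0" by (cases "cov Y Z = 0") (auto simp: field_simps)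
    then show ?thesis using True by simp
  next
    case False
    then have p: "cov Z Z > 0" using cov_nonneg[of Z] by simp
    have "0 \<le> cov Z Z * (cov Y Y * cov Z Z - (cov Y Z)\<^sup>2)" using q[of "cov Z Z" "- cov Y Z"]
      by (simp add: algebra_simps power2_eq_square)
    then show ?thesis using p by (simp add: zero_le_mult_iff)
  qed
qed

text \<open>By \<open>gauss_rv_limit\<close> the variances of the differences
  \<open>Y n - Y0\<close>, which tend to 0 pointwise, tend to 0; the Cauchy-Schwarz inequality then
  controls the covariances with \<open>Z\<close>. This is the tool for differentiating
  covariances.\<close>

lemma cov_tendsto:
  assumes "\<And>n. Y n \<in> H" "Y0 \<in> H" "Z \<in> H" and lim: "\<And>u. (\<lambda>n. Y n u) \<longlonglongrightarrow> Y0 u"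
  shows "(\<lambda>n. cov (Y n) Z) \<longlonglongrightarrow> cov Y0 Z"
proof -
  let ?D = "\<lambda>n u. Y n u - 1 * Y0 u"
  have D: "?D n \<in> H" for n by (rule diff_scale_H) (use assms in auto)
  have l: "(\<lambda>n. ?D n u) \<longlonglongrightarrow> 0" for u unfolding mult_1_left by (rule LIM_zero[OF lim])
  have L0: "AE u in M. (\<lambda>n. ?D n u) \<longlonglongrightarrow> (\<lambda>_. 0) u" by (rule AE_I2, rule l)
  obtain w where w: "gauss_rv M (\<lambda>_. 0) w" "(\<lambda>n. cov (?D n) (?D n)) \<longlonglongrightarrow> w"
    using gauss_rv_limit[where Y="?D" and Z="\<lambda>_. 0", OF gauss[OF D] L0 borel_measurable_const]
    by (elim exE conjE) (rule that)
  have w0: "w = 0" using gauss_rv_moments(4)[OF w(1)] by simp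
  have "(\<lambda>n. sqrt (cov (?D n) (?D n) * cov Z Z)) \<longlonglongrightarrow> sqrt (0 * cov Z Z)"
    by (rule tendsto_real_sqrt, rule tendsto_mult[OF w(2)[unfolded w0] tendsto_const])
  then have s0: "(\<lambda>n. sqrt (cov (?D n) (?D n) * cov Z Z)) \<longlonglongrightarrow> 0" by (simp only: mult_zero_left real_sqrt_zero)
  have le: "\<bar>cov (?D n) Z\<bar> \<le> sqrt (cov (?D n) (?D n) * cov Z Z)" for n
    using real_sqrt_le_mono[OF cauchy_schwarz[OF D[of n] assms(3)]] by (simp only: real_sqrt_abs)
  have "(\<lambda>n. cov (?D n) Z) \<longlonglongrightarrow> 0"
  proof (rule Lim_null_comparison[OF _ s0])
    show "\<forall>\<^sub>F n in sequentially. norm (cov (?D n) Z) \<le> sqrt (cov (?D n) (?D n) * cov Z Z)"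
      by (rule always_eventually, rule allI, unfold real_norm_def, rule le)
  qed
  moreover have "cov (?D n) Z = cov (Y n) Z - cov Y0 Z" for n
    using cov_diff[OF assms(1)[of n] assms(2,3), of 1] by (simp only: mult_1_left)
  ultimately have "(\<lambda>n. cov (Y n) Z - cov Y0 Z) \<longlonglongrightarrow> 0" by (simp only:)
  then show ?thesis by (rule LIM_zero_cancel)
qed

lemma expect_cos: "Y \<in> H \<Longrightarrow> (LINT w|M. cos (Y w)) = exp (- cov Y Y / 2)"
  and expect_sin: "Y \<in> H \<Longrightarrow> (LINT w|M. sin (Y w)) = 0"
proof -
  assume Y: "Y \<in> H"
  have "(LINT w|M. cos (1 * Y w)) = exp (- (cov Y Y * 1\<^sup>2) / 2) \<and> (LINT w|M. sin (1 * Y w)) = 0"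
    using gauss[OF Y] unfolding gauss_rv_def by blast
  then show "(LINT w|M. cos (Y w)) = exp (- cov Y Y / 2)" "(LINT w|M. sin (Y w)) = 0"
    by simp_all
qed

end

section \<open>Independence of uncorrelated variables, and the exponential tilt behind the
  conditional law\<close>

context gauss_space
begin

lemma cov_diff_diff:
  assumes "Y \<in> H" "Z \<in> H"
  shows "cov (\<lambda>w. Y w - b * Z w) (\<lambda>w. Y w - b * Z w) = cov Y Y - 2 * b * cov Y Z + b\<^sup>2 * cov Z Z"
  unfolding cov_diff[OF assms diff_scale_H[OF assms]] cov_diff_right[OF assms assms(1)] cov_diff_right[OF assms assms(2)] cov_commute[of Z Y]
  by (simp add: algebra_simps power2_eq_square)

text \<open>Uncorrelated members of a Gaussian space are independent, even against an infinite
  family. Independence is realised on \<open>M \<Otimes>\<^sub>M M\<close>, with \<open>X\<close>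
  read in the first and all \<open>W i\<close> in the second coordinate: the characteristic
  functions agree because variances of uncorrelated summands add.\<close>

lemma uncorrelated_split:
  fixes W :: "'i \<Rightarrow> 'a \<Rightarrow> real" and \<Phi> :: "real \<Rightarrow> ('i \<Rightarrow> real) \<Rightarrow> ennreal"
  assumes X: "X \<in> H" and W: "\<And>i. W i \<in> H" and uc: "\<And>i. cov X (W i) = 0"
    and \<Phi>: "(\<lambda>(x, w). \<Phi> x w) \<in> borel_measurable (borel \<Otimes>\<^sub>M PiM UNIV (\<lambda>_. borel))"
  shows "(\<integral>\<^sup>+u. \<Phi> (X u) (\<lambda>i. W i u) \<partial>M) = (\<integral>\<^sup>+u'. \<integral>\<^sup>+u. \<Phi> (X u) (\<lambda>i. W i u') \<partial>M \<partial>M)"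
proof -
  interpret MM: pair_prob_space M M ..
  let ?P = "PiM UNIV (\<lambda>_::'i option. borel :: real measure)"
  define F :: "'i option \<Rightarrow> 'a \<Rightarrow> real" where "F i = (case i of None \<Rightarrow> X | Some j \<Rightarrow> W j)" for i
  define F' :: "'i option \<Rightarrow> 'a \<times> 'a \<Rightarrow> real" where
    "F' i = (case i of None \<Rightarrow> \<lambda>p. X (fst p) | Some j \<Rightarrow> \<lambda>p. W j (snd p))" for i
  have Xm[measurable]: "X \<in> borel_measurable M" and Wm[measurable]: "\<And>i. W i \<in> borel_measurable M" using X W meas_H by auto
  have Fm: "F i \<in> borel_measurable M" "F' i \<in> borel_measurable (M \<Otimes>\<^sub>M M)" for i
    using Xm Wm by (auto simp: F_def F'_def split: option.split)
  have split: "(\<Sum>i\<in>I. c i * F i u) = (if None \<in> I then c None else 0) * X u + (\<Sum>i\<in>{i. Some i \<in> I}. c (Some i) * W i u)"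
    and split': "(\<Sum>i\<in>I. c i * F' i p) = (if None \<in> I then c None else 0) * X (fst p) + (\<Sum>i\<in>{i. Some i \<in> I}. c (Some i) * W i (snd p))"
    if "finite I" for I and c :: "'i option \<Rightarrow> real" and u p
  proof -
    have fin: "finite {i. Some i \<in> I}" using finite_vimageI[OF that, of Some] by (simp add: vimage_def)
    have I: "I = (if None \<in> I then {None} else {}) \<union> Some ` {i. Some i \<in> I}"
    proof (rule set_eqI)
      fix x show "x \<in> I \<longleftrightarrow> x \<in> (if None \<in> I then {None} else {}) \<union> Some ` {i. Some i \<in> I}"
        by (cases x) auto
    qed
    have gen: "(\<Sum>i\<in>I. g i) = (if None \<in> I then g None else 0) + (\<Sum>i\<in>{i. Some i \<in> I}. g (Some i))" for g :: "'i option \<Rightarrow> real"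
      by (subst I, subst sum.union_disjoint) (auto simp: fin sum.reindex)
    show "(\<Sum>i\<in>I. c i * F i u) = (if None \<in> I then c None else 0) * X u + (\<Sum>i\<in>{i. Some i \<in> I}. c (Some i) * W i u)"
      "(\<Sum>i\<in>I. c i * F' i p) = (if None \<in> I then c None else 0) * X (fst p) + (\<Sum>i\<in>{i. Some i \<in> I}. c (Some i) * W i (snd p))"
      unfolding gen by (simp_all add: F_def F'_def)
  qed
  have ch: "(LINT u|M. cos (\<Sum>i\<in>I. c i * F i u)) = (LINT p|(M \<Otimes>\<^sub>M M). cos (\<Sum>i\<in>I. c i * F' i p)) \<and>
    (LINT u|M. sin (\<Sum>i\<in>I. c i * F i u)) = (LINT p|(M \<Otimes>\<^sub>M M). sin (\<Sum>i\<in>I. c i * F' i p))" if fin: "finite I" for I c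
  proof -
    define A where "A = (\<lambda>u. (if None \<in> I then c None else 0) * X u)"
    define B where "B = (\<lambda>u. \<Sum>i\<in>{i. Some i \<in> I}. c (Some i) * W i u)"
    have finS: "finite {i. Some i \<in> I}" using finite_vimageI[OF fin, of Some] by (simp add: vimage_def)
    have A: "A \<in> H" unfolding A_def by (rule scale_H[OF X])
    have B: "B \<in> H" unfolding B_def by (rule sum_H[OF finS X W])
    have [measurable]: "A \<in> borel_measurable M" "B \<in> borel_measurable M" using A B meas_H by auto
    have AB: "(\<lambda>u. 1 * A u + 1 * B u) \<in> H" by (rule lin_comb[OF A B])
    have "cov B X = 0" unfolding B_def cov_sum[OF finS W X] using uc by (simp add: cov_commute)
    then have c0: "cov A B = 0" unfolding A_def cov_scale by (simp add: cov_commute)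
    have vv: "cov (\<lambda>u. 1 * A u + 1 * B u) (\<lambda>u. 1 * A u + 1 * B u) = cov A A + cov B B"
      unfolding cov_lin[OF A B AB] cov_lin_right[OF A B A] cov_lin_right[OF A B B] by (simp add: c0 cov_commute[of B A])
    have ib: "integrable M (\<lambda>u. q (Y u))" if q: "q = cos \<or> q = sin" and [measurable]: "Y \<in> borel_measurable M" for q :: "real \<Rightarrow> real" and Y
    proof (rule integrable_const_bound[of _ 1])
      have [measurable]: "q \<in> borel_measurable borel" using q by auto
      show "(\<lambda>u. q (Y u)) \<in> borel_measurable M" by measurable
    qed (use q in auto)
    have pr: "integrable (M \<Otimes>\<^sub>M M) (\<lambda>p. q (A (fst p)) * r (B (snd p)))" "(LINT p|(M \<Otimes>\<^sub>M M). q (A (fst p)) * r (B (snd p))) = (LINT u|M. q (A u)) * (LINT u|M. r (B u))"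
      if q: "q = cos \<or> q = sin" "r = cos \<or> r = sin" for q r :: "real \<Rightarrow> real"
    proof -
      have [measurable]: "q \<in> borel_measurable borel" "r \<in> borel_measurable borel" using q by auto
      have bnd: "\<bar>q x * r y\<bar> \<le> 1" for x y
        unfolding abs_mult by (rule mult_le_one) (use q in auto)
      show int: "integrable (M \<Otimes>\<^sub>M M) (\<lambda>p. q (A (fst p)) * r (B (snd p)))"
      proof (rule MM.integrable_const_bound[of _ 1])
        show "AE p in M \<Otimes>\<^sub>M M. norm (q (A (fst p)) * r (B (snd p))) \<le> 1" by (rule AE_I2) (use bnd in simp)
      qed measurable
      have "(LINT p|(M \<Otimes>\<^sub>M M). q (A (fst p)) * r (B (snd p))) = (LINT u|M. LINT u'|M. q (A u) * r (B u'))"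
        using MM.integral_fst'[of "\<lambda>p. q (A (fst p)) * r (B (snd p))"] int by simp
      then show "(LINT p|(M \<Otimes>\<^sub>M M). q (A (fst p)) * r (B (snd p))) = (LINT u|M. q (A u)) * (LINT u|M. r (B u))" by simp
    qed
    have cA: "(LINT u|M. cos (A u)) = exp (- cov A A / 2)" "(LINT u|M. cos (B u)) = exp (- cov B B / 2)"
      "(LINT u|M. sin (A u)) = 0" "(LINT u|M. sin (B u)) = 0"
      using expect_cos[OF A] expect_cos[OF B] expect_sin[OF A] expect_sin[OF B] by auto
    have 1: "(LINT u|M. cos (A u + B u)) = exp (- (cov A A + cov B B) / 2)" "(LINT u|M. sin (A u + B u)) = 0"
      using expect_cos[OF AB] expect_sin[OF AB] unfolding vv by simp_all
    have 2: "(LINT p|(M \<Otimes>\<^sub>M M). cos (A (fst p) + B (snd p))) = exp (- cov A A / 2) * exp (- cov B B / 2)"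
    proof -
      note p1 = pr[of cos cos] and p2 = pr[of sin sin]
      show ?thesis unfolding cos_add by (subst Bochner_Integration.integral_diff) (simp_all add: p1 p2 cA)
    qed
    have 3: "(LINT p|(M \<Otimes>\<^sub>M M). sin (A (fst p) + B (snd p))) = 0"
    proof -
      note p1 = pr[of cos sin] and p2 = pr[of sin cos]
      show ?thesis unfolding sin_add by (subst Bochner_Integration.integral_add) (simp_all add: p1 p2 cA)
    qed
    have "exp (- (cov A A + cov B B) / 2) = exp (- cov A A / 2) * exp (- cov B B / 2)"
      unfolding exp_add[symmetric] by (simp add: add_divide_distrib)
    then show ?thesis unfolding split[OF fin] split'[OF fin] using 1 2 3 unfolding A_def B_def by simp
  qed
  have eq: "distr M ?P (\<lambda>u i. F i u) = distr (M \<Otimes>\<^sub>M M) ?P (\<lambda>p i. F' i p)"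
    by (rule distr_PiM_eqI_char) (use ch Fm in \<open>auto intro: finite_measure_axioms MM.finite_measure_axioms\<close>)
  let ?f = "\<lambda>x. \<Phi> (x None) (\<lambda>i. x (Some i))"
  have fm: "?f \<in> borel_measurable ?P"
  proof -
    have "(\<lambda>x. (x None, \<lambda>i. x (Some i))) \<in> ?P \<rightarrow>\<^sub>M borel \<Otimes>\<^sub>M PiM UNIV (\<lambda>_. borel)"
      by (intro measurable_Pair measurable_PiM_single' measurable_component_singleton) auto
    from measurable_compose[OF this \<Phi>] show ?thesis by simp
  qed
  have mF: "(\<lambda>u i. F i u) \<in> M \<rightarrow>\<^sub>M ?P" "(\<lambda>p i. F' i p) \<in> M \<Otimes>\<^sub>M M \<rightarrow>\<^sub>M ?P"
    by (rule measurable_PiM_single'; simp add: Fm)+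
  have "(\<integral>\<^sup>+u. \<Phi> (X u) (\<lambda>i. W i u) \<partial>M) = (\<integral>\<^sup>+x. ?f x \<partial>distr M ?P (\<lambda>u i. F i u))"
    by (subst nn_integral_distr[OF mF(1)]) (simp_all add: fm F_def)
  also have "\<dots> = (\<integral>\<^sup>+p. ?f (\<lambda>i. F' i p) \<partial>(M \<Otimes>\<^sub>M M))"
    unfolding eq by (rule nn_integral_distr[OF mF(2)]) (simp add: fm)
  also have "\<dots> = (\<integral>\<^sup>+u'. \<integral>\<^sup>+u. ?f (\<lambda>i. F' i (u, u')) \<partial>M \<partial>M)"
    by (rule MM.nn_integral_snd[symmetric, where f="\<lambda>p. ?f (\<lambda>i. F' i p)"]) (rule measurable_compose[OF mF(2) fm])
  finally show ?thesis by (simp add: F'_def)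
qed

text \<open>Write \<open>X = \<alpha> * \<xi> + g\<close> with \<open>g\<close> independent of
  \<open>\<xi>\<close>. Then \<open>X\<close> vanishes for \<open>\<xi> = - g / \<alpha>\<close>, so
  \<open>w\<close> is the density of \<open>X\<close> at 0 given \<open>g\<close>. \<open>U\<close>
  is uncorrelated with \<open>\<xi>\<close> and equals \<open>Z\<close> where \<open>X = 0\<close>;
  it is the value that \<open>Z\<close> takes there. \<open>V\<close> is the regression residual of
  \<open>Z\<close> on \<open>X\<close>. The claim: averaging over \<open>g\<close> produces the
  density of \<open>X\<close> at 0 times the conditional law of \<open>Z\<close> given
  \<open>X = 0\<close>.\<close>

lemma tilted_char:
  assumes X: "X \<in> H" and \<xi>: "\<xi> \<in> H" and c0: "cov X \<xi> \<noteq> 0" and Z: "Z \<in> H"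
  defines "v0 \<equiv> cov \<xi> \<xi>"
  defines "\<alpha> \<equiv> cov X \<xi> / v0"
  defines "w \<equiv> (\<lambda>\<omega>. normal_density 0 (sqrt v0) ((X \<omega> - \<alpha> * \<xi> \<omega>) / \<alpha>) / \<bar>\<alpha>\<bar>)"
  defines "U \<equiv> (\<lambda>\<omega>. Z \<omega> - cov Z \<xi> / cov X \<xi> * X \<omega>)"
  defines "V \<equiv> (\<lambda>\<omega>. Z \<omega> - cov Z X / cov X X * X \<omega>)"
  shows "(LINT \<omega>|M. w \<omega> * cos (U \<omega>)) = 1 / sqrt (2 * pi * cov X X) * (LINT \<omega>|M. cos (V \<omega>))"
    and "(LINT \<omega>|M. w \<omega> * sin (U \<omega>)) = 1 / sqrt (2 * pi * cov X X) * (LINT \<omega>|M. sin (V \<omega>))"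
proof -
  define v where "v = cov X X"
  define g where "g = (\<lambda>\<omega>. X \<omega> - \<alpha> * \<xi> \<omega>)"
  have v0: "v0 > 0" "v > 0"
  proof -
    have "0 < (cov X \<xi>)\<^sup>2" using c0 by simp
    also have "\<dots> \<le> cov X X * cov \<xi> \<xi>" by (rule cauchy_schwarz[OF X \<xi>])
    finally show "v0 > 0" "v > 0" unfolding v0_def v_def using cov_nonneg[of X] cov_nonneg[of \<xi>] by (auto simp: zero_less_mult_iff)
  qed
  have \<alpha>: "\<alpha> \<noteq> 0" using c0 v0 by (simp add: \<alpha>_def)
  have UH: "U \<in> H" unfolding U_def by (rule diff_scale_H[OF Z X])
  have VH: "V \<in> H" unfolding V_def by (rule diff_scale_H[OF Z X])
  have gH: "g \<in> H" unfolding g_def by (rule diff_scale_H[OF X \<xi>])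
  have [measurable]: "U \<in> borel_measurable M" "g \<in> borel_measurable M" using UH gH meas_H by auto
  have U\<xi>: "cov U \<xi> = 0" unfolding U_def cov_diff[OF Z X \<xi>] using c0 by simp
  have gU: "cov g U = cov U X"
    unfolding g_def cov_diff[OF X \<xi> UH] cov_commute[of \<xi> U] U\<xi> by (simp add: cov_commute)
  have gg: "cov g g = v - \<alpha>\<^sup>2 * v0"
  proof -
    have "cov X \<xi> = \<alpha> * v0" using v0(1) by (simp add: \<alpha>_def)
    then show ?thesis unfolding g_def cov_diff_diff[OF X \<xi>] by (simp add: v_def v0_def[symmetric] power2_eq_square)
  qed
  have VV: "cov V V = cov U U - (cov U X)\<^sup>2 / v"
  proof -
    define b where "b = cov Z \<xi> / cov X \<xi>"
    have UU: "cov U U = cov Z Z - 2 * b * cov Z X + b\<^sup>2 * v" "cov U X = cov Z X - b * v"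
      unfolding U_def b_def[symmetric] cov_diff_diff[OF Z X] cov_diff[OF Z X X] by (simp_all add: v_def)
    have "cov V V = cov Z Z - (cov Z X)\<^sup>2 / v"
      unfolding V_def cov_diff_diff[OF Z X] using v0(2) by (simp add: v_def[symmetric] power2_eq_square)
    moreover have "(cov Z X - b * v)\<^sup>2 / v = (cov Z X)\<^sup>2 / v - 2 * b * cov Z X + b\<^sup>2 * v"
      using v0(2) by (simp add: power2_diff field_simps power2_eq_square)
    ultimately show ?thesis unfolding UU by simp
  qed
  define \<rho> where "\<rho> = normal_density 0 (1 / sqrt v0)"
  define K where "K = 1 / sqrt (2 * pi * v0)"
  \<comment> \<open>The normal density is itself a Fourier integral, against the normal density
    \<open>\<rho>\<close> of variance \<open>1 / v0\<close>. This dissolves the weight and leaves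
    characteristic functions of combinations of \<open>U\<close> and \<open>g\<close>.\<close>
  have wf: "w \<omega> = K / \<bar>\<alpha>\<bar> * (LINT z|lborel. \<rho> z * cos (z / \<alpha> * g \<omega>))" for \<omega>
  proof -
    have "(LINT z|lborel. \<rho> z * cos (z / \<alpha> * g \<omega>)) = (LINT z|lborel. \<rho> z * cos (g \<omega> / \<alpha> * z))" by (simp add: mult.commute)
    also have "\<dots> = exp (- ((1 / sqrt v0)\<^sup>2 * (g \<omega> / \<alpha>)\<^sup>2) / 2)" unfolding \<rho>_def by (rule normal_density_cos_sin) (use v0 in simp)
    finally show ?thesis unfolding w_def K_def g_def normal_density_def using v0 by (simp add: power_divide mult_ac)
  qed
  have \<rho>m[measurable]: "\<rho> \<in> borel_measurable borel" unfolding \<rho>_def by simp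
  have \<rho>i: "integrable lborel \<rho>" unfolding \<rho>_def by (rule integrable_normal_density) (use v0 in simp)
  have \<rho>0: "\<rho> z \<ge> 0" for z unfolding \<rho>_def by simp
  interpret LM: pair_sigma_finite lborel M ..
  have swap: "(LINT \<omega>|M. w \<omega> * q (U \<omega>)) = K / \<bar>\<alpha>\<bar> * (LINT z|lborel. \<rho> z * (LINT \<omega>|M. cos (z / \<alpha> * g \<omega>) * q (U \<omega>)))"
    if q: "q = cos \<or> q = sin" for q
  proof -
    have [measurable]: "q \<in> borel_measurable borel" using q by auto
    have qb: "\<bar>q x\<bar> \<le> 1" for x using q by auto
    have int: "integrable (lborel \<Otimes>\<^sub>M M) (\<lambda>(z, \<omega>). \<rho> z * cos (z / \<alpha> * g \<omega>) * q (U \<omega>))"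
    proof (rule Bochner_Integration.integrable_bound)
      show "integrable (lborel \<Otimes>\<^sub>M M) (\<lambda>(z, \<omega>). \<rho> z * 1)"
      proof (rule LM.Fubini_integrable)
        show "integrable lborel (\<lambda>z. LINT \<omega>|M. norm (case (z, \<omega>) of (z, \<omega>) \<Rightarrow> \<rho> z * 1))"
          using integrable_norm[OF \<rho>i] by (simp add: prob_space)
      qed auto
      have "\<bar>\<rho> z * cos x * q y\<bar> \<le> \<rho> z" for x y z
      proof -
        have "\<bar>\<rho> z * cos x * q y\<bar> = \<rho> z * (\<bar>cos x\<bar> * \<bar>q y\<bar>)" using \<rho>0 by (simp add: abs_mult)
        also have "\<dots> \<le> \<rho> z * 1" by (intro mult_left_mono mult_le_one qb \<rho>0) auto
        finally show ?thesis by simp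
      qed
      then show "AE p in lborel \<Otimes>\<^sub>M M. norm (case p of (z, \<omega>) \<Rightarrow> \<rho> z * cos (z / \<alpha> * g \<omega>) * q (U \<omega>)) \<le> norm (case p of (z, \<omega>) \<Rightarrow> \<rho> z * 1)"
        by (intro AE_I2) (auto simp: \<rho>0)
    qed measurable
    have "(LINT \<omega>|M. w \<omega> * q (U \<omega>)) = (LINT \<omega>|M. K / \<bar>\<alpha>\<bar> * (LINT z|lborel. \<rho> z * cos (z / \<alpha> * g \<omega>) * q (U \<omega>)))"
      unfolding wf integral_mult_left_zero unfolding mult.assoc ..
    also have "\<dots> = K / \<bar>\<alpha>\<bar> * (LINT \<omega>|M. LINT z|lborel. \<rho> z * cos (z / \<alpha> * g \<omega>) * q (U \<omega>))" by simp
    also have "(LINT \<omega>|M. LINT z|lborel. \<rho> z * cos (z / \<alpha> * g \<omega>) * q (U \<omega>)) = (LINT z|lborel. LINT \<omega>|M. \<rho> z * cos (z / \<alpha> * g \<omega>) * q (U \<omega>))"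
      by (rule LM.Fubini_integral[OF int])
    finally show ?thesis by (simp add: mult.assoc)
  qed
  define k u where "k = cov U X / \<alpha>" and "u = cov U U"
  define s where "s = cov g g / \<alpha>\<^sup>2"
  have UgH: "(\<lambda>\<omega>. 1 * U \<omega> + (b * z / \<alpha>) * g \<omega>) \<in> H" for b z by (rule lin_comb[OF UH gH])
  have Ug: "cov (\<lambda>\<omega>. 1 * U \<omega> + (b * z / \<alpha>) * g \<omega>) (\<lambda>\<omega>. 1 * U \<omega> + (b * z / \<alpha>) * g \<omega>) = s * z\<^sup>2 + 2 * z * (b * k) + u"
    if "b\<^sup>2 = 1" for b z
  proof -
    have "cov (\<lambda>\<omega>. 1 * U \<omega> + (b * z / \<alpha>) * g \<omega>) (\<lambda>\<omega>. 1 * U \<omega> + (b * z / \<alpha>) * g \<omega>) = u + 2 * (b * z / \<alpha>) * cov U X + (b * z / \<alpha>)\<^sup>2 * cov g g"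
      unfolding cov_lin[OF UH gH UgH] cov_lin_right[OF UH gH UH] cov_lin_right[OF UH gH gH] cov_commute[of U g] gU
      by (simp add: u_def algebra_simps power2_eq_square)
    also have "(b * z / \<alpha>)\<^sup>2 = z\<^sup>2 / \<alpha>\<^sup>2" using that by (simp add: power_mult_distrib power_divide)
    finally show ?thesis by (simp add: s_def k_def mult_ac)
  qed
  have ec: "(LINT \<omega>|M. cos (U \<omega> + (b * z / \<alpha>) * g \<omega>)) = exp (- (s * z\<^sup>2 + 2 * z * (b * k) + u) / 2)"
    and es: "(LINT \<omega>|M. sin (U \<omega> + (b * z / \<alpha>) * g \<omega>)) = 0" if "b\<^sup>2 = 1" for b z
    using expect_cos[OF UgH, of b z] expect_sin[OF UgH, of b z] unfolding Ug[OF that] by simp_all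
  have ib: "integrable M (\<lambda>\<omega>. q (U \<omega> + (b * z / \<alpha>) * g \<omega>))" if q: "q = cos \<or> q = sin" for q :: "real \<Rightarrow> real" and b z
  proof (rule integrable_const_bound[of _ 1])
    have [measurable]: "q \<in> borel_measurable borel" using q by auto
    show "(\<lambda>\<omega>. q (U \<omega> + (b * z / \<alpha>) * g \<omega>)) \<in> borel_measurable M" by measurable
  qed (use q in auto)
  \<comment> \<open>The signs \<open>b = 1\<close> and \<open>b = -1\<close> arise from turning the
    product into a sum; after integration over \<open>z\<close> both give the same value, because
    only \<open>k\<^sup>2\<close> remains.\<close>
  have pc: "cos (z / \<alpha> * x) * q y = (q (y + (1 * z / \<alpha>) * x) + q (y + ((-1) * z / \<alpha>) * x)) / 2"
    if q: "q = cos \<or> q = sin" for q :: "real \<Rightarrow> real" and x y z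
    using q by (auto simp: cos_add sin_add cos_diff sin_diff)
  have inner: "(LINT \<omega>|M. cos (z / \<alpha> * g \<omega>) * q (U \<omega>)) = ((LINT \<omega>|M. q (U \<omega> + (1 * z / \<alpha>) * g \<omega>)) + (LINT \<omega>|M. q (U \<omega> + ((-1) * z / \<alpha>) * g \<omega>))) / 2"
    if q: "q = cos \<or> q = sin" for q :: "real \<Rightarrow> real" and z
    unfolding pc[OF q] integral_divide_zero Bochner_Integration.integral_add[OF ib[OF q] ib[OF q]] ..
  have one: "(1::real)\<^sup>2 = 1" "(-1::real)\<^sup>2 = 1" by auto
  have "(LINT \<omega>|M. w \<omega> * sin (U \<omega>)) = 0"
    unfolding swap[OF disjI2[OF refl]] inner[OF disjI2[OF refl]] es[OF one(1)] es[OF one(2)] by simp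
  then show "(LINT \<omega>|M. w \<omega> * sin (U \<omega>)) = 1 / sqrt (2 * pi * cov X X) * (LINT \<omega>|M. sin (V \<omega>))"
    unfolding expect_sin[OF VH] by simp
  \<comment> \<open>The exponent \<open>v0\<close> of \<open>\<rho>\<close> plus the variance
    \<open>s\<close> of \<open>g / \<alpha>\<close> is the variance of \<open>X / \<alpha>\<close>;
    this is how the density of \<open>X\<close> at 0 emerges.\<close>
  define A where "A = v0 + s"
  have A: "A = v / \<alpha>\<^sup>2" unfolding A_def s_def gg using \<alpha> by (simp add: field_simps)
  have Ap: "A > 0" unfolding A using v0 \<alpha> by simp
  have gi: "(LINT z|lborel. \<rho> z * exp (- (s * z\<^sup>2 + 2 * z * (b * k) + u) / 2)) = sqrt (v0 / (2 * pi)) * (sqrt (2 * pi / A) * exp (k\<^sup>2 / (2 * A) - u / 2))"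
    and gint: "integrable lborel (\<lambda>z. \<rho> z * exp (- (s * z\<^sup>2 + 2 * z * (b * k) + u) / 2))"
    if b: "b\<^sup>2 = 1" for b
  proof -
    have "\<rho> z * exp (- (s * z\<^sup>2 + 2 * z * (b * k) + u) / 2) = sqrt (v0 / (2 * pi)) * exp (- (A * z\<^sup>2 + 2 * z * (b * k) + u) / 2)" for z
    proof -
      have "\<rho> z = sqrt (v0 / (2 * pi)) * exp (- (v0 * z\<^sup>2) / 2)"
        unfolding \<rho>_def normal_density_def using v0 by (simp add: power_divide real_sqrt_divide mult.commute)
      then show ?thesis unfolding A_def by (simp add: mult.assoc exp_add[symmetric] algebra_simps add_divide_distrib diff_divide_distrib)
    qed
    then have eq: "(\<lambda>z. \<rho> z * exp (- (s * z\<^sup>2 + 2 * z * (b * k) + u) / 2)) = (\<lambda>z. sqrt (v0 / (2 * pi)) * exp (- (A * z\<^sup>2 + 2 * z * (b * k) + u) / 2))" by (rule ext)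
    have "(b * k)\<^sup>2 = k\<^sup>2" using b by (simp add: power_mult_distrib)
    then have "has_bochner_integral lborel (\<lambda>z. \<rho> z * exp (- (s * z\<^sup>2 + 2 * z * (b * k) + u) / 2)) (sqrt (v0 / (2 * pi)) * (sqrt (2 * pi / A) * exp (k\<^sup>2 / (2 * A) - u / 2)))"
      unfolding eq using has_bochner_integral_mult_right[OF gaussian_integral_linear[OF Ap, of "b * k" u], of "sqrt (v0 / (2 * pi))"] by simp
    then show "(LINT z|lborel. \<rho> z * exp (- (s * z\<^sup>2 + 2 * z * (b * k) + u) / 2)) = sqrt (v0 / (2 * pi)) * (sqrt (2 * pi / A) * exp (k\<^sup>2 / (2 * A) - u / 2))"
      "integrable lborel (\<lambda>z. \<rho> z * exp (- (s * z\<^sup>2 + 2 * z * (b * k) + u) / 2))"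
      by (auto simp: has_bochner_integral_iff)
  qed
  have "(LINT \<omega>|M. w \<omega> * cos (U \<omega>)) = K / \<bar>\<alpha>\<bar> * (LINT z|lborel. (\<rho> z * exp (- (s * z\<^sup>2 + 2 * z * (1 * k) + u) / 2) + \<rho> z * exp (- (s * z\<^sup>2 + 2 * z * ((-1) * k) + u) / 2)) / 2)"
    unfolding swap[OF disjI1[OF refl]] inner[OF disjI1[OF refl]] ec[OF one(1)] ec[OF one(2)] by (simp only: distrib_left times_divide_eq_right)
  also have "\<dots> = K / \<bar>\<alpha>\<bar> * (sqrt (v0 / (2 * pi)) * (sqrt (2 * pi / A) * exp (k\<^sup>2 / (2 * A) - u / 2)))"
    unfolding integral_divide_zero Bochner_Integration.integral_add[OF gint[OF one(1)] gint[OF one(2)]] gi[OF one(1)] gi[OF one(2)] by simp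
  also have "\<dots> = 1 / sqrt (2 * pi * v) * exp (- cov V V / 2)"
  proof -
    have e: "k\<^sup>2 / (2 * A) - u / 2 = - cov V V / 2"
      unfolding VV A k_def u_def using \<alpha> v0 by (simp add: field_simps power2_eq_square)
    have sA: "sqrt (2 * pi / A) = \<bar>\<alpha>\<bar> * sqrt (2 * pi) / sqrt v"
      unfolding A using \<alpha> by (simp add: real_sqrt_divide real_sqrt_mult)
    have eK: "K / \<bar>\<alpha>\<bar> * (sqrt (v0 / (2 * pi)) * sqrt (2 * pi / A)) = 1 / sqrt (2 * pi * v)"
      unfolding K_def sA using \<alpha> v0 by (simp add: real_sqrt_divide real_sqrt_mult field_simps)
    show ?thesis unfolding e[symmetric] eK[symmetric] by (simp only: mult.assoc)
  qed
  finally show "(LINT \<omega>|M. w \<omega> * cos (U \<omega>)) = 1 / sqrt (2 * pi * cov X X) * (LINT \<omega>|M. cos (V \<omega>))"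
    unfolding expect_cos[OF VH] v_def .
qed

end

section \<open>The Palm formula\<close>

text \<open>A zero in \<open>{c..<d}\<close>, expressed through values at rational times so as to be
  measurable for the product sigma-algebra. The index \<open>j\<close> exhausts the half-open
  interval by closed ones, on which a continuous function with arbitrarily small absolute values has
  a zero.\<close>

definition hits :: "real \<Rightarrow> real \<Rightarrow> (real \<Rightarrow> real) \<Rightarrow> bool" where
  "hits c d x \<longleftrightarrow> (\<exists>j::nat. \<forall>m::nat. \<exists>q\<in>\<rat>. q \<in> {c..d - 1 / (real j + 1)} \<and> \<bar>x q\<bar> < 1 / (real m + 1))"

lemma hits_iff:
  assumes x: "continuous_on UNIV x" and cd: "c < d"
  shows "hits c d x \<longleftrightarrow> (\<exists>t\<in>{c..<d}. x t = 0)"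
proof
  assume "hits c d x"
  then obtain j :: nat where j: "\<And>m::nat. \<exists>q\<in>\<rat>. q \<in> {c..d - 1 / (real j + 1)} \<and> \<bar>x q\<bar> < 1 / (real m + 1)"
    unfolding hits_def by blast
  define e where "e = d - 1 / (real j + 1)"
  have e: "e < d" by (simp add: e_def)
  have ne: "{c..e} \<noteq> {}" using j[of 0] by (auto simp: e_def)
  have "continuous_on {c..e} (\<lambda>t. \<bar>x t\<bar>)" by (intro continuous_intros continuous_on_subset[OF x]) auto
  then obtain t where t: "t \<in> {c..e}" "\<And>s. s \<in> {c..e} \<Longrightarrow> \<bar>x t\<bar> \<le> \<bar>x s\<bar>"
    using continuous_attains_inf[OF compact_Icc ne] by blast
  have "\<bar>x t\<bar> < inverse (real (Suc m))" for m
  proof -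
    obtain q where q: "q \<in> {c..e}" "\<bar>x q\<bar> < 1 / (real m + 1)" using j[of m] by (auto simp: e_def)
    then show ?thesis using t(2)[of q] by (simp add: inverse_eq_divide add.commute)
  qed
  then have "\<not> 0 < \<bar>x t\<bar>" using reals_Archimedean[of "\<bar>x t\<bar>"] by (meson less_asym)
  then have "x t = 0" by simp
  then show "\<exists>t\<in>{c..<d}. x t = 0" using t(1) e by auto
next
  assume "\<exists>t\<in>{c..<d}. x t = 0"
  then obtain t where t: "c \<le> t" "t < d" "x t = 0" by auto
  obtain j where j: "inverse (real (Suc j)) < d - t" using reals_Archimedean[of "d - t"] t by auto
  define e where "e = d - 1 / (real j + 1)"
  \<comment> \<open>Strictness leaves room to the right of \<open>t\<close> inside
    \<open>{c..e}\<close>, where the rational points near \<open>t\<close> are taken.\<close>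
  have te: "t < e" using j by (simp add: e_def inverse_eq_divide add.commute)
  have "\<exists>q\<in>\<rat>. q \<in> {c..e} \<and> \<bar>x q\<bar> < 1 / (real m + 1)" for m :: nat
  proof -
    have "isCont x t" using x by (simp add: continuous_on_eq_continuous_at)
    then have "\<forall>\<^sub>F s in at t. dist (x s) (x t) < 1 / (real m + 1)" by (intro tendstoD) (auto simp: isCont_def)
    then obtain r where r: "r > 0" "\<And>s. s \<noteq> t \<Longrightarrow> dist s t < r \<Longrightarrow> dist (x s) (x t) < 1 / (real m + 1)"
      by (auto simp: eventually_at)
    have "t < min e (t + r)" using te r by simp
    then obtain q where q: "q \<in> \<rat>" "t < q" "q < min e (t + r)" using Rats_dense_in_real by blast
    then show ?thesis using r(2)[of q] t by (intro bexI[of _ q]) (auto simp: dist_real_def)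
  qed
  then show "hits c d x" unfolding hits_def e_def by blast
qed

lemma hits_measurable: "Measurable.pred (PiM UNIV (\<lambda>_. borel)) (hits c d)"
proof -
  have "Measurable.pred (PiM UNIV (\<lambda>_. borel)) (\<lambda>x. q \<in> {c..d - 1 / (real j + 1)} \<and> \<bar>x q :: real\<bar> < 1 / (real m + 1))" for j m :: nat and q :: real
  proof -
    have [measurable]: "(\<lambda>x. x q) \<in> PiM UNIV (\<lambda>_. borel) \<rightarrow>\<^sub>M (borel :: real measure)"
      by (rule measurable_component_singleton) simp
    show ?thesis by measurable
  qed
  moreover have "Measurable.pred (PiM UNIV (\<lambda>_. borel)) (\<lambda>x. \<exists>q\<in>\<rat>. q \<in> {c..d - 1 / (real j + 1)} \<and> \<bar>x q :: real\<bar> < 1 / (real m + 1))"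
    if "\<And>q j m. Measurable.pred (PiM UNIV (\<lambda>_. borel)) (\<lambda>x. q \<in> {c..d - 1 / (real j + 1)} \<and> \<bar>x q :: real\<bar> < 1 / (real m + 1))" for j m :: nat
  proof -
    have eq: "(\<exists>q\<in>\<rat>. P q) \<longleftrightarrow> (\<exists>r::rat. P (real_of_rat r))" for P by (auto simp: Rats_def)
    show ?thesis unfolding eq using that by (rule pred_intros_countable(2))
  qed
  ultimately show ?thesis unfolding hits_def by (intro pred_intros_countable(2)[OF pred_intros_countable(1)]) blast
qed

text \<open>Defined for arbitrary functions in order to be measurable on the product space; it is
  the number of zeros in \<open>{a..<b}\<close> as soon as the function is continuous.\<close>

definition zero_count :: "real \<Rightarrow> real \<Rightarrow> (real \<Rightarrow> real) \<Rightarrow> ennreal" where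
  "zero_count a b x = (SUP n. \<Sum>k<2 ^ n. if hits (dyadic_pt a b n k) (dyadic_pt a b n (Suc k)) x then 1 else 0)"

lemma zero_count_eq:
  assumes "a < b" and x: "continuous_on UNIV x"
  shows "zero_count a b x = ncard {t\<in>{a..<b}. x t = 0}"
proof -
  have "(\<Sum>k<2 ^ n. if hits (dyadic_pt a b n k) (dyadic_pt a b n (Suc k)) x then 1 else 0) = dyadic_count a b n {t\<in>{a..<b}. x t = 0}" for n
    unfolding dyadic_count_level[OF assms(1)]
  proof (rule sum.cong)
    fix k
    have "hits (dyadic_pt a b n k) (dyadic_pt a b n (Suc k)) x \<longleftrightarrow> 0 \<in> x ` dyadic_piece a b n k"
      unfolding hits_iff[OF x dyadic_pt_mono[OF assms(1)]] dyadic_piece_def by (auto simp: image_iff)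
    then show "(if hits (dyadic_pt a b n k) (dyadic_pt a b n (Suc k)) x then 1 else 0) = (indicator (x ` dyadic_piece a b n k) 0 :: ennreal)"
      by (simp add: indicator_def)
  qed simp
  moreover have "{t\<in>{a..<b}. x t = 0} \<subseteq> {a..<b}" by auto
  ultimately show ?thesis unfolding zero_count_def by (simp only: dyadic_count_SUP[OF assms(1)])
qed

lemma zero_count_measurable: "zero_count a b \<in> borel_measurable (PiM UNIV (\<lambda>_. borel))"
  unfolding zero_count_def
  by (intro borel_measurable_SUP borel_measurable_sum measurable_If predE[OF hits_measurable]) auto

text \<open>Each path is the limit of its values at the grid point just below \<open>t\<close>, and
  these grid points form a countable set for each mesh.\<close>

lemma jointly_measurable:
  fixes X :: "real \<Rightarrow> 'a \<Rightarrow> real"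
  assumes m: "\<And>t. X t \<in> borel_measurable M" and c: "\<And>w. w \<in> space M \<Longrightarrow> continuous_on UNIV (\<lambda>t. X t w)"
  shows "(\<lambda>(t, w). X t w) \<in> borel_measurable (borel \<Otimes>\<^sub>M M)"
proof -
  have "(\<lambda>p. X (fst p) (snd p)) \<in> borel_measurable (borel \<Otimes>\<^sub>M M)"
  proof (rule borel_measurable_LIMSEQ_real)
    show "(\<lambda>p. X (real_of_int \<lfloor>(real n + 1) * fst p\<rfloor> / (real n + 1)) (snd p)) \<in> borel_measurable (borel \<Otimes>\<^sub>M M)" for n :: nat
    proof (rule measurable_compose_countable[where f="\<lambda>i p. X (real_of_int i / (real n + 1)) (snd p)" and g="\<lambda>p. \<lfloor>(real n + 1) * fst p\<rfloor>"])
      show "(\<lambda>p. X (real_of_int i / (real n + 1)) (snd p)) \<in> borel_measurable (borel \<Otimes>\<^sub>M M)" for i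
        by (rule measurable_compose[OF measurable_snd m])
      show "(\<lambda>p. \<lfloor>(real n + 1) * fst p\<rfloor>) \<in> borel \<Otimes>\<^sub>M M \<rightarrow>\<^sub>M count_space UNIV" by measurable
    qed
  next
    fix p :: "real \<times> 'a" assume p: "p \<in> space (borel \<Otimes>\<^sub>M M)"
    obtain t w where to: "p = (t, w)" "w \<in> space M" using p by (auto simp: space_pair_measure)
    have lim: "(\<lambda>n. real_of_int \<lfloor>(real n + 1) * t\<rfloor> / (real n + 1)) \<longlonglongrightarrow> t"
    proof (rule tendsto_sandwich[of "\<lambda>n. t - 1 / (real n + 1)" _ _ "\<lambda>n. t"])
      show "\<forall>\<^sub>F n in sequentially. t - 1 / (real n + 1) \<le> real_of_int \<lfloor>(real n + 1) * t\<rfloor> / (real n + 1)"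
      proof (rule always_eventually, rule allI)
        fix n :: nat
        have "(real n + 1) * t - 1 \<le> real_of_int \<lfloor>(real n + 1) * t\<rfloor>" by linarith
        then have "((real n + 1) * t - 1) / (real n + 1) \<le> real_of_int \<lfloor>(real n + 1) * t\<rfloor> / (real n + 1)" by (rule divide_right_mono) simp
        then show "t - 1 / (real n + 1) \<le> real_of_int \<lfloor>(real n + 1) * t\<rfloor> / (real n + 1)" by (simp add: diff_divide_distrib)
      qed
      show "\<forall>\<^sub>F n in sequentially. real_of_int \<lfloor>(real n + 1) * t\<rfloor> / (real n + 1) \<le> t"
        by (rule always_eventually) (simp add: pos_divide_le_eq mult.commute)
      show "(\<lambda>n. t - 1 / (real n + 1)) \<longlonglongrightarrow> t" by real_asymp
    qed simp
    have "isCont (\<lambda>t. X t w) t" using c[OF to(2)] by (simp add: continuous_on_eq_continuous_at)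
    from isCont_tendsto_compose[OF this lim]
    show "(\<lambda>n. X (real_of_int \<lfloor>(real n + 1) * fst p\<rfloor> / (real n + 1)) (snd p)) \<longlonglongrightarrow> X (fst p) (snd p)"
      by (simp add: to)
  qed
  then show ?thesis by (simp add: split_beta')
qed

context gauss_space
begin

text \<open>Both sides integrate \<open>\<Psi>\<close> against the image of a finite measure. A
  linear combination of the \<open>G j\<close> has the form of \<open>G\<close> for the combination
  of the \<open>Z j\<close>, so \<open>tilted_char\<close> equates all characteristic functions and
  hence the two images.\<close>

lemma tilted_functional:
  fixes Z :: "'j \<Rightarrow> 'a \<Rightarrow> real"
  assumes X: "X \<in> H" and \<xi>: "\<xi> \<in> H" and c0: "cov X \<xi> \<noteq> 0" and Z: "\<And>j. Z j \<in> H"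
    and \<Psi>: "\<Psi> \<in> borel_measurable (PiM UNIV (\<lambda>_. borel))"
  defines "v0 \<equiv> cov \<xi> \<xi>"
  defines "\<alpha> \<equiv> cov X \<xi> / v0"
  shows "(\<integral>\<^sup>+u. ennreal (normal_density 0 (sqrt v0) ((X u - \<alpha> * \<xi> u) / \<alpha>) / \<bar>\<alpha>\<bar>) * \<Psi> (\<lambda>j. Z j u - cov (Z j) \<xi> / cov X \<xi> * X u) \<partial>M)
    = ennreal (1 / sqrt (2 * pi * cov X X)) * (\<integral>\<^sup>+u. \<Psi> (\<lambda>j. Z j u - cov (Z j) X / cov X X * X u) \<partial>M)"
proof -
  let ?P = "PiM UNIV (\<lambda>_::'j. borel :: real measure)"
  define w where "w = (\<lambda>u. normal_density 0 (sqrt v0) ((X u - \<alpha> * \<xi> u) / \<alpha>) / \<bar>\<alpha>\<bar>)"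
  define C where "C = 1 / sqrt (2 * pi * cov X X)"
  define G where "G j u = Z j u - cov (Z j) \<xi> / cov X \<xi> * X u" for j u
  define G' where "G' j u = Z j u - cov (Z j) X / cov X X * X u" for j u
  have [measurable]: "X \<in> borel_measurable M" "\<xi> \<in> borel_measurable M" "\<And>j. Z j \<in> borel_measurable M"
    using X \<xi> Z meas_H by auto
  have wm[measurable]: "w \<in> borel_measurable M" unfolding w_def by measurable
  have w0: "w u \<ge> 0" for u unfolding w_def by simp
  have C0: "C \<ge> 0" unfolding C_def by (simp add: cov_nonneg)
  have Gm[measurable]: "G j \<in> borel_measurable M" "G' j \<in> borel_measurable M" for j unfolding G_def G'_def by measurable
  let ?M1 = "density M (\<lambda>u. ennreal (w u))" and ?M2 = "density M (\<lambda>u. ennreal C)"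
  define B where "B = 1 / sqrt (2 * pi * (sqrt v0)\<^sup>2) / \<bar>\<alpha>\<bar>"
  have wB: "w u \<le> B" for u
  proof -
    have "normal_density 0 (sqrt v0) y \<le> 1 / sqrt (2 * pi * (sqrt v0)\<^sup>2)" for y
      unfolding normal_density_def by (rule mult_left_le) (simp_all add: cov_nonneg v0_def)
    then show ?thesis unfolding w_def B_def by (intro divide_right_mono) auto
  qed
  have f1: "finite_measure ?M1"
  proof (rule finite_measureI)
    have "emeasure ?M1 (space ?M1) = (\<integral>\<^sup>+u. ennreal (w u) \<partial>M)" by (simp add: emeasure_density cong: nn_integral_cong)
    also have "\<dots> \<le> (\<integral>\<^sup>+u. ennreal B \<partial>M)" by (intro nn_integral_mono ennreal_leI wB)
    also have "\<dots> < \<infinity>" by (simp add: emeasure_space_1)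
    finally show "emeasure ?M1 (space ?M1) \<noteq> \<infinity>" by simp
  qed
  have f2: "finite_measure ?M2"
    by (rule finite_measureI) (simp add: emeasure_density emeasure_space_1 cong: nn_integral_cong)
  have ch: "(LINT u|?M1. cos (\<Sum>i\<in>I. c i * G i u)) = (LINT u|?M2. cos (\<Sum>i\<in>I. c i * G' i u)) \<and>
     (LINT u|?M1. sin (\<Sum>i\<in>I. c i * G i u)) = (LINT u|?M2. sin (\<Sum>i\<in>I. c i * G' i u))" if fin: "finite I" for I c
  proof -
    define Zc where "Zc = (\<lambda>u. \<Sum>i\<in>I. c i * Z i u)"
    have Zc: "Zc \<in> H" unfolding Zc_def by (rule sum_H[OF fin X Z])
    have 1: "(\<Sum>i\<in>I. c i * G i u) = Zc u - cov Zc \<xi> / cov X \<xi> * X u" for u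
      unfolding Zc_def cov_sum[OF fin Z \<xi>] G_def by (simp add: sum_subtractf sum_divide_distrib sum_distrib_right right_diff_distrib mult.assoc)
    have 2: "(\<Sum>i\<in>I. c i * G' i u) = Zc u - cov Zc X / cov X X * X u" for u
      unfolding Zc_def cov_sum[OF fin Z X] G'_def by (simp add: sum_subtractf sum_divide_distrib sum_distrib_right right_diff_distrib mult.assoc)
    have [measurable]: "Zc \<in> borel_measurable M" using Zc meas_H by auto
    have d1: "(LINT u|?M1. q u) = (LINT u|M. w u * q u)" if "q \<in> borel_measurable M" for q :: "'a \<Rightarrow> real"
      by (rule integral_real_density) (use that w0 in auto)
    have d2: "(LINT u|?M2. q u) = (LINT u|M. C * q u)" if "q \<in> borel_measurable M" for q :: "'a \<Rightarrow> real"
      by (rule integral_real_density) (use that C0 in auto)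
    note T = tilted_char[OF X \<xi> c0 Zc, folded v0_def, folded \<alpha>_def]
    have m: "(\<lambda>u. q (Zc u - b * X u)) \<in> borel_measurable M" if "q = cos \<or> q = sin" for q :: "real \<Rightarrow> real" and b
    proof -
      have [measurable]: "q \<in> borel_measurable borel" using that by auto
      show ?thesis by measurable
    qed
    show ?thesis
      unfolding 1 2 d1[OF m[OF disjI1[OF refl]]] d1[OF m[OF disjI2[OF refl]]]
        d2[OF m[OF disjI1[OF refl]]] d2[OF m[OF disjI2[OF refl]]] integral_mult_right_zero
      unfolding w_def C_def using T by blast
  qed
  have eq: "distr ?M1 ?P (\<lambda>u j. G j u) = distr ?M2 ?P (\<lambda>u j. G' j u)"
    by (rule distr_PiM_eqI_char[OF f1 f2]) (use ch in \<open>simp_all add: Gm\<close>)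
  have mG: "(\<lambda>u j. G j u) \<in> M \<rightarrow>\<^sub>M ?P" "(\<lambda>u j. G' j u) \<in> M \<rightarrow>\<^sub>M ?P"
    by (rule measurable_PiM_single'; simp add: Gm)+
  have \<Psi>G: "(\<lambda>u. \<Psi> (\<lambda>j. G j u)) \<in> borel_measurable M" "(\<lambda>u. \<Psi> (\<lambda>j. G' j u)) \<in> borel_measurable M"
    by (rule measurable_compose[OF mG(1) \<Psi>], rule measurable_compose[OF mG(2) \<Psi>])
  have "(\<integral>\<^sup>+u. ennreal (w u) * \<Psi> (\<lambda>j. G j u) \<partial>M) = (\<integral>\<^sup>+u. \<Psi> (\<lambda>j. G j u) \<partial>?M1)"
    by (subst nn_integral_density) (simp_all add: \<Psi>G)
  also have "\<dots> = (\<integral>\<^sup>+x. \<Psi> x \<partial>distr ?M1 ?P (\<lambda>u j. G j u))"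
    by (subst nn_integral_distr) (simp_all add: \<Psi> mG)
  also have "\<dots> = (\<integral>\<^sup>+u. \<Psi> (\<lambda>j. G' j u) \<partial>?M2)"
    unfolding eq by (subst nn_integral_distr) (simp_all add: \<Psi> mG)
  also have "\<dots> = ennreal C * (\<integral>\<^sup>+u. \<Psi> (\<lambda>j. G' j u) \<partial>M)"
    by (subst nn_integral_density) (simp_all add: \<Psi>G nn_integral_cmult)
  finally show ?thesis unfolding w_def C_def G_def G'_def .
qed

end

text \<open>Regularity is demanded of every path, which keeps null sets out of the area formula and
  of the measurability arguments. Processes that are only almost surely regular are brought to this
  form by a modification.\<close>

locale gauss_path = gauss_space M H for M :: "'a measure" and H +
  fixes X X' :: "real \<Rightarrow> 'a \<Rightarrow> real"
  assumes X_H: "X t \<in> H" and X'_H: "X' t \<in> H"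
    and X_deriv: "((\<lambda>t. X t w) has_real_derivative X' t w) (at t)"
    and X'_cont: "continuous_on UNIV (\<lambda>t. X' t w)"
begin

lemma X_cont: "continuous_on UNIV (\<lambda>t. X t w)"
  by (rule DERIV_continuous_on[OF has_field_derivative_at_within[OF X_deriv]])

lemma X_meas: "X t \<in> borel_measurable M" and X'_meas: "X' t \<in> borel_measurable M"
  using meas_H X_H X'_H by auto

lemma X_path_meas: "(\<lambda>t. X t w) \<in> borel_measurable borel" and X'_path_meas: "(\<lambda>t. X' t w) \<in> borel_measurable borel"
  by (rule borel_measurable_continuous_onI[OF X_cont], rule borel_measurable_continuous_onI[OF X'_cont])

lemma X_joint: "(\<lambda>(t, w). X t w) \<in> borel_measurable (borel \<Otimes>\<^sub>M M)"
  and X'_joint: "(\<lambda>(t, w). X' t w) \<in> borel_measurable (borel \<Otimes>\<^sub>M M)"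
  by (rule jointly_measurable[OF X_meas X_cont], rule jointly_measurable[OF X'_meas X'_cont])

lemma cov_X_meas: "Z \<in> H \<Longrightarrow> (\<lambda>t. cov Z (X t)) \<in> borel_measurable borel"
  and cov_X'_X_meas: "(\<lambda>t. cov (X' t) (X t)) \<in> borel_measurable borel"
  and cov_X_X_meas: "(\<lambda>t. cov (X t) (X t)) \<in> borel_measurable borel"
proof -
  note [measurable] = X_joint X'_joint
  have [measurable]: "(\<lambda>p. X (fst p) (snd p)) \<in> borel_measurable (borel \<Otimes>\<^sub>M M)" "(\<lambda>p. X' (fst p) (snd p)) \<in> borel_measurable (borel \<Otimes>\<^sub>M M)"
    using X_joint X'_joint by (simp_all add: split_beta')
  show "(\<lambda>t. cov Z (X t)) \<in> borel_measurable borel" if "Z \<in> H"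
  proof -
    have [measurable]: "Z \<in> borel_measurable M" using meas_H that by auto
    show ?thesis unfolding cov_def by (rule borel_measurable_lebesgue_integral) (simp add: split_beta')
  qed
  show "(\<lambda>t. cov (X' t) (X t)) \<in> borel_measurable borel" "(\<lambda>t. cov (X t) (X t)) \<in> borel_measurable borel"
    unfolding cov_def by (rule borel_measurable_lebesgue_integral, simp add: split_beta')+
qed

lemma cov_X'_continuous:
  assumes "Z \<in> H"
  shows "continuous_on UNIV (\<lambda>t. cov (X' t) Z)"
  unfolding continuous_on_sequentially comp_def
proof clarify
  fix s :: "nat \<Rightarrow> real" and t :: real assume "s \<longlonglongrightarrow> t"
  moreover have "isCont (\<lambda>t. X' t w) t" for w using X'_cont by (simp add: continuous_on_eq_continuous_at)
  ultimately have "(\<lambda>n. X' (s n) w) \<longlonglongrightarrow> X' t w" for w by (rule isCont_tendsto_compose[rotated])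
  then show "(\<lambda>n. cov (X' (s n)) Z) \<longlonglongrightarrow> cov (X' t) Z" by (rule cov_tendsto[OF X'_H X'_H assms])
qed

text \<open>The difference quotients lie in \<open>H\<close> and converge on every path, so
  \<open>cov_tendsto\<close> applies to them.\<close>

lemma cov_X_deriv:
  assumes "Z \<in> H"
  shows "((\<lambda>t. cov (X t) Z) has_real_derivative cov (X' t) Z) (at t)"
  unfolding has_field_derivative_iff
proof -
  show "((\<lambda>y. (cov (X y) Z - cov (X t) Z) / (y - t)) \<longlongrightarrow> cov (X' t) Z) (at t)"
    unfolding tendsto_at_iff_sequentially comp_def
  proof (intro allI impI)
    fix s :: "nat \<Rightarrow> real" assume s: "\<forall>n. s n \<in> UNIV - {t}" "s \<longlonglongrightarrow> t"
    have YH: "(\<lambda>w. (1 / (s n - t)) * X (s n) w + (- 1 / (s n - t)) * X t w) \<in> H" for n by (rule lin_comb[OF X_H X_H])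
    have "(\<lambda>n. cov (\<lambda>w. (1 / (s n - t)) * X (s n) w + (- 1 / (s n - t)) * X t w) Z) \<longlonglongrightarrow> cov (X' t) Z"
    proof (rule cov_tendsto[OF YH X'_H assms])
      fix w
      have "((\<lambda>y. (X y w - X t w) / (y - t)) \<longlongrightarrow> X' t w) (at t)" using X_deriv unfolding has_field_derivative_iff .
      then have "(\<lambda>n. (X (s n) w - X t w) / (s n - t)) \<longlonglongrightarrow> X' t w"
        using s unfolding tendsto_at_iff_sequentially comp_def by blast
      then show "(\<lambda>n. (1 / (s n - t)) * X (s n) w + (- 1 / (s n - t)) * X t w) \<longlonglongrightarrow> X' t w"
        by (simp add: diff_divide_distrib)
    qed
    then show "(\<lambda>n. (cov (X (s n)) Z - cov (X t) Z) / (s n - t)) \<longlonglongrightarrow> cov (X' t) Z"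
      unfolding cov_lin[OF X_H X_H assms] by (simp add: diff_divide_distrib)
  qed
qed

text \<open>Regression on \<open>X t\<close>: the residual is independent of \<open>X t\<close>, so
  its law is the conditional law of \<open>Z\<close> given \<open>X t = 0\<close>.\<close>

definition residual :: "real \<Rightarrow> ('a \<Rightarrow> real) \<Rightarrow> 'a \<Rightarrow> real" where
  "residual t Z w = Z w - cov Z (X t) / cov (X t) (X t) * X t w"

lemma residual_H: "Z \<in> H \<Longrightarrow> residual t Z \<in> H"
  unfolding residual_def by (rule diff_scale_H[OF _ X_H])

text \<open>Near \<open>t\<^sub>0\<close> the variable \<open>\<xi> = X t\<^sub>0\<close> is split off: for fixed values of the part of the process
  uncorrelated with \<open>\<xi>\<close>, a zero at \<open>t\<close> means that \<open>\<xi>\<close> takes the value \<open>h t\<close> of a smooth function,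
  so that the area formula applies to the integral over \<open>\<xi>\<close>, without any limiting procedure.\<close>

lemma palm_local:
  fixes Y :: "'i \<Rightarrow> 'a \<Rightarrow> real"
  assumes ab: "a < b" and Y: "\<And>i. Y i \<in> H" and V: "V \<in> borel_measurable (PiM UNIV (\<lambda>_. borel))"
    and pos: "\<And>t. t \<in> {a..b} \<Longrightarrow> 0 < cov (X t) (X t0)"
  shows "(\<integral>\<^sup>+y. V (\<lambda>i. Y i y) * ncard {t\<in>{a..<b}. X t y = 0} \<partial>M) =
    (\<integral>\<^sup>+t. indicator {a..<b} t * (ennreal (1 / sqrt (2 * pi * cov (X t) (X t))) *
       (\<integral>\<^sup>+y. ennreal \<bar>residual t (X' t) y\<bar> * V (\<lambda>i. residual t (Y i) y) \<partial>M)) \<partial>lborel)"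
proof -
  define \<xi> where "\<xi> = X t0"
  define v0 where "v0 = cov \<xi> \<xi>"
  have \<xi>H: "\<xi> \<in> H" unfolding \<xi>_def by (rule X_H)
  have v0: "v0 > 0"
  proof -
    have "0 < (cov (X a) \<xi>)\<^sup>2" using pos[of a] ab by (simp add: \<xi>_def)
    also have "\<dots> \<le> cov (X a) (X a) * v0" unfolding v0_def by (rule cauchy_schwarz[OF X_H \<xi>H])
    finally show ?thesis using cov_nonneg[of "X a"] cov_nonneg[of \<xi>] by (auto simp: v0_def zero_less_mult_iff)
  qed
  define \<alpha> where "\<alpha> t = cov (X t) \<xi> / v0" for t
  define \<alpha>' where "\<alpha>' t = cov (X' t) \<xi> / v0" for t
  define \<beta> where "\<beta> i = cov (Y i) \<xi> / v0" for i
  have \<alpha>pos: "\<alpha> t > 0" if "t \<in> {a..b}" for t using pos[OF that] v0 by (simp add: \<alpha>_def \<xi>_def)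
  have \<alpha>d: "(\<alpha> has_real_derivative \<alpha>' t) (at t)" for t
    unfolding \<alpha>_def \<alpha>'_def by (rule DERIV_cdivide[OF cov_X_deriv[OF \<xi>H]])
  have \<alpha>c: "continuous_on UNIV \<alpha>" by (rule DERIV_continuous_on[OF has_field_derivative_at_within[OF \<alpha>d]])
  have \<alpha>'c: "continuous_on UNIV \<alpha>'"
    unfolding \<alpha>'_def by (intro continuous_intros cov_X'_continuous[OF \<xi>H]) (use v0 in auto)
  have \<alpha>m[measurable]: "\<alpha> \<in> borel_measurable borel" "\<alpha>' \<in> borel_measurable borel"
    by (rule borel_measurable_continuous_onI[OF \<alpha>c], rule borel_measurable_continuous_onI[OF \<alpha>'c])
  define W :: "'i + real \<Rightarrow> 'a \<Rightarrow> real" where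
    "W k = (case k of Inl i \<Rightarrow> \<lambda>y. Y i y - \<beta> i * \<xi> y | Inr t \<Rightarrow> \<lambda>y. X t y - \<alpha> t * \<xi> y)" for k
  have WH: "W k \<in> H" for k
    unfolding W_def using diff_scale_H[OF Y \<xi>H] diff_scale_H[OF X_H \<xi>H] by (cases k) simp_all
  have W0: "cov \<xi> (W k) = 0" for k
  proof (cases k)
    case (Inl i)
    then show ?thesis using cov_diff_right[OF Y[of i] \<xi>H \<xi>H, of "\<beta> i"] v0 by (simp add: W_def \<beta>_def v0_def cov_commute[of \<xi> "Y i"])
  next
    case (Inr t)
    then show ?thesis using cov_diff_right[OF X_H[of t] \<xi>H \<xi>H, of "\<alpha> t"] v0 by (simp add: W_def \<alpha>_def v0_def cov_commute[of \<xi> "X t"])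
  qed
  let ?P = "PiM UNIV (\<lambda>_. borel :: real measure)"
  \<comment> \<open>The variable \<open>u\<close> stands for the value of \<open>\<xi>\<close>, and
    \<open>w\<close> for the part of all processes that is uncorrelated with it.\<close>
  define \<Phi> where "\<Phi> u w = V (\<lambda>i. \<beta> i * u + w (Inl i)) * zero_count a b (\<lambda>t. \<alpha> t * u + w (Inr t))" for u and w :: "'i + real \<Rightarrow> real"
  have m1: "(\<lambda>(u, w). (\<lambda>i. \<beta> i * u + w (Inl i))) \<in> borel \<Otimes>\<^sub>M ?P \<rightarrow>\<^sub>M PiM UNIV (\<lambda>_. borel)"
    and m2: "(\<lambda>(u, w). (\<lambda>t. \<alpha> t * u + w (Inr t))) \<in> borel \<Otimes>\<^sub>M ?P \<rightarrow>\<^sub>M PiM UNIV (\<lambda>_. borel)"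
  proof -
    have e: "(\<lambda>p. snd p k) \<in> borel_measurable (borel \<Otimes>\<^sub>M ?P)" for k :: "'i + real"
      by (rule measurable_compose[OF measurable_snd]) (rule measurable_component_singleton, simp)
    show "(\<lambda>(u, w). (\<lambda>i. \<beta> i * u + w (Inl i))) \<in> borel \<Otimes>\<^sub>M ?P \<rightarrow>\<^sub>M PiM UNIV (\<lambda>_. borel)"
      "(\<lambda>(u, w). (\<lambda>t. \<alpha> t * u + w (Inr t))) \<in> borel \<Otimes>\<^sub>M ?P \<rightarrow>\<^sub>M PiM UNIV (\<lambda>_. borel)"
      unfolding split_beta' by (rule measurable_PiM_single'; simp add: e)+
  qed
  have \<Phi>m: "(\<lambda>(u, w). \<Phi> u w) \<in> borel_measurable (borel \<Otimes>\<^sub>M ?P)"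
    using measurable_compose[OF m1 V] measurable_compose[OF m2 zero_count_measurable]
    unfolding \<Phi>_def split_beta' by (rule borel_measurable_times_ennreal)
  define p where "p u = normal_density 0 (sqrt v0) u" for u
  have pm[measurable]: "p \<in> borel_measurable borel" unfolding p_def by simp
  have dist: "distributed M lborel \<xi> (\<lambda>u. ennreal (p u))"
    unfolding p_def v0_def by (rule gauss_rv_distributed[OF gauss[OF \<xi>H]]) (use v0 v0_def in simp)
  have 1: "(\<integral>\<^sup>+y. V (\<lambda>i. Y i y) * ncard {t\<in>{a..<b}. X t y = 0} \<partial>M) = (\<integral>\<^sup>+y. \<Phi> (\<xi> y) (\<lambda>k. W k y) \<partial>M)"
    unfolding \<Phi>_def W_def by (simp add: zero_count_eq[OF ab X_cont])
  have 2: "\<dots> = (\<integral>\<^sup>+y'. \<integral>\<^sup>+y. \<Phi> (\<xi> y) (\<lambda>k. W k y') \<partial>M \<partial>M)"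
    by (rule uncorrelated_split[OF \<xi>H WH W0 \<Phi>m])
  define c where "c Z t = cov Z \<xi> / cov (X t) \<xi>" for Z t
  define G where "G t y = ennreal (p ((X t y - \<alpha> t * \<xi> y) / \<alpha> t) / \<bar>\<alpha> t\<bar>) *
    (ennreal \<bar>X' t y - c (X' t) t * X t y\<bar> * V (\<lambda>i. Y i y - c (Y i) t * X t y))" for t y
  have 3: "(\<integral>\<^sup>+y. \<Phi> (\<xi> y) (\<lambda>k. W k y') \<partial>M) = (\<integral>\<^sup>+t. indicator {a..<b} t * G t y' \<partial>lborel)" for y'
  proof -
    have \<Phi>u: "(\<lambda>u. \<Phi> u (\<lambda>k. W k y')) \<in> borel_measurable borel"
      using measurable_compose[OF measurable_Pair2'[of "\<lambda>k. W k y'" ?P borel] \<Phi>m] by (simp add: space_PiM)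
    define w where "w u = ennreal (p u) * V (\<lambda>i. \<beta> i * u + W (Inl i) y')" for u
    have wm: "w \<in> borel_measurable borel"
    proof -
      have "(\<lambda>u i. \<beta> i * u + W (Inl i) y') \<in> borel \<rightarrow>\<^sub>M PiM UNIV (\<lambda>_. borel)"
        by (rule measurable_PiM_single'; simp)
      from measurable_compose[OF this V] show ?thesis unfolding w_def by measurable
    qed
    \<comment> \<open>The value that \<open>\<xi>\<close> must take for the process to vanish at
      \<open>t\<close>, the uncorrelated part being frozen at \<open>y'\<close>.\<close>
    define h where "h t = - (X t y' - \<alpha> t * \<xi> y') / \<alpha> t" for t
    define h' where "h' t = - (X' t y' - c (X' t) t * X t y') / \<alpha> t" for t
    have ca: "c (X' t) t = \<alpha>' t / \<alpha> t" for t unfolding c_def \<alpha>'_def \<alpha>_def using v0 by simp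
    have hd: "(h has_real_derivative h' t) (at t)" if t: "t \<in> {a..b}" for t
      unfolding h_def h'_def ca using \<alpha>pos[OF t]
      by (auto intro!: derivative_eq_intros X_deriv \<alpha>d simp: field_simps power2_eq_square)
    have h'_alt: "h' = (\<lambda>t. - (X' t y' - \<alpha>' t / \<alpha> t * X t y') / \<alpha> t)"
      by (rule ext) (simp only: h'_def ca)
    have ne: "\<And>t. t \<in> {a..b} \<Longrightarrow> \<alpha> t \<noteq> 0" using \<alpha>pos by (metis less_irrefl)
    have h'c: "continuous_on {a..b} h'"
      unfolding h'_alt by (intro continuous_intros continuous_on_subset[OF X'_cont] continuous_on_subset[OF X_cont]
        continuous_on_subset[OF \<alpha>'c] continuous_on_subset[OF \<alpha>c] ballI ne) auto
    have hm: "h' \<in> borel_measurable borel" "h \<in> borel_measurable borel"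
    proof -
      note [measurable] = X_path_meas[of y'] X'_path_meas[of y']
      show "h' \<in> borel_measurable borel" "h \<in> borel_measurable borel" unfolding h'_alt h_def by measurable
    qed
    have "(\<integral>\<^sup>+y. \<Phi> (\<xi> y) (\<lambda>k. W k y') \<partial>M) = (\<integral>\<^sup>+u. ennreal (p u) * \<Phi> u (\<lambda>k. W k y') \<partial>lborel)"
      by (rule distributed_nn_integral[OF dist, symmetric]) (simp add: \<Phi>u)
    also have "\<dots> = (\<integral>\<^sup>+u. w u * ncard {t\<in>{a..<b}. h t = u} \<partial>lborel)"
    proof (rule nn_integral_cong)
      fix u
      have "continuous_on UNIV (\<lambda>t. \<alpha> t * u + W (Inr t) y')"
        unfolding W_def sum.case by (intro continuous_intros \<alpha>c X_cont)
      then have "zero_count a b (\<lambda>t. \<alpha> t * u + W (Inr t) y') = ncard {t\<in>{a..<b}. \<alpha> t * u + W (Inr t) y' = 0}"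
        by (rule zero_count_eq[OF ab])
      also have "{t\<in>{a..<b}. \<alpha> t * u + W (Inr t) y' = 0} = {t\<in>{a..<b}. h t = u}"
      proof (rule Collect_cong, rule conj_cong[OF refl])
        fix t assume "t \<in> {a..<b}"
        then have "\<alpha> t \<noteq> 0" using ne[of t] by simp
        then show "(\<alpha> t * u + W (Inr t) y' = 0) = (h t = u)" unfolding W_def h_def by (auto simp: field_simps)
      qed
      finally show "ennreal (p u) * \<Phi> u (\<lambda>k. W k y') = w u * ncard {t\<in>{a..<b}. h t = u}"
        unfolding \<Phi>_def w_def by (simp only: mult.assoc)
    qed
    also have "\<dots> = (\<integral>\<^sup>+t. ennreal \<bar>h' t\<bar> * w (h t) * indicator {a..<b} t \<partial>lborel)"
      by (rule area_formula[OF ab hd h'c wm hm])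
    also have "\<dots> = (\<integral>\<^sup>+t. indicator {a..<b} t * G t y' \<partial>lborel)"
    proof (rule nn_integral_cong)
      fix t
      show "ennreal \<bar>h' t\<bar> * w (h t) * indicator {a..<b} t = indicator {a..<b} t * G t y'"
      proof (cases "t \<in> {a..<b}")
        case True
        then have a: "\<alpha> t > 0" using \<alpha>pos[of t] by simp
        have b: "\<beta> i / \<alpha> t = c (Y i) t" for i unfolding \<beta>_def \<alpha>_def c_def using v0 by simp
        have e1: "\<beta> i * h t + W (Inl i) y' = Y i y' - c (Y i) t * X t y'" for i
          unfolding h_def W_def b[symmetric] using a by (simp add: field_simps)
        have e2: "p (h t) = p ((X t y' - \<alpha> t * \<xi> y') / \<alpha> t)" 
        proof -
          have "p (- x) = p x" for x unfolding p_def normal_density_def by simp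
          then show ?thesis unfolding h_def minus_divide_left[symmetric] .
        qed
        have e3: "ennreal \<bar>h' t\<bar> * ennreal (p (h t)) = ennreal (p (h t) / \<bar>\<alpha> t\<bar>) * ennreal \<bar>X' t y' - c (X' t) t * X t y'\<bar>"
        proof -
          have "\<bar>h' t\<bar> = \<bar>X' t y' - c (X' t) t * X t y'\<bar> / \<bar>\<alpha> t\<bar>"
            unfolding h'_def abs_divide abs_minus_cancel ..
          moreover have "p (h t) \<ge> 0" unfolding p_def by simp
          ultimately show ?thesis by (simp add: ennreal_mult'[symmetric] mult.commute)
        qed
        have "\<bar>h' t\<bar> * w (h t) = (ennreal \<bar>h' t\<bar> * ennreal (p (h t))) * V (\<lambda>i. Y i y' - c (Y i) t * X t y')"
          unfolding w_def e1 by (simp only: mult.assoc)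
        also have "\<dots> = G t y'" unfolding e3 unfolding G_def e2 by (simp only: mult.assoc)
        finally show ?thesis using True by simp
      qed simp
    qed
    finally show ?thesis .
  qed
  have Gm: "(\<lambda>(t, y). indicator {a..<b} t * G t y) \<in> borel_measurable (lborel \<Otimes>\<^sub>M M)"
  proof -
    note [measurable] = X_joint[unfolded split_beta'] X'_joint[unfolded split_beta'] meas_H[OF \<xi>H]
    have cm[measurable]: "(\<lambda>t. c (X' t) t) \<in> borel_measurable borel" "(\<lambda>t. c (Y i) t) \<in> borel_measurable borel" for i
    proof -
      have a: "cov (X t) \<xi> = \<alpha> t * v0" "cov (X' t) \<xi> = \<alpha>' t * v0" for t unfolding \<alpha>_def \<alpha>'_def using v0 by auto
      show "(\<lambda>t. c (X' t) t) \<in> borel_measurable borel" "(\<lambda>t. c (Y i) t) \<in> borel_measurable borel" unfolding c_def a by measurable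
    qed
    have "(\<lambda>p. (\<lambda>i. Y i (snd p) - c (Y i) (fst p) * X (fst p) (snd p))) \<in> borel \<Otimes>\<^sub>M M \<rightarrow>\<^sub>M PiM UNIV (\<lambda>_. borel)"
    proof (rule measurable_PiM_single')
      fix i
      have [measurable]: "Y i \<in> borel_measurable M" by (rule meas_H[OF Y])
      show "(\<lambda>p. Y i (snd p) - c (Y i) (fst p) * X (fst p) (snd p)) \<in> borel_measurable (borel \<Otimes>\<^sub>M M)" by measurable
    qed simp
    from measurable_compose[OF this V]
    have [measurable]: "(\<lambda>p. V (\<lambda>i. Y i (snd p) - c (Y i) (fst p) * X (fst p) (snd p))) \<in> borel_measurable (borel \<Otimes>\<^sub>M M)" .
    have "(\<lambda>(t, y). indicator {a..<b} t * G t y) \<in> borel_measurable (borel \<Otimes>\<^sub>M M)"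
      unfolding G_def split_beta' by measurable
    then show ?thesis by (simp cong: measurable_cong_sets)
  qed
  interpret LM: pair_sigma_finite lborel M ..
  have 4: "(\<integral>\<^sup>+y'. \<integral>\<^sup>+t. indicator {a..<b} t * G t y' \<partial>lborel \<partial>M) = (\<integral>\<^sup>+t. \<integral>\<^sup>+y. indicator {a..<b} t * G t y \<partial>M \<partial>lborel)"
    by (rule LM.Fubini'[OF Gm])
  \<comment> \<open>Only after integration over \<open>y\<close> does the auxiliary variable
    \<open>\<xi>\<close> disappear: the right-hand side involves regression on \<open>X t\<close>
    alone.\<close>
  have 5: "(\<integral>\<^sup>+y. indicator {a..<b} t * G t y \<partial>M) = indicator {a..<b} t * (ennreal (1 / sqrt (2 * pi * cov (X t) (X t))) *
       (\<integral>\<^sup>+y. ennreal \<bar>residual t (X' t) y\<bar> * V (\<lambda>i. residual t (Y i) y) \<partial>M))" for t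
  proof (cases "t \<in> {a..<b}")
    case True
    then have c0: "cov (X t) \<xi> \<noteq> 0" using pos[of t] by (simp add: \<xi>_def)
    define Z where "Z k = (case k of None \<Rightarrow> X' t | Some i \<Rightarrow> Y i)" for k
    have ZH: "Z k \<in> H" for k unfolding Z_def using X'_H Y by (cases k) auto
    define \<Psi> where "\<Psi> x = ennreal \<bar>x None\<bar> * V (\<lambda>i. x (Some i))" for x :: "'i option \<Rightarrow> real"
    have \<Psi>m: "\<Psi> \<in> borel_measurable (PiM UNIV (\<lambda>_. borel))"
    proof -
      have e: "(\<lambda>x. x k) \<in> borel_measurable (PiM UNIV (\<lambda>_. borel :: real measure))" for k :: "'i option"
        by (rule measurable_component_singleton) simp
      have "(\<lambda>x i. x (Some i)) \<in> PiM UNIV (\<lambda>_. borel :: real measure) \<rightarrow>\<^sub>M PiM UNIV (\<lambda>_. borel)"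
        by (rule measurable_PiM_single'; simp add: e)
      from measurable_compose[OF this V] e[of None] show ?thesis unfolding \<Psi>_def by measurable
    qed
    have "(\<integral>\<^sup>+y. G t y \<partial>M) = ennreal (1 / sqrt (2 * pi * cov (X t) (X t))) *
       (\<integral>\<^sup>+y. ennreal \<bar>residual t (X' t) y\<bar> * V (\<lambda>i. residual t (Y i) y) \<partial>M)"
      using tilted_functional[where Z=Z, OF X_H[of t] \<xi>H c0 ZH \<Psi>m]
      unfolding \<Psi>_def Z_def option.case G_def p_def c_def \<alpha>_def v0_def residual_def .
    then show ?thesis using True by simp
  qed simp
  show ?thesis unfolding 1 2 3 4 5 ..
qed

lemma residual_joint:
  assumes "Z \<in> H"
  shows "(\<lambda>p. residual (fst p) Z (snd p)) \<in> borel_measurable (borel \<Otimes>\<^sub>M M)"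
    and "(\<lambda>p. residual (fst p) (X' (fst p)) (snd p)) \<in> borel_measurable (borel \<Otimes>\<^sub>M M)"
proof -
  note [measurable] = X_joint[unfolded split_beta'] X'_joint[unfolded split_beta'] meas_H[OF assms] cov_X_meas[OF assms] cov_X'_X_meas cov_X_X_meas
  show "(\<lambda>p. residual (fst p) Z (snd p)) \<in> borel_measurable (borel \<Otimes>\<^sub>M M)"
    "(\<lambda>p. residual (fst p) (X' (fst p)) (snd p)) \<in> borel_measurable (borel \<Otimes>\<^sub>M M)"
    unfolding residual_def by measurable
qed

text \<open>The Kac-Rice integrand: the density of \<open>X t\<close> at 0 times the conditional
  expectation, given \<open>X t = 0\<close>, of \<open>\<bar>X' t\<bar>\<close> multiplied by the
  functional \<open>V\<close> of the family \<open>Y\<close>.\<close>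

definition palm_density :: "('i \<Rightarrow> 'a \<Rightarrow> real) \<Rightarrow> (('i \<Rightarrow> real) \<Rightarrow> ennreal) \<Rightarrow> real \<Rightarrow> ennreal" where
  "palm_density Y V t = ennreal (1 / sqrt (2 * pi * cov (X t) (X t))) *
     (\<integral>\<^sup>+w. ennreal \<bar>residual t (X' t) w\<bar> * V (\<lambda>i. residual t (Y i) w) \<partial>M)"

lemma palm_density_measurable:
  fixes Y :: "'i \<Rightarrow> 'a \<Rightarrow> real"
  assumes Y: "\<And>i. Y i \<in> H" and V: "V \<in> borel_measurable (PiM UNIV (\<lambda>_. borel))"
  shows "palm_density Y V \<in> borel_measurable borel"
proof -
  have "(\<lambda>p i. residual (fst p) (Y i) (snd p)) \<in> borel \<Otimes>\<^sub>M M \<rightarrow>\<^sub>M PiM UNIV (\<lambda>_. borel)"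
    by (rule measurable_PiM_single'; simp add: residual_joint[OF Y])
  note [measurable] = measurable_compose[OF this V] residual_joint(2)[OF X_H[of 0]] cov_X_X_meas
  have "(\<lambda>t. \<integral>\<^sup>+w. ennreal \<bar>residual t (X' t) w\<bar> * V (\<lambda>i. residual t (Y i) w) \<partial>M) \<in> borel_measurable borel"
    by (rule borel_measurable_nn_integral) (simp add: split_beta')
  then show ?thesis unfolding palm_density_def by measurable
qed

lemma zero_ncard_measurable:
  assumes "a < b"
  shows "(\<lambda>w. ncard {t\<in>{a..<b}. X t w = 0}) \<in> borel_measurable M"
proof -
  have "(\<lambda>w t. X t w) \<in> M \<rightarrow>\<^sub>M PiM UNIV (\<lambda>_. borel)"
    by (rule measurable_PiM_single'; simp add: X_meas)
  from measurable_compose[OF this zero_count_measurable[of a b]]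
  show ?thesis by (simp add: zero_count_eq[OF assms X_cont])
qed

text \<open>The local formula requires a reference time \<open>t0\<close> positively correlated with
  all times of the interval. Continuity of the covariance provides one near each time of positive
  variance, and both sides are additive over adjacent intervals, so bisection extends the identity
  to \<open>{A..<B}\<close>.\<close>

theorem palm_formula:
  fixes Y :: "'i \<Rightarrow> 'a \<Rightarrow> real"
  assumes AB: "A < B" and Y: "\<And>i. Y i \<in> H" and V: "V \<in> borel_measurable (PiM UNIV (\<lambda>_. borel))"
    and pos: "\<And>t. t \<in> {A..B} \<Longrightarrow> 0 < cov (X t) (X t)"
  shows "(\<integral>\<^sup>+w. V (\<lambda>i. Y i w) * ncard {t\<in>{A..<B}. X t w = 0} \<partial>M) = (\<integral>\<^sup>+t. indicator {A..<B} t * palm_density Y V t \<partial>lborel)"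
proof -
  define L where "L a b = (\<integral>\<^sup>+w. V (\<lambda>i. Y i w) * ncard {t\<in>{a..<b}. X t w = 0} \<partial>M)" for a b
  define R where "R a b = (\<integral>\<^sup>+t. indicator {a..<b} t * palm_density Y V t \<partial>lborel)" for a b
  \<comment> \<open>The premises make \<open>P\<close> vacuous on degenerate intervals and on those
    leaving \<open>{A..B}\<close>, which the bisection principle also meets.\<close>
  define P where "P a b \<longleftrightarrow> (A \<le> a \<and> b \<le> B \<and> a < b \<longrightarrow> L a b = R a b)" for a b
  have "(\<lambda>w i. Y i w) \<in> M \<rightarrow>\<^sub>M PiM UNIV (\<lambda>_. borel)"
    by (rule measurable_PiM_single'; simp add: meas_H[OF Y])
  note VY[measurable] = measurable_compose[OF this V]
  note pm[measurable] = palm_density_measurable[OF Y V]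
  have L: "L a c = L a b + L b c" if "a < b" "b < c" for a b c
  proof -
    have m: "(\<lambda>w. V (\<lambda>i. Y i w) * ncard {t\<in>{a..<b}. X t w = 0}) \<in> borel_measurable M" if "a < b" for a b
      by (intro borel_measurable_times_ennreal VY zero_ncard_measurable that)
    have eq: "ncard {t\<in>{a..<c}. X t w = 0} = ncard {t\<in>{a..<b}. X t w = 0} + ncard {t\<in>{b..<c}. X t w = 0}" for w
      by (subst plus_emeasure) (use that in \<open>auto intro!: arg_cong[where f=ncard]\<close>)
    show ?thesis unfolding L_def eq distrib_left by (rule nn_integral_add[OF m[OF that(1)] m[OF that(2)]])
  qed
  have R: "R a c = R a b + R b c" if "a < b" "b < c" for a b c
  proof -
    have "indicator {a..<c} t = indicator {a..<b} t + (indicator {b..<c} t :: ennreal)" for t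
      using that by (auto simp: indicator_def)
    then show ?thesis unfolding R_def by (subst nn_integral_add[symmetric]) (simp_all add: distrib_right)
  qed
  have "A \<le> B" using AB by simp
  then have "P A B"
  proof (induction rule: Bolzano)
    case (trans a b c)
    show ?case unfolding P_def
    proof (rule impI)
      assume abc: "A \<le> a \<and> c \<le> B \<and> a < c"
      consider "a = b" | "b = c" | "a < b" "b < c" using trans(3,4) by linarith
      then show "L a c = R a c"
      proof cases
        case 1 then show ?thesis using trans(2) abc unfolding P_def by blast
      next
        case 2 then show ?thesis using trans(1) abc unfolding P_def by blast
      next
        case 3
        have "L a b = R a b" "L b c = R b c" using trans(1,2) abc 3 trans(3,4) unfolding P_def by force+
        then show ?thesis using L[OF 3] R[OF 3] by simp
      qed
    qed
  next
    case (local x)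
    have p: "cov (X x) (X x) > 0" using pos[of x] local by simp
    have "isCont (\<lambda>t. cov (X t) (X x)) x" by (rule DERIV_isCont[OF cov_X_deriv[OF X_H]])
    then have "\<forall>\<^sub>F t in at x. 0 < cov (X t) (X x)" using p unfolding isCont_def by (intro order_tendstoD(1))
    then obtain d where d: "d > 0" "\<And>t. t \<noteq> x \<Longrightarrow> dist t x < d \<Longrightarrow> 0 < cov (X t) (X x)"
      unfolding eventually_at by auto
    show ?case
    proof (intro exI[of _ d] conjI allI impI d)
      fix a b assume ab: "a \<le> x \<and> x \<le> b \<and> b - a < d"
      show "P a b" unfolding P_def
      proof (intro impI)
        assume "A \<le> a \<and> b \<le> B \<and> a < b"
        then have "a < b" by simp
        have "0 < cov (X t) (X x)" if "t \<in> {a..b}" for t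
          by (cases "t = x") (use p d(2)[of t] ab that in \<open>auto simp: dist_real_def\<close>)
        from palm_local[OF \<open>a < b\<close> Y V this] show "L a b = R a b" unfolding L_def R_def palm_density_def .
      qed
    qed
  qed
  then show ?thesis using AB unfolding P_def L_def R_def by simp
qed

end

section \<open>Absolute moments of Gaussian pairs\<close>

lemma has_derivative_cauchy_primitive:
  fixes r s :: real
  shows "((\<lambda>t. r / 2 * (t / (1 + t\<^sup>2) + arctan t) - s / (2 * (1 + t\<^sup>2))) has_real_derivative (r + s * t) / (1 + t\<^sup>2)\<^sup>2) (at t)"
proof -
  have p: "1 + t\<^sup>2 > 0" by (simp add: add_pos_nonneg)
  have "((\<lambda>t. r / 2 * (t / (1 + t\<^sup>2) + arctan t) - s / (2 * (1 + t\<^sup>2))) has_real_derivative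
     r / 2 * ((1 * (1 + t\<^sup>2) - t * (2 * t)) / ((1 + t\<^sup>2) * (1 + t\<^sup>2)) + inverse (1 + t\<^sup>2)) - (0 * (2 * (1 + t\<^sup>2)) - s * (2 * (2 * t))) / ((2 * (1 + t\<^sup>2)) * (2 * (1 + t\<^sup>2)))) (at t)"
    using p by (auto intro!: derivative_eq_intros)
  moreover have "r / 2 * ((1 * (1 + t\<^sup>2) - t * (2 * t)) / ((1 + t\<^sup>2) * (1 + t\<^sup>2)) + inverse (1 + t\<^sup>2)) - (0 * (2 * (1 + t\<^sup>2)) - s * (2 * (2 * t))) / ((2 * (1 + t\<^sup>2)) * (2 * (1 + t\<^sup>2))) = (r + s * t) / (1 + t\<^sup>2)\<^sup>2"
    using p by (simp add: inverse_eq_divide divide_simps) (simp add: algebra_simps power2_eq_square)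
  ultimately show ?thesis by simp
qed

text \<open>Here the arcsine enters: as \<open>r\<^sup>2 + s\<^sup>2 = 1\<close>, the primitive at
  the zero \<open>- r / s\<close> of \<open>r + s * t\<close> contains
  \<open>arctan (- r / s) = - arcsin r\<close>. Nonnegativity of the value is recorded because two
  such values are added inside \<open>ennreal\<close>.\<close>

lemma half_line_integral:
  fixes r s :: real
  assumes s: "0 < s" and rs: "r\<^sup>2 + s\<^sup>2 = 1"
  shows "(\<integral>\<^sup>+t. ennreal ((r + s * t) / (1 + t\<^sup>2)\<^sup>2) * indicator {- r / s..} t \<partial>lborel) = ennreal (r * pi / 4 + (s + r * arcsin r) / 2)"
    and "0 \<le> r * pi / 4 + (s + r * arcsin r) / 2"
proof -
  let ?G = "\<lambda>t. r / 2 * (t / (1 + t\<^sup>2) + arctan t) - s / (2 * (1 + t\<^sup>2))"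
  have r1: "\<bar>r\<bar> < 1"
  proof -
    have "s\<^sup>2 > 0" using s by simp
    then have "r\<^sup>2 < 1" using rs by linarith
    then show ?thesis by (simp add: abs_square_less_1)
  qed
  have "s = sqrt (1 - r\<^sup>2)" using rs s by (intro real_sqrt_unique[symmetric]) auto
  then have at: "arctan (- r / s) = - arcsin r" using arcsin_arctan[of r] r1 by (simp add: arctan_minus abs_less_iff)
  have q: "1 + (- r / s)\<^sup>2 = 1 / s\<^sup>2" using rs s by (simp add: field_simps)
  have G0: "?G (- r / s) = - (s + r * arcsin r) / 2"
  proof -
    have "?G (- r / s) = r / 2 * (- r / s * s\<^sup>2 - arcsin r) - s * s\<^sup>2 / 2"
      unfolding q at by simp
    also have "\<dots> = - (s * (r\<^sup>2 + s\<^sup>2) + r * arcsin r) / 2"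
      using s by (simp add: algebra_simps power2_eq_square power3_eq_cube)
    finally show ?thesis unfolding rs by simp
  qed
  have lim: "(?G \<longlongrightarrow> r / 2 * (0 + pi / 2) - 0) at_top"
  proof (intro tendsto_intros tendsto_arctan_at_top)
    show "((\<lambda>t::real. t / (1 + t\<^sup>2)) \<longlongrightarrow> 0) at_top" by real_asymp
    show "((\<lambda>t::real. s / (2 * (1 + t\<^sup>2))) \<longlongrightarrow> 0) at_top" by real_asymp
  qed
  have nn: "0 \<le> (r + s * t) / (1 + t\<^sup>2)\<^sup>2" if "- r / s \<le> t" for t
  proof -
    have "- r \<le> t * s" using that by (rule pos_divide_le_eq[OF s, THEN iffD1])
    then show ?thesis by (simp add: mult.commute)
  qed
  have 1: "(\<integral>\<^sup>+t. ennreal ((r + s * t) / (1 + t\<^sup>2)\<^sup>2) * indicator {- r / s..} t \<partial>lborel) = ennreal (r / 2 * (0 + pi / 2) - 0 - ?G (- r / s))"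
    by (rule nn_integral_FTC_atLeast[OF _ has_derivative_cauchy_primitive nn lim]) auto
  have "?G (- r / s) \<le> r / 2 * (0 + pi / 2) - 0"
  proof (rule tendsto_lowerbound[OF lim])
    show "\<forall>\<^sub>F x in at_top. ?G (- r / s) \<le> ?G x"
      unfolding eventually_at_top_linorder
    proof (intro exI allI impI)
      fix x assume x: "- r / s \<le> x"
      show "?G (- r / s) \<le> ?G x"
        by (rule DERIV_nonneg_imp_nondecreasing[OF x]) (use has_derivative_cauchy_primitive nn in blast)
    qed
  qed simp
  then show "0 \<le> r * pi / 4 + (s + r * arcsin r) / 2" unfolding G0 by (simp add: field_simps)
  show "(\<integral>\<^sup>+t. ennreal ((r + s * t) / (1 + t\<^sup>2)\<^sup>2) * indicator {- r / s..} t \<partial>lborel) = ennreal (r * pi / 4 + (s + r * arcsin r) / 2)"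
    unfolding 1 G0 by (simp add: field_simps)
qed

text \<open>Cut at the zero of \<open>r + s * t\<close> and reflect the left half-line. It turns
  into a right one with \<open>- r\<close> in place of \<open>r\<close>, and the terms
  \<open>r * pi / 4\<close> cancel.\<close>

lemma abs_affine_cauchy_integral:
  fixes r s :: real
  assumes s: "0 < s" and rs: "r\<^sup>2 + s\<^sup>2 = 1"
  shows "(\<integral>\<^sup>+t. ennreal (\<bar>r + s * t\<bar> / (1 + t\<^sup>2)\<^sup>2) \<partial>lborel) = ennreal (s + r * arcsin r)"
proof -
  have rs': "(- r)\<^sup>2 + s\<^sup>2 = 1" using rs by simp
  have "r\<^sup>2 \<le> 1" using rs zero_le_power2[of s] by linarith
  then have am: "arcsin (- r) = - arcsin r" by (intro arcsin_minus) (auto simp: abs_square_le_1 abs_le_iff)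
  have e: "r * pi / 4 + (s + r * arcsin r) / 2 + (- r * pi / 4 + (s + - r * arcsin (- r)) / 2) = s + r * arcsin r"
    unfolding am by (simp add: add_divide_distrib)
  have "(\<integral>\<^sup>+t. ennreal (\<bar>r + s * t\<bar> / (1 + t\<^sup>2)\<^sup>2) \<partial>lborel) =
     (\<integral>\<^sup>+t. ennreal ((r + s * t) / (1 + t\<^sup>2)\<^sup>2) * indicator {- r / s..} t + ennreal ((- r + s * (- t)) / (1 + (- t)\<^sup>2)\<^sup>2) * indicator {- (- r) / s..} (- t) \<partial>lborel)"
  proof (rule nn_integral_cong_AE)
    have "AE t in lborel. t \<noteq> - r / s" by (rule AE_lborel_singleton)
    then show "AE t in lborel. ennreal (\<bar>r + s * t\<bar> / (1 + t\<^sup>2)\<^sup>2) = ennreal ((r + s * t) / (1 + t\<^sup>2)\<^sup>2) * indicator {- r / s..} t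
        + ennreal ((- r + s * (- t)) / (1 + (- t)\<^sup>2)\<^sup>2) * indicator {- (- r) / s..} (- t)"
    proof eventually_elim
      case (elim t)
      show ?case
      proof (cases "- r / s < t")
        case True
        then have "- r < t * s" by (rule pos_divide_less_eq[OF s, THEN iffD1])
        moreover have "\<not> r / s \<le> - t" using True by simp
        ultimately show ?thesis using True by (simp add: mult.commute)
      next
        case False
        then have t: "t < - r / s" using elim by simp
        then have "t * s < - r" by (rule pos_less_divide_eq[OF s, THEN iffD1])
        moreover have "r / s \<le> - t" "\<not> - r / s \<le> t" using t by simp_all
        ultimately show ?thesis by (simp add: mult.commute abs_if)
      qed
    qed
  qed
  also have "\<dots> = (\<integral>\<^sup>+t. ennreal ((r + s * t) / (1 + t\<^sup>2)\<^sup>2) * indicator {- r / s..} t \<partial>lborel)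
     + (\<integral>\<^sup>+t. ennreal ((- r + s * (- t)) / (1 + (- t)\<^sup>2)\<^sup>2) * indicator {- (- r) / s..} (- t) \<partial>lborel)"
    by (rule nn_integral_add) auto
  also have "(\<integral>\<^sup>+t. ennreal ((- r + s * (- t)) / (1 + (- t)\<^sup>2)\<^sup>2) * indicator {- (- r) / s..} (- t) \<partial>lborel)
     = (\<integral>\<^sup>+t. ennreal ((- r + s * t) / (1 + t\<^sup>2)\<^sup>2) * indicator {- (- r) / s..} t \<partial>lborel)"
    by (subst nn_integral_real_affine[where c="-1" and t=0, of "\<lambda>t. ennreal ((- r + s * t) / (1 + t\<^sup>2)\<^sup>2) * indicator {- (- r) / s..} t"]) auto
  finally show ?thesis
    unfolding half_line_integral(1)[OF s rs] half_line_integral(1)[OF s rs']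
    unfolding ennreal_plus[OF half_line_integral(2)[OF s rs] half_line_integral(2)[OF s rs'], symmetric] e .
qed

text \<open>As a function of \<open>x\<close> the product of the densities is a multiple of the
  normal density of variance \<open>1 / (1 + t\<^sup>2)\<close>. The third power will collect the
  two factors of a product moment and the Jacobian of the substitution that introduces
  \<open>t\<close>.\<close>

lemma normal_product_third_moment:
  fixes t :: real
  shows "(\<integral>\<^sup>+x. ennreal (\<bar>x\<bar> ^ 3 * (std_normal_density x * std_normal_density (x * t))) \<partial>lborel) = ennreal (2 / pi / (1 + t\<^sup>2)\<^sup>2)"
proof -
  define \<sigma> where "\<sigma> = 1 / sqrt (1 + t\<^sup>2)"
  have p: "1 + t\<^sup>2 > 0" by (simp add: add_pos_nonneg)
  have s: "\<sigma> > 0" "\<sigma>\<^sup>2 = 1 / (1 + t\<^sup>2)" using p by (auto simp: \<sigma>_def power_divide)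
  have "\<bar>x\<bar> ^ 3 * (std_normal_density x * std_normal_density (x * t)) = \<sigma> / sqrt (2 * pi) * (normal_density 0 \<sigma> x * \<bar>x\<bar> ^ 3)" for x
  proof -
    have "std_normal_density x * std_normal_density (x * t) = 1 / sqrt (2 * pi) * (1 / sqrt (2 * pi)) * exp (- (x\<^sup>2 * (1 + t\<^sup>2)) / 2)"
      unfolding std_normal_density_def by (simp add: exp_add[symmetric] power_mult_distrib algebra_simps add_divide_distrib)
    moreover have "\<sigma> * normal_density 0 \<sigma> x = 1 / sqrt (2 * pi) * exp (- (x\<^sup>2 * (1 + t\<^sup>2)) / 2)"
    proof -
      have sq: "sqrt (2 * pi * \<sigma>\<^sup>2) = sqrt (2 * pi) * \<sigma>" using s(1) by (simp add: real_sqrt_mult)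
      have ex: "- (x - 0)\<^sup>2 / (2 * \<sigma>\<^sup>2) = - (x\<^sup>2 * (1 + t\<^sup>2)) / 2" unfolding s(2) by simp
      show ?thesis unfolding normal_density_def sq ex using s(1) by simp
    qed
    moreover have "\<sigma> / sqrt (2 * pi) * (normal_density 0 \<sigma> x * \<bar>x\<bar> ^ 3) = \<bar>x\<bar> ^ 3 * (1 / sqrt (2 * pi) * (\<sigma> * normal_density 0 \<sigma> x))"
      by simp
    ultimately show ?thesis by (simp only: mult.assoc)
  qed
  then have "has_bochner_integral lborel (\<lambda>x. \<bar>x\<bar> ^ 3 * (std_normal_density x * std_normal_density (x * t))) (\<sigma> / sqrt (2 * pi) * (2 ^ 1 * \<sigma> ^ 3 * fact 1 * sqrt (2 / pi)))"
    using has_bochner_integral_mult_right[OF normal_moment_abs_odd[OF s(1), of 0 1], of "\<sigma> / sqrt (2 * pi)"] by (simp add: numeral_3_eq_3)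
  then have "(\<integral>\<^sup>+x. ennreal (\<bar>x\<bar> ^ 3 * (std_normal_density x * std_normal_density (x * t))) \<partial>lborel) = ennreal (\<sigma> / sqrt (2 * pi) * (2 ^ 1 * \<sigma> ^ 3 * fact 1 * sqrt (2 / pi)))"
    by (intro nn_integral_eq_integral[THEN trans]) (auto simp: has_bochner_integral_iff)
  also have "\<sigma> / sqrt (2 * pi) * (2 ^ 1 * \<sigma> ^ 3 * fact 1 * sqrt (2 / pi)) = 2 * (\<sigma>\<^sup>2)\<^sup>2 * (sqrt (2 / pi) / sqrt (2 * pi))"
    by (simp add: power2_eq_square power3_eq_cube)
  also have "sqrt (2 / pi) / sqrt (2 * pi) = 1 / pi"
    by (simp add: real_sqrt_divide real_sqrt_mult)
  finally show ?thesis unfolding s(2) by (simp add: power_divide)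
qed

context gauss_space
begin

text \<open>After normalisation the second variable is \<open>r * U + W\<close> with
  \<open>W\<close> independent of \<open>U\<close> and of standard deviation \<open>s\<close>. The
  substitution \<open>w = s * x * t\<close> makes the integral over \<open>x\<close> a third
  absolute moment and leaves the integral of
  \<open>\<bar>r + s * t\<bar> / (1 + t\<^sup>2)\<^sup>2\<close>.\<close>

lemma abs_product_expectation:
  assumes Y: "Y \<in> H" and Z: "Z \<in> H" and vY: "0 < cov Y Y" and vZ: "0 < cov Z Z"
  defines "r \<equiv> cov Y Z / sqrt (cov Y Y * cov Z Z)"
  shows "(\<integral>\<^sup>+\<omega>. ennreal (\<bar>Y \<omega>\<bar> * \<bar>Z \<omega>\<bar>) \<partial>M) = ennreal (2 / pi * sqrt (cov Y Y * cov Z Z) * (sqrt (1 - r\<^sup>2) + r * arcsin r))"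
    and "\<bar>r\<bar> \<le> 1"
proof -
  define y z where "y = sqrt (cov Y Y)" and "z = sqrt (cov Z Z)"
  have yz: "y > 0" "z > 0" "y\<^sup>2 = cov Y Y" "z\<^sup>2 = cov Z Z" using vY vZ by (auto simp: y_def z_def)
  have r: "r = cov Y Z / (y * z)" unfolding r_def y_def z_def real_sqrt_mult ..
  define U where "U = (\<lambda>\<omega>. (1 / y) * Y \<omega>)"
  define Z1 where "Z1 = (\<lambda>\<omega>. (1 / z) * Z \<omega>)"
  define W where "W = (\<lambda>\<omega>. Z1 \<omega> - r * U \<omega>)"
  have UH: "U \<in> H" and Z1H: "Z1 \<in> H" unfolding U_def Z1_def by (rule scale_H[OF Y], rule scale_H[OF Z])
  have WH: "W \<in> H" unfolding W_def by (rule diff_scale_H[OF Z1H UH])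
  have UU: "cov U U = 1" and ZZ: "cov Z1 Z1 = 1" and UZ: "cov U Z1 = r"
    unfolding U_def Z1_def cov_scale cov_commute[of Y "\<lambda>\<omega>. c * X \<omega>" for c X] cov_commute[of Z "\<lambda>\<omega>. c * X \<omega>" for c X]
    using yz by (simp_all add: cov_scale r cov_commute[of Z Y] flip: yz(3,4)) (simp_all add: power2_eq_square)
  have UW: "cov U W = 0" unfolding W_def cov_diff_right[OF Z1H UH UH] UZ UU by simp
  have WW: "cov W W = 1 - r\<^sup>2" unfolding W_def cov_diff_diff[OF Z1H UH] ZZ UU cov_commute[of Z1 U] UZ by (simp add: power2_eq_square)
  have r1: "r\<^sup>2 \<le> 1" using cov_nonneg[of W] unfolding WW by simp
  then show "\<bar>r\<bar> \<le> 1" by (simp add: abs_square_le_1)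
  define s where "s = sqrt (1 - r\<^sup>2)"
  have s: "s \<ge> 0" "r\<^sup>2 + s\<^sup>2 = 1" using r1 by (auto simp: s_def)
  have dU: "distributed M lborel U (\<lambda>x. ennreal (std_normal_density x))"
    using gauss_rv_distributed[OF gauss[OF UH]] UU by simp
  have [measurable]: "U \<in> borel_measurable M" "W \<in> borel_measurable M" using UH WH meas_H by auto
  have main: "(\<integral>\<^sup>+\<omega>. ennreal (\<bar>U \<omega>\<bar> * \<bar>r * U \<omega> + W \<omega>\<bar>) \<partial>M) = ennreal (2 / pi * (s + r * arcsin r))"
  \<comment> \<open>For \<open>s = 0\<close> the variable \<open>W\<close> has no density; but then
    \<open>r\<close> is 1 or -1 and the product is \<open>(U \<omega>)\<^sup>2\<close>.\<close>
  proof (cases "s = 0")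
    case True
    have "AE \<omega> in M. W \<omega> = 0" using gauss_rv_AE_zero gauss[OF WH] WW True by (simp add: s_def)
    then have "(\<integral>\<^sup>+\<omega>. ennreal (\<bar>U \<omega>\<bar> * \<bar>r * U \<omega> + W \<omega>\<bar>) \<partial>M) = (\<integral>\<^sup>+\<omega>. ennreal ((U \<omega>)\<^sup>2) \<partial>M)"
    proof (intro nn_integral_cong_AE, eventually_elim)
      case (elim \<omega>)
      have "\<bar>r\<bar> = 1" using s True by (auto simp: power2_eq_1_iff)
      then show ?case using elim by (simp add: abs_mult power2_eq_square)
    qed
    also have "\<dots> = ennreal 1" using gauss_rv_moments(1,4)[OF gauss[OF UH]] UU by (subst nn_integral_eq_integral) auto
    also have "1 = 2 / pi * (s + r * arcsin r)"
    proof -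
      have "r = 1 \<or> r = -1" using s True by (simp add: power2_eq_1_iff)
      then show ?thesis using True by auto
    qed
    finally show ?thesis .
  next
    case False
    then have sp: "s > 0" using s by simp
    have dW: "distributed M lborel W (\<lambda>x. ennreal (normal_density 0 s x))"
      using gauss_rv_distributed[OF gauss[OF WH]] WW sp by (simp add: s_def)
    have "(\<integral>\<^sup>+\<omega>. ennreal (\<bar>U \<omega>\<bar> * \<bar>r * U \<omega> + W \<omega>\<bar>) \<partial>M) = (\<integral>\<^sup>+\<omega>'. \<integral>\<^sup>+\<omega>. ennreal (\<bar>U \<omega>\<bar> * \<bar>r * U \<omega> + W \<omega>'\<bar>) \<partial>M \<partial>M)"
    proof (rule uncorrelated_split[where W="\<lambda>_::unit. W" and \<Phi>="\<lambda>u w. ennreal (\<bar>u\<bar> * \<bar>r * u + w ()\<bar>)", OF UH WH UW])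
      have [measurable]: "(\<lambda>p. snd p ()) \<in> borel_measurable (borel \<Otimes>\<^sub>M PiM UNIV (\<lambda>_. borel :: real measure))"
        by (rule measurable_compose[OF measurable_snd]) (rule measurable_component_singleton, simp)
      show "(\<lambda>(u, w). ennreal (\<bar>u\<bar> * \<bar>r * u + w ()\<bar>)) \<in> borel_measurable (borel \<Otimes>\<^sub>M PiM UNIV (\<lambda>_. borel :: real measure))"
        unfolding split_beta' by measurable
    qed
    also have "\<dots> = (\<integral>\<^sup>+\<omega>'. \<integral>\<^sup>+x. ennreal (std_normal_density x) * ennreal (\<bar>x\<bar> * \<bar>r * x + W \<omega>'\<bar>) \<partial>lborel \<partial>M)"
      by (intro nn_integral_cong distributed_nn_integral[OF dU, symmetric]) simp
    also have "\<dots> = (\<integral>\<^sup>+w. ennreal (normal_density 0 s w) * (\<integral>\<^sup>+x. ennreal (std_normal_density x) * ennreal (\<bar>x\<bar> * \<bar>r * x + w\<bar>) \<partial>lborel) \<partial>lborel)"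
      by (rule distributed_nn_integral[OF dW, symmetric]) measurable
    also have "\<dots> = (\<integral>\<^sup>+w. \<integral>\<^sup>+x. ennreal (normal_density 0 s w * (std_normal_density x * (\<bar>x\<bar> * \<bar>r * x + w\<bar>))) \<partial>lborel \<partial>lborel)"
      by (intro nn_integral_cong, subst nn_integral_cmult[symmetric]) (simp_all add: ennreal_mult')
    also have "\<dots> = (\<integral>\<^sup>+x. \<integral>\<^sup>+w. ennreal (normal_density 0 s w * (std_normal_density x * (\<bar>x\<bar> * \<bar>r * x + w\<bar>))) \<partial>lborel \<partial>lborel)"
      by (rule lborel_pair.Fubini') measurable
    also have "\<dots> = (\<integral>\<^sup>+x. \<integral>\<^sup>+t. ennreal (\<bar>r + s * t\<bar> * (\<bar>x\<bar> ^ 3 * (std_normal_density x * std_normal_density (x * t)))) \<partial>lborel \<partial>lborel)"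
    proof (rule nn_integral_cong_AE)
      have "AE x in lborel. x \<noteq> (0::real)" by (rule AE_lborel_singleton)
      then show "AE x in lborel. (\<integral>\<^sup>+w. ennreal (normal_density 0 s w * (std_normal_density x * (\<bar>x\<bar> * \<bar>r * x + w\<bar>))) \<partial>lborel) =
         (\<integral>\<^sup>+t. ennreal (\<bar>r + s * t\<bar> * (\<bar>x\<bar> ^ 3 * (std_normal_density x * std_normal_density (x * t)))) \<partial>lborel)"
      proof eventually_elim
        case (elim x)
        then have sx: "s * x \<noteq> 0" using sp by simp
        have "(\<integral>\<^sup>+w. ennreal (normal_density 0 s w * (std_normal_density x * (\<bar>x\<bar> * \<bar>r * x + w\<bar>))) \<partial>lborel)
          = ennreal \<bar>s * x\<bar> * (\<integral>\<^sup>+t. ennreal (normal_density 0 s (0 + s * x * t) * (std_normal_density x * (\<bar>x\<bar> * \<bar>r * x + (0 + s * x * t)\<bar>))) \<partial>lborel)"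
          by (rule nn_integral_real_affine[OF _ sx]) simp
        also have "\<dots> = (\<integral>\<^sup>+t. ennreal \<bar>s * x\<bar> * ennreal (normal_density 0 s (0 + s * x * t) * (std_normal_density x * (\<bar>x\<bar> * \<bar>r * x + (0 + s * x * t)\<bar>))) \<partial>lborel)"
          by (rule nn_integral_cmult[symmetric]) simp
        also have "\<dots> = (\<integral>\<^sup>+t. ennreal (\<bar>r + s * t\<bar> * (\<bar>x\<bar> ^ 3 * (std_normal_density x * std_normal_density (x * t)))) \<partial>lborel)"
        proof (rule nn_integral_cong)
          fix t
          have "normal_density 0 s (0 + s * x * t) = std_normal_density (x * t) / s"
            using normal_density_zero_mean_scale[OF sp, of "x * t"] by (simp add: mult.assoc)
          moreover have "\<bar>r * x + (0 + s * x * t)\<bar> = \<bar>x\<bar> * \<bar>r + s * t\<bar>"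
            unfolding abs_mult[symmetric] by (simp add: algebra_simps)
          ultimately have "\<bar>s * x\<bar> * (normal_density 0 s (0 + s * x * t) * (std_normal_density x * (\<bar>x\<bar> * \<bar>r * x + (0 + s * x * t)\<bar>)))
              = \<bar>r + s * t\<bar> * (\<bar>x\<bar> ^ 3 * (std_normal_density x * std_normal_density (x * t)))"
            using sp by (simp add: abs_mult power3_eq_cube)
          then show "ennreal \<bar>s * x\<bar> * ennreal (normal_density 0 s (0 + s * x * t) * (std_normal_density x * (\<bar>x\<bar> * \<bar>r * x + (0 + s * x * t)\<bar>)))
              = ennreal (\<bar>r + s * t\<bar> * (\<bar>x\<bar> ^ 3 * (std_normal_density x * std_normal_density (x * t))))"
            by (subst ennreal_mult'[symmetric]) simp_all
        qed
        finally show ?case .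
      qed
    qed
    also have "\<dots> = (\<integral>\<^sup>+t. \<integral>\<^sup>+x. ennreal (\<bar>r + s * t\<bar> * (\<bar>x\<bar> ^ 3 * (std_normal_density x * std_normal_density (x * t)))) \<partial>lborel \<partial>lborel)"
      by (rule lborel_pair.Fubini') measurable
    also have "\<dots> = (\<integral>\<^sup>+t. ennreal (2 / pi) * ennreal (\<bar>r + s * t\<bar> / (1 + t\<^sup>2)\<^sup>2) \<partial>lborel)"
    proof (rule nn_integral_cong)
      fix t
      have "(\<integral>\<^sup>+x. ennreal (\<bar>r + s * t\<bar> * (\<bar>x\<bar> ^ 3 * (std_normal_density x * std_normal_density (x * t)))) \<partial>lborel)
        = (\<integral>\<^sup>+x. ennreal \<bar>r + s * t\<bar> * ennreal (\<bar>x\<bar> ^ 3 * (std_normal_density x * std_normal_density (x * t))) \<partial>lborel)"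
        by (intro nn_integral_cong ennreal_mult') simp
      also have "\<dots> = ennreal \<bar>r + s * t\<bar> * ennreal (2 / pi / (1 + t\<^sup>2)\<^sup>2)"
        by (subst nn_integral_cmult) (simp_all only: normal_product_third_moment, simp)
      also have "\<dots> = ennreal (2 / pi) * ennreal (\<bar>r + s * t\<bar> / (1 + t\<^sup>2)\<^sup>2)"
        by (simp add: ennreal_mult'[symmetric] mult.commute)
      finally show "(\<integral>\<^sup>+x. ennreal (\<bar>r + s * t\<bar> * (\<bar>x\<bar> ^ 3 * (std_normal_density x * std_normal_density (x * t)))) \<partial>lborel) = ennreal (2 / pi) * ennreal (\<bar>r + s * t\<bar> / (1 + t\<^sup>2)\<^sup>2)" .
    qed
    also have "\<dots> = ennreal (2 / pi) * ennreal (s + r * arcsin r)"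
      by (subst nn_integral_cmult) (simp_all add: abs_affine_cauchy_integral[OF sp s(2)])
    finally show ?thesis by (simp add: ennreal_mult'[symmetric])
  qed
  have "\<bar>Y \<omega>\<bar> * \<bar>Z \<omega>\<bar> = (y * z) * (\<bar>U \<omega>\<bar> * \<bar>r * U \<omega> + W \<omega>\<bar>)" for \<omega>
    using yz unfolding W_def U_def Z1_def by (simp add: abs_mult abs_divide)
  then have "(\<integral>\<^sup>+\<omega>. ennreal (\<bar>Y \<omega>\<bar> * \<bar>Z \<omega>\<bar>) \<partial>M) = ennreal (y * z) * (\<integral>\<^sup>+\<omega>. ennreal (\<bar>U \<omega>\<bar> * \<bar>r * U \<omega> + W \<omega>\<bar>) \<partial>M)"
    using yz by (subst nn_integral_cmult[symmetric]) (simp_all add: ennreal_mult')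
  also have "\<dots> = ennreal (y * z * (2 / pi * (s + r * arcsin r)))" unfolding main by (rule ennreal_mult'[symmetric]) (use yz in simp)
  also have "y * z * (2 / pi * (s + r * arcsin r)) = 2 / pi * sqrt (cov Y Y * cov Z Z) * (sqrt (1 - r\<^sup>2) + r * arcsin r)"
    unfolding s_def y_def z_def real_sqrt_mult by simp
  finally show "(\<integral>\<^sup>+\<omega>. ennreal (\<bar>Y \<omega>\<bar> * \<bar>Z \<omega>\<bar>) \<partial>M) = ennreal (2 / pi * sqrt (cov Y Y * cov Z Z) * (sqrt (1 - r\<^sup>2) + r * arcsin r))" .
qed

text \<open>Split \<open>Y\<close> into \<open>b * \<eta>\<close> and an independent
  \<open>W\<close>. The absolute moments of \<open>\<eta>\<close> of order 3 and 1 are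
  \<open>2 * sqrt (2 / pi)\<close> and \<open>sqrt (2 / pi)\<close>, which gives
  \<open>2 * b\<^sup>2\<close> plus the variance \<open>cov Y Y - b\<^sup>2\<close> of
  \<open>W\<close>; the mixed term disappears because \<open>W\<close> is centred.\<close>

lemma abs_times_square_expectation:
  assumes Y: "Y \<in> H" and E: "\<eta> \<in> H" and v: "cov \<eta> \<eta> = 1"
  shows "(\<integral>\<^sup>+x. ennreal (\<bar>\<eta> x\<bar> * (Y x)\<^sup>2) \<partial>M) = ennreal (sqrt (2 / pi) * (cov Y Y + (cov \<eta> Y)\<^sup>2))"
proof -
  define b where "b = cov \<eta> Y"
  define W where "W = (\<lambda>x. Y x - b * \<eta> x)"
  have WH: "W \<in> H" unfolding W_def by (rule diff_scale_H[OF Y E])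
  have W0: "cov \<eta> W = 0" unfolding W_def cov_diff_right[OF Y E E] v b_def by simp
  have WW: "cov W W = cov Y Y - b\<^sup>2" unfolding W_def cov_diff_diff[OF Y E] v cov_commute[of Y \<eta>] b_def[symmetric] by (simp add: power2_eq_square)
  have [measurable]: "\<eta> \<in> borel_measurable M" "W \<in> borel_measurable M" using E WH meas_H by auto
  note mE = gauss_rv_moments[OF gauss[OF E]] and mW = gauss_rv_moments[OF gauss[OF WH]]
  define B where "B = (LINT x|M. \<bar>\<eta> x\<bar> * \<eta> x)"
  have iB: "integrable M (\<lambda>x. \<bar>\<eta> x\<bar> * \<eta> x)"
    by (rule Bochner_Integration.integrable_bound[OF mE(1)[of 2]]) (auto simp: power2_eq_square abs_mult)
  have inner: "(\<integral>\<^sup>+x. ennreal (\<bar>\<eta> x\<bar> * (b * \<eta> x + w)\<^sup>2) \<partial>M) = ennreal (b\<^sup>2 * (2 * sqrt (2 / pi)) + 2 * b * B * w + sqrt (2 / pi) * w\<^sup>2)" for w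
  proof -
    have e: "\<bar>\<eta> x\<bar> * (b * \<eta> x + w)\<^sup>2 = b\<^sup>2 * \<bar>\<eta> x\<bar> ^ 3 + (2 * b * w) * (\<bar>\<eta> x\<bar> * \<eta> x) + w\<^sup>2 * \<bar>\<eta> x\<bar> ^ 1" for x
    proof -
      have "\<bar>\<eta> x\<bar> ^ 3 = \<bar>\<eta> x\<bar> * (\<eta> x)\<^sup>2" by (simp add: power3_eq_cube power2_eq_square)
      then show ?thesis by (simp add: power2_eq_square algebra_simps)
    qed
    have i: "integrable M (\<lambda>x. b\<^sup>2 * \<bar>\<eta> x\<bar> ^ 3)" "integrable M (\<lambda>x. (2 * b * w) * (\<bar>\<eta> x\<bar> * \<eta> x))" "integrable M (\<lambda>x. w\<^sup>2 * \<bar>\<eta> x\<bar> ^ 1)"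
      using mE(2)[of 3] iB mE(2)[of 1] by simp_all
    have "integrable M (\<lambda>x. \<bar>\<eta> x\<bar> * (b * \<eta> x + w)\<^sup>2)" unfolding e using i by (intro Bochner_Integration.integrable_add)
    then have "(\<integral>\<^sup>+x. ennreal (\<bar>\<eta> x\<bar> * (b * \<eta> x + w)\<^sup>2) \<partial>M) = ennreal (LINT x|M. \<bar>\<eta> x\<bar> * (b * \<eta> x + w)\<^sup>2)"
      by (rule nn_integral_eq_integral) simp
    also have "(LINT x|M. \<bar>\<eta> x\<bar> * (b * \<eta> x + w)\<^sup>2) = b\<^sup>2 * (2 * sqrt (2 / pi)) + 2 * b * w * B + w\<^sup>2 * sqrt (2 / pi)"
      unfolding e Bochner_Integration.integral_add[OF Bochner_Integration.integrable_add[OF i(1,2)] i(3)] Bochner_Integration.integral_add[OF i(1,2)]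
      using mE(6,7) v by (simp add: B_def)
    finally show ?thesis by (simp add: mult_ac)
  qed
  have nonneg: "0 \<le> b\<^sup>2 * (2 * sqrt (2 / pi)) + 2 * b * B * w + sqrt (2 / pi) * w\<^sup>2" for w
  proof -
    have "(LINT x|M. \<bar>\<eta> x\<bar> * (b * \<eta> x + w)\<^sup>2) \<ge> 0" by simp
    moreover have "\<bar>\<eta> x\<bar> * (b * \<eta> x + w)\<^sup>2 = b\<^sup>2 * \<bar>\<eta> x\<bar> ^ 3 + (2 * b * w) * (\<bar>\<eta> x\<bar> * \<eta> x) + w\<^sup>2 * \<bar>\<eta> x\<bar> ^ 1" for x
    proof -
      have "\<bar>\<eta> x\<bar> ^ 3 = \<bar>\<eta> x\<bar> * (\<eta> x)\<^sup>2" by (simp add: power3_eq_cube power2_eq_square)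
      then show ?thesis by (simp add: power2_eq_square algebra_simps)
    qed
    ultimately have "0 \<le> (LINT x|M. b\<^sup>2 * \<bar>\<eta> x\<bar> ^ 3 + (2 * b * w) * (\<bar>\<eta> x\<bar> * \<eta> x) + w\<^sup>2 * \<bar>\<eta> x\<bar> ^ 1)" by simp
    also have "\<dots> = b\<^sup>2 * (2 * sqrt (2 / pi)) + 2 * b * w * B + w\<^sup>2 * sqrt (2 / pi)"
      using mE(2)[of 3] iB mE(2)[of 1] mE(6,7) v by (simp add: B_def)
    finally show ?thesis by (simp add: mult_ac)
  qed
  have "(\<integral>\<^sup>+x. ennreal (\<bar>\<eta> x\<bar> * (Y x)\<^sup>2) \<partial>M) = (\<integral>\<^sup>+x. ennreal (\<bar>\<eta> x\<bar> * (b * \<eta> x + W x)\<^sup>2) \<partial>M)"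
    unfolding W_def by simp
  also have "\<dots> = (\<integral>\<^sup>+x'. \<integral>\<^sup>+x. ennreal (\<bar>\<eta> x\<bar> * (b * \<eta> x + W x')\<^sup>2) \<partial>M \<partial>M)"
  proof (rule uncorrelated_split[where W="\<lambda>_::unit. W" and \<Phi>="\<lambda>u w. ennreal (\<bar>u\<bar> * (b * u + w ())\<^sup>2)", OF E WH W0])
    have [measurable]: "(\<lambda>p. snd p ()) \<in> borel_measurable (borel \<Otimes>\<^sub>M PiM UNIV (\<lambda>_. borel :: real measure))"
      by (rule measurable_compose[OF measurable_snd]) (rule measurable_component_singleton, simp)
    show "(\<lambda>(u, w). ennreal (\<bar>u\<bar> * (b * u + w ())\<^sup>2)) \<in> borel_measurable (borel \<Otimes>\<^sub>M PiM UNIV (\<lambda>_. borel :: real measure))"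
      unfolding split_beta' by measurable
  qed
  also have "\<dots> = ennreal (LINT x|M. b\<^sup>2 * (2 * sqrt (2 / pi)) + 2 * b * B * W x + sqrt (2 / pi) * (W x)\<^sup>2)"
    unfolding inner by (rule nn_integral_eq_integral) (use mW(1)[of 1] mW(1)[of 2] nonneg in auto)
  also have "(LINT x|M. b\<^sup>2 * (2 * sqrt (2 / pi)) + 2 * b * B * W x + sqrt (2 / pi) * (W x)\<^sup>2) = b\<^sup>2 * (2 * sqrt (2 / pi)) + sqrt (2 / pi) * cov W W"
    using mW(1)[of 1] mW(1)[of 2] mW(3,4) by (simp add: prob_space)
  also have "\<dots> = sqrt (2 / pi) * (cov Y Y + b\<^sup>2)" unfolding WW by (simp add: algebra_simps)
  finally show ?thesis unfolding b_def .
qed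

text \<open>The polarisation \<open>12 * y\<^sup>2 * z\<^sup>2 = (y + z) ^ 4 + (y - z) ^ 4 - 2 * y ^
  4 - 2 * z ^ 4\<close> reduces the mixed moment to fourth moments of members of
  \<open>H\<close>.\<close>

lemma square_square_expectation:
  assumes Y: "Y \<in> H" and Z: "Z \<in> H"
  shows "integrable M (\<lambda>w. (Y w)\<^sup>2 * (Z w)\<^sup>2)" "(LINT w|M. (Y w)\<^sup>2 * (Z w)\<^sup>2) = cov Y Y * cov Z Z + 2 * (cov Y Z)\<^sup>2"
proof -
  define P Q where "P = (\<lambda>w. Y w - (-1) * Z w)" and "Q = (\<lambda>w. Y w - 1 * Z w)"
  have PH: "P \<in> H" and QH: "Q \<in> H" unfolding P_def Q_def by (rule diff_scale_H[OF Y Z])+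
  note m = gauss_rv_moments[OF gauss[OF PH]] gauss_rv_moments[OF gauss[OF QH]] gauss_rv_moments[OF gauss[OF Y]] gauss_rv_moments[OF gauss[OF Z]]
  have e: "(Y w)\<^sup>2 * (Z w)\<^sup>2 = (P w ^ 4 + Q w ^ 4 - 2 * Y w ^ 4 - 2 * Z w ^ 4) / 12" for w
    unfolding P_def Q_def by (simp add: power2_eq_square power4_eq_xxxx algebra_simps)
  show "integrable M (\<lambda>w. (Y w)\<^sup>2 * (Z w)\<^sup>2)" unfolding e
    by (intro integrable_divide_zero Bochner_Integration.integrable_diff Bochner_Integration.integrable_add integrable_mult_right m(1,8,15,22))
  have "(LINT w|M. (Y w)\<^sup>2 * (Z w)\<^sup>2) = (3 * (cov P P)\<^sup>2 + 3 * (cov Q Q)\<^sup>2 - 2 * (3 * (cov Y Y)\<^sup>2) - 2 * (3 * (cov Z Z)\<^sup>2)) / 12"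
    unfolding e using m(1)[of 4] m(8)[of 4] m(15)[of 4] m(22)[of 4] m(5,12,19,26) by simp
  also have "\<dots> = cov Y Y * cov Z Z + 2 * (cov Y Z)\<^sup>2"
    unfolding P_def Q_def cov_diff_diff[OF Y Z] by (simp add: power2_eq_square algebra_simps)
  finally show "(LINT w|M. (Y w)\<^sup>2 * (Z w)\<^sup>2) = cov Y Y * cov Z Z + 2 * (cov Y Z)\<^sup>2" .
qed

end

section \<open>Integrability of the covariance density\<close>

text \<open>The mean of the absolute product of two standard Gaussian variables of correlation
  \<open>a\<close>, divided by its value \<open>2 / pi\<close> under independence.\<close>

definition abs_corr :: "real \<Rightarrow> real" where
  "abs_corr a = sqrt (1 - a\<^sup>2) + a * arcsin a"

lemma arcsin_ge_self: "0 \<le> x \<Longrightarrow> x \<le> 1 \<Longrightarrow> x \<le> arcsin x"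
  using sin_x_le_x[of "arcsin x"] arcsin_nonneg[of x] by simp

lemma arcsin_le_double:
  assumes "0 \<le> x" "x \<le> 1/2"
  shows "arcsin x \<le> 2 * x"
proof -
  have "2 * 0 - arcsin 0 \<le> 2 * x - arcsin x"
  proof (rule DERIV_nonneg_imp_nondecreasing[OF assms(1)])
    fix t :: real assume t: "0 \<le> t" "t \<le> x"
    then have t1: "-1 < t" "t < 1" "t \<le> 1/2" using assms by auto
    have "t\<^sup>2 \<le> (1/2)\<^sup>2" using t t1 by (intro power_mono) auto
    then have "(1/2)\<^sup>2 \<le> 1 - t\<^sup>2" by (simp add: power2_eq_square)
    then have "1/2 \<le> sqrt (1 - t\<^sup>2)" by (rule real_le_rsqrt)
    then have "inverse (sqrt (1 - t\<^sup>2)) \<le> inverse (1/2)" by (rule le_imp_inverse_le) simp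
    moreover have "((\<lambda>t. 2 * t - arcsin t) has_real_derivative 2 * 1 - inverse (sqrt (1 - t\<^sup>2))) (at t)"
      using t1 by (intro DERIV_diff DERIV_cmult DERIV_ident DERIV_arcsin) auto
    ultimately show "\<exists>y. ((\<lambda>t. 2 * t - arcsin t) has_real_derivative y) (at t) \<and> 0 \<le> y" by (intro exI conjI) auto
  qed
  then show ?thesis by simp
qed

lemma abs_corr_even: "\<bar>a\<bar> \<le> 1 \<Longrightarrow> abs_corr a = sqrt (1 - \<bar>a\<bar>\<^sup>2) + \<bar>a\<bar> * arcsin \<bar>a\<bar>"
  by (cases "a \<ge> 0") (simp_all add: abs_corr_def arcsin_minus)

lemma abs_corr_minus: "\<bar>a\<bar> \<le> 1 \<Longrightarrow> abs_corr (- a) = abs_corr a"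
  by (simp add: abs_corr_even)

text \<open>By evenness it is enough to look at \<open>\<bar>a\<bar>\<close>. The lower bound
  combines \<open>sqrt (1 - a\<^sup>2) \<ge> 1 - a\<^sup>2\<close> with
  \<open>arcsin x \<ge> x\<close>; the 3 comes from \<open>1 + pi / 2\<close> and
  \<open>pi < 4\<close>. The quadratic bound is what makes \<open>F\<close> of second order at
  infinity.\<close>

lemma abs_corr_bounds:
  assumes a: "\<bar>a\<bar> \<le> 1"
  shows "1 \<le> abs_corr a" "abs_corr a \<le> 3" "\<bar>a\<bar> \<le> 1/2 \<Longrightarrow> abs_corr a \<le> 1 + 2 * a\<^sup>2"
proof -
  have a2: "\<bar>a\<bar>\<^sup>2 \<le> 1" using a by (simp add: abs_square_le_1)
  have "1 - \<bar>a\<bar>\<^sup>2 \<le> sqrt (1 - \<bar>a\<bar>\<^sup>2)"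
    using a2 by (intro real_le_rsqrt) (auto simp: power2_eq_square intro!: mult_left_le)
  moreover have "\<bar>a\<bar>\<^sup>2 \<le> \<bar>a\<bar> * arcsin \<bar>a\<bar>"
    unfolding power2_eq_square by (intro mult_left_mono arcsin_ge_self) (use a in auto)
  ultimately show "1 \<le> abs_corr a" unfolding abs_corr_even[OF a] by linarith
  have s1: "sqrt (1 - \<bar>a\<bar>\<^sup>2) \<le> 1" by simp
  have "\<bar>a\<bar> * arcsin \<bar>a\<bar> \<le> 1 * (pi / 2)"
    by (intro mult_mono arcsin_ubound arcsin_nonneg) (use a in auto)
  then show "abs_corr a \<le> 3" unfolding abs_corr_even[OF a] using s1 pi_less_4 by linarith
  assume "\<bar>a\<bar> \<le> 1/2"
  then have "\<bar>a\<bar> * arcsin \<bar>a\<bar> \<le> \<bar>a\<bar> * (2 * \<bar>a\<bar>)" by (intro mult_left_mono arcsin_le_double) auto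
  moreover have "\<bar>a\<bar> * (2 * \<bar>a\<bar>) = 2 * a\<^sup>2" by (simp add: power2_eq_square)
  ultimately show "abs_corr a \<le> 1 + 2 * a\<^sup>2" unfolding abs_corr_even[OF a] using s1 by linarith
qed

text \<open>What the probabilistic part has to supply about \<open>\<kappa>\<close>. The expression
  in \<open>D_pos\<close> is the Gram determinant of \<open>f 0\<close>, \<open>f' 0\<close>,
  \<open>f t\<close>; divided by \<open>1 - (\<kappa> t)\<^sup>2\<close> it is the residual variance
  of \<open>f' 0\<close> after regression on \<open>f 0\<close> and \<open>f t\<close>. The bound of
  this variance by a multiple of \<open>t\<^sup>2\<close> in \<open>near_0\<close> reflects twice
  differentiable paths.\<close>

locale correlation =
  fixes \<kappa> \<kappa>' \<kappa>'' :: "real \<Rightarrow> real"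
  assumes \<kappa>_deriv: "(\<kappa> has_real_derivative \<kappa>' x) (at x)"
    and \<kappa>'_deriv: "(\<kappa>' has_real_derivative \<kappa>'' x) (at x)"
    and \<kappa>''_cont: "continuous_on UNIV \<kappa>''"
    and \<kappa>_even: "\<kappa> (- x) = \<kappa> x"
    and \<kappa>_0: "\<kappa> 0 = 1" and \<kappa>''_0: "\<kappa>'' 0 = -1"
    and \<kappa>_lim: "(\<kappa> \<longlongrightarrow> 0) at_top" and \<kappa>'_lim: "(\<kappa>' \<longlongrightarrow> 0) at_top" and \<kappa>''_lim: "(\<kappa>'' \<longlongrightarrow> 0) at_top"
    and \<kappa>_sq: "integrable lborel (\<lambda>x. (\<kappa> x)\<^sup>2)" and \<kappa>''_sq: "integrable lborel (\<lambda>x. (\<kappa>'' x)\<^sup>2)"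
    and D_pos: "0 < t \<Longrightarrow> 0 < 1 - (\<kappa> t)\<^sup>2 - (\<kappa>' t)\<^sup>2"
    and near_0: "\<exists>C \<delta>. 0 < \<delta> \<and> (\<forall>t. 0 < t \<and> t < \<delta> \<longrightarrow> 1 - (\<kappa> t)\<^sup>2 - (\<kappa>' t)\<^sup>2 \<le> C * t\<^sup>2 * (1 - (\<kappa> t)\<^sup>2))"
    and a_bound: "0 < t \<Longrightarrow> \<bar>(\<kappa> t * (\<kappa>' t)\<^sup>2 - (\<kappa> t)\<^sup>2 * \<kappa>'' t + \<kappa>'' t) / (1 - (\<kappa> t)\<^sup>2 - (\<kappa>' t)\<^sup>2)\<bar> \<le> 1"
begin

lemma \<kappa>_cont: "continuous_on UNIV \<kappa>" and \<kappa>'_cont: "continuous_on UNIV \<kappa>'"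
  by (rule DERIV_continuous_on[OF has_field_derivative_at_within[OF \<kappa>_deriv]],
      rule DERIV_continuous_on[OF has_field_derivative_at_within[OF \<kappa>'_deriv]])

lemma \<kappa>_meas[measurable]: "\<kappa> \<in> borel_measurable borel" "\<kappa>' \<in> borel_measurable borel" "\<kappa>'' \<in> borel_measurable borel"
  by (rule borel_measurable_continuous_onI, rule \<kappa>_cont \<kappa>'_cont \<kappa>''_cont)+

lemma \<kappa>'_odd: "\<kappa>' (- x) = - \<kappa>' x"
proof -
  have "((\<lambda>x. \<kappa> (- x)) has_real_derivative \<kappa>' (- x) * (- 1)) (at x)"
    by (rule DERIV_chain2[OF \<kappa>_deriv]) (auto intro!: derivative_eq_intros)
  then have "(\<kappa> has_real_derivative \<kappa>' (- x) * (- 1)) (at x)" by (simp add: \<kappa>_even)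
  from DERIV_unique[OF this \<kappa>_deriv] show ?thesis by simp
qed

lemma \<kappa>''_even: "\<kappa>'' (- x) = \<kappa>'' x"
proof -
  have "((\<lambda>x. \<kappa>' (- x)) has_real_derivative \<kappa>'' (- x) * (- 1)) (at x)"
    by (rule DERIV_chain2[OF \<kappa>'_deriv]) (auto intro!: derivative_eq_intros)
  moreover have "((\<lambda>x. \<kappa>' (- x)) has_real_derivative - \<kappa>'' x) (at x)"
    unfolding \<kappa>'_odd by (rule DERIV_minus[OF \<kappa>'_deriv])
  ultimately show ?thesis using DERIV_unique by fastforce
qed

lemma \<kappa>'_0: "\<kappa>' 0 = 0"
  using \<kappa>'_odd[of 0] by simp

lemma \<kappa>_sq_less: "0 < t \<Longrightarrow> (\<kappa> t)\<^sup>2 < 1"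
  using D_pos[of t] zero_le_power2[of "\<kappa>' t"] by linarith

definition A :: "real \<Rightarrow> real" where
  "A t = (\<kappa> t * (\<kappa>' t)\<^sup>2 - (\<kappa> t)\<^sup>2 * \<kappa>'' t + \<kappa>'' t) / (1 - (\<kappa> t)\<^sup>2 - (\<kappa>' t)\<^sup>2)"

text \<open>The density of pairs of zeros at distance \<open>t\<close> relative to the value
  \<open>1 / pi\<^sup>2\<close> of uncorrelated points; \<open>F\<close> is accordingly the
  truncated density.\<close>

definition pair_corr :: "real \<Rightarrow> real" where
  "pair_corr t = (1 - (\<kappa> t)\<^sup>2 - (\<kappa>' t)\<^sup>2) / (1 - (\<kappa> t)\<^sup>2) powr (3 / 2) * abs_corr (A t)"

definition F :: "real \<Rightarrow> real" where
  "F t = pair_corr t - 1"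

lemma F_even: "F (- t) = F t"
  by (simp add: F_def pair_corr_def A_def \<kappa>_even \<kappa>'_odd \<kappa>''_even)

lemma F_meas[measurable]: "F \<in> borel_measurable borel"
proof -
  \<comment> \<open>Clamping makes \<open>arcsin\<close> continuous on the whole line and does not
    alter the values used, as \<open>\<bar>A t\<bar> \<le> 1\<close> for all \<open>t\<close>; at 0
    this holds because \<open>A 0 = 0 / 0 = 0\<close>.\<close>
  have "continuous_on UNIV (\<lambda>x::real. arcsin (max (-1) (min 1 x)))"
    by (intro continuous_on_arcsin continuous_intros) auto
  then have [measurable]: "(\<lambda>x::real. arcsin (max (-1) (min 1 x))) \<in> borel_measurable borel"
    by (rule borel_measurable_continuous_onI)
  have "\<bar>A t\<bar> \<le> 1" for t
  proof (cases t "0::real" rule: linorder_cases)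
    case less
    then have "\<bar>A (- t)\<bar> \<le> 1" unfolding A_def by (intro a_bound) simp
    then show ?thesis by (simp add: A_def \<kappa>_even \<kappa>'_odd \<kappa>''_even)
  next
    case greater
    then show ?thesis unfolding A_def by (rule a_bound)
  qed (simp add: A_def \<kappa>_0 \<kappa>'_0)
  then have clamp: "max (-1) (min 1 (A t)) = A t" for t
    by (metis abs_le_iff max.absorb2 min.absorb2 minus_le_iff)
  have "(\<lambda>t. (1 - (\<kappa> t)\<^sup>2 - (\<kappa>' t)\<^sup>2) / (1 - (\<kappa> t)\<^sup>2) powr (3 / 2) * (sqrt (1 - (A t)\<^sup>2) + A t * arcsin (max (-1) (min 1 (A t)))) - 1) \<in> borel_measurable borel"
    unfolding A_def by measurable
  then show ?thesis unfolding F_def pair_corr_def abs_corr_def clamp .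
qed

lemma pair_corr_bounds:
  assumes "0 < t"
  shows "0 \<le> pair_corr t" "pair_corr t \<le> 3 * ((1 - (\<kappa> t)\<^sup>2 - (\<kappa>' t)\<^sup>2) / (1 - (\<kappa> t)\<^sup>2) powr (3 / 2))"
proof -
  have a: "\<bar>A t\<bar> \<le> 1" unfolding A_def by (rule a_bound[OF assms])
  have q: "0 \<le> (1 - (\<kappa> t)\<^sup>2 - (\<kappa>' t)\<^sup>2) / (1 - (\<kappa> t)\<^sup>2) powr (3 / 2)"
    using D_pos[OF assms] by (intro divide_nonneg_nonneg) auto
  show "0 \<le> pair_corr t" unfolding pair_corr_def using q abs_corr_bounds(1)[OF a] by (intro mult_nonneg_nonneg) auto
  show "pair_corr t \<le> 3 * ((1 - (\<kappa> t)\<^sup>2 - (\<kappa>' t)\<^sup>2) / (1 - (\<kappa> t)\<^sup>2) powr (3 / 2))"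
    unfolding pair_corr_def using mult_left_mono[OF abs_corr_bounds(2)[OF a] q] by (simp add: mult.commute)
qed

lemma powr_three_halves: "0 < v \<Longrightarrow> v powr (3 / 2) = v * sqrt v" for v :: real
proof -
  assume v: "0 < v"
  have "v powr (3 / 2) = v powr (1 + 1 / 2)" by simp
  also have "\<dots> = v * sqrt v" unfolding powr_add using v by (simp add: powr_half_sqrt)
  finally show ?thesis .
qed

text \<open>Since \<open>\<kappa>'' 0 = -1\<close>, the variance
  \<open>1 - (\<kappa> t)\<^sup>2\<close> is at least \<open>t\<^sup>2 / 4\<close> near 0, while
  \<open>near_0\<close> bounds the numerator by \<open>C * t\<^sup>2\<close> times the same
  variance. What remains is of order \<open>t\<close>: close zeros repel each other.\<close>

lemma pair_corr_near_0: "\<exists>B \<delta>. 0 < \<delta> \<and> (\<forall>t. 0 < t \<and> t < \<delta> \<longrightarrow> pair_corr t \<le> B)"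
proof -
  obtain C \<delta> where C: "0 < \<delta>" "\<And>t. 0 < t \<Longrightarrow> t < \<delta> \<Longrightarrow> 1 - (\<kappa> t)\<^sup>2 - (\<kappa>' t)\<^sup>2 \<le> C * t\<^sup>2 * (1 - (\<kappa> t)\<^sup>2)"
    using near_0 by blast
  have "isCont \<kappa>'' 0" using \<kappa>''_cont by (simp add: continuous_on_eq_continuous_at)
  then have "\<forall>\<^sub>F t in at 0. \<kappa>'' t < - 1/2" unfolding isCont_def by (rule order_tendstoD) (simp add: \<kappa>''_0)
  then obtain d1 where d1: "d1 > 0" "\<And>t. t \<noteq> 0 \<Longrightarrow> dist t 0 < d1 \<Longrightarrow> \<kappa>'' t < - 1/2" unfolding eventually_at by auto
  have "isCont \<kappa> 0" using \<kappa>_cont by (simp add: continuous_on_eq_continuous_at)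
  then have "\<forall>\<^sub>F t in at 0. 0 < \<kappa> t" unfolding isCont_def by (rule order_tendstoD) (simp add: \<kappa>_0)
  then obtain d2 where d2: "d2 > 0" "\<And>t. t \<noteq> 0 \<Longrightarrow> dist t 0 < d2 \<Longrightarrow> 0 < \<kappa> t" unfolding eventually_at by auto
  define d where "d = min \<delta> (min 1 (min d1 d2))"
  have \<kappa>': "\<kappa>' s \<le> - s / 2" if s: "0 \<le> s" "s < d" for s
  proof -
    have "(\<kappa>' s + s / 2) \<le> (\<kappa>' 0 + 0 / 2)"
    proof (rule DERIV_nonpos_imp_nonincreasing[OF s(1)])
      fix x assume x: "0 \<le> x" "x \<le> s"
      have "\<kappa>'' x \<le> - 1/2" by (cases "x = 0") (use \<kappa>''_0 d1(2)[of x] x s in \<open>auto simp: d_def\<close>)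
      moreover have "((\<lambda>s. \<kappa>' s + s / 2) has_real_derivative \<kappa>'' x + 1 / 2) (at x)"
        by (intro DERIV_add \<kappa>'_deriv DERIV_cdivide DERIV_ident)
      ultimately show "\<exists>y. ((\<lambda>s. \<kappa>' s + s / 2) has_real_derivative y) (at x) \<and> y \<le> 0" by (intro exI conjI) auto
    qed
    then show ?thesis by (simp add: \<kappa>'_0)
  qed
  have \<kappa>q: "\<kappa> t \<le> 1 - t\<^sup>2 / 4" if t: "0 \<le> t" "t < d" for t
  proof -
    have "(\<kappa> t + t\<^sup>2 / 4) \<le> (\<kappa> 0 + 0\<^sup>2 / 4)"
    proof (rule DERIV_nonpos_imp_nonincreasing[OF t(1)])
      fix x assume x: "0 \<le> x" "x \<le> t"
      have "\<kappa>' x \<le> - x / 2" using \<kappa>'[of x] x t by simp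
      moreover have "((\<lambda>s. \<kappa> s + s\<^sup>2 / 4) has_real_derivative \<kappa>' x + (2 * x) / 4) (at x)"
        by (intro DERIV_add \<kappa>_deriv DERIV_cdivide) (auto intro!: derivative_eq_intros)
      ultimately show "\<exists>y. ((\<lambda>s. \<kappa> s + s\<^sup>2 / 4) has_real_derivative y) (at x) \<and> y \<le> 0" by (intro exI conjI) auto
    qed
    then show ?thesis by (simp add: \<kappa>_0)
  qed
  have "pair_corr t \<le> 6 * \<bar>C\<bar>" if t: "0 < t" "t < d" for t
  proof -
    define v where "v = 1 - (\<kappa> t)\<^sup>2"
    have \<kappa>t: "0 < \<kappa> t" "\<kappa> t \<le> 1 - t\<^sup>2 / 4" using d2(2)[of t] \<kappa>q[of t] t by (auto simp: d_def)
    have "\<kappa> t \<le> 1" using \<kappa>t zero_le_power2[of t] by linarith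
    \<comment> \<open>Hence \<open>1 - (\<kappa> t)\<^sup>2 \<ge> 1 - \<kappa> t \<ge> (t /
      2)\<^sup>2\<close>.\<close>
    then have "(\<kappa> t)\<^sup>2 \<le> \<kappa> t" using \<kappa>t by (simp add: power2_eq_square mult_left_le)
    then have v: "(t / 2)\<^sup>2 \<le> v" using \<kappa>t by (simp add: v_def power_divide)
    then have vp: "0 < v" using t by (smt (verit) zero_less_power divide_pos_pos)
    have sv: "t / 2 \<le> sqrt v" using v by (rule real_le_rsqrt)
    have "(1 - (\<kappa> t)\<^sup>2 - (\<kappa>' t)\<^sup>2) / v powr (3 / 2) \<le> (C * t\<^sup>2 * v) / (v * sqrt v)"
      unfolding powr_three_halves[OF vp] using C(2)[of t] t vp by (intro divide_right_mono) (auto simp: v_def d_def)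
    also have "\<dots> = C * t\<^sup>2 / sqrt v" using vp by simp
    also have "\<dots> \<le> \<bar>C\<bar> * t\<^sup>2 / (t / 2)"
    proof (rule frac_le)
      show "C * t\<^sup>2 \<le> \<bar>C\<bar> * t\<^sup>2" by (intro mult_right_mono) auto
    qed (use sv t in auto)
    also have "\<dots> = 2 * \<bar>C\<bar> * t" using t by (simp add: power2_eq_square)
    also have "\<dots> \<le> 2 * \<bar>C\<bar> * 1" using t by (intro mult_left_mono) (auto simp: d_def)
    finally show ?thesis using pair_corr_bounds(2)[OF t(1)] unfolding v_def by linarith
  qed
  moreover have "d > 0" using C(1) d1(1) d2(1) by (simp add: d_def)
  ultimately show ?thesis by blast
qed

text \<open>When \<open>\<kappa>\<close>, \<open>\<kappa>'\<close>, \<open>\<kappa>''\<close> are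
  small, the quotient \<open>Q\<close> differs from 1 by a quadratic term and \<open>a\<close> is at
  most of the order of \<open>\<bar>\<kappa>'\<bar> + \<bar>\<kappa>''\<bar>\<close>. As
  \<open>abs_corr\<close> leaves 1 only to second order, \<open>F\<close> is quadratic, and square
  integrability is the natural condition.\<close>

lemma F_far: "\<exists>T>0. \<forall>t\<ge>T. \<bar>F t\<bar> \<le> 32 * ((\<kappa> t)\<^sup>2 + (\<kappa>' t)\<^sup>2 + (\<kappa>'' t)\<^sup>2)"
proof -
  have "\<forall>\<^sub>F t in at_top. \<bar>\<kappa> t\<bar> < 1/10" "\<forall>\<^sub>F t in at_top. \<bar>\<kappa>' t\<bar> < 1/10" "\<forall>\<^sub>F t in at_top. \<bar>\<kappa>'' t\<bar> < 1/10"
    using tendstoD[OF \<kappa>_lim, of "1/10"] tendstoD[OF \<kappa>'_lim, of "1/10"] tendstoD[OF \<kappa>''_lim, of "1/10"] by (simp_all add: dist_real_def)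
  then have "\<forall>\<^sub>F t in at_top. \<bar>\<kappa> t\<bar> < 1/10 \<and> \<bar>\<kappa>' t\<bar> < 1/10 \<and> \<bar>\<kappa>'' t\<bar> < 1/10" by eventually_elim auto
  then obtain T0 where T0: "\<And>t. t \<ge> T0 \<Longrightarrow> \<bar>\<kappa> t\<bar> < 1/10 \<and> \<bar>\<kappa>' t\<bar> < 1/10 \<and> \<bar>\<kappa>'' t\<bar> < 1/10"
    unfolding eventually_at_top_linorder by blast
  have "\<bar>F t\<bar> \<le> 32 * ((\<kappa> t)\<^sup>2 + (\<kappa>' t)\<^sup>2 + (\<kappa>'' t)\<^sup>2)" if t: "t \<ge> max T0 1" for t
  proof -
    define x y z where "x = \<kappa> t" and "y = \<kappa>' t" and "z = \<kappa>'' t"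
    have b: "\<bar>x\<bar> < 1/10" "\<bar>y\<bar> < 1/10" "\<bar>z\<bar> < 1/10" using T0[of t] t by (auto simp: x_def y_def z_def)
    have sq: "w\<^sup>2 \<le> 1/100" if "\<bar>w\<bar> < 1/10" for w :: real
    proof -
      have "\<bar>w\<bar>\<^sup>2 \<le> (1/10)\<^sup>2" by (rule power_mono) (use that in auto)
      then show ?thesis by (simp add: power_divide)
    qed
    have q: "x\<^sup>2 \<le> 1/100" "y\<^sup>2 \<le> 1/100" "z\<^sup>2 \<le> 1/100" using sq b by auto
    define v D where "v = 1 - x\<^sup>2" and "D = 1 - x\<^sup>2 - y\<^sup>2"
    have v: "99/100 \<le> v" "v \<le> 1" using q by (auto simp: v_def)
    have D: "98/100 \<le> D" "D \<le> 1" using q zero_le_power2[of x] zero_le_power2[of y] unfolding D_def by linarith+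
    define a where "a = A t"
    have a: "a = (x * y\<^sup>2 + z * v) / D" unfolding a_def A_def x_def y_def z_def v_def D_def by (simp add: algebra_simps)
    have a1: "\<bar>a\<bar> \<le> 1" unfolding a_def A_def by (rule a_bound) (use t in simp)
    have "\<bar>a\<bar> \<le> (\<bar>x\<bar> * \<bar>y\<bar> * \<bar>y\<bar> + \<bar>z\<bar> * 1) / (98/100)"
      unfolding a abs_divide
    proof (rule frac_le)
      have "\<bar>x * y\<^sup>2 + z * v\<bar> \<le> \<bar>x * y\<^sup>2\<bar> + \<bar>z * v\<bar>" by (rule abs_triangle_ineq)
      also have "\<bar>z * v\<bar> \<le> \<bar>z\<bar> * 1" unfolding abs_mult using v by (intro mult_left_mono) auto
      finally show "\<bar>x * y\<^sup>2 + z * v\<bar> \<le> \<bar>x\<bar> * \<bar>y\<bar> * \<bar>y\<bar> + \<bar>z\<bar> * 1" by (simp add: abs_mult power2_eq_square)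
    qed (use D in auto)
    also have "\<bar>x\<bar> * \<bar>y\<bar> * \<bar>y\<bar> \<le> (1/10) * (1/10) * \<bar>y\<bar>" using b by (intro mult_mono) auto
    finally have a2: "\<bar>a\<bar> \<le> (\<bar>y\<bar> / 100 + \<bar>z\<bar>) * (100/98)" by (simp add: divide_right_mono)
    then have a2: "98 * \<bar>a\<bar> \<le> \<bar>y\<bar> + 100 * \<bar>z\<bar>" by (simp add: field_simps)
    then have ah: "\<bar>a\<bar> \<le> 1/2" using b by linarith
    have a3: "\<bar>a\<bar> \<le> \<bar>y\<bar> + 2 * \<bar>z\<bar>" using a2 by linarith
    have asq: "a\<^sup>2 \<le> 2 * y\<^sup>2 + 8 * z\<^sup>2"
    proof -
      have "\<bar>a\<bar>\<^sup>2 \<le> (\<bar>y\<bar> + 2 * \<bar>z\<bar>)\<^sup>2" by (rule power_mono[OF a3]) simp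
      also have "\<dots> \<le> 2 * \<bar>y\<bar>\<^sup>2 + 8 * \<bar>z\<bar>\<^sup>2" using zero_le_power2[of "\<bar>y\<bar> - 2 * \<bar>z\<bar>"] by (simp add: power2_eq_square algebra_simps)
      finally show ?thesis by simp
    qed
    define Q where "Q = D / v powr (3 / 2)"
    have sv: "v \<le> sqrt v" "sqrt v \<le> 1" using v by (auto intro!: real_le_rsqrt simp: power2_eq_square mult_left_le)
    have vv: "v * v \<le> v * sqrt v" "v * sqrt v \<le> v" using v sv by (auto intro!: mult_left_mono mult_left_le)
    have Q: "Q = D / (v * sqrt v)" unfolding Q_def by (subst powr_three_halves) (use v in auto)
    have v2: "98/100 \<le> v * v"
    proof -
      have "(99/100) * (99/100) \<le> v * v" using v by (intro mult_mono) auto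
      then show ?thesis by simp
    qed
    have Qu: "Q \<le> 1 + 2 * x\<^sup>2"
    proof -
      have "Q \<le> v / (v * v)" unfolding Q
        by (rule frac_le) (use v vv D v2 in \<open>auto simp: D_def v_def\<close>)
      also have "\<dots> = 1 / v" using v by simp
      also have "\<dots> \<le> 1 + 2 * x\<^sup>2"
      proof -
        have "1 \<le> (1 + 2 * x\<^sup>2) * v"
        proof -
          have "x\<^sup>2 * x\<^sup>2 \<le> x\<^sup>2 * (1/100)" using q by (intro mult_left_mono) auto
          moreover have "0 \<le> x\<^sup>2 * x\<^sup>2" by simp
          moreover have "(1 + 2 * x\<^sup>2) * (1 - x\<^sup>2) = 1 + x\<^sup>2 - 2 * (x\<^sup>2 * x\<^sup>2)"
          proof -
            have "(1 + 2 * X) * (1 - X) = 1 + X - 2 * (X * X)" for X :: real by (simp add: algebra_simps)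
            then show ?thesis .
          qed
          ultimately show ?thesis unfolding v_def by linarith
        qed
        then show ?thesis using v by (simp add: pos_divide_le_eq)
      qed
      finally show ?thesis .
    qed
    have Ql: "1 - 2 * y\<^sup>2 \<le> Q"
    proof -
      have "(1 - 2 * y\<^sup>2) * (v * sqrt v) \<le> (1 - 2 * y\<^sup>2) * v"
        using vv q by (intro mult_left_mono) auto
      also have "\<dots> \<le> D"
      proof -
        have "(2 * y\<^sup>2) * (1/2) \<le> (2 * y\<^sup>2) * v" using v by (intro mult_left_mono) auto
        then show ?thesis unfolding D_def v_def by (simp add: algebra_simps)
      qed
      finally show ?thesis unfolding Q using v vv v2 by (subst pos_le_divide_eq) linarith+
    qed
    have F: "F t = Q * abs_corr a - 1" unfolding F_def pair_corr_def Q_def D_def v_def x_def y_def a_def ..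
    have g: "1 \<le> abs_corr a" "abs_corr a \<le> 1 + 2 * a\<^sup>2" using abs_corr_bounds[OF a1] ah by auto
    have Q0: "0 \<le> Q" "Q \<le> 2" using Ql Qu q by linarith+
    have "Q * abs_corr a \<le> Q * (1 + 2 * a\<^sup>2)" using g Q0 by (intro mult_left_mono) auto
    also have "\<dots> = Q + Q * (2 * a\<^sup>2)" by (simp add: algebra_simps)
    also have "Q * (2 * a\<^sup>2) \<le> 2 * (2 * a\<^sup>2)" using Q0 by (intro mult_right_mono) auto
    \<comment> \<open>Together with \<open>a\<^sup>2 \<le> 2 * y\<^sup>2 + 8 * z\<^sup>2\<close>
      this bounds \<open>F t\<close> by
      \<open>2 * x\<^sup>2 + 8 * y\<^sup>2 + 32 * z\<^sup>2\<close>, the origin of the factor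
      32.\<close>
    finally have up: "F t \<le> 2 * x\<^sup>2 + 4 * a\<^sup>2" unfolding F using Qu by linarith
    have "Q * 1 \<le> Q * abs_corr a" using g Q0 by (intro mult_left_mono) auto
    then have lo: "- 2 * y\<^sup>2 \<le> F t" unfolding F using Ql by linarith
    show ?thesis unfolding x_def[symmetric] y_def[symmetric] z_def[symmetric]
      using up lo asq zero_le_power2[of x] zero_le_power2[of y] zero_le_power2[of z] unfolding distrib_left by (intro abs_leI) linarith+
  qed
  then show ?thesis by (intro exI[of _ "max T0 1"]) auto
qed

text \<open>Away from 0 the only danger is that \<open>(\<kappa> t)\<^sup>2\<close> comes close to
  1, which continuity excludes on a compact set.\<close>

lemma F_bounded_compact:
  assumes "0 < T"
  shows "\<exists>B. \<forall>t. 0 < t \<and> t \<le> T \<longrightarrow> \<bar>F t\<bar> \<le> B"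
proof -
  obtain B0 \<delta> where B0: "0 < \<delta>" "\<And>t. 0 < t \<Longrightarrow> t < \<delta> \<Longrightarrow> pair_corr t \<le> B0" using pair_corr_near_0 by blast
  define S where "S = {min \<delta> T..T}"
  have "continuous_on S (\<lambda>t. 1 - (\<kappa> t)\<^sup>2)" by (intro continuous_intros continuous_on_subset[OF \<kappa>_cont]) auto
  moreover have "compact S" "S \<noteq> {}" by (auto simp: S_def)
  ultimately obtain t0 where t0: "t0 \<in> S" "\<And>t. t \<in> S \<Longrightarrow> 1 - (\<kappa> t0)\<^sup>2 \<le> 1 - (\<kappa> t)\<^sup>2"
    using continuous_attains_inf[of S "\<lambda>t. 1 - (\<kappa> t)\<^sup>2"] by blast
  define m where "m = 1 - (\<kappa> t0)\<^sup>2"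
  have m: "m > 0" using \<kappa>_sq_less[of t0] t0(1) B0(1) assms by (auto simp: m_def S_def)
  have "\<bar>F t\<bar> \<le> \<bar>B0\<bar> + 3 * (1 / (m powr (3/2))) + 1" if t: "0 < t" "t \<le> T" for t
  proof -
    have "pair_corr t \<le> \<bar>B0\<bar> + 3 * (1 / (m powr (3/2)))"
    proof (cases "t < \<delta>")
      case True
      have "0 \<le> 3 * (1 / (m powr (3/2)))" by simp
      then show ?thesis using B0(2)[OF t(1) True] by linarith
    next
      case False
      then have tS: "t \<in> S" using t by (auto simp: S_def)
      have "(1 - (\<kappa> t)\<^sup>2 - (\<kappa>' t)\<^sup>2) / (1 - (\<kappa> t)\<^sup>2) powr (3 / 2) \<le> 1 / (m powr (3/2))"
      proof (rule frac_le)
        show "1 - (\<kappa> t)\<^sup>2 - (\<kappa>' t)\<^sup>2 \<le> 1" by simp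
        show "m powr (3 / 2) \<le> (1 - (\<kappa> t)\<^sup>2) powr (3 / 2)" using t0(2)[OF tS] m by (intro powr_mono2) (auto simp: m_def)
      qed (use m in auto)
      then have "pair_corr t \<le> 3 * (1 / (m powr (3/2)))" using pair_corr_bounds(2)[OF t(1)] by linarith
      then show ?thesis by linarith
    qed
    then show ?thesis using pair_corr_bounds(1)[OF t(1)] unfolding F_def unfolding distrib_left by (intro abs_leI) linarith+
  qed
  then show ?thesis by blast
qed

lemma \<kappa>\<kappa>''_int: "integrable lborel (\<lambda>x. \<kappa> x * \<kappa>'' x)"
proof (rule Bochner_Integration.integrable_bound[OF Bochner_Integration.integrable_add[OF \<kappa>_sq \<kappa>''_sq]])
  have "\<bar>a * b\<bar> \<le> a\<^sup>2 + b\<^sup>2" for a b :: real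
  proof -
    have "2 * (\<bar>a\<bar> * \<bar>b\<bar>) \<le> a\<^sup>2 + b\<^sup>2" using zero_le_power2[of "\<bar>a\<bar> - \<bar>b\<bar>"] by (simp add: power2_diff)
    moreover have "0 \<le> \<bar>a\<bar> * \<bar>b\<bar>" by simp
    ultimately show ?thesis unfolding abs_mult by linarith
  qed
  then show "AE x in lborel. norm (\<kappa> x * \<kappa>'' x) \<le> norm ((\<kappa> x)\<^sup>2 + (\<kappa>'' x)\<^sup>2)" by (intro AE_I2) simp
qed simp

text \<open>Integration by parts: \<open>\<kappa>'\<^sup>2 + \<kappa> \<kappa>'' = (\<kappa> \<kappa>')'\<close>.\<close>

lemma \<kappa>'_sq: "integrable lborel (\<lambda>x. (\<kappa>' x)\<^sup>2)" "(LINT x|lborel. (\<kappa>' x)\<^sup>2) = - (LINT x|lborel. \<kappa> x * \<kappa>'' x)"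
proof -
  let ?I = "\<lambda>n::nat. {- real n..real n}"
  have cont: "continuous_on S (\<lambda>x. \<kappa>' x * \<kappa>' x + \<kappa>'' x * \<kappa> x)" for S
    by (intro continuous_intros continuous_on_subset[OF \<kappa>_cont] continuous_on_subset[OF \<kappa>'_cont] continuous_on_subset[OF \<kappa>''_cont]) auto
  have der: "((\<lambda>x. \<kappa> x * \<kappa>' x) has_real_derivative \<kappa>' x * \<kappa>' x + \<kappa>'' x * \<kappa> x) (at x)" for x
    by (rule DERIV_mult[OF \<kappa>_deriv \<kappa>'_deriv])
  have ftc: "has_bochner_integral lborel (\<lambda>x. (\<kappa>' x * \<kappa>' x + \<kappa>'' x * \<kappa> x) * indicator (?I n) x) (\<kappa> (real n) * \<kappa>' (real n) - \<kappa> (- real n) * \<kappa>' (- real n))" for n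
  proof (rule has_bochner_integral_FTC_Icc_real)
    show "isCont (\<lambda>x. \<kappa>' x * \<kappa>' x + \<kappa>'' x * \<kappa> x) x" for x
      using cont[of UNIV] by (simp add: continuous_on_eq_continuous_at)
  qed (simp, rule der)
  have i2: "integrable lborel (\<lambda>x. (\<kappa> x * \<kappa>'' x) * indicator (?I n) x)" for n
    by (rule integrable_real_mult_indicator[OF _ \<kappa>\<kappa>''_int]) simp
  have split: "(\<kappa>' x)\<^sup>2 * indicator (?I n) x = (\<kappa>' x * \<kappa>' x + \<kappa>'' x * \<kappa> x) * indicator (?I n) x - (\<kappa> x * \<kappa>'' x) * indicator (?I n) x" for n x
    by (simp add: power2_eq_square algebra_simps)
  have i1: "integrable lborel (\<lambda>x. (\<kappa>' x)\<^sup>2 * indicator (?I n) x)" for n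
    unfolding split using ftc[of n] i2[of n] by (intro Bochner_Integration.integrable_diff) (auto simp: has_bochner_integral_iff)
  have v1: "(LINT x|lborel. (\<kappa>' x)\<^sup>2 * indicator (?I n) x) = 2 * (\<kappa> (real n) * \<kappa>' (real n)) - (LINT x|lborel. (\<kappa> x * \<kappa>'' x) * indicator (?I n) x)" for n
    unfolding split using ftc[of n] i2[of n] by (subst Bochner_Integration.integral_diff) (auto simp: has_bochner_integral_iff \<kappa>_even \<kappa>'_odd)
  have ind: "(\<lambda>n. indicator (?I n) x :: real) \<longlonglongrightarrow> 1" for x :: real
  proof (rule tendsto_eventually)
    obtain N :: nat where N: "\<bar>x\<bar> \<le> real N" using real_arch_simple by blast
    have "x \<in> ?I n" if "N \<le> n" for n using N that by (auto simp: abs_le_iff intro: order_trans)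
    then show "\<forall>\<^sub>F n in sequentially. indicator (?I n) x = (1::real)" unfolding eventually_sequentially by (intro exI[of _ N]) simp
  qed
  have l2: "(\<lambda>n. LINT x|lborel. (\<kappa> x * \<kappa>'' x) * indicator (?I n) x) \<longlonglongrightarrow> (LINT x|lborel. \<kappa> x * \<kappa>'' x)"
  proof (rule integral_dominated_convergence[where w="\<lambda>x. \<bar>\<kappa> x * \<kappa>'' x\<bar>"])
    show "integrable lborel (\<lambda>x. \<bar>\<kappa> x * \<kappa>'' x\<bar>)" using integrable_abs[OF \<kappa>\<kappa>''_int] .
    show "AE x in lborel. (\<lambda>n. (\<kappa> x * \<kappa>'' x) * indicator (?I n) x) \<longlonglongrightarrow> \<kappa> x * \<kappa>'' x"
      using tendsto_mult[OF tendsto_const ind] by (intro AE_I2) simp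
    show "AE x in lborel. norm ((\<kappa> x * \<kappa>'' x) * indicator (?I n) x) \<le> \<bar>\<kappa> x * \<kappa>'' x\<bar>" for n
      by (intro AE_I2) (auto simp: indicator_def)
  qed auto
  have l1: "(\<lambda>n. \<kappa> (real n) * \<kappa>' (real n)) \<longlonglongrightarrow> 0 * 0"
    by (intro tendsto_mult filterlim_compose[OF \<kappa>_lim] filterlim_compose[OF \<kappa>'_lim] filterlim_real_sequentially)
  have lim: "(\<lambda>n. LINT x|lborel. (\<kappa>' x)\<^sup>2 * indicator (?I n) x) \<longlonglongrightarrow> 2 * (0 * 0) - (LINT x|lborel. \<kappa> x * \<kappa>'' x)"
    unfolding v1 by (rule tendsto_diff[OF tendsto_mult[OF tendsto_const l1] l2])
  \<comment> \<open>The truncated integrals converge and the integrand is nonnegative, so monotone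
    convergence yields the integrability of \<open>(\<kappa>' x)\<^sup>2\<close>, derived here from
    that of the two neighbouring squares.\<close>
  have mono: "AE x in lborel. mono (\<lambda>n. (\<kappa>' x)\<^sup>2 * indicator (?I n) x)"
    by (intro AE_I2) (auto simp: mono_def indicator_def)
  have al: "AE x in lborel. (\<lambda>n. (\<kappa>' x)\<^sup>2 * indicator (?I n) x) \<longlonglongrightarrow> (\<kappa>' x)\<^sup>2"
    using tendsto_mult[OF tendsto_const ind] by (intro AE_I2) simp
  show "integrable lborel (\<lambda>x. (\<kappa>' x)\<^sup>2)" "(LINT x|lborel. (\<kappa>' x)\<^sup>2) = - (LINT x|lborel. \<kappa> x * \<kappa>'' x)"
    using integrable_monotone_convergence[OF i1 mono al lim] integral_monotone_convergence[OF i1 mono al lim] by simp_all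
qed

lemma F_int: "integrable lborel F"
proof -
  obtain T where T: "T > 0" "\<And>t. t \<ge> T \<Longrightarrow> \<bar>F t\<bar> \<le> 32 * ((\<kappa> t)\<^sup>2 + (\<kappa>' t)\<^sup>2 + (\<kappa>'' t)\<^sup>2)" using F_far by blast
  obtain B where B: "\<And>t. 0 < t \<Longrightarrow> t \<le> T \<Longrightarrow> \<bar>F t\<bar> \<le> B" using F_bounded_compact[OF T(1)] by blast
  define G where "G t = \<bar>B\<bar> * indicator {- T..T} t + 32 * ((\<kappa> t)\<^sup>2 + (\<kappa>' t)\<^sup>2 + (\<kappa>'' t)\<^sup>2)" for t
  have G0: "\<bar>F t\<bar> \<le> G t" if "0 < t" for t
  proof (cases "t \<le> T")
    case True
    have "0 \<le> 32 * ((\<kappa> t)\<^sup>2 + (\<kappa>' t)\<^sup>2 + (\<kappa>'' t)\<^sup>2)" by simp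
    moreover have "indicator {- T..T} t = (1::real)"
      using that True T(1) by simp
    then have "G t = \<bar>B\<bar> + 32 * ((\<kappa> t)\<^sup>2 + (\<kappa>' t)\<^sup>2 + (\<kappa>'' t)\<^sup>2)" unfolding G_def by simp
    ultimately show ?thesis using B[OF that True] by linarith
  next
    case False
    then show ?thesis using T(2)[of t] unfolding G_def by (simp add: indicator_def)
  qed
  have Geven: "G (- t) = G t" for t
  proof -
    have "- t \<in> {- T..T} \<longleftrightarrow> t \<in> {- T..T}" by auto
    then have "indicator {- T..T} (- t) = (indicator {- T..T} t :: real)" by (simp only: indicator_def)
    then show ?thesis unfolding G_def by (simp add: \<kappa>_even \<kappa>'_odd \<kappa>''_even)
  qed
  have "integrable lborel (indicat_real {- T..T})" by (rule integrable_real_indicator) (auto simp: emeasure_lborel_Icc_eq)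
  then have "integrable lborel G" unfolding G_def
    by (intro Bochner_Integration.integrable_add integrable_mult_right \<kappa>_sq \<kappa>'_sq \<kappa>''_sq)
  then show ?thesis
  proof (rule Bochner_Integration.integrable_bound)
    have "AE t in lborel. t \<noteq> (0::real)" by (rule AE_lborel_singleton)
    then show "AE t in lborel. norm (F t) \<le> norm (G t)"
    proof eventually_elim
      case (elim t)
      have "\<bar>F t\<bar> \<le> G t"
      proof (cases "0 < t")
        case False
        then have "\<bar>F (- t)\<bar> \<le> G (- t)" using elim by (intro G0) simp
        then show ?thesis by (simp add: F_even Geven)
      qed (rule G0)
      then show ?case by simp
    qed
  qed simp
qed

lemma F_half: "set_integrable lborel {0<..} F" "(LINT t|lborel. F t) = 2 * (LINT t:{0<..}|lborel. F t)"
proof -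
  have i: "set_integrable lborel S F" if "S \<in> sets borel" for S
    unfolding set_integrable_def by (rule integrable_mult_indicator) (use that F_int in auto)
  show "set_integrable lborel {0<..} F" by (rule i) simp
  have neg: "(LINT t:{..<0}|lborel. F t) = (LINT t:{0<..}|lborel. F t)"
    unfolding set_lebesgue_integral_def
    by (subst lborel_integral_real_affine[where c="-1" and t=0]) (auto simp: F_even indicator_def intro!: Bochner_Integration.integral_cong)
  have "(LINT t|lborel. F t) = (LINT t:({..<0} \<union> {0<..})|lborel. F t)"
    unfolding set_lebesgue_integral_def
  proof (rule integral_cong_AE)
    have "AE t in lborel. t \<noteq> (0::real)" by (rule AE_lborel_singleton)
    then show "AE t in lborel. F t = indicator ({..<0} \<union> {0<..}) t *\<^sub>R F t" by eventually_elim (auto simp: indicator_def)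
  qed auto
  also have "\<dots> = (LINT t:{..<0}|lborel. F t) + (LINT t:{0<..}|lborel. F t)"
    by (rule set_integral_Un) (use i in auto)
  finally show "(LINT t|lborel. F t) = 2 * (LINT t:{0<..}|lborel. F t)" unfolding neg by simp
qed

text \<open>Half the covariance of \<open>f\<^sup>2 - f'\<^sup>2\<close> at two times at distance
  \<open>t\<close>.\<close>

definition C2 :: "real \<Rightarrow> real" where
  "C2 t = (\<kappa> t)\<^sup>2 - 2 * (\<kappa>' t)\<^sup>2 + (\<kappa>'' t)\<^sup>2"

lemma C2_int: "integrable lborel C2"
  unfolding C2_def by (intro Bochner_Integration.integrable_add Bochner_Integration.integrable_diff integrable_mult_right \<kappa>_sq \<kappa>'_sq \<kappa>''_sq)

text \<open>Integration by parts turns the integral into that of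
  \<open>(\<kappa> t + \<kappa>'' t)\<^sup>2\<close>. If this vanished identically,
  \<open>\<kappa>'' = - \<kappa>\<close> would keep
  \<open>\<kappa>\<^sup>2 + \<kappa>'\<^sup>2\<close> at its initial value 1, against
  \<open>D_pos\<close>; the excluded case is the cosine.\<close>

lemma C2_integral_pos: "0 < (LINT t|lborel. C2 t)"
proof -
  have sq: "(\<kappa> t + \<kappa>'' t)\<^sup>2 = (\<kappa> t)\<^sup>2 + 2 * (\<kappa> t * \<kappa>'' t) + (\<kappa>'' t)\<^sup>2" for t by (simp add: power2_eq_square algebra_simps)
  have isq: "integrable lborel (\<lambda>t. (\<kappa> t + \<kappa>'' t)\<^sup>2)" unfolding sq
    by (intro Bochner_Integration.integrable_add integrable_mult_right \<kappa>_sq \<kappa>\<kappa>''_int \<kappa>''_sq)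
  have eq: "(LINT t|lborel. C2 t) = (LINT t|lborel. (\<kappa> t + \<kappa>'' t)\<^sup>2)"
    unfolding sq C2_def using \<kappa>_sq \<kappa>'_sq \<kappa>\<kappa>''_int \<kappa>''_sq by simp
  have "\<exists>t. \<kappa> t + \<kappa>'' t \<noteq> 0"
  proof (rule ccontr)
    assume "\<not> ?thesis"
    then have z: "\<kappa> t + \<kappa>'' t = 0" for t by simp
    have "((\<lambda>t. \<kappa> t * \<kappa> t + \<kappa>' t * \<kappa>' t) has_real_derivative 0) (at t)" for t
    proof -
      have "((\<lambda>t. \<kappa> t * \<kappa> t + \<kappa>' t * \<kappa>' t) has_real_derivative (\<kappa>' t * \<kappa> t + \<kappa>' t * \<kappa> t) + (\<kappa>'' t * \<kappa>' t + \<kappa>'' t * \<kappa>' t)) (at t)"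
        by (intro DERIV_add DERIV_mult \<kappa>_deriv \<kappa>'_deriv)
      moreover have "\<kappa>'' t = - \<kappa> t" using z[of t] by simp
      ultimately show ?thesis by simp
    qed
    then have "\<kappa> 1 * \<kappa> 1 + \<kappa>' 1 * \<kappa>' 1 = \<kappa> 0 * \<kappa> 0 + \<kappa>' 0 * \<kappa>' 0" using DERIV_isconst_all by blast
    then show False using D_pos[of 1] by (simp add: \<kappa>_0 \<kappa>'_0 power2_eq_square)
  qed
  then obtain t0 where t0: "(\<kappa> t0 + \<kappa>'' t0)\<^sup>2 > 0" by auto
  have "isCont (\<lambda>t. (\<kappa> t + \<kappa>'' t)\<^sup>2) t0"
    using \<kappa>_cont \<kappa>''_cont by (intro continuous_intros) (auto simp: continuous_on_eq_continuous_at)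
  then have "\<forall>\<^sub>F t in at t0. (\<kappa> t0 + \<kappa>'' t0)\<^sup>2 / 2 < (\<kappa> t + \<kappa>'' t)\<^sup>2"
    unfolding isCont_def by (rule order_tendstoD) (use t0 in simp)
  then obtain d where d: "d > 0" "\<And>t. t \<noteq> t0 \<Longrightarrow> dist t t0 < d \<Longrightarrow> (\<kappa> t0 + \<kappa>'' t0)\<^sup>2 / 2 < (\<kappa> t + \<kappa>'' t)\<^sup>2"
    unfolding eventually_at by auto
  have "0 < (\<kappa> t0 + \<kappa>'' t0)\<^sup>2 / 2 * d" using t0 d by simp
  also have "\<dots> = (LINT t|lborel. (\<kappa> t0 + \<kappa>'' t0)\<^sup>2 / 2 * indicator {t0<..<t0 + d} t)" using d by simp
  also have "\<dots> \<le> (LINT t|lborel. (\<kappa> t + \<kappa>'' t)\<^sup>2)"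
  proof (rule integral_mono[OF _ isq])
    show "(\<kappa> t0 + \<kappa>'' t0)\<^sup>2 / 2 * indicator {t0<..<t0 + d} t \<le> (\<kappa> t + \<kappa>'' t)\<^sup>2" for t
      using d(2)[of t] by (cases "t \<in> {t0<..<t0 + d}") (auto simp: dist_real_def)
  qed (use d in simp)
  finally show ?thesis unfolding eq .
qed

end

section \<open>Scaling limits of bilinear forms with an integrable kernel\<close>

lemma AE_lborel_shift:
  fixes P :: "real \<Rightarrow> bool"
  assumes "AE x in lborel. P x"
  shows "AE x in lborel. P (x + h)"
proof -
  obtain N where N: "N \<in> null_sets lborel" "{x \<in> space lborel. \<not> P x} \<subseteq> N" using assms by (auto simp: eventually_ae_filter)
  have [measurable]: "N \<in> sets borel" using N(1) by (auto simp: null_sets_def)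
  have "AE x in lborel. x \<notin> N" by (rule AE_not_in[OF N(1)])
  then have "AE x in distr lborel borel ((+) h). x \<notin> N" unfolding lborel_distr_plus .
  then have "AE x in lborel. h + x \<notin> N" by (subst (asm) AE_distr_iff) auto
  then show ?thesis using N(2) by (auto simp: add.commute elim!: eventually_mono)
qed

text \<open>A test function is replaced by a bounded Borel function \<open>\<psi>\<close> that agrees with it off a null set;
  almost every point is a continuity point of the test function itself, though not of \<open>\<psi>\<close>.\<close>

lemma shifted_correlation_tendsto:
  fixes \<psi>1 \<psi>2 \<phi> :: "real \<Rightarrow> real"
  assumes \<psi>1: "integrable lborel \<psi>1" and \<psi>2[measurable]: "\<psi>2 \<in> borel_measurable borel" and bnd: "\<And>x. \<bar>\<psi>2 x\<bar> \<le> C"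
    and ae: "AE x in lborel. \<psi>2 x = \<phi> x" and cont: "AE x in lborel. isCont \<phi> x"
  shows "((\<lambda>R. LINT x|lborel. \<psi>1 x * \<psi>2 (x + t / R)) \<longlongrightarrow> (LINT x|lborel. \<psi>1 x * \<psi>2 x)) at_top"
proof (rule tendsto_at_topI_sequentially)
  fix R :: "nat \<Rightarrow> real" assume R: "filterlim R at_top sequentially"
  have [measurable]: "\<psi>1 \<in> borel_measurable borel" using \<psi>1 by auto
  show "(\<lambda>n. LINT x|lborel. \<psi>1 x * \<psi>2 (x + t / R n)) \<longlonglongrightarrow> (LINT x|lborel. \<psi>1 x * \<psi>2 x)"
  proof (rule integral_dominated_convergence[where w="\<lambda>x. \<bar>\<psi>1 x\<bar> * C"])
    show "integrable lborel (\<lambda>x. \<bar>\<psi>1 x\<bar> * C)" using \<psi>1 by simp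
    have "AE x in lborel. \<forall>n. \<psi>2 (x + t / R n) = \<phi> (x + t / R n)"
      unfolding AE_all_countable by (intro allI AE_lborel_shift ae)
    then show "AE x in lborel. (\<lambda>n. \<psi>1 x * \<psi>2 (x + t / R n)) \<longlonglongrightarrow> \<psi>1 x * \<psi>2 x"
      using ae cont
    proof eventually_elim
      case (elim x)
      have "(\<lambda>n. t / R n) \<longlonglongrightarrow> 0" by (rule tendsto_divide_0[OF tendsto_const filterlim_at_top_imp_at_infinity[OF R]])
      then have "(\<lambda>n. x + t / R n) \<longlonglongrightarrow> x + 0" by (rule tendsto_add[OF tendsto_const])
      then have "(\<lambda>n. \<phi> (x + t / R n)) \<longlonglongrightarrow> \<phi> x" using isCont_tendsto_compose[OF elim(3)] by simp
      then show ?case using elim(1,2) by (intro tendsto_mult tendsto_const) simp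
    qed
    show "AE x in lborel. norm (\<psi>1 x * \<psi>2 (x + t / R n)) \<le> \<bar>\<psi>1 x\<bar> * C" for n
      using bnd by (intro AE_I2) (auto simp: abs_mult intro!: mult_left_mono)
  qed auto
qed

text \<open>The inner integral is bounded by \<open>C\<close> times the L1 norm of
  \<open>\<psi>1\<close>, uniformly in \<open>t\<close> and \<open>R\<close>, so a multiple of
  \<open>\<bar>F t\<bar>\<close> dominates; the pointwise limit is
  \<open>shifted_correlation_tendsto\<close>.\<close>

lemma kernel_asymptotics:
  fixes \<psi>1 \<psi>2 \<phi> F :: "real \<Rightarrow> real"
  assumes \<psi>1: "integrable lborel \<psi>1" and \<psi>2[measurable]: "\<psi>2 \<in> borel_measurable borel" and bnd: "\<And>x. \<bar>\<psi>2 x\<bar> \<le> C"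
    and ae: "AE x in lborel. \<psi>2 x = \<phi> x" and cont: "AE x in lborel. isCont \<phi> x" and F: "integrable lborel F"
  shows "((\<lambda>R. LINT t|lborel. F t * (LINT x|lborel. \<psi>1 x * \<psi>2 (x + t / R))) \<longlongrightarrow> (LINT t|lborel. F t) * (LINT x|lborel. \<psi>1 x * \<psi>2 x)) at_top"
proof -
  have [measurable]: "\<psi>1 \<in> borel_measurable borel" "F \<in> borel_measurable borel" using \<psi>1 F by auto
  have "((\<lambda>R. LINT t|lborel. F t * (LINT x|lborel. \<psi>1 x * \<psi>2 (x + t / R))) \<longlongrightarrow> (LINT t|lborel. F t * (LINT x|lborel. \<psi>1 x * \<psi>2 x))) at_top"
  proof (rule integral_dominated_convergence_at_top[where w="\<lambda>t. \<bar>F t\<bar> * (C * (LINT x|lborel. \<bar>\<psi>1 x\<bar>))"])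
    show "integrable lborel (\<lambda>t. \<bar>F t\<bar> * (C * (LINT x|lborel. \<bar>\<psi>1 x\<bar>)))" using F by simp
    show "(\<lambda>t. F t * (LINT x|lborel. \<psi>1 x * \<psi>2 (x + t / R))) \<in> borel_measurable lborel" for R
    proof -
      have "(\<lambda>t. LINT x|lborel. \<psi>1 x * \<psi>2 (x + t / R)) \<in> borel_measurable lborel"
        by (rule lborel.borel_measurable_lebesgue_integral) (simp add: split_beta')
      then show ?thesis by simp
    qed
    show "AE t in lborel. ((\<lambda>R. F t * (LINT x|lborel. \<psi>1 x * \<psi>2 (x + t / R))) \<longlongrightarrow> F t * (LINT x|lborel. \<psi>1 x * \<psi>2 x)) at_top"
      by (intro AE_I2 tendsto_mult tendsto_const shifted_correlation_tendsto[OF \<psi>1 \<psi>2 bnd ae cont])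
    have "norm (F t * (LINT x|lborel. \<psi>1 x * \<psi>2 (x + t / R))) \<le> \<bar>F t\<bar> * (C * (LINT x|lborel. \<bar>\<psi>1 x\<bar>))" for t R
    proof -
      have "\<bar>LINT x|lborel. \<psi>1 x * \<psi>2 (x + t / R)\<bar> \<le> (LINT x|lborel. \<bar>\<psi>1 x\<bar> * C)"
      proof (rule integral_abs_bound_integral)
        show b: "\<bar>\<psi>1 x * \<psi>2 (x + t / R)\<bar> \<le> \<bar>\<psi>1 x\<bar> * C" for x unfolding abs_mult by (intro mult_left_mono bnd) simp
        show "integrable lborel (\<lambda>x. \<psi>1 x * \<psi>2 (x + t / R))"
          by (rule Bochner_Integration.integrable_bound[of _ "\<lambda>x. \<bar>\<psi>1 x\<bar> * C"]) (use \<psi>1 b in \<open>auto intro!: AE_I2 intro: order_trans[OF _ abs_ge_self]\<close>)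
      qed (use \<psi>1 in simp)
      then show ?thesis by (simp add: abs_mult mult.commute mult_left_mono)
    qed
    then show "\<forall>\<^sub>F R in at_top. AE t in lborel. norm (F t * (LINT x|lborel. \<psi>1 x * \<psi>2 (x + t / R))) \<le> \<bar>F t\<bar> * (C * (LINT x|lborel. \<bar>\<psi>1 x\<bar>))"
      by (intro always_eventually allI AE_I2)
  qed simp
  then show ?thesis by simp
qed

text \<open>Substitute first \<open>y = x + t\<close>, then rescale \<open>x\<close> by
  \<open>R\<close>. The kernel lives at a fixed scale and is not stretched, so a single factor
  \<open>R\<close> appears: the linear growth of the variance.\<close>

lemma kernel_change_of_variables:
  fixes \<psi>1 \<psi>2 F :: "real \<Rightarrow> real"
  assumes \<psi>1: "integrable lborel \<psi>1" and \<psi>2[measurable]: "\<psi>2 \<in> borel_measurable borel" and bnd: "\<And>x. \<bar>\<psi>2 x\<bar> \<le> C"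
    and F: "integrable lborel F" and R: "0 < R"
  shows "integrable (lborel \<Otimes>\<^sub>M lborel) (\<lambda>(x, y). \<psi>1 (x / R) * \<psi>2 (y / R) * F (y - x))"
    and "(LINT p|(lborel \<Otimes>\<^sub>M lborel). \<psi>1 (fst p / R) * \<psi>2 (snd p / R) * F (snd p - fst p)) = R * (LINT t|lborel. F t * (LINT x|lborel. \<psi>1 x * \<psi>2 (x + t / R)))"
proof -
  have [measurable]: "\<psi>1 \<in> borel_measurable borel" "F \<in> borel_measurable borel" using \<psi>1 F by auto
  have shift: "(LINT y|lborel. g (y - x)) = (LINT t|lborel. g t)" for g :: "real \<Rightarrow> real" and x
    by (subst lborel_integral_real_affine[where c=1 and t=x]) auto
  have i1: "integrable lborel (\<lambda>x. \<psi>1 (x / R))"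
    using lborel_integrable_real_affine[OF \<psi>1, of "1 / R" 0] R by (simp add: field_simps)
  have C0: "0 \<le> C" using bnd[of 0] by linarith
  have int0: "integrable (lborel \<Otimes>\<^sub>M lborel) (\<lambda>(x, t). \<psi>1 (x / R) * (C * F t))"
  proof (rule lborel_pair.Fubini_integrable)
    show "integrable lborel (\<lambda>x. LINT y|lborel. norm (case (x, y) of (x, t) \<Rightarrow> \<psi>1 (x / R) * (C * F t)))"
      using i1 by (simp add: abs_mult)
    show "AE x in lborel. integrable lborel (\<lambda>y. case (x, y) of (x, t) \<Rightarrow> \<psi>1 (x / R) * (C * F t))" using F by simp
  qed measurable
  show int1: "integrable (lborel \<Otimes>\<^sub>M lborel) (\<lambda>(x, y). \<psi>1 (x / R) * \<psi>2 (y / R) * F (y - x))"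
  proof (rule lborel_pair.Fubini_integrable)
    have "integrable lborel (\<lambda>x. \<bar>\<psi>1 (x / R)\<bar> * (C * (LINT t|lborel. \<bar>F t\<bar>)))" using i1 by simp
    then show "integrable lborel (\<lambda>x. LINT y|lborel. norm (case (x, y) of (x, y) \<Rightarrow> \<psi>1 (x / R) * \<psi>2 (y / R) * F (y - x)))"
    proof (rule Bochner_Integration.integrable_bound)
      show "(\<lambda>x. LINT y|lborel. norm (case (x, y) of (x, y) \<Rightarrow> \<psi>1 (x / R) * \<psi>2 (y / R) * F (y - x))) \<in> borel_measurable lborel"
        by (rule lborel.borel_measurable_lebesgue_integral) (simp add: split_beta')
      have "(LINT y|lborel. \<bar>\<psi>1 (x / R) * \<psi>2 (y / R) * F (y - x)\<bar>) \<le> \<bar>\<psi>1 (x / R)\<bar> * (C * (LINT t|lborel. \<bar>F t\<bar>))" for x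
      proof -
        have Fx: "integrable lborel (\<lambda>y. F (y - x))" using lborel_integrable_real_affine[OF F, of 1 "- x"] by (simp add: algebra_simps)
        have "(LINT y|lborel. \<bar>\<psi>1 (x / R) * \<psi>2 (y / R) * F (y - x)\<bar>) \<le> (LINT y|lborel. \<bar>\<psi>1 (x / R)\<bar> * (C * \<bar>F (y - x)\<bar>))"
        proof (rule integral_mono')
          show "integrable lborel (\<lambda>y. \<bar>\<psi>1 (x / R)\<bar> * (C * \<bar>F (y - x)\<bar>))" using Fx by simp
          show "\<bar>\<psi>1 (x / R) * \<psi>2 (y / R) * F (y - x)\<bar> \<le> \<bar>\<psi>1 (x / R)\<bar> * (C * \<bar>F (y - x)\<bar>)" for y
            unfolding abs_mult mult.assoc by (intro mult_left_mono mult_right_mono bnd) auto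
          show "0 \<le> \<bar>\<psi>1 (x / R)\<bar> * (C * \<bar>F (y - x)\<bar>)" for y using C0 by simp
        qed
        also have "\<dots> = \<bar>\<psi>1 (x / R)\<bar> * (C * (LINT t|lborel. \<bar>F t\<bar>))" using shift[of "\<lambda>t. \<bar>F t\<bar>" x] by simp
        finally show ?thesis .
      qed
      then show "AE x in lborel. norm (LINT y|lborel. norm (case (x, y) of (x, y) \<Rightarrow> \<psi>1 (x / R) * \<psi>2 (y / R) * F (y - x))) \<le> norm (\<bar>\<psi>1 (x / R)\<bar> * (C * (LINT t|lborel. \<bar>F t\<bar>)))"
        by (intro AE_I2) (auto intro: order_trans[OF _ abs_ge_self])
    qed
    show "AE x in lborel. integrable lborel (\<lambda>y. case (x, y) of (x, y) \<Rightarrow> \<psi>1 (x / R) * \<psi>2 (y / R) * F (y - x))"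
    proof (rule AE_I2)
      fix x
      have Fx: "integrable lborel (\<lambda>y. \<psi>1 (x / R) * (C * F (y - x)))" using lborel_integrable_real_affine[OF F, of 1 "- x"] by (simp add: algebra_simps)
      show "integrable lborel (\<lambda>y. case (x, y) of (x, y) \<Rightarrow> \<psi>1 (x / R) * \<psi>2 (y / R) * F (y - x))"
        using bnd C0 by (intro Bochner_Integration.integrable_bound[OF Fx]) (auto simp: abs_mult mult.assoc intro!: AE_I2 mult_left_mono mult_right_mono)
    qed
  qed measurable
  have int2: "integrable (lborel \<Otimes>\<^sub>M lborel) (\<lambda>(x, t). \<psi>1 (x / R) * \<psi>2 ((x + t) / R) * F t)"
  proof (rule Bochner_Integration.integrable_bound[OF int0])
    show "AE p in lborel \<Otimes>\<^sub>M lborel. norm (case p of (x, t) \<Rightarrow> \<psi>1 (x / R) * \<psi>2 ((x + t) / R) * F t) \<le> norm (case p of (x, t) \<Rightarrow> \<psi>1 (x / R) * (C * F t))"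
      using bnd C0 by (intro AE_I2) (auto simp: abs_mult mult.assoc intro!: mult_left_mono mult_right_mono)
  qed measurable
  have "(LINT p|(lborel \<Otimes>\<^sub>M lborel). \<psi>1 (fst p / R) * \<psi>2 (snd p / R) * F (snd p - fst p)) = (LINT x|lborel. LINT y|lborel. \<psi>1 (x / R) * \<psi>2 (y / R) * F (y - x))"
    using lborel_pair.integral_fst'[of "\<lambda>p. \<psi>1 (fst p / R) * \<psi>2 (snd p / R) * F (snd p - fst p)"] int1 by (simp add: split_beta')
  also have "\<dots> = (LINT x|lborel. LINT t|lborel. \<psi>1 (x / R) * \<psi>2 ((x + t) / R) * F t)"
  proof (rule Bochner_Integration.integral_cong[OF refl])
    fix x
    show "(LINT y|lborel. \<psi>1 (x / R) * \<psi>2 (y / R) * F (y - x)) = (LINT t|lborel. \<psi>1 (x / R) * \<psi>2 ((x + t) / R) * F t)"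
      by (subst lborel_integral_real_affine[where c=1 and t=x]) auto
  qed
  also have "\<dots> = (LINT t|lborel. LINT x|lborel. \<psi>1 (x / R) * \<psi>2 ((x + t) / R) * F t)"
    by (rule lborel_pair.Fubini_integral[symmetric, OF int2])
  also have "\<dots> = (LINT t|lborel. R * (F t * (LINT x|lborel. \<psi>1 x * \<psi>2 (x + t / R))))"
  proof (rule Bochner_Integration.integral_cong[OF refl])
    fix t
    have "(LINT x|lborel. \<psi>1 (x / R) * \<psi>2 ((x + t) / R) * F t) = R * (LINT x|lborel. \<psi>1 (R * x / R) * \<psi>2 ((R * x + t) / R) * F t)"
      using R by (subst lborel_integral_real_affine[where c=R and t=0]) auto
    also have "\<dots> = R * (F t * (LINT x|lborel. \<psi>1 x * \<psi>2 (x + t / R)))"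
      using R by (simp add: add_divide_distrib mult.commute)
    finally show "(LINT x|lborel. \<psi>1 (x / R) * \<psi>2 ((x + t) / R) * F t) = R * (F t * (LINT x|lborel. \<psi>1 x * \<psi>2 (x + t / R)))" .
  qed
  finally show "(LINT p|(lborel \<Otimes>\<^sub>M lborel). \<psi>1 (fst p / R) * \<psi>2 (snd p / R) * F (snd p - fst p)) = R * (LINT t|lborel. F t * (LINT x|lborel. \<psi>1 x * \<psi>2 (x + t / R)))"
    by simp
qed

section \<open>Intensities of the zeros\<close>

locale zero_process = gauss_path M H f f' + correlation \<kappa> \<kappa>' \<kappa>''
  for M :: "'a measure" and H f f' and \<kappa> \<kappa>' \<kappa>'' :: "real \<Rightarrow> real" +
  assumes cov_ff: "cov (f s) (f t) = \<kappa> (t - s)"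
    and cov_f'f: "cov (f' s) (f t) = - \<kappa>' (t - s)"
    and cov_f'f': "cov (f' s) (f' t) = - \<kappa>'' (t - s)"
begin

definition zeros :: "'a \<Rightarrow> real set" where
  "zeros w = {t. f t w = 0}"

lemma zeros_Int: "zeros w \<inter> {a..<b} = {t\<in>{a..<b}. f t w = 0}"
  by (auto simp: zeros_def)

lemma residual_f': "residual t (f' t) = f' t"
  by (rule ext) (simp add: residual_def cov_f'f cov_ff \<kappa>'_0)

lemma var_f: "cov (f t) (f t) = 1"
  by (simp add: cov_ff \<kappa>_0)

lemma var_f': "cov (f' t) (f' t) = 1"
  by (simp add: cov_f'f' \<kappa>''_0)

text \<open>The derivative \<open>f' t\<close> is uncorrelated with \<open>f t\<close>, so
  conditioning on a zero leaves it unchanged, and the density is \<open>1 / sqrt (2 * pi)\<close>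
  times the mean \<open>sqrt (2 / pi)\<close> of \<open>\<bar>f' t\<bar>\<close>: Rice's
  formula.\<close>

lemma one_point:
  assumes "a < b"
  shows "(\<integral>\<^sup>+w. ncard (zeros w \<inter> {a..<b}) \<partial>M) = (\<integral>\<^sup>+t. indicator {a..<b} t * ennreal (1 / pi) \<partial>lborel)"
proof -
  have "palm_density (\<lambda>_::unit. f 0) (\<lambda>_. 1) t = ennreal (1 / pi)" for t
  proof -
    have i: "integrable M (\<lambda>w. \<bar>f' t w\<bar>)" using gauss_rv_moments(2)[OF gauss[OF X'_H[of t]], of 1] by simp
    have "(\<integral>\<^sup>+w. ennreal \<bar>f' t w\<bar> \<partial>M) = ennreal (sqrt (2 / pi))"
      using gauss_rv_moments(6)[OF gauss[OF X'_H[of t]]] var_f' by (subst nn_integral_eq_integral[OF i]) auto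
    then show ?thesis unfolding palm_density_def residual_f' var_f
      by (simp add: ennreal_mult'[symmetric] real_sqrt_divide real_sqrt_mult)
  qed
  moreover have "(\<integral>\<^sup>+w. 1 * ncard {t\<in>{a..<b}. f t w = 0} \<partial>M) = (\<integral>\<^sup>+t. indicator {a..<b} t * palm_density (\<lambda>_::unit. f 0) (\<lambda>_. 1) t \<partial>lborel)"
    by (rule palm_formula[OF assms X_H]) (use var_f in auto)
  ultimately show ?thesis by (simp add: zeros_Int)
qed

text \<open>Conditioning on \<open>f s = 0\<close> subtracts a multiple of \<open>f s\<close>, on
  the same probability space and with the same \<open>H\<close>, so the Palm formula applies once
  more. Stationarity is lost, and the variance vanishes at \<open>t = s\<close>; the second point
  has to differ from the first.\<close>

lemma conditioned_path:
  "gauss_path M H (\<lambda>t. residual s (f t)) (\<lambda>t. residual s (f' t))"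
proof
  show "residual s (f t) \<in> H" "residual s (f' t) \<in> H" for t by (rule residual_H[OF X_H], rule residual_H[OF X'_H])
  show "((\<lambda>t. residual s (f t) w) has_real_derivative residual s (f' t) w) (at t)" for w t
    unfolding residual_def by (intro DERIV_diff X_deriv DERIV_cmult_right DERIV_cdivide cov_X_deriv X_H)
  show "continuous_on UNIV (\<lambda>t. residual s (f' t) w)" for w
    unfolding residual_def by (intro continuous_intros X'_cont cov_X'_continuous X_H) (simp add: var_f)
qed

text \<open>Regression on the value at \<open>t\<close> as well leaves residuals of the derivatives
  at \<open>t\<close> and at \<open>s\<close>, both of variance \<open>D / v\<close> and with
  correlation \<open>- A \<tau>\<close>; the sign is lost because \<open>abs_corr\<close> is even.
  The factors \<open>1 / sqrt (2 * pi)\<close>, \<open>1 / sqrt (2 * pi * v)\<close> and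
  \<open>2 / pi * (D / v)\<close> then combine to the pair density.\<close>

lemma conditioned_density:
  assumes st: "s < t"
  shows "ennreal (1 / sqrt (2 * pi)) * gauss_path.palm_density M (\<lambda>t. residual s (f t)) (\<lambda>t. residual s (f' t)) (\<lambda>_::unit. f' s) (\<lambda>x. ennreal \<bar>x ()\<bar>) t = ennreal (pair_corr (t - s) / pi\<^sup>2)"
    and "0 < cov (residual s (f t)) (residual s (f t))"
proof -
  interpret g: gauss_path M H "\<lambda>t. residual s (f t)" "\<lambda>t. residual s (f' t)" by (rule conditioned_path)
  define \<tau> k k1 k2 where "\<tau> = t - s" and "k = \<kappa> \<tau>" and "k1 = \<kappa>' \<tau>" and "k2 = \<kappa>'' \<tau>"
  have \<tau>: "0 < \<tau>" using st by (simp add: \<tau>_def)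
  have neg: "s - t = - \<tau>" by (simp add: \<tau>_def)
  define v D where "v = 1 - k\<^sup>2" and "D = 1 - k\<^sup>2 - k1\<^sup>2"
  have D: "0 < D" using D_pos[OF \<tau>] by (simp add: D_def k_def k1_def)
  have v: "0 < v" using \<kappa>_sq_less[OF \<tau>] by (simp add: v_def k_def)
  have Xt: "residual s (f t) = (\<lambda>u. f t u - k * f s u)"
    by (rule ext) (simp add: residual_def cov_ff neg \<kappa>_even \<kappa>_0 k_def)
  have X't: "residual s (f' t) = (\<lambda>u. f' t u - k1 * f s u)"
    by (rule ext) (simp add: residual_def cov_f'f cov_ff neg \<kappa>'_odd \<kappa>_0 k1_def)
  note H = X_H[of s] X_H[of t] X'_H[of s] X'_H[of t]
  have c: "cov (f t) (f s) = k" "cov (f s) (f t) = k" "cov (f' t) (f s) = k1" "cov (f s) (f' t) = k1"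
    "cov (f' s) (f t) = - k1" "cov (f t) (f' s) = - k1" "cov (f' s) (f' t) = - k2" "cov (f' t) (f' s) = - k2"
    "cov (f s) (f' s) = 0" "cov (f' s) (f s) = 0" "cov (f t) (f' t) = 0" "cov (f' t) (f t) = 0"
    by (simp_all add: cov_ff cov_f'f cov_f'f' cov_commute[of "f s" "f' t"] cov_commute[of "f t" "f' s"] cov_commute[of "f s" "f' s"]
      cov_commute[of "f t" "f' t"] neg \<tau>_def[symmetric] \<kappa>_even \<kappa>'_odd \<kappa>''_even \<kappa>'_0 k_def k1_def k2_def)
  have XH: "residual s (f t) \<in> H" "residual s (f' t) \<in> H" by (rule g.X_H, rule g.X'_H)
  have vX: "cov (residual s (f t)) (residual s (f t)) = v"
    unfolding Xt cov_diff_diff[OF H(2,1)] c var_f v_def by (simp add: power2_eq_square)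
  then show "0 < cov (residual s (f t)) (residual s (f t))" using v by simp
  have vX': "cov (residual s (f' t)) (residual s (f' t)) = 1 - k1\<^sup>2"
    unfolding X't cov_diff_diff[OF H(4,1)] c var_f var_f' by (simp add: power2_eq_square)
  have cX'X: "cov (residual s (f' t)) (residual s (f t)) = - (k * k1)"
    unfolding X't cov_diff[OF H(4,1) XH(1)] unfolding Xt cov_diff_right[OF H(2,1,4)] cov_diff_right[OF H(2,1,1)] c var_f by simp
  have cf'X: "cov (f' s) (residual s (f t)) = - k1" unfolding Xt cov_diff_right[OF H(2,1,3)] c by simp
  have cf'X': "cov (f' s) (residual s (f' t)) = - k2" unfolding X't cov_diff_right[OF H(4,1,3)] c by simp
  define A1 where "A1 = g.residual t (residual s (f' t))"
  define B1 where "B1 = g.residual t (f' s)"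
  have A1: "A1 = (\<lambda>u. residual s (f' t) u - (- (k * k1) / v) * residual s (f t) u)"
    unfolding A1_def g.residual_def cX'X vX by simp
  have B1: "B1 = (\<lambda>u. f' s u - (- k1 / v) * residual s (f t) u)"
    unfolding B1_def g.residual_def cf'X vX by simp
  have AH: "A1 \<in> H" "B1 \<in> H" unfolding A1_def B1_def by (rule g.residual_H[OF XH(2)], rule g.residual_H[OF H(3)])
  have vA: "cov A1 A1 = D / v"
    unfolding A1 cov_diff_diff[OF XH(2,1)] vX' cX'X vX using v by (simp add: D_def field_simps power2_eq_square) (simp add: v_def algebra_simps power2_eq_square)
  have vB: "cov B1 B1 = D / v"
    unfolding B1 cov_diff_diff[OF H(3) XH(1)] var_f' cf'X vX using v by (simp add: D_def field_simps power2_eq_square) (simp add: v_def algebra_simps power2_eq_square)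
  have cAB: "cov A1 B1 = - (k2 * v + k * k1\<^sup>2) / v"
  proof -
    have z: "cov A1 (residual s (f t)) = 0" unfolding A1 cov_diff[OF XH(2,1,1)] cX'X vX using v by simp
    have "cov A1 B1 = cov A1 (f' s)" unfolding B1 cov_diff_right[OF H(3) XH(1) AH(1)] z by simp
    also have "\<dots> = - k2 - k * k1 * k1 / v"
      unfolding A1 cov_diff[OF XH(2,1) H(3)] cov_commute[of _ "f' s"] cf'X cf'X' by simp
    finally show ?thesis using v by (simp add: field_simps power2_eq_square)
  qed
  have Dv: "0 < D / v" using D v by simp
  have q: "sqrt (cov A1 A1 * cov B1 B1) = D / v" unfolding vA vB real_sqrt_abs2 using D v by simp
  define r where "r = cov A1 B1 / sqrt (cov A1 A1 * cov B1 B1)"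
  have r: "r = - A \<tau>"
  proof -
    have "A \<tau> = (k * k1\<^sup>2 - k\<^sup>2 * k2 + k2) / D"
      unfolding A_def k_def[symmetric] k1_def[symmetric] k2_def[symmetric] D_def[symmetric] ..
    also have "k * k1\<^sup>2 - k\<^sup>2 * k2 + k2 = k2 * v + k * k1\<^sup>2" by (simp add: v_def algebra_simps)
    finally have A: "A \<tau> = (k2 * v + k * k1\<^sup>2) / D" .
    have "- N / v / (D / v) = - (N / D)" for N using v by simp
    then show ?thesis unfolding r_def q cAB A .
  qed
  have r1: "\<bar>r\<bar> \<le> 1" unfolding r_def by (rule abs_product_expectation(2)[OF AH]) (use vA vB Dv in auto)
  have "(\<integral>\<^sup>+u. ennreal (\<bar>A1 u\<bar> * \<bar>B1 u\<bar>) \<partial>M) = ennreal (2 / pi * (D / v) * abs_corr r)"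
  proof -
    have "0 < cov A1 A1" "0 < cov B1 B1" using vA vB Dv by auto
    from abs_product_expectation(1)[OF AH this] show ?thesis unfolding r_def q abs_corr_def .
  qed
  also have "abs_corr r = abs_corr (A \<tau>)" using abs_corr_minus[of r] r1 by (simp add: r)
  finally have E: "(\<integral>\<^sup>+u. ennreal (\<bar>A1 u\<bar> * \<bar>B1 u\<bar>) \<partial>M) = ennreal (2 / pi * (D / v) * abs_corr (A \<tau>))" .
  have P: "g.palm_density (\<lambda>_::unit. f' s) (\<lambda>x. ennreal \<bar>x ()\<bar>) t = ennreal (1 / sqrt (2 * pi * v)) * ennreal (2 / pi * (D / v) * abs_corr (A \<tau>))"
    unfolding g.palm_density_def vX A1_def[symmetric] B1_def[symmetric] E[symmetric] by (simp add: ennreal_mult')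
  have Q: "1 / sqrt (2 * pi) * (1 / sqrt (2 * pi * v) * (2 / pi * (D / v) * abs_corr (A \<tau>))) = pair_corr (t - s) / pi\<^sup>2"
  proof -
    have "pair_corr (t - s) = D / (v * sqrt v) * abs_corr (A \<tau>)"
      unfolding pair_corr_def \<tau>_def[symmetric] k_def[symmetric] k1_def[symmetric] v_def[symmetric] powr_three_halves[OF v]
      by (simp add: D_def v_def)
    moreover have "1 / w * (1 / (w * z) * (2 / pi * (D / v) * c)) = 2 * D * c / (w * w * (z * pi * v))" for w z c :: real
      by (simp add: mult_ac)
    moreover have "sqrt (2 * pi * v) = sqrt (2 * pi) * sqrt v" by (rule real_sqrt_mult)
    moreover have "sqrt (2 * pi) * sqrt (2 * pi) = 2 * pi" by simp
    moreover have "2 * D * c / (2 * pi * (z * pi * v)) = D / (v * z) * c / pi\<^sup>2" for z c :: real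
      by (simp add: power2_eq_square mult_ac)
    ultimately show ?thesis by (simp only:)
  qed
  have m: "ennreal x * (ennreal y * ennreal z) = ennreal (x * (y * z))" if "0 \<le> x" "0 \<le> y" for x y z
    using that by (simp add: ennreal_mult')
  show "ennreal (1 / sqrt (2 * pi)) * g.palm_density (\<lambda>_::unit. f' s) (\<lambda>x. ennreal \<bar>x ()\<bar>) t = ennreal (pair_corr (t - s) / pi\<^sup>2)"
    unfolding P Q[symmetric] by (rule m) (use v in simp_all)
qed

lemma pair_corr_meas[measurable]: "pair_corr \<in> borel_measurable borel"
proof -
  have "pair_corr = (\<lambda>t. F t + 1)" by (rule ext) (simp add: F_def)
  then show ?thesis by simp
qed

definition \<rho> :: "real \<Rightarrow> ennreal" where
  "\<rho> t = ennreal (pair_corr t / pi\<^sup>2)"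

lemma \<rho>_meas[measurable]: "\<rho> \<in> borel_measurable borel"
  unfolding \<rho>_def by measurable

text \<open>The Palm formula at \<open>s\<close>, with the number of zeros in \<open>{c..<d}\<close>
  as functional, and then at \<open>t\<close> for the process conditioned on a zero at
  \<open>s\<close>, with \<open>\<bar>f' s\<bar>\<close> as functional. Half-open intervals with
  \<open>b \<le> c\<close> ensure \<open>s < t\<close> even when they touch.\<close>

lemma two_point:
  assumes ab: "a < b" and bc: "b \<le> c" and cd: "c < d"
  shows "(\<integral>\<^sup>+w. ncard (zeros w \<inter> {c..<d}) * ncard (zeros w \<inter> {a..<b}) \<partial>M) =
    (\<integral>\<^sup>+s. indicator {a..<b} s * (\<integral>\<^sup>+t. indicator {c..<d} t * \<rho> (t - s) \<partial>lborel) \<partial>lborel)"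
proof -
  have pd: "palm_density f (zero_count c d) s = (\<integral>\<^sup>+t. indicator {c..<d} t * \<rho> (t - s) \<partial>lborel)" if s: "s \<in> {a..<b}" for s
  proof -
    interpret g: gauss_path M H "\<lambda>t. residual s (f t)" "\<lambda>t. residual s (f' t)" by (rule conditioned_path)
    let ?Y = "\<lambda>_::unit. f' s" and ?V = "\<lambda>x::unit \<Rightarrow> real. ennreal \<bar>x ()\<bar>"
    have Vm: "?V \<in> borel_measurable (PiM UNIV (\<lambda>_. borel))"
    proof -
      have [measurable]: "(\<lambda>x. x ()) \<in> borel_measurable (PiM UNIV (\<lambda>_. borel :: real measure))"
        by (rule measurable_component_singleton) simp
      show ?thesis by measurable
    qed
    have st: "s < t" if "t \<in> {c..d}" for t using s bc that by auto
    have pos: "0 < cov (residual s (f t)) (residual s (f t))" if "t \<in> {c..d}" for t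
      by (rule conditioned_density(2)[OF st[OF that]])
    have "(\<integral>\<^sup>+w. ennreal \<bar>f' s w\<bar> * zero_count c d (\<lambda>t. residual s (f t) w) \<partial>M) = (\<integral>\<^sup>+w. ?V (\<lambda>i. ?Y i w) * ncard {t\<in>{c..<d}. residual s (f t) w = 0} \<partial>M)"
      by (simp add: zero_count_eq[OF cd g.X_cont])
    also have "\<dots> = (\<integral>\<^sup>+t. indicator {c..<d} t * g.palm_density ?Y ?V t \<partial>lborel)"
      by (rule g.palm_formula[OF cd X'_H Vm pos])
    finally have e: "(\<integral>\<^sup>+w. ennreal \<bar>f' s w\<bar> * zero_count c d (\<lambda>t. residual s (f t) w) \<partial>M) = (\<integral>\<^sup>+t. indicator {c..<d} t * g.palm_density ?Y ?V t \<partial>lborel)" .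
    have m: "(\<lambda>t. indicator {c..<d} t * g.palm_density ?Y ?V t) \<in> borel_measurable lborel"
      using g.palm_density_measurable[of ?Y ?V, OF X'_H Vm] by simp
    have "palm_density f (zero_count c d) s = ennreal (1 / sqrt (2 * pi)) * (\<integral>\<^sup>+t. indicator {c..<d} t * g.palm_density ?Y ?V t \<partial>lborel)"
      unfolding palm_density_def residual_f' var_f e by simp
    also have "\<dots> = (\<integral>\<^sup>+t. ennreal (1 / sqrt (2 * pi)) * (indicator {c..<d} t * g.palm_density ?Y ?V t) \<partial>lborel)"
      by (rule nn_integral_cmult[symmetric, OF m])
    also have "\<dots> = (\<integral>\<^sup>+t. indicator {c..<d} t * \<rho> (t - s) \<partial>lborel)"
    proof (rule nn_integral_cong)
      fix t
      show "ennreal (1 / sqrt (2 * pi)) * (indicator {c..<d} t * g.palm_density ?Y ?V t) = indicator {c..<d} t * \<rho> (t - s)"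
      proof (cases "t \<in> {c..<d}")
        case True
        then have "s < t" using st[of t] by simp
        from conditioned_density(1)[OF this] True show ?thesis unfolding \<rho>_def by simp
      qed simp
    qed
    finally show ?thesis .
  qed
  have "(\<integral>\<^sup>+w. ncard (zeros w \<inter> {c..<d}) * ncard (zeros w \<inter> {a..<b}) \<partial>M) = (\<integral>\<^sup>+w. zero_count c d (\<lambda>t. f t w) * ncard {t\<in>{a..<b}. f t w = 0} \<partial>M)"
    by (simp add: zeros_Int zero_count_eq[OF cd X_cont])
  also have "\<dots> = (\<integral>\<^sup>+s. indicator {a..<b} s * palm_density f (zero_count c d) s \<partial>lborel)"
    by (rule palm_formula[OF ab X_H zero_count_measurable]) (simp add: var_f)
  also have "\<dots> = (\<integral>\<^sup>+s. indicator {a..<b} s * (\<integral>\<^sup>+t. indicator {c..<d} t * \<rho> (t - s) \<partial>lborel) \<partial>lborel)"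
    by (intro nn_integral_cong) (simp add: indicator_def pd)
  finally show ?thesis .
qed

text \<open>To be used for \<open>Y\<close> a value of \<open>f\<close> or of \<open>f'\<close>.
  Conditioning on \<open>f t = 0\<close> takes \<open>(cov Y (f t))\<^sup>2\<close> away from the
  variance of \<open>Y\<close>, and the weight \<open>\<bar>f' t\<bar>\<close> adds
  \<open>(cov Y (f' t))\<^sup>2\<close>.\<close>

lemma weighted_one_point:
  assumes ab: "a < b" and Y: "Y \<in> H"
  shows "(\<integral>\<^sup>+w. ennreal ((Y w)\<^sup>2) * ncard (zeros w \<inter> {a..<b}) \<partial>M) =
    (\<integral>\<^sup>+t. indicator {a..<b} t * ennreal ((cov Y Y - (cov Y (f t))\<^sup>2 + (cov Y (f' t))\<^sup>2) / pi) \<partial>lborel)"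
proof -
  let ?Y = "\<lambda>_::unit. Y" and ?V = "\<lambda>x::unit \<Rightarrow> real. ennreal ((x ())\<^sup>2)"
  have Vm: "?V \<in> borel_measurable (PiM UNIV (\<lambda>_. borel))"
  proof -
    have [measurable]: "(\<lambda>x. x ()) \<in> borel_measurable (PiM UNIV (\<lambda>_. borel :: real measure))"
      by (rule measurable_component_singleton) simp
    show ?thesis by measurable
  qed
  have "palm_density ?Y ?V t = ennreal ((cov Y Y - (cov Y (f t))\<^sup>2 + (cov Y (f' t))\<^sup>2) / pi)" for t
  proof -
    have R: "residual t Y = (\<lambda>w. Y w - cov Y (f t) * f t w)" by (rule ext) (simp add: residual_def var_f)
    have RH: "residual t Y \<in> H" by (rule residual_H[OF Y])
    have z: "cov (f' t) (f t) = 0" by (simp add: cov_f'f \<kappa>'_0)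
    have vR: "cov (residual t Y) (residual t Y) = cov Y Y - (cov Y (f t))\<^sup>2"
      unfolding R cov_diff_diff[OF Y X_H] var_f by (simp add: power2_eq_square)
    have cR: "cov (f' t) (residual t Y) = cov Y (f' t)"
      unfolding R cov_diff_right[OF Y X_H X'_H] z by (simp add: cov_commute)
    have "palm_density ?Y ?V t = ennreal (1 / sqrt (2 * pi)) * ennreal (sqrt (2 / pi) * (cov Y Y - (cov Y (f t))\<^sup>2 + (cov Y (f' t))\<^sup>2))"
      unfolding palm_density_def residual_f' var_f using abs_times_square_expectation[OF RH X'_H[of t] var_f'] unfolding vR cR
      by (simp add: ennreal_mult')
    also have "\<dots> = ennreal (1 / sqrt (2 * pi) * (sqrt (2 / pi) * (cov Y Y - (cov Y (f t))\<^sup>2 + (cov Y (f' t))\<^sup>2)))"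
      by (rule ennreal_mult'[symmetric]) simp
    also have "1 / sqrt (2 * pi) * (sqrt (2 / pi) * x) = x / pi" for x
    proof -
      have "1 / sqrt (2 * pi) * sqrt (2 / pi) = 1 / pi" by (simp add: real_sqrt_mult real_sqrt_divide)
      then have "1 / sqrt (2 * pi) * sqrt (2 / pi) * x = 1 / pi * x" by (rule arg_cong)
      then show ?thesis by (simp only: mult.assoc) simp
    qed
    finally show ?thesis .
  qed
  then show ?thesis using palm_formula[where Y="?Y" and V="?V", OF ab Y Vm] by (simp add: var_f zeros_Int)
qed

end

section \<open>Linear statistics of the zeros: first moments and intensities\<close>

locale discrete_zero_process = zero_process +
  assumes finite_zeros: "finite (zeros w \<inter> {a..<b})"
begin

definition nu :: "'a \<Rightarrow> (real \<Rightarrow> ennreal) \<Rightarrow> ennreal" where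
  "nu w \<phi> = (\<integral>\<^sup>+t. \<phi> t * indicator (zeros w) t \<partial>count_space UNIV)"

lemma nu_indicator: "nu w (indicator B) = ncard (zeros w \<inter> B)"
proof -
  have "nu w (indicator B) = (\<integral>\<^sup>+t. indicator (zeros w \<inter> B) t \<partial>count_space UNIV)"
    unfolding nu_def by (intro nn_integral_cong) (auto split: split_indicator)
  then show ?thesis by simp
qed

lemma nu_cmult: "nu w (\<lambda>t. c * \<phi> t) = c * nu w \<phi>"
  unfolding nu_def by (simp add: nn_integral_cmult mult.assoc)

lemma nu_add: "nu w (\<lambda>t. \<phi> t + \<psi> t) = nu w \<phi> + nu w \<psi>"
  unfolding nu_def by (simp add: nn_integral_add distrib_right)

lemma nu_mono: "(\<And>t. \<phi> t \<le> \<psi> t) \<Longrightarrow> nu w \<phi> \<le> nu w \<psi>"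
  unfolding nu_def by (intro nn_integral_mono mult_right_mono) auto

lemma nu_SUP: "incseq \<phi> \<Longrightarrow> nu w (\<lambda>t. SUP n. \<phi> n t) = (SUP n. nu w (\<phi> n))" for \<phi> :: "nat \<Rightarrow> real \<Rightarrow> ennreal"
  unfolding nu_def SUP_mult_right_ennreal
  by (rule nn_integral_monotone_convergence_SUP) (auto simp: incseq_def le_fun_def intro!: mult_right_mono)

lemma nu_suminf: "nu w (\<lambda>t. \<Sum>n. \<phi> n t) = (\<Sum>n. nu w (\<phi> n))" for \<phi> :: "nat \<Rightarrow> real \<Rightarrow> ennreal"
proof -
  have "(\<Sum>n. \<phi> n t) * indicator (zeros w) t = (\<Sum>n. \<phi> n t * indicator (zeros w) t)" for t
    by (rule ennreal_suminf_multc[symmetric])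
  then show ?thesis unfolding nu_def by (simp only:) (rule nn_integral_suminf, simp)
qed

lemma zeros_ncard_meas: "(\<lambda>w. ncard (zeros w \<inter> {a..<b})) \<in> borel_measurable M"
proof (cases "a < b")
  case True
  show ?thesis unfolding zeros_Int by (rule zero_ncard_measurable[OF True])
qed simp

text \<open>Half-open intervals form an intersection-stable generator, and finiteness of the
  weighted count permits complements. The weight \<open>W\<close> is arbitrary, so that a statistic
  of the zeros can itself become the weight and the two-point identity be extended in one variable
  at a time.\<close>

lemma intensity_sets:
  assumes W[measurable]: "W \<in> borel_measurable M" and r[measurable]: "r \<in> borel_measurable borel"
    and eq: "\<And>c d. a \<le> c \<Longrightarrow> c < d \<Longrightarrow> d \<le> b \<Longrightarrow> (\<integral>\<^sup>+w. W w * ncard (zeros w \<inter> {c..<d}) \<partial>M) = (\<integral>\<^sup>+t. indicator {c..<d} t * r t \<partial>lborel)"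
    and fin: "(\<integral>\<^sup>+w. W w * ncard (zeros w \<inter> {a..<b}) \<partial>M) < \<infinity>"
    and B: "B \<in> sets borel"
  shows "(\<lambda>w. ncard (zeros w \<inter> ({a..<b} \<inter> B))) \<in> borel_measurable M \<and>
    (\<integral>\<^sup>+w. W w * ncard (zeros w \<inter> ({a..<b} \<inter> B)) \<partial>M) = (\<integral>\<^sup>+t. indicator ({a..<b} \<inter> B) t * r t \<partial>lborel)"
proof -
  define N where "N B w = ncard (zeros w \<inter> ({a..<b} \<inter> B))" for B w
  define Q where "Q B = (\<integral>\<^sup>+t. indicator ({a..<b} \<inter> B) t * r t \<partial>lborel)" for B
  define P where "P B \<longleftrightarrow> N B \<in> borel_measurable M \<and> (\<integral>\<^sup>+w. W w * N B w \<partial>M) = Q B" for B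
  have Nall: "N UNIV = (\<lambda>w. ncard (zeros w \<inter> {a..<b}))" by (rule ext) (simp add: N_def)
  have "Int_stable (range (\<lambda>(c, d). {c..<d::real}))"
    by (auto simp: Int_stable_def)
  moreover have "range (\<lambda>(c, d). {c..<d::real}) \<subseteq> Pow UNIV" by simp
  moreover have "B \<in> sigma_sets UNIV (range (\<lambda>(c, d). {c..<d::real}))"
    using B by (simp add: borel_eq_atLeastLessThan)
  ultimately have "P B"
  proof (induction rule: sigma_sets_induct_disjoint)
    case (basic B)
    then obtain c d where B: "B = {c..<d}" by auto
    have I: "{a..<b} \<inter> B = {max a c..<min b d}" unfolding B by auto
    show ?case
    proof (cases "max a c < min b d")
      case True
      then show ?thesis unfolding P_def N_def Q_def I using eq[of "max a c" "min b d"] zeros_ncard_meas by simp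
    next
      case False
      then have e: "{max a c..<min b d} = {}" by simp
      show ?thesis unfolding P_def N_def Q_def I e by simp
    qed
  next
    case empty
    then show ?case unfolding P_def N_def Q_def by simp
  next
    case (compl B)
    then have Bm: "B \<in> sets borel" by (simp add: borel_eq_atLeastLessThan)
    have N: "N UNIV w = N B w + N (UNIV - B) w" for w
      unfolding N_def by (subst plus_emeasure) (auto intro!: arg_cong[where f=ncard])
    \<comment> \<open>Subtraction in \<open>ennreal\<close> cancels only a finite term; here the
      finiteness of the zero set for every \<open>w\<close> enters.\<close>
    have Nf: "N B w \<noteq> \<infinity>" for w
    proof -
      have "finite (zeros w \<inter> ({a..<b} \<inter> B))" by (rule finite_subset[OF _ finite_zeros[of w a b]]) auto
      then show ?thesis unfolding N_def by (simp add: emeasure_count_space)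
    qed
    have NB[measurable]: "N B \<in> borel_measurable M" using compl.IH unfolding P_def by simp
    have NU[measurable]: "N UNIV \<in> borel_measurable M" unfolding Nall by (rule zeros_ncard_meas)
    have "N (UNIV - B) = (\<lambda>w. N UNIV w - N B w)"
      unfolding N using Nf by (intro ext) (simp add: ennreal_add_diff_cancel_left)
    then have NC[measurable]: "N (UNIV - B) \<in> borel_measurable M" by simp
    have Qs: "Q UNIV = Q B + Q (UNIV - B)"
    proof -
      have "indicator ({a..<b} \<inter> UNIV) t = indicator ({a..<b} \<inter> B) t + (indicator ({a..<b} \<inter> (UNIV - B)) t :: ennreal)" for t
        by (auto simp: indicator_def)
      then show ?thesis unfolding Q_def using Bm by (subst nn_integral_add[symmetric]) (simp_all add: distrib_right)
    qed
    have IU: "(\<integral>\<^sup>+w. W w * N UNIV w \<partial>M) = Q UNIV"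
    proof (cases "a < b")
      case True then show ?thesis unfolding Nall Q_def using eq[of a b] by simp
    next
      case False then show ?thesis unfolding Nall Q_def by simp
    qed
    have S: "(\<integral>\<^sup>+w. W w * N UNIV w \<partial>M) = (\<integral>\<^sup>+w. W w * N B w \<partial>M) + (\<integral>\<^sup>+w. W w * N (UNIV - B) w \<partial>M)"
      unfolding N distrib_left by (rule nn_integral_add) measurable
    have "(\<integral>\<^sup>+w. W w * N B w \<partial>M) = Q B" using compl.IH unfolding P_def by blast
    with S Qs IU have eq2: "Q B + (\<integral>\<^sup>+w. W w * N (UNIV - B) w \<partial>M) = Q B + Q (UNIV - B)" by metis
    have "Q UNIV < \<infinity>" using fin IU unfolding Nall by simp
    then have "Q B \<noteq> \<infinity>" unfolding Qs by auto
    with eq2 have "(\<integral>\<^sup>+w. W w * N (UNIV - B) w \<partial>M) = Q (UNIV - B)"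
      by (metis ennreal_add_left_cancel infinity_ennreal_def)
    then show ?case unfolding P_def using NC by simp
  next
    case (union B)
    then have Bm: "\<And>i. B i \<in> sets borel" by (simp add: borel_eq_atLeastLessThan range_subsetD)
    have NB[measurable]: "\<And>i. N (B i) \<in> borel_measurable M" using union unfolding P_def by simp
    have N: "N (\<Union>i. B i) = (\<lambda>w. \<Sum>i. N (B i) w)"
    proof (rule ext)
      fix w
      have "zeros w \<inter> ({a..<b} \<inter> (\<Union>i. B i)) = (\<Union>i. zeros w \<inter> ({a..<b} \<inter> B i))" by auto
      then show "N (\<Union>i. B i) w = (\<Sum>i. N (B i) w)" unfolding N_def
        using union(1) by (subst suminf_emeasure) (auto simp: disjoint_family_on_def)
    qed
    have Q: "Q (\<Union>i. B i) = (\<Sum>i. Q (B i))"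
    proof -
      have "indicator ({a..<b} \<inter> (\<Union>i. B i)) t = (\<Sum>i. indicator ({a..<b} \<inter> B i) t :: ennreal)" for t
      proof -
        have "disjoint_family (\<lambda>i. {a..<b} \<inter> B i)" using union(1) by (auto simp: disjoint_family_on_def)
        from suminf_indicator[OF this] show ?thesis by simp
      qed
      then show ?thesis unfolding Q_def using Bm by (simp add: nn_integral_suminf[symmetric] ennreal_suminf_multc)
    qed
    have "(\<integral>\<^sup>+w. W w * (\<Sum>i. N (B i) w) \<partial>M) = (\<Sum>i. \<integral>\<^sup>+w. W w * N (B i) w \<partial>M)"
      unfolding ennreal_suminf_cmult[symmetric] by (rule nn_integral_suminf) measurable
    also have "\<dots> = (\<Sum>i. Q (B i))" using union unfolding P_def by simp
    finally show ?case unfolding P_def N Q by simp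
  qed
  then show ?thesis unfolding P_def N_def Q_def .
qed

lemma intensity_functions:
  assumes W[measurable]: "W \<in> borel_measurable M" and r[measurable]: "r \<in> borel_measurable borel"
    and eq: "\<And>c d. a \<le> c \<Longrightarrow> c < d \<Longrightarrow> d \<le> b \<Longrightarrow> (\<integral>\<^sup>+w. W w * ncard (zeros w \<inter> {c..<d}) \<partial>M) = (\<integral>\<^sup>+t. indicator {c..<d} t * r t \<partial>lborel)"
    and fin: "(\<integral>\<^sup>+w. W w * ncard (zeros w \<inter> {a..<b}) \<partial>M) < \<infinity>"
    and \<phi>: "\<phi> \<in> borel_measurable borel"
  shows "(\<lambda>w. nu w (\<lambda>t. indicator {a..<b} t * \<phi> t)) \<in> borel_measurable M \<and>
    (\<integral>\<^sup>+w. W w * nu w (\<lambda>t. indicator {a..<b} t * \<phi> t) \<partial>M) = (\<integral>\<^sup>+t. indicator {a..<b} t * \<phi> t * r t \<partial>lborel)"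
  using \<phi>
proof (induction \<phi> rule: borel_measurable_induct)
  case (cong f g)
  have "f = g" using cong(3) by (intro ext) simp
  then show ?case using cong by simp
next
  case (set B)
  then have B: "B \<in> sets borel" by simp
  have e: "indicator {a..<b} t * indicator B t = (indicator ({a..<b} \<inter> B) t :: ennreal)" for t
    by (simp split: split_indicator)
  have "nu w (\<lambda>t. indicator {a..<b} t * indicator B t) = ncard (zeros w \<inter> ({a..<b} \<inter> B))" for w
    unfolding e by (rule nu_indicator)
  then show ?case using intensity_sets[OF W r eq fin B] unfolding e by simp
next
  case (mult u c)
  have e: "nu w (\<lambda>t. indicator {a..<b} t * (c * u t)) = c * nu w (\<lambda>t. indicator {a..<b} t * u t)" for w
    using nu_cmult[of w c "\<lambda>t. indicator {a..<b} t * u t"] by (simp add: mult_ac)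
  have [measurable]: "u \<in> borel_measurable borel" "(\<lambda>w. nu w (\<lambda>t. indicator {a..<b} t * u t)) \<in> borel_measurable M" using mult by auto
  have "(\<integral>\<^sup>+w. W w * (c * nu w (\<lambda>t. indicator {a..<b} t * u t)) \<partial>M) = c * (\<integral>\<^sup>+w. W w * nu w (\<lambda>t. indicator {a..<b} t * u t) \<partial>M)"
    unfolding mult.left_commute[of _ c] by (rule nn_integral_cmult) measurable
  also have "\<dots> = c * (\<integral>\<^sup>+t. indicator {a..<b} t * u t * r t \<partial>lborel)" using mult by simp
  also have "\<dots> = (\<integral>\<^sup>+t. c * (indicator {a..<b} t * u t * r t) \<partial>lborel)"
    by (rule nn_integral_cmult[symmetric]) measurable
  also have "\<dots> = (\<integral>\<^sup>+t. indicator {a..<b} t * (c * u t) * r t \<partial>lborel)"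
    by (simp only: mult_ac)
  finally show ?case unfolding e by simp
next
  case (add u v)
  have e: "nu w (\<lambda>t. indicator {a..<b} t * (v t + u t)) = nu w (\<lambda>t. indicator {a..<b} t * v t) + nu w (\<lambda>t. indicator {a..<b} t * u t)" for w
    unfolding nu_add[symmetric] by (simp add: distrib_left)
  have [measurable]: "u \<in> borel_measurable borel" "v \<in> borel_measurable borel"
    "(\<lambda>w. nu w (\<lambda>t. indicator {a..<b} t * u t)) \<in> borel_measurable M" "(\<lambda>w. nu w (\<lambda>t. indicator {a..<b} t * v t)) \<in> borel_measurable M" using add by auto
  have "(\<integral>\<^sup>+w. W w * (nu w (\<lambda>t. indicator {a..<b} t * v t) + nu w (\<lambda>t. indicator {a..<b} t * u t)) \<partial>M)
     = (\<integral>\<^sup>+w. W w * nu w (\<lambda>t. indicator {a..<b} t * v t) \<partial>M) + (\<integral>\<^sup>+w. W w * nu w (\<lambda>t. indicator {a..<b} t * u t) \<partial>M)"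
    unfolding distrib_left by (rule nn_integral_add) measurable
  also have "\<dots> = (\<integral>\<^sup>+t. indicator {a..<b} t * v t * r t \<partial>lborel) + (\<integral>\<^sup>+t. indicator {a..<b} t * u t * r t \<partial>lborel)"
    using add.IH by simp
  also have "\<dots> = (\<integral>\<^sup>+t. indicator {a..<b} t * (v t + u t) * r t \<partial>lborel)"
    unfolding distrib_left distrib_right by (rule nn_integral_add[symmetric]) measurable
  finally show ?case unfolding e by simp
next
  case (seq U)
  have Um[measurable]: "\<And>i. U i \<in> borel_measurable borel" using seq by simp
  have Nm[measurable]: "\<And>i. (\<lambda>w. nu w (\<lambda>t. indicator {a..<b} t * U i t)) \<in> borel_measurable M" using seq.IH by simp
  have inc: "incseq (\<lambda>i t. indicator {a..<b} t * U i t)"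
  proof -
    have "incseq U" using seq by simp
    then show ?thesis by (auto simp: incseq_def le_fun_def intro!: mult_left_mono)
  qed
  have US: "Sup (range U) t = (SUP i. U i t)" for t by (simp add: image_image)
  have e: "nu w (\<lambda>t. indicator {a..<b} t * Sup (range U) t) = (SUP i. nu w (\<lambda>t. indicator {a..<b} t * U i t))" for w
    unfolding nu_SUP[OF inc, symmetric] US SUP_mult_left_ennreal ..
  have incN: "incseq (\<lambda>i w. W w * nu w (\<lambda>t. indicator {a..<b} t * U i t))"
  proof (rule incseq_SucI, rule le_funI, rule mult_left_mono)
    fix n w
    show "nu w (\<lambda>t. indicator {a..<b} t * U n t) \<le> nu w (\<lambda>t. indicator {a..<b} t * U (Suc n) t)"
      by (rule nu_mono) (use incseq_SucD[OF inc, of n] in \<open>simp add: le_fun_def\<close>)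
  qed simp
  have "(\<integral>\<^sup>+w. W w * (SUP i. nu w (\<lambda>t. indicator {a..<b} t * U i t)) \<partial>M) = (SUP i. \<integral>\<^sup>+w. W w * nu w (\<lambda>t. indicator {a..<b} t * U i t) \<partial>M)"
    unfolding SUP_mult_left_ennreal by (rule nn_integral_monotone_convergence_SUP[OF incN]) measurable
  also have "\<dots> = (SUP i. \<integral>\<^sup>+t. indicator {a..<b} t * U i t * r t \<partial>lborel)" using seq.IH by simp
  also have "\<dots> = (\<integral>\<^sup>+t. (SUP i. indicator {a..<b} t * U i t * r t) \<partial>lborel)"
  proof (rule nn_integral_monotone_convergence_SUP[symmetric])
    show "incseq (\<lambda>i t. indicator {a..<b} t * U i t * r t)"
      using inc by (auto simp: incseq_def le_fun_def intro!: mult_right_mono)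
  qed measurable
  also have "\<dots> = (\<integral>\<^sup>+t. indicator {a..<b} t * Sup (range U) t * r t \<partial>lborel)"
    unfolding US SUP_mult_left_ennreal SUP_mult_right_ennreal ..
  finally show ?case unfolding e by simp
qed

lemma cells_sum: "(\<Sum>n. indicator {real_of_int (int_decode n)..<real_of_int (int_decode n) + 1} t :: ennreal) = 1"
  for t :: real
proof -
  have d: "disjoint_family (\<lambda>n. {real_of_int (int_decode n)..<real_of_int (int_decode n) + 1})"
    unfolding disjoint_family_on_def
  proof (intro ballI impI)
    fix m n :: nat assume "m \<noteq> n"
    then have "int_decode m \<noteq> int_decode n" by (metis int_decode_inverse)
    then show "{real_of_int (int_decode m)..<real_of_int (int_decode m) + 1} \<inter> {real_of_int (int_decode n)..<real_of_int (int_decode n) + 1} = {}"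
      by (auto simp: disjoint_iff)
  qed
  have "t \<in> (\<Union>n. {real_of_int (int_decode n)..<real_of_int (int_decode n) + 1})"
    by (rule UN_I[of "int_encode \<lfloor>t\<rfloor>"]) (auto simp: int_encode_inverse)
  then show ?thesis using suminf_indicator[OF d, of t] by simp
qed

lemma nu_split_cells:
  "nu w \<phi> = (\<Sum>n. nu w (\<lambda>t. indicator {real_of_int (int_decode n)..<real_of_int (int_decode n) + 1} t * \<phi> t))"
proof -
  have "(\<Sum>n. nu w (\<lambda>t. indicator {real_of_int (int_decode n)..<real_of_int (int_decode n) + 1} t * \<phi> t))
    = nu w (\<lambda>t. (\<Sum>n. indicator {real_of_int (int_decode n)..<real_of_int (int_decode n) + 1} t * \<phi> t))"
    by (rule nu_suminf[symmetric])
  also have "\<dots> = nu w \<phi>" by (simp add: ennreal_suminf_multc cells_sum)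
  finally show ?thesis by (rule sym)
qed

text \<open>Campbell's formula. Finite weighted counts require a bounded window, so the line is cut
  into unit cells and the contributions are summed.\<close>

lemma nu_measurable: "\<phi> \<in> borel_measurable borel \<Longrightarrow> (\<lambda>w. nu w \<phi>) \<in> borel_measurable M"
  and nu_mean: "\<phi> \<in> borel_measurable borel \<Longrightarrow> (\<integral>\<^sup>+w. nu w \<phi> \<partial>M) = (\<integral>\<^sup>+t. \<phi> t * ennreal (1 / pi) \<partial>lborel)"
proof -
  assume \<phi>[measurable]: "\<phi> \<in> borel_measurable borel"
  let ?I = "\<lambda>n. {real_of_int (int_decode n)..<real_of_int (int_decode n) + 1}"
  have fin: "(\<integral>\<^sup>+w. 1 * ncard (zeros w \<inter> {a..<a + 1}) \<partial>M) < \<infinity>" for a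
    using one_point[of a "a + 1"] by (simp add: nn_integral_multc)
  have c: "(\<lambda>w. nu w (\<lambda>t. indicator (?I n) t * \<phi> t)) \<in> borel_measurable M \<and>
     (\<integral>\<^sup>+w. 1 * nu w (\<lambda>t. indicator (?I n) t * \<phi> t) \<partial>M) = (\<integral>\<^sup>+t. indicator (?I n) t * \<phi> t * ennreal (1 / pi) \<partial>lborel)" for n
    by (rule intensity_functions[OF _ _ _ fin \<phi>]) (simp_all add: one_point)
  then have [measurable]: "\<And>n. (\<lambda>w. nu w (\<lambda>t. indicator (?I n) t * \<phi> t)) \<in> borel_measurable M" by blast
  show "(\<lambda>w. nu w \<phi>) \<in> borel_measurable M" unfolding nu_split_cells[of _ \<phi>] by measurable
  have "(\<integral>\<^sup>+w. nu w \<phi> \<partial>M) = (\<Sum>n. \<integral>\<^sup>+w. nu w (\<lambda>t. indicator (?I n) t * \<phi> t) \<partial>M)"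
    unfolding nu_split_cells[of _ \<phi>] by (rule nn_integral_suminf) measurable
  also have "\<dots> = (\<Sum>n. \<integral>\<^sup>+t. indicator (?I n) t * \<phi> t * ennreal (1 / pi) \<partial>lborel)" using c by simp
  also have "\<dots> = (\<integral>\<^sup>+t. (\<Sum>n. indicator (?I n) t * \<phi> t * ennreal (1 / pi)) \<partial>lborel)"
    by (rule nn_integral_suminf[symmetric]) measurable
  also have "\<dots> = (\<integral>\<^sup>+t. \<phi> t * ennreal (1 / pi) \<partial>lborel)"
    by (simp add: ennreal_suminf_multc cells_sum)
  finally show "(\<integral>\<^sup>+w. nu w \<phi> \<partial>M) = (\<integral>\<^sup>+t. \<phi> t * ennreal (1 / pi) \<partial>lborel)" .
qed

end

section \<open>Exhaustion of the half-plane \<open>s < t\<close> by dyadic cells, and second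
  moments\<close>

definition level :: "nat \<Rightarrow> real \<Rightarrow> int" where
  "level n t = \<lfloor>2 ^ n * t\<rfloor>"

lemma level_eq: "level n t = k \<longleftrightarrow> t \<in> {real_of_int k / 2 ^ n..<(real_of_int k + 1) / 2 ^ n}"
  unfolding level_def floor_eq_iff by (auto simp: field_simps)

lemma level_meas[measurable]: "level n \<in> measurable borel (count_space UNIV)"
  unfolding level_def by measurable

lemma level_Suc: "level n s < level n t \<Longrightarrow> level (Suc n) s < level (Suc n) t"
proof -
  assume l: "level n s < level n t"
  define x y where "x = 2 ^ n * s" and "y = 2 ^ n * t"
  have "\<lfloor>x\<rfloor> + 1 \<le> \<lfloor>y\<rfloor>" using l unfolding level_def x_def y_def by simp
  then have "2 * x < real_of_int (2 * \<lfloor>y\<rfloor>)" "real_of_int (2 * \<lfloor>y\<rfloor>) \<le> 2 * y" by linarith+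
  then have "\<lfloor>2 * x\<rfloor> < \<lfloor>2 * y\<rfloor>" by (metis floor_less_iff le_floor_iff less_le_trans)
  then show ?thesis by (simp add: level_def x_def y_def mult_ac)
qed

text \<open>Two points with \<open>s < t\<close> are separated once
  \<open>2 ^ n * (t - s) > 1\<close>, and by monotonicity of the floor a pair in the wrong order
  never is.\<close>

lemma level_SUP: "(SUP n. of_bool (level n s < level n t)) = (of_bool (s < t) :: ennreal)"
proof (cases "s < t")
  case True
  obtain n where n: "1 / (t - s) < 2 ^ n" using real_arch_pow[of 2 "1 / (t - s)"] by auto
  have "1 < 2 ^ n * (t - s)" using n True by (simp add: field_simps)
  then have "level n s < level n t" unfolding level_def right_diff_distrib by linarith
  then have "of_bool (s < t) \<le> (SUP n. of_bool (level n s < level n t) :: ennreal)"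
    by (intro SUP_upper2[of n]) auto
  then show ?thesis using True by (intro antisym SUP_least) auto
next
  case False
  then have "\<not> level n s < level n t" for n
    by (simp add: level_def floor_mono not_less)
  then show ?thesis using False by simp
qed

lemma suminf_int_decode:
  fixes h :: "int \<Rightarrow> ennreal"
  shows "(\<Sum>i. h (int_decode i) * of_bool (k = int_decode i)) = h k"
proof -
  have "(\<Sum>i. h (int_decode i) * of_bool (k = int_decode i)) = (\<Sum>i\<in>{int_encode k}. h (int_decode i) * of_bool (k = int_decode i))"
    by (rule suminf_finite) auto
  then show ?thesis by simp
qed

text \<open>The strict upper triangle of the plane is exhausted by finite unions of products of
  disjoint dyadic intervals, the first lying to the left of the second.\<close>

lemma triangle_cells:
  fixes R :: "real \<Rightarrow> real \<Rightarrow> ennreal" and N :: "real measure"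
  assumes m1: "\<And>i j s. (\<lambda>t. of_bool (level n s = i) * of_bool (level n t = j) * R s t) \<in> borel_measurable N"
    and m2: "\<And>i j. (\<lambda>s. \<integral>\<^sup>+t. of_bool (level n s = i) * of_bool (level n t = j) * R s t \<partial>N) \<in> borel_measurable N"
  shows "(\<integral>\<^sup>+s. \<integral>\<^sup>+t. of_bool (level n s < level n t) * R s t \<partial>N \<partial>N) =
    (\<Sum>i. \<Sum>j. of_bool (int_decode i < int_decode j) *
       (\<integral>\<^sup>+s. \<integral>\<^sup>+t. of_bool (level n s = int_decode i) * of_bool (level n t = int_decode j) * R s t \<partial>N \<partial>N))"
proof -
  have *: "of_bool (level n s < level n t) * R s t =
      (\<Sum>i. \<Sum>j. of_bool (int_decode i < int_decode j) * (of_bool (level n s = int_decode i) * of_bool (level n t = int_decode j) * R s t))" for s t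
  proof -
    have "(\<Sum>j. of_bool (int_decode i < int_decode j) * (of_bool (level n s = int_decode i) * of_bool (level n t = int_decode j) * R s t))
      = of_bool (int_decode i < level n t) * R s t * of_bool (level n s = int_decode i)" for i
    proof -
      have "of_bool (int_decode i < int_decode j) * (of_bool (level n s = int_decode i) * of_bool (level n t = int_decode j) * R s t)
        = (of_bool (int_decode i < int_decode j) * R s t * of_bool (level n s = int_decode i)) * of_bool (level n t = int_decode j)" for j
        by (simp only: mult_ac)
      then show ?thesis
        using suminf_int_decode[of "\<lambda>k. of_bool (int_decode i < k) * R s t * of_bool (level n s = int_decode i)" "level n t"] by (simp only:)
    qed
    then show ?thesis using suminf_int_decode[of "\<lambda>k. of_bool (k < level n t) * R s t" "level n s"] by (simp only:)
  qed
  note m1' = m1[THEN borel_measurable_const[THEN borel_measurable_times_ennreal]]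
  note m2' = m2[THEN borel_measurable_const[THEN borel_measurable_times_ennreal]]
  have "(\<integral>\<^sup>+t. of_bool (level n s < level n t) * R s t \<partial>N) =
      (\<Sum>i. \<Sum>j. of_bool (int_decode i < int_decode j) * (\<integral>\<^sup>+t. of_bool (level n s = int_decode i) * of_bool (level n t = int_decode j) * R s t \<partial>N))" for s
    unfolding * by (simp only: nn_integral_suminf nn_integral_cmult borel_measurable_suminf_order m1 m1')
  then show ?thesis
    by (simp only: nn_integral_suminf nn_integral_cmult borel_measurable_suminf_order m2 m2')
qed

text \<open>The measure \<open>N\<close> is left open because two are inserted: the counting measure
  on the zeros and Lebesgue measure. This transfers an identity known on product cells to the whole
  triangle.\<close>

lemma triangle_SUP:
  fixes R :: "real \<Rightarrow> real \<Rightarrow> ennreal" and N :: "real measure"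
  assumes m1: "\<And>n s. (\<lambda>t. of_bool (level n s < level n t) * R s t) \<in> borel_measurable N"
    and m2: "\<And>n. (\<lambda>s. \<integral>\<^sup>+t. of_bool (level n s < level n t) * R s t \<partial>N) \<in> borel_measurable N"
  shows "(SUP n. \<integral>\<^sup>+s. \<integral>\<^sup>+t. of_bool (level n s < level n t) * R s t \<partial>N \<partial>N) = (\<integral>\<^sup>+s. \<integral>\<^sup>+t. of_bool (s < t) * R s t \<partial>N \<partial>N)"
    and "incseq (\<lambda>n. \<integral>\<^sup>+s. \<integral>\<^sup>+t. of_bool (level n s < level n t) * R s t \<partial>N \<partial>N)"
proof -
  have i: "of_bool (level n s < level n t) * R s t \<le> of_bool (level (Suc n) s < level (Suc n) t) * R s t" for n s t
    using level_Suc[of n s t] by simp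
  have i1: "incseq (\<lambda>n t. of_bool (level n s < level n t) * R s t)" for s
    by (rule incseq_SucI, rule le_funI, rule i)
  have i2: "incseq (\<lambda>n s. \<integral>\<^sup>+t. of_bool (level n s < level n t) * R s t \<partial>N)"
    by (rule incseq_SucI, rule le_funI, rule nn_integral_mono, rule i)
  show "incseq (\<lambda>n. \<integral>\<^sup>+s. \<integral>\<^sup>+t. of_bool (level n s < level n t) * R s t \<partial>N \<partial>N)"
    by (rule incseq_SucI, rule nn_integral_mono, rule nn_integral_mono, rule i)
  have "of_bool (s < t) * R s t = (SUP n. of_bool (level n s < level n t) * R s t)" for s t
    unfolding level_SUP[symmetric] SUP_mult_right_ennreal ..
  then have "(\<integral>\<^sup>+t. of_bool (s < t) * R s t \<partial>N) = (SUP n. \<integral>\<^sup>+t. of_bool (level n s < level n t) * R s t \<partial>N)" for s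
    using nn_integral_monotone_convergence_SUP[OF i1 m1, of s] by simp
  then show "(SUP n. \<integral>\<^sup>+s. \<integral>\<^sup>+t. of_bool (level n s < level n t) * R s t \<partial>N \<partial>N) = (\<integral>\<^sup>+s. \<integral>\<^sup>+t. of_bool (s < t) * R s t \<partial>N \<partial>N)"
    using nn_integral_monotone_convergence_SUP[OF i2 m2] by simp
qed

context discrete_zero_process
begin

text \<open>Supplies the finiteness on which the extension of the two-point identity depends:
  \<open>\<rho>\<close> is at most \<open>\<bar>F\<bar> + 1\<close>, as
  \<open>pi\<^sup>2 \<ge> 1\<close>, and \<open>F\<close> is integrable.\<close>

lemma \<rho>_integral_le:
  "(\<integral>\<^sup>+t. indicator {c..<d} t * \<rho> (t - s) \<partial>lborel) \<le> ennreal (LINT t|lborel. \<bar>F t\<bar>) + ennreal \<bar>d - c\<bar>"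
proof -
  have le: "\<rho> t \<le> ennreal \<bar>F t\<bar> + 1" for t
  proof -
    have "1 \<le> pi\<^sup>2" using pi_ge_two by (simp add: one_le_power)
    then have "(\<bar>F t\<bar> + 1) / pi\<^sup>2 \<le> (\<bar>F t\<bar> + 1) / 1" by (intro divide_left_mono) auto
    moreover have "pair_corr t / pi\<^sup>2 \<le> (\<bar>F t\<bar> + 1) / pi\<^sup>2" by (intro divide_right_mono) (auto simp: F_def)
    ultimately have "\<rho> t \<le> ennreal (\<bar>F t\<bar> + 1)" unfolding \<rho>_def by (intro ennreal_leI) simp
    then show ?thesis by (simp add: ennreal_plus)
  qed
  have "(\<integral>\<^sup>+t. indicator {c..<d} t * \<rho> (t - s) \<partial>lborel) \<le> (\<integral>\<^sup>+t. ennreal \<bar>F (t - s)\<bar> + indicator {c..<d} t \<partial>lborel)"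
    using le[of "_ - s"] by (intro nn_integral_mono) (auto split: split_indicator)
  also have "\<dots> = (\<integral>\<^sup>+t. ennreal \<bar>F (t - s)\<bar> \<partial>lborel) + emeasure lborel {c..<d}"
    by (subst nn_integral_add) auto
  also have "(\<integral>\<^sup>+t. ennreal \<bar>F (t - s)\<bar> \<partial>lborel) = (\<integral>\<^sup>+t. ennreal \<bar>F t\<bar> \<partial>lborel)"
    by (subst nn_integral_real_affine[of "\<lambda>t. ennreal \<bar>F t\<bar>" 1 "- s"]) (auto simp: one_ennreal_def[symmetric] add.commute)
  also have "\<dots> = ennreal (LINT t|lborel. \<bar>F t\<bar>)" using F_int by (intro nn_integral_eq_integral) auto
  also have "emeasure lborel {c..<d} \<le> ennreal \<bar>d - c\<bar>" by (cases "c \<le> d") auto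
  finally show ?thesis by (auto intro: add_left_mono)
qed

lemma cross_interval_count:
  assumes ab: "a < b" and bc: "b \<le> c" and cd: "c < d" and \<phi>[measurable]: "\<phi> \<in> borel_measurable borel"
  shows "(\<integral>\<^sup>+w. ncard (zeros w \<inter> {c..<d}) * nu w (\<lambda>t. indicator {a..<b} t * \<phi> t) \<partial>M) =
    (\<integral>\<^sup>+s. indicator {a..<b} s * \<phi> s * (\<integral>\<^sup>+t. indicator {c..<d} t * \<rho> (t - s) \<partial>lborel) \<partial>lborel)"
proof -
  have fin: "(\<integral>\<^sup>+w. ncard (zeros w \<inter> {c..<d}) * ncard (zeros w \<inter> {a..<b}) \<partial>M) < \<infinity>"
  proof -
    have "(\<integral>\<^sup>+w. ncard (zeros w \<inter> {c..<d}) * ncard (zeros w \<inter> {a..<b}) \<partial>M)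
       \<le> (\<integral>\<^sup>+s. indicator {a..<b} s * (ennreal (LINT t|lborel. \<bar>F t\<bar>) + ennreal \<bar>d - c\<bar>) \<partial>lborel)"
      unfolding two_point[OF ab bc cd] by (intro nn_integral_mono mult_left_mono \<rho>_integral_le) simp
    also have "\<dots> = ennreal (b - a) * (ennreal (LINT t|lborel. \<bar>F t\<bar>) + ennreal \<bar>d - c\<bar>)"
      using ab by (subst nn_integral_multc) auto
    also have "\<dots> < \<infinity>" by (simp add: ennreal_mult_less_top)
    finally show ?thesis .
  qed
  show ?thesis
  proof (rule conjunct2[OF intensity_functions[OF zeros_ncard_meas _ _ fin \<phi>]])
    show "(\<lambda>s. \<integral>\<^sup>+t. indicator {c..<d} t * \<rho> (t - s) \<partial>lborel) \<in> borel_measurable borel" by measurable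
    show "(\<integral>\<^sup>+w. ncard (zeros w \<inter> {c..<d}) * ncard (zeros w \<inter> {x..<y}) \<partial>M) =
      (\<integral>\<^sup>+s. indicator {x..<y} s * (\<integral>\<^sup>+t. indicator {c..<d} t * \<rho> (t - s) \<partial>lborel) \<partial>lborel)" if "a \<le> x" "x < y" "y \<le> b" for x y
      by (rule two_point) (use that bc cd in auto)
  qed
qed

text \<open>The indicators in the two-point identity are replaced one after the other: the statistic
  of \<open>\<phi>\<close> on the left interval, whose weighted counts are given by
  \<open>cross_interval_count\<close>, serves as weight for the extension on the right one. The
  bound \<open>K\<close> secures finiteness.\<close>

lemma cross_interval:
  assumes ab: "a < b" and bc: "b \<le> c" and cd: "c < d" and \<phi>[measurable]: "\<phi> \<in> borel_measurable borel"
    and \<psi>[measurable]: "\<psi> \<in> borel_measurable borel" and K: "\<And>t. \<phi> t \<le> ennreal K"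
  shows "(\<integral>\<^sup>+w. nu w (\<lambda>t. indicator {a..<b} t * \<phi> t) * nu w (\<lambda>t. indicator {c..<d} t * \<psi> t) \<partial>M) =
    (\<integral>\<^sup>+s. \<integral>\<^sup>+t. indicator {a..<b} s * indicator {c..<d} t * (\<phi> s * \<psi> t * \<rho> (t - s)) \<partial>lborel \<partial>lborel)"
proof -
  let ?W = "\<lambda>w. nu w (\<lambda>t. indicator {a..<b} t * \<phi> t)"
  let ?r = "\<lambda>t. \<integral>\<^sup>+s. indicator {a..<b} s * \<phi> s * \<rho> (t - s) \<partial>lborel"
  have W[measurable]: "?W \<in> borel_measurable M" by (rule nu_measurable) measurable
  have eq: "(\<integral>\<^sup>+w. ?W w * ncard (zeros w \<inter> {x..<y}) \<partial>M) = (\<integral>\<^sup>+t. indicator {x..<y} t * ?r t \<partial>lborel)"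
    if "c \<le> x" "x < y" "y \<le> d" for x y
  proof -
    have "(\<integral>\<^sup>+w. ?W w * ncard (zeros w \<inter> {x..<y}) \<partial>M) = (\<integral>\<^sup>+s. indicator {a..<b} s * \<phi> s * (\<integral>\<^sup>+t. indicator {x..<y} t * \<rho> (t - s) \<partial>lborel) \<partial>lborel)"
      unfolding mult.commute[of "?W _"] by (rule cross_interval_count) (use ab bc that \<phi> in auto)
    also have "\<dots> = (\<integral>\<^sup>+s. \<integral>\<^sup>+t. indicator {a..<b} s * \<phi> s * (indicator {x..<y} t * \<rho> (t - s)) \<partial>lborel \<partial>lborel)"
      by (intro nn_integral_cong nn_integral_cmult[symmetric]) measurable
    also have "\<dots> = (\<integral>\<^sup>+t. \<integral>\<^sup>+s. indicator {a..<b} s * \<phi> s * (indicator {x..<y} t * \<rho> (t - s)) \<partial>lborel \<partial>lborel)"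
      by (rule lborel_pair.Fubini') measurable
    also have "\<dots> = (\<integral>\<^sup>+t. \<integral>\<^sup>+s. indicator {x..<y} t * (indicator {a..<b} s * \<phi> s * \<rho> (t - s)) \<partial>lborel \<partial>lborel)"
      by (simp only: mult_ac)
    also have "\<dots> = (\<integral>\<^sup>+t. indicator {x..<y} t * ?r t \<partial>lborel)"
      by (intro nn_integral_cong nn_integral_cmult) measurable
    finally show ?thesis .
  qed
  have fin: "(\<integral>\<^sup>+w. ?W w * ncard (zeros w \<inter> {c..<d}) \<partial>M) < \<infinity>"
  proof -
    have "(\<integral>\<^sup>+w. ?W w * ncard (zeros w \<inter> {c..<d}) \<partial>M) = (\<integral>\<^sup>+s. indicator {a..<b} s * \<phi> s * (\<integral>\<^sup>+t. indicator {c..<d} t * \<rho> (t - s) \<partial>lborel) \<partial>lborel)"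
      unfolding mult.commute[of "?W _"] by (rule cross_interval_count[OF ab bc cd \<phi>])
    also have "\<dots> \<le> (\<integral>\<^sup>+s. indicator {a..<b} s * (ennreal K * (ennreal (LINT t|lborel. \<bar>F t\<bar>) + ennreal \<bar>d - c\<bar>)) \<partial>lborel)"
      unfolding mult.assoc by (intro nn_integral_mono mult_left_mono mult_mono K \<rho>_integral_le) auto
    also have "\<dots> = ennreal (b - a) * (ennreal K * (ennreal (LINT t|lborel. \<bar>F t\<bar>) + ennreal \<bar>d - c\<bar>))"
      using ab by (subst nn_integral_multc) auto
    also have "\<dots> < \<infinity>" by (simp add: ennreal_mult_less_top)
    finally show ?thesis .
  qed
  have "(\<integral>\<^sup>+w. ?W w * nu w (\<lambda>t. indicator {c..<d} t * \<psi> t) \<partial>M) = (\<integral>\<^sup>+t. indicator {c..<d} t * \<psi> t * ?r t \<partial>lborel)"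
    by (rule conjunct2[OF intensity_functions[OF W _ eq fin \<psi>]]) measurable
  also have "\<dots> = (\<integral>\<^sup>+t. \<integral>\<^sup>+s. indicator {c..<d} t * \<psi> t * (indicator {a..<b} s * \<phi> s * \<rho> (t - s)) \<partial>lborel \<partial>lborel)"
    by (intro nn_integral_cong nn_integral_cmult[symmetric]) measurable
  also have "\<dots> = (\<integral>\<^sup>+s. \<integral>\<^sup>+t. indicator {c..<d} t * \<psi> t * (indicator {a..<b} s * \<phi> s * \<rho> (t - s)) \<partial>lborel \<partial>lborel)"
    by (rule lborel_pair.Fubini') measurable
  finally show ?thesis by (simp only: mult_ac)
qed

lemma nu_count_space: "nu w \<phi> = (\<integral>\<^sup>+t. \<phi> t \<partial>count_space (zeros w))"
  unfolding nu_def by (subst nn_integral_count_space_indicator) auto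

text \<open>\<open>cross_interval\<close> covers only pairs of disjoint ordered intervals. At level
  \<open>n\<close> the sum over pairs of zeros in different, correctly ordered cells is a countable
  sum of such products; monotone convergence in \<open>n\<close> reaches all pairs
  \<open>s < t\<close>.\<close>

lemma upper_triangle:
  assumes \<phi>[measurable]: "\<phi> \<in> borel_measurable borel"
    and \<psi>[measurable]: "\<psi> \<in> borel_measurable borel" and K: "\<And>t. \<phi> t \<le> ennreal K"
  shows "(\<lambda>w. nu w (\<lambda>s. nu w (\<lambda>t. of_bool (s < t) * (\<phi> s * \<psi> t)))) \<in> borel_measurable M"
    and "(\<integral>\<^sup>+w. nu w (\<lambda>s. nu w (\<lambda>t. of_bool (s < t) * (\<phi> s * \<psi> t))) \<partial>M) =
      (\<integral>\<^sup>+s. \<integral>\<^sup>+t. of_bool (s < t) * (\<phi> s * \<psi> t * \<rho> (t - s)) \<partial>lborel \<partial>lborel)"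
proof -
  let ?T = "\<lambda>n w. nu w (\<lambda>s. nu w (\<lambda>t. of_bool (level n s < level n t) * (\<phi> s * \<psi> t)))"
  let ?c = "\<lambda>n k t. of_bool (level n t = k) :: ennreal"
  let ?k = "\<lambda>n i. {real_of_int (int_decode i) / 2 ^ n..<(real_of_int (int_decode i) + 1) / 2 ^ n}"
  have ind: "?c n (int_decode i) t = indicator (?k n i) t" for n i t
    unfolding level_eq by (simp add: indicator_def)
  let ?N = "\<lambda>n i j w. nu w (\<lambda>t. indicator (?k n i) t * \<phi> t) * nu w (\<lambda>t. indicator (?k n j) t * \<psi> t)"
  have nuk[measurable]: "(\<lambda>w. nu w (\<lambda>t. indicator (?k n i) t * \<phi> t)) \<in> borel_measurable M"
    "(\<lambda>w. nu w (\<lambda>t. indicator (?k n i) t * \<psi> t)) \<in> borel_measurable M" for n i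
    by (rule nu_measurable, measurable)+
  have pr: "nu w (\<lambda>s. nu w (\<lambda>t. ?c n (int_decode i) s * ?c n (int_decode j) t * (\<phi> s * \<psi> t))) = ?N n i j w" for n i j w
  proof -
    have "nu w (\<lambda>t. ?c n (int_decode i) s * ?c n (int_decode j) t * (\<phi> s * \<psi> t)) = nu w (\<lambda>t. indicator (?k n j) t * \<psi> t) * (indicator (?k n i) s * \<phi> s)" for s
      unfolding ind mult.commute[of _ "indicator (?k n i) s * \<phi> s"] nu_cmult[symmetric] by (simp only: mult_ac)
    then show ?thesis by (simp only: nu_cmult) (simp only: mult_ac)
  qed
  have T: "?T n w = (\<Sum>i. \<Sum>j. of_bool (int_decode i < int_decode j) * ?N n i j w)" for n w
    unfolding pr[symmetric] unfolding nu_count_space by (rule triangle_cells) simp_all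
  have Tm[measurable]: "?T n \<in> borel_measurable M" for n unfolding T by measurable
  have ET: "(\<integral>\<^sup>+w. ?T n w \<partial>M) = (\<integral>\<^sup>+s. \<integral>\<^sup>+t. of_bool (level n s < level n t) * (\<phi> s * \<psi> t * \<rho> (t - s)) \<partial>lborel \<partial>lborel)" for n
  proof -
    have "of_bool (int_decode i < int_decode j) * (\<integral>\<^sup>+w. ?N n i j w \<partial>M) = of_bool (int_decode i < int_decode j) *
        (\<integral>\<^sup>+s. \<integral>\<^sup>+t. ?c n (int_decode i) s * ?c n (int_decode j) t * (\<phi> s * \<psi> t * \<rho> (t - s)) \<partial>lborel \<partial>lborel)" for i j
    proof (cases "int_decode i < int_decode j")
      case True
      then have "real_of_int (int_decode i) + 1 \<le> real_of_int (int_decode j)" by linarith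
      then have "(\<integral>\<^sup>+w. ?N n i j w \<partial>M) = (\<integral>\<^sup>+s. \<integral>\<^sup>+t. indicator (?k n i) s * indicator (?k n j) t * (\<phi> s * \<psi> t * \<rho> (t - s)) \<partial>lborel \<partial>lborel)"
        by (intro cross_interval[OF _ _ _ \<phi> \<psi> K] divide_strict_right_mono divide_right_mono) auto
      then show ?thesis unfolding ind by simp
    qed simp
    moreover have "(\<integral>\<^sup>+w. ?T n w \<partial>M) = (\<Sum>i. \<Sum>j. of_bool (int_decode i < int_decode j) * (\<integral>\<^sup>+w. ?N n i j w \<partial>M))"
    proof -
      have "(\<integral>\<^sup>+w. ?T n w \<partial>M) = (\<Sum>i. \<integral>\<^sup>+w. (\<Sum>j. of_bool (int_decode i < int_decode j) * ?N n i j w) \<partial>M)"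
        unfolding T by (rule nn_integral_suminf) measurable
      also have "\<dots> = (\<Sum>i. \<Sum>j. \<integral>\<^sup>+w. of_bool (int_decode i < int_decode j) * ?N n i j w \<partial>M)"
        by (intro suminf_cong nn_integral_suminf) measurable
      also have "\<dots> = (\<Sum>i. \<Sum>j. of_bool (int_decode i < int_decode j) * (\<integral>\<^sup>+w. ?N n i j w \<partial>M))"
        by (intro suminf_cong nn_integral_cmult) measurable
      finally show ?thesis .
    qed
    moreover have "(\<integral>\<^sup>+s. \<integral>\<^sup>+t. of_bool (level n s < level n t) * (\<phi> s * \<psi> t * \<rho> (t - s)) \<partial>lborel \<partial>lborel) =
      (\<Sum>i. \<Sum>j. of_bool (int_decode i < int_decode j) *
       (\<integral>\<^sup>+s. \<integral>\<^sup>+t. ?c n (int_decode i) s * ?c n (int_decode j) t * (\<phi> s * \<psi> t * \<rho> (t - s)) \<partial>lborel \<partial>lborel))"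
      by (rule triangle_cells) measurable
    ultimately show ?thesis by simp
  qed
  have S: "(SUP n. ?T n w) = nu w (\<lambda>s. nu w (\<lambda>t. of_bool (s < t) * (\<phi> s * \<psi> t)))" "incseq (\<lambda>n. ?T n w)" for w
    unfolding nu_count_space by (rule triangle_SUP; simp)+
  show "(\<lambda>w. nu w (\<lambda>s. nu w (\<lambda>t. of_bool (s < t) * (\<phi> s * \<psi> t)))) \<in> borel_measurable M"
    unfolding S(1)[symmetric] by measurable
  have "incseq ?T" using S(2) by (simp add: incseq_def le_fun_def)
  then have "(\<integral>\<^sup>+w. nu w (\<lambda>s. nu w (\<lambda>t. of_bool (s < t) * (\<phi> s * \<psi> t))) \<partial>M) = (SUP n. \<integral>\<^sup>+w. ?T n w \<partial>M)"
    unfolding S(1)[symmetric] by (rule nn_integral_monotone_convergence_SUP) measurable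
  also have "\<dots> = (\<integral>\<^sup>+s. \<integral>\<^sup>+t. of_bool (s < t) * (\<phi> s * \<psi> t * \<rho> (t - s)) \<partial>lborel \<partial>lborel)"
    unfolding ET by (rule triangle_SUP) measurable
  finally show "(\<integral>\<^sup>+w. nu w (\<lambda>s. nu w (\<lambda>t. of_bool (s < t) * (\<phi> s * \<psi> t))) \<partial>M) =
      (\<integral>\<^sup>+s. \<integral>\<^sup>+t. of_bool (s < t) * (\<phi> s * \<psi> t * \<rho> (t - s)) \<partial>lborel \<partial>lborel)" .
qed

text \<open>The double sum over zeros consists of the diagonal and two triangles. The diagonal is a
  single sum again and produces the one-point term of the variance.\<close>

lemma nu_product:
  "nu w \<phi> * nu w \<psi> = nu w (\<lambda>t. \<phi> t * \<psi> t) + nu w (\<lambda>s. nu w (\<lambda>t. of_bool (s < t) * (\<phi> s * \<psi> t)))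
     + nu w (\<lambda>s. nu w (\<lambda>t. of_bool (s < t) * (\<psi> s * \<phi> t)))"
proof -
  have d: "\<phi> s * \<psi> t = of_bool (s = t) * (\<phi> s * \<psi> t) + of_bool (s < t) * (\<phi> s * \<psi> t) + of_bool (t < s) * (\<phi> s * \<psi> t)" for s t
    by (cases s t rule: linorder_cases) auto
  have "nu w \<phi> * nu w \<psi> = nu w (\<lambda>s. nu w \<psi> * \<phi> s)"
    unfolding nu_cmult by (rule mult.commute)
  also have "\<dots> = nu w (\<lambda>s. nu w (\<lambda>t. \<phi> s * \<psi> t))" by (simp only: nu_cmult mult.commute)
  also have "\<dots> = nu w (\<lambda>s. nu w (\<lambda>t. of_bool (s = t) * (\<phi> s * \<psi> t))) + nu w (\<lambda>s. nu w (\<lambda>t. of_bool (s < t) * (\<phi> s * \<psi> t)))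
     + nu w (\<lambda>s. nu w (\<lambda>t. of_bool (t < s) * (\<phi> s * \<psi> t)))"
    by (subst d) (simp only: nu_add)
  also have "nu w (\<lambda>s. nu w (\<lambda>t. of_bool (s = t) * (\<phi> s * \<psi> t))) = nu w (\<lambda>t. \<phi> t * \<psi> t)"
  proof -
    have "nu w (\<lambda>t. of_bool (s = t) * (\<phi> s * \<psi> t)) * indicator (zeros w) s = \<phi> s * \<psi> s * indicator (zeros w) s" for s
    proof -
      have "nu w (\<lambda>t. of_bool (s = t) * (\<phi> s * \<psi> t)) = (\<integral>\<^sup>+t. (\<phi> s * \<psi> t * indicator (zeros w) t) * indicator {s} t \<partial>count_space UNIV)"
        unfolding nu_def by (intro nn_integral_cong) (auto split: split_indicator)
      also have "\<dots> = \<phi> s * \<psi> s * indicator (zeros w) s"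
        by (subst nn_integral_indicator_singleton) auto
      finally show ?thesis by (simp split: split_indicator)
    qed
    then show ?thesis unfolding nu_def[of w "\<lambda>s. nu w (_ s)"] unfolding nu_def[of w "\<lambda>s. _ s * _ s"] by simp
  qed
  also have "nu w (\<lambda>s. nu w (\<lambda>t. of_bool (t < s) * (\<phi> s * \<psi> t))) = nu w (\<lambda>s. nu w (\<lambda>t. of_bool (s < t) * (\<psi> s * \<phi> t)))"
  proof -
    let ?g = "\<lambda>(s, t). of_bool (t < s) * (\<phi> s * \<psi> t) * indicator (zeros w) t * (indicator (zeros w) s :: ennreal)"
    have "nu w (\<lambda>s. nu w (\<lambda>t. of_bool (t < s) * (\<phi> s * \<psi> t))) = (\<integral>\<^sup>+s. \<integral>\<^sup>+t. ?g (s, t) \<partial>count_space UNIV \<partial>count_space UNIV)"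
      unfolding nu_def by (simp add: nn_integral_multc)
    also have "\<dots> = (\<integral>\<^sup>+t. \<integral>\<^sup>+s. ?g (s, t) \<partial>count_space UNIV \<partial>count_space UNIV)"
      unfolding nn_integral_fst_count_space nn_integral_snd_count_space ..
    also have "\<dots> = (\<integral>\<^sup>+t. \<integral>\<^sup>+s. (of_bool (t < s) * (\<psi> t * \<phi> s) * indicator (zeros w) s) * indicator (zeros w) t \<partial>count_space UNIV \<partial>count_space UNIV)"
      by (simp only: mult_ac split_conv)
    also have "\<dots> = nu w (\<lambda>s. nu w (\<lambda>t. of_bool (s < t) * (\<psi> s * \<phi> t)))"
      unfolding nu_def by (simp add: nn_integral_multc)
    finally show ?thesis .
  qed
  finally show ?thesis .
qed

lemma pair_corr_even: "pair_corr (- t) = pair_corr t"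
  using F_even[of t] by (simp add: F_def)

text \<open>The second triangle is the first with \<open>\<phi>\<close> and \<open>\<psi>\<close>
  exchanged; evenness of \<open>\<rho>\<close> joins both to a full double integral, since the
  diagonal of the plane is a null set.\<close>

lemma second_moment:
  assumes \<phi>[measurable]: "\<phi> \<in> borel_measurable borel" and \<psi>[measurable]: "\<psi> \<in> borel_measurable borel"
    and K: "\<And>t. \<phi> t \<le> ennreal K" "\<And>t. \<psi> t \<le> ennreal K"
  shows "(\<integral>\<^sup>+w. nu w \<phi> * nu w \<psi> \<partial>M) = (\<integral>\<^sup>+t. \<phi> t * \<psi> t * ennreal (1 / pi) \<partial>lborel) +
    (\<integral>\<^sup>+s. \<integral>\<^sup>+t. \<phi> s * \<psi> t * \<rho> (t - s) \<partial>lborel \<partial>lborel)"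
proof -
  note [measurable] = upper_triangle(1)[OF \<phi> \<psi> K(1)] upper_triangle(1)[OF \<psi> \<phi> K(2)] nu_measurable[of "\<lambda>t. \<phi> t * \<psi> t"]
  have "(\<integral>\<^sup>+w. nu w \<phi> * nu w \<psi> \<partial>M) = (\<integral>\<^sup>+w. nu w (\<lambda>t. \<phi> t * \<psi> t) \<partial>M)
     + (\<integral>\<^sup>+w. nu w (\<lambda>s. nu w (\<lambda>t. of_bool (s < t) * (\<phi> s * \<psi> t))) \<partial>M)
     + (\<integral>\<^sup>+w. nu w (\<lambda>s. nu w (\<lambda>t. of_bool (s < t) * (\<psi> s * \<phi> t))) \<partial>M)"
    unfolding nu_product by (subst nn_integral_add, measurable)+
  also have "(\<integral>\<^sup>+w. nu w (\<lambda>t. \<phi> t * \<psi> t) \<partial>M) = (\<integral>\<^sup>+t. \<phi> t * \<psi> t * ennreal (1 / pi) \<partial>lborel)"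
    by (rule nu_mean) measurable
  also have "(\<integral>\<^sup>+w. nu w (\<lambda>s. nu w (\<lambda>t. of_bool (s < t) * (\<psi> s * \<phi> t))) \<partial>M) =
     (\<integral>\<^sup>+s. \<integral>\<^sup>+t. of_bool (t < s) * (\<phi> s * \<psi> t * \<rho> (t - s)) \<partial>lborel \<partial>lborel)"
  proof -
    have "\<rho> (t - s) = \<rho> (s - t)" for s t using pair_corr_even[of "s - t"] by (simp add: \<rho>_def)
    then have "(\<integral>\<^sup>+s. \<integral>\<^sup>+t. of_bool (s < t) * (\<psi> s * \<phi> t * \<rho> (t - s)) \<partial>lborel \<partial>lborel)
      = (\<integral>\<^sup>+s. \<integral>\<^sup>+t. of_bool (s < t) * (\<phi> t * \<psi> s * \<rho> (s - t)) \<partial>lborel \<partial>lborel)"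
      by (simp only: mult.commute[of "\<psi> _" "\<phi> _"])
    also have "\<dots> = (\<integral>\<^sup>+t. \<integral>\<^sup>+s. of_bool (s < t) * (\<phi> t * \<psi> s * \<rho> (s - t)) \<partial>lborel \<partial>lborel)"
      by (rule lborel_pair.Fubini') measurable
    finally show ?thesis using upper_triangle(2)[OF \<psi> \<phi> K(2)] by simp
  qed
  also have "(\<integral>\<^sup>+w. nu w (\<lambda>s. nu w (\<lambda>t. of_bool (s < t) * (\<phi> s * \<psi> t))) \<partial>M) =
      (\<integral>\<^sup>+s. \<integral>\<^sup>+t. of_bool (s < t) * (\<phi> s * \<psi> t * \<rho> (t - s)) \<partial>lborel \<partial>lborel)" by (rule upper_triangle(2)[OF \<phi> \<psi> K(1)])
  finally have e: "(\<integral>\<^sup>+w. nu w \<phi> * nu w \<psi> \<partial>M) = (\<integral>\<^sup>+t. \<phi> t * \<psi> t * ennreal (1 / pi) \<partial>lborel) +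
    ((\<integral>\<^sup>+s. \<integral>\<^sup>+t. of_bool (s < t) * (\<phi> s * \<psi> t * \<rho> (t - s)) \<partial>lborel \<partial>lborel) +
     (\<integral>\<^sup>+s. \<integral>\<^sup>+t. of_bool (t < s) * (\<phi> s * \<psi> t * \<rho> (t - s)) \<partial>lborel \<partial>lborel))" by (simp only: add.assoc)
  have "(\<integral>\<^sup>+s. \<integral>\<^sup>+t. of_bool (s < t) * (\<phi> s * \<psi> t * \<rho> (t - s)) \<partial>lborel \<partial>lborel) +
     (\<integral>\<^sup>+s. \<integral>\<^sup>+t. of_bool (t < s) * (\<phi> s * \<psi> t * \<rho> (t - s)) \<partial>lborel \<partial>lborel)
    = (\<integral>\<^sup>+s. (\<integral>\<^sup>+t. of_bool (s < t) * (\<phi> s * \<psi> t * \<rho> (t - s)) + of_bool (t < s) * (\<phi> s * \<psi> t * \<rho> (t - s)) \<partial>lborel) \<partial>lborel)"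
    by (subst nn_integral_add[symmetric], measurable, measurable, intro nn_integral_cong nn_integral_add[symmetric]) measurable
  also have "\<dots> = (\<integral>\<^sup>+s. \<integral>\<^sup>+t. \<phi> s * \<psi> t * \<rho> (t - s) \<partial>lborel \<partial>lborel)"
  proof (rule nn_integral_cong, rule nn_integral_cong_AE)
    fix s :: real
    show "AE t in lborel. of_bool (s < t) * (\<phi> s * \<psi> t * \<rho> (t - s)) + of_bool (t < s) * (\<phi> s * \<psi> t * \<rho> (t - s)) = \<phi> s * \<psi> t * \<rho> (t - s)"
      using AE_lborel_singleton[of s] by eventually_elim auto
  qed
  finally show ?thesis using e by simp
qed

lemma pair_corr_nonneg: "0 \<le> pair_corr t"
proof (cases t "0::real" rule: linorder_cases)
  case less
  then show ?thesis using pair_corr_bounds(1)[of "- t"] pair_corr_even[of t] by simp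
next
  \<comment> \<open>At 0 the quotient reads \<open>0 / 0\<close>, hence
    \<open>pair_corr 0 = 0\<close>.\<close>
  case equal
  then show ?thesis by (simp add: pair_corr_def \<kappa>_0 \<kappa>'_0)
next
  case greater
  then show ?thesis by (rule pair_corr_bounds(1))
qed

section \<open>Real-valued statistics and their covariance\<close>

definition pos_stat :: "(real \<Rightarrow> real) \<Rightarrow> 'a \<Rightarrow> real" where
  "pos_stat \<phi> w = enn2real (nu w (\<lambda>t. ennreal (\<phi> t)))"

definition kernel_form :: "(real \<Rightarrow> real) \<Rightarrow> (real \<Rightarrow> real) \<Rightarrow> real" where
  "kernel_form \<phi> \<psi> = (LINT p|(lborel \<Otimes>\<^sub>M lborel). \<phi> (fst p) * \<psi> (snd p) * F (snd p - fst p))"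

lemma kernel_integrable:
  assumes \<phi>: "integrable lborel \<phi>" and \<psi>: "integrable lborel \<psi>" and bnd: "\<And>t. \<bar>\<psi> t\<bar> \<le> C"
  shows "integrable (lborel \<Otimes>\<^sub>M lborel) (\<lambda>p. \<phi> (fst p) * \<psi> (snd p) * F (snd p - fst p))"
proof -
  have "\<psi> \<in> borel_measurable borel" using \<psi> by auto
  from kernel_change_of_variables(1)[OF \<phi> this bnd F_int, where R=1] show ?thesis by (simp add: split_beta')
qed

lemma tensor_integrable:
  fixes \<phi> \<psi> :: "real \<Rightarrow> real"
  assumes \<phi>: "integrable lborel \<phi>" and \<psi>: "integrable lborel \<psi>"
  shows "integrable (lborel \<Otimes>\<^sub>M lborel) (\<lambda>p. \<phi> (fst p) * \<psi> (snd p))"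
    and "(LINT p|(lborel \<Otimes>\<^sub>M lborel). \<phi> (fst p) * \<psi> (snd p)) = (LINT t|lborel. \<phi> t) * (LINT t|lborel. \<psi> t)"
proof -
  have [measurable]: "\<phi> \<in> borel_measurable borel" "\<psi> \<in> borel_measurable borel" using \<phi> \<psi> by auto
  show i: "integrable (lborel \<Otimes>\<^sub>M lborel) (\<lambda>p. \<phi> (fst p) * \<psi> (snd p))"
  proof (rule lborel_pair.Fubini_integrable)
    show "integrable lborel (\<lambda>x. LINT y|lborel. norm (\<phi> (fst (x, y)) * \<psi> (snd (x, y))))"
      using \<phi> by (simp add: abs_mult)
    show "AE x in lborel. integrable lborel (\<lambda>y. \<phi> (fst (x, y)) * \<psi> (snd (x, y)))" using \<psi> by simp
  qed measurable
  show "(LINT p|(lborel \<Otimes>\<^sub>M lborel). \<phi> (fst p) * \<psi> (snd p)) = (LINT t|lborel. \<phi> t) * (LINT t|lborel. \<psi> t)"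
    unfolding lborel_pair.integral_fst'[OF i, symmetric] by simp
qed

lemma bounded_product_integrable:
  fixes \<phi> \<psi> :: "real \<Rightarrow> real"
  assumes \<phi>: "integrable lborel \<phi>" and \<psi>: "integrable lborel \<psi>" and bnd: "\<And>t. \<bar>\<psi> t\<bar> \<le> C"
  shows "integrable lborel (\<lambda>t. \<phi> t * \<psi> t)"
proof (rule Bochner_Integration.integrable_bound)
  show "integrable lborel (\<lambda>t. C * \<phi> t)" using \<phi> by simp
  show "(\<lambda>t. \<phi> t * \<psi> t) \<in> borel_measurable lborel" using \<phi> \<psi> by measurable
  show "AE t in lborel. norm (\<phi> t * \<psi> t) \<le> norm (C * \<phi> t)"
  proof (rule AE_I2)
    fix t
    have "\<bar>\<psi> t\<bar> * \<bar>\<phi> t\<bar> \<le> \<bar>C\<bar> * \<bar>\<phi> t\<bar>" using bnd[of t] by (intro mult_right_mono) auto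
    then show "norm (\<phi> t * \<psi> t) \<le> norm (C * \<phi> t)" by (simp add: abs_mult mult.commute)
  qed
qed

lemma nonneg_mean:
  assumes \<phi>: "integrable lborel \<phi>" and p: "\<And>t. 0 \<le> \<phi> t"
  shows "AE w in M. nu w (\<lambda>t. ennreal (\<phi> t)) \<noteq> \<infinity>" "integrable M (pos_stat \<phi>)" "(LINT w|M. pos_stat \<phi> w) = (LINT t|lborel. \<phi> t) / pi"
    "pos_stat \<phi> \<in> borel_measurable M"
proof -
  have [measurable]: "\<phi> \<in> borel_measurable borel" using \<phi> by auto
  have m[measurable]: "(\<lambda>w. nu w (\<lambda>t. ennreal (\<phi> t))) \<in> borel_measurable M" by (rule nu_measurable) measurable
  show pm[measurable]: "pos_stat \<phi> \<in> borel_measurable M" unfolding pos_stat_def by measurable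
  have "(\<integral>\<^sup>+w. nu w (\<lambda>t. ennreal (\<phi> t)) \<partial>M) = (\<integral>\<^sup>+t. ennreal (\<phi> t) * ennreal (1 / pi) \<partial>lborel)"
    by (rule nu_mean) measurable
  also have "\<dots> = (\<integral>\<^sup>+t. ennreal (\<phi> t / pi) \<partial>lborel)" using p by (simp add: ennreal_mult[symmetric])
  also have "\<dots> = ennreal ((LINT t|lborel. \<phi> t) / pi)"
    using \<phi> p by (subst nn_integral_eq_integral) auto
  finally have E: "(\<integral>\<^sup>+w. nu w (\<lambda>t. ennreal (\<phi> t)) \<partial>M) = ennreal ((LINT t|lborel. \<phi> t) / pi)" .
  show ae: "AE w in M. nu w (\<lambda>t. ennreal (\<phi> t)) \<noteq> \<infinity>"
    by (rule nn_integral_PInf_AE[OF m]) (simp add: E)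
  have "(\<integral>\<^sup>+w. ennreal (pos_stat \<phi> w) \<partial>M) = (\<integral>\<^sup>+w. nu w (\<lambda>t. ennreal (\<phi> t)) \<partial>M)"
    by (rule nn_integral_cong_AE) (use ae in \<open>eventually_elim; simp add: pos_stat_def ennreal_enn2real less_top\<close>)
  then have "has_bochner_integral M (pos_stat \<phi>) ((LINT t|lborel. \<phi> t) / pi)"
    unfolding E by (intro has_bochner_integral_nn_integral) (auto simp: pos_stat_def p)
  then show "integrable M (pos_stat \<phi>)" "(LINT w|M. pos_stat \<phi> w) = (LINT t|lborel. \<phi> t) / pi"
    by (auto simp: has_bochner_integral_iff)
qed

text \<open>Writing \<open>pair_corr = 1 + F\<close> splits the pair integral into the product of
  the integrals and \<open>kernel_form\<close>. Since \<open>F\<close> changes sign in general, only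
  the sum of the two integrands is nonnegative, so the passage from \<open>ennreal\<close> to real
  integrals precedes the splitting.\<close>

lemma nonneg_second_moment:
  assumes \<phi>: "integrable lborel \<phi>" and p: "\<And>t. 0 \<le> \<phi> t" and b: "\<And>t. \<phi> t \<le> C"
    and \<psi>: "integrable lborel \<psi>" and q: "\<And>t. 0 \<le> \<psi> t" and c: "\<And>t. \<psi> t \<le> C"
  shows "integrable M (\<lambda>w. pos_stat \<phi> w * pos_stat \<psi> w)"
    and "(LINT w|M. pos_stat \<phi> w * pos_stat \<psi> w) = (LINT t|lborel. \<phi> t * \<psi> t) / pi +
      ((LINT t|lborel. \<phi> t) * (LINT t|lborel. \<psi> t) + kernel_form \<phi> \<psi>) / pi\<^sup>2"
proof -
  have [measurable]: "\<phi> \<in> borel_measurable borel" "\<psi> \<in> borel_measurable borel" using \<phi> \<psi> by auto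
  note [measurable] = nonneg_mean(4)[OF \<phi> p] nonneg_mean(4)[OF \<psi> q]
  have cb: "\<bar>\<psi> t\<bar> \<le> C" for t using q[of t] c[of t] by simp
  let ?G = "\<lambda>p. \<phi> (fst p) * \<psi> (snd p) + \<phi> (fst p) * \<psi> (snd p) * F (snd p - fst p)"
  have G: "?G p = \<phi> (fst p) * \<psi> (snd p) * pair_corr (snd p - fst p)" for p by (simp add: F_def algebra_simps)
  have iG: "integrable (lborel \<Otimes>\<^sub>M lborel) ?G"
    by (intro Bochner_Integration.integrable_add tensor_integrable(1)[OF \<phi> \<psi>] kernel_integrable[OF \<phi> \<psi> cb])
  have G0: "0 \<le> ?G p" for p unfolding G by (intro mult_nonneg_nonneg p q pair_corr_nonneg)
  have IG: "(LINT p|(lborel \<Otimes>\<^sub>M lborel). ?G p) = (LINT t|lborel. \<phi> t) * (LINT t|lborel. \<psi> t) + kernel_form \<phi> \<psi>"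
    using Bochner_Integration.integral_add[OF tensor_integrable(1)[OF \<phi> \<psi>] kernel_integrable[OF \<phi> \<psi> cb]] tensor_integrable(2)[OF \<phi> \<psi>]
    by (simp add: kernel_form_def)
  have "(\<integral>\<^sup>+s. \<integral>\<^sup>+t. ennreal (\<phi> s) * ennreal (\<psi> t) * \<rho> (t - s) \<partial>lborel \<partial>lborel) = (\<integral>\<^sup>+s. \<integral>\<^sup>+t. ennreal (?G (s, t) / pi\<^sup>2) \<partial>lborel \<partial>lborel)"
    unfolding G \<rho>_def using p q pair_corr_nonneg by (simp add: ennreal_mult[symmetric])
  also have "\<dots> = (\<integral>\<^sup>+p. ennreal (?G p / pi\<^sup>2) \<partial>(lborel \<Otimes>\<^sub>M lborel))"
    by (rule lborel.nn_integral_fst) measurable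
  also have "\<dots> = ennreal (LINT p|(lborel \<Otimes>\<^sub>M lborel). ?G p / pi\<^sup>2)"
    using iG G0 by (intro nn_integral_eq_integral) auto
  finally have e2: "(\<integral>\<^sup>+s. \<integral>\<^sup>+t. ennreal (\<phi> s) * ennreal (\<psi> t) * \<rho> (t - s) \<partial>lborel \<partial>lborel)
      = ennreal (((LINT t|lborel. \<phi> t) * (LINT t|lborel. \<psi> t) + kernel_form \<phi> \<psi>) / pi\<^sup>2)"
    unfolding integral_divide_zero IG .
  have i1: "integrable lborel (\<lambda>t. \<phi> t * \<psi> t)" by (rule bounded_product_integrable[OF \<phi> \<psi> cb])
  have "(\<integral>\<^sup>+t. ennreal (\<phi> t) * ennreal (\<psi> t) * ennreal (1 / pi) \<partial>lborel) = (\<integral>\<^sup>+t. ennreal (\<phi> t * \<psi> t / pi) \<partial>lborel)"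
    using p q by (simp add: ennreal_mult[symmetric])
  also have "\<dots> = ennreal ((LINT t|lborel. \<phi> t * \<psi> t) / pi)"
    using i1 p q by (subst nn_integral_eq_integral) auto
  finally have e1: "(\<integral>\<^sup>+t. ennreal (\<phi> t) * ennreal (\<psi> t) * ennreal (1 / pi) \<partial>lborel) = ennreal ((LINT t|lborel. \<phi> t * \<psi> t) / pi)" .
  let ?V = "(LINT t|lborel. \<phi> t * \<psi> t) / pi + ((LINT t|lborel. \<phi> t) * (LINT t|lborel. \<psi> t) + kernel_form \<phi> \<psi>) / pi\<^sup>2"
  have n1: "0 \<le> (LINT t|lborel. \<phi> t * \<psi> t) / pi" using p q by simp
  have n2: "0 \<le> ((LINT t|lborel. \<phi> t) * (LINT t|lborel. \<psi> t) + kernel_form \<phi> \<psi>) / pi\<^sup>2"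
    unfolding IG[symmetric] using G0 by (intro divide_nonneg_nonneg integral_nonneg_AE AE_I2) auto
  have "(\<integral>\<^sup>+w. nu w (\<lambda>t. ennreal (\<phi> t)) * nu w (\<lambda>t. ennreal (\<psi> t)) \<partial>M) = ennreal ?V"
    unfolding ennreal_plus[OF n1 n2] e1[symmetric] e2[symmetric]
    by (rule second_moment[where K=C]) (use b c in \<open>auto intro!: ennreal_leI\<close>)
  moreover have "(\<integral>\<^sup>+w. ennreal (pos_stat \<phi> w * pos_stat \<psi> w) \<partial>M) = (\<integral>\<^sup>+w. nu w (\<lambda>t. ennreal (\<phi> t)) * nu w (\<lambda>t. ennreal (\<psi> t)) \<partial>M)"
    by (rule nn_integral_cong_AE) (use nonneg_mean(1)[OF \<phi> p] nonneg_mean(1)[OF \<psi> q] in \<open>eventually_elim; simp add: pos_stat_def ennreal_enn2real less_top ennreal_mult\<close>)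
  ultimately have E: "(\<integral>\<^sup>+w. ennreal (pos_stat \<phi> w * pos_stat \<psi> w) \<partial>M) = ennreal ?V" by simp
  have "has_bochner_integral M (\<lambda>w. pos_stat \<phi> w * pos_stat \<psi> w) ?V"
  proof (rule has_bochner_integral_nn_integral[OF _ _ _ E])
    show "0 \<le> ?V" using n1 n2 by simp
    show "AE w in M. 0 \<le> pos_stat \<phi> w * pos_stat \<psi> w" by (simp add: pos_stat_def)
  qed measurable
  then show "integrable M (\<lambda>w. pos_stat \<phi> w * pos_stat \<psi> w)" "(LINT w|M. pos_stat \<phi> w * pos_stat \<psi> w) = ?V"
    by (auto simp: has_bochner_integral_iff)
qed

definition stat :: "(real \<Rightarrow> real) \<Rightarrow> 'a \<Rightarrow> real" where
  "stat \<psi> w = pos_stat (\<lambda>t. max 0 (\<psi> t)) w - pos_stat (\<lambda>t. max 0 (- \<psi> t)) w"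

lemma stat_AE:
  assumes \<psi>: "integrable lborel \<psi>"
  shows "AE w in M. integrable (count_space (zeros w)) \<psi> \<and> (LINT t|count_space (zeros w). \<psi> t) = stat \<psi> w"
proof -
  have i: "integrable lborel (\<lambda>t. max 0 (\<psi> t))" "integrable lborel (\<lambda>t. max 0 (- \<psi> t))" using \<psi> by (auto intro!: integrable_max)
  show ?thesis using nonneg_mean(1)[OF i(1) max.cobounded1] nonneg_mean(1)[OF i(2) max.cobounded1]
  proof eventually_elim
    case (elim w)
    have m: "ennreal (max 0 x) = ennreal x" for x by (simp add: max_def ennreal_neg)
    from elim have fin: "(\<integral>\<^sup>+t. ennreal (\<psi> t) \<partial>count_space (zeros w)) \<noteq> \<infinity>" "(\<integral>\<^sup>+t. ennreal (- \<psi> t) \<partial>count_space (zeros w)) \<noteq> \<infinity>"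
      by (simp_all add: nu_count_space m)
    have "integrable (count_space (zeros w)) \<psi>" unfolding real_integrable_def using fin by simp
    then show ?case by (simp add: real_lebesgue_integral_def stat_def pos_stat_def nu_count_space m)
  qed
qed

text \<open>Bilinear expansion in positive and negative parts, which inherit integrability and the
  bound \<open>C\<close>.\<close>

lemma stat_moments:
  assumes \<phi>: "integrable lborel \<phi>" and b: "\<And>t. \<bar>\<phi> t\<bar> \<le> C" and \<psi>: "integrable lborel \<psi>" and c: "\<And>t. \<bar>\<psi> t\<bar> \<le> C"
  shows "stat \<phi> \<in> borel_measurable M" "integrable M (stat \<phi>)" "(LINT w|M. stat \<phi> w) = (LINT t|lborel. \<phi> t) / pi"
    and "integrable M (\<lambda>w. stat \<phi> w * stat \<psi> w)"
    and "(LINT w|M. stat \<phi> w * stat \<psi> w) = (LINT t|lborel. \<phi> t * \<psi> t) / pi +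
      ((LINT t|lborel. \<phi> t) * (LINT t|lborel. \<psi> t) + kernel_form \<phi> \<psi>) / pi\<^sup>2"
proof -
  define \<phi>p \<phi>n \<psi>p \<psi>n where "\<phi>p = (\<lambda>t. max 0 (\<phi> t))" and "\<phi>n = (\<lambda>t. max 0 (- \<phi> t))" and "\<psi>p = (\<lambda>t. max 0 (\<psi> t))" and "\<psi>n = (\<lambda>t. max 0 (- \<psi> t))"
  note defs = \<phi>p_def \<phi>n_def \<psi>p_def \<psi>n_def
  have s: "stat \<phi> = (\<lambda>w. pos_stat \<phi>p w - pos_stat \<phi>n w)" "stat \<psi> = (\<lambda>w. pos_stat \<psi>p w - pos_stat \<psi>n w)"
    unfolding defs by (auto simp: stat_def)
  have d: "\<phi> t = \<phi>p t - \<phi>n t" "\<psi> t = \<psi>p t - \<psi>n t" for t unfolding defs by auto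
  have i: "integrable lborel \<phi>p" "integrable lborel \<phi>n" "integrable lborel \<psi>p" "integrable lborel \<psi>n"
    unfolding defs using \<phi> \<psi> by (auto intro!: integrable_max)
  have p: "0 \<le> \<phi>p t" "0 \<le> \<phi>n t" "0 \<le> \<psi>p t" "0 \<le> \<psi>n t" for t by (auto simp: defs)
  have C0: "0 \<le> C" using b[of 0] by linarith
  have q: "\<phi>p t \<le> C" "\<phi>n t \<le> C" "\<psi>p t \<le> C" "\<psi>n t \<le> C" for t using b[of t] c[of t] C0 by (auto simp: defs)
  have ab: "\<bar>\<psi>p t\<bar> \<le> C" "\<bar>\<psi>n t\<bar> \<le> C" for t using p(3,4)[of t] q(3,4)[of t] by auto
  show "stat \<phi> \<in> borel_measurable M" unfolding s using nonneg_mean(4)[OF i(1) p(1)] nonneg_mean(4)[OF i(2) p(2)] by measurable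
  show "integrable M (stat \<phi>)" unfolding s by (intro Bochner_Integration.integrable_diff nonneg_mean(2) i p)
  have "(LINT t|lborel. \<phi> t) = (LINT t|lborel. \<phi>p t) - (LINT t|lborel. \<phi>n t)"
    unfolding d by (rule Bochner_Integration.integral_diff[OF i(1,2)])
  then show "(LINT w|M. stat \<phi> w) = (LINT t|lborel. \<phi> t) / pi"
    unfolding s using nonneg_mean(2,3)[OF i(1) p(1)] nonneg_mean(2,3)[OF i(2) p(2)] by (simp add: diff_divide_distrib)
  note m1 = nonneg_second_moment[OF i(1) p(1) q(1) i(3) p(3) q(3)]
  note m2 = nonneg_second_moment[OF i(1) p(1) q(1) i(4) p(4) q(4)]
  note m3 = nonneg_second_moment[OF i(2) p(2) q(2) i(3) p(3) q(3)]
  note m4 = nonneg_second_moment[OF i(2) p(2) q(2) i(4) p(4) q(4)]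
  have e: "stat \<phi> w * stat \<psi> w = (pos_stat \<phi>p w * pos_stat \<psi>p w - pos_stat \<phi>p w * pos_stat \<psi>n w) - (pos_stat \<phi>n w * pos_stat \<psi>p w - pos_stat \<phi>n w * pos_stat \<psi>n w)" for w
    unfolding s by (simp add: algebra_simps)
  show "integrable M (\<lambda>w. stat \<phi> w * stat \<psi> w)" unfolding e
    by (intro Bochner_Integration.integrable_diff m1(1) m2(1) m3(1) m4(1))
  have E: "(LINT w|M. stat \<phi> w * stat \<psi> w) = ((LINT w|M. pos_stat \<phi>p w * pos_stat \<psi>p w) - (LINT w|M. pos_stat \<phi>p w * pos_stat \<psi>n w))
    - ((LINT w|M. pos_stat \<phi>n w * pos_stat \<psi>p w) - (LINT w|M. pos_stat \<phi>n w * pos_stat \<psi>n w))"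
    unfolding e by (simp only: Bochner_Integration.integral_diff Bochner_Integration.integrable_diff m1(1) m2(1) m3(1) m4(1))
  have I1: "(LINT t|lborel. \<phi> t * \<psi> t) = ((LINT t|lborel. \<phi>p t * \<psi>p t) - (LINT t|lborel. \<phi>p t * \<psi>n t)) - ((LINT t|lborel. \<phi>n t * \<psi>p t) - (LINT t|lborel. \<phi>n t * \<psi>n t))"
  proof -
    have "\<phi> t * \<psi> t = (\<phi>p t * \<psi>p t - \<phi>p t * \<psi>n t) - (\<phi>n t * \<psi>p t - \<phi>n t * \<psi>n t)" for t unfolding d by (simp add: algebra_simps)
    then show ?thesis by (simp only: Bochner_Integration.integral_diff Bochner_Integration.integrable_diff
      bounded_product_integrable[OF i(1) i(3) ab(1)] bounded_product_integrable[OF i(1) i(4) ab(2)]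
      bounded_product_integrable[OF i(2) i(3) ab(1)] bounded_product_integrable[OF i(2) i(4) ab(2)])
  qed
  have I2: "kernel_form \<phi> \<psi> = (kernel_form \<phi>p \<psi>p - kernel_form \<phi>p \<psi>n) - (kernel_form \<phi>n \<psi>p - kernel_form \<phi>n \<psi>n)"
  proof -
    have "\<phi> x * \<psi> y * z = (\<phi>p x * \<psi>p y * z - \<phi>p x * \<psi>n y * z) - (\<phi>n x * \<psi>p y * z - \<phi>n x * \<psi>n y * z)" for x y z unfolding d by (simp add: algebra_simps)
    then show ?thesis unfolding kernel_form_def by (simp only: Bochner_Integration.integral_diff Bochner_Integration.integrable_diff
      kernel_integrable[OF i(1) i(3) ab(1)] kernel_integrable[OF i(1) i(4) ab(2)]
      kernel_integrable[OF i(2) i(3) ab(1)] kernel_integrable[OF i(2) i(4) ab(2)])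
  qed
  have I3: "(LINT t|lborel. \<phi> t) = (LINT t|lborel. \<phi>p t) - (LINT t|lborel. \<phi>n t)" "(LINT t|lborel. \<psi> t) = (LINT t|lborel. \<psi>p t) - (LINT t|lborel. \<psi>n t)"
    unfolding d by (rule Bochner_Integration.integral_diff[OF i(1,2)], rule Bochner_Integration.integral_diff[OF i(3,4)])
  show "(LINT w|M. stat \<phi> w * stat \<psi> w) = (LINT t|lborel. \<phi> t * \<psi> t) / pi +
      ((LINT t|lborel. \<phi> t) * (LINT t|lborel. \<psi> t) + kernel_form \<phi> \<psi>) / pi\<^sup>2"
    unfolding E m1(2) m2(2) m3(2) m4(2) I1 I2 I3
    by (simp add: diff_divide_distrib add_divide_distrib left_diff_distrib right_diff_distrib)
qed

text \<open>The product of the integrals divided by \<open>pi\<^sup>2\<close> is exactly the product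
  of the two means and cancels; the diagonal term and the kernel term remain.\<close>

lemma stat_covariance:
  assumes \<phi>: "integrable lborel \<phi>" and b: "\<And>t. \<bar>\<phi> t\<bar> \<le> C" and \<psi>: "integrable lborel \<psi>" and c: "\<And>t. \<bar>\<psi> t\<bar> \<le> C"
  shows "integrable M (\<lambda>w. (stat \<phi> w - (LINT w|M. stat \<phi> w)) * (stat \<psi> w - (LINT w|M. stat \<psi> w)))"
    and "(LINT w|M. (stat \<phi> w - (LINT w|M. stat \<phi> w)) * (stat \<psi> w - (LINT w|M. stat \<psi> w))) =
      (LINT t|lborel. \<phi> t * \<psi> t) / pi + kernel_form \<phi> \<psi> / pi\<^sup>2"
proof -
  define m n where "m = (LINT w|M. stat \<phi> w)" and "n = (LINT w|M. stat \<psi> w)"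
  note A = stat_moments[OF \<phi> b \<psi> c] and B = stat_moments[OF \<psi> c \<phi> b]
  have e: "(stat \<phi> w - m) * (stat \<psi> w - n) = stat \<phi> w * stat \<psi> w - n * stat \<phi> w - m * stat \<psi> w + m * n" for w
    by (simp add: algebra_simps)
  have i: "integrable M (\<lambda>w. stat \<phi> w * stat \<psi> w)" "integrable M (\<lambda>w. n * stat \<phi> w)" "integrable M (\<lambda>w. m * stat \<psi> w)"
    using A(4) A(2) B(2) by auto
  show "integrable M (\<lambda>w. (stat \<phi> w - m) * (stat \<psi> w - n))"
    unfolding e using i by simp
  have "(LINT w|M. (stat \<phi> w - m) * (stat \<psi> w - n)) = (LINT w|M. stat \<phi> w * stat \<psi> w) - m * n"
    unfolding e using i by (simp add: prob_space m_def[symmetric] n_def[symmetric])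
  also have "\<dots> = (LINT t|lborel. \<phi> t * \<psi> t) / pi + kernel_form \<phi> \<psi> / pi\<^sup>2"
    unfolding A(5) m_def n_def A(3) B(3) by (simp add: add_divide_distrib power2_eq_square)
  finally show "(LINT w|M. (stat \<phi> w - m) * (stat \<psi> w - n)) = (LINT t|lborel. \<phi> t * \<psi> t) / pi + kernel_form \<phi> \<psi> / pi\<^sup>2" .
qed

definition variance_rate :: real where
  "variance_rate = 1 / pi + (LINT t|lborel. F t) / pi\<^sup>2"

lemma covariance_asymptotics:
  assumes \<psi>1: "integrable lborel \<psi>1" and \<psi>2: "integrable lborel \<psi>2" and bnd: "\<And>x. \<bar>\<psi>2 x\<bar> \<le> C"
    and ae: "AE x in lborel. \<psi>2 x = \<phi> x" and cont: "AE x in lborel. isCont \<phi> x"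
  shows "((\<lambda>R. ((LINT t|lborel. \<psi>1 (t / R) * \<psi>2 (t / R)) / pi + kernel_form (\<lambda>t. \<psi>1 (t / R)) (\<lambda>t. \<psi>2 (t / R)) / pi\<^sup>2) / R)
     \<longlongrightarrow> variance_rate * (LINT x|lborel. \<psi>1 x * \<psi>2 x)) at_top"
proof -
  have [measurable]: "\<psi>2 \<in> borel_measurable borel" using \<psi>2 by auto
  let ?k = "\<lambda>R. LINT t|lborel. F t * (LINT x|lborel. \<psi>1 x * \<psi>2 (x + t / R))"
  have "((LINT t|lborel. \<psi>1 (t / R) * \<psi>2 (t / R)) / pi + kernel_form (\<lambda>t. \<psi>1 (t / R)) (\<lambda>t. \<psi>2 (t / R)) / pi\<^sup>2) / R
     = (LINT x|lborel. \<psi>1 x * \<psi>2 x) / pi + ?k R / pi\<^sup>2" if R: "0 < R" for R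
  proof -
    have "(LINT t|lborel. \<psi>1 (t / R) * \<psi>2 (t / R)) = R * (LINT x|lborel. \<psi>1 x * \<psi>2 x)"
      using R by (subst lborel_integral_real_affine[of R _ 0]) auto
    moreover have "kernel_form (\<lambda>t. \<psi>1 (t / R)) (\<lambda>t. \<psi>2 (t / R)) = R * ?k R"
      unfolding kernel_form_def by (rule kernel_change_of_variables(2)[OF \<psi>1 _ bnd F_int R]) simp
    ultimately show ?thesis using R by (simp add: field_simps)
  qed
  then have ev: "\<forall>\<^sub>F R in at_top. ((LINT t|lborel. \<psi>1 (t / R) * \<psi>2 (t / R)) / pi + kernel_form (\<lambda>t. \<psi>1 (t / R)) (\<lambda>t. \<psi>2 (t / R)) / pi\<^sup>2) / R
     = (LINT x|lborel. \<psi>1 x * \<psi>2 x) / pi + ?k R / pi\<^sup>2"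
    using eventually_gt_at_top[of "0::real"] by (rule eventually_mono[rotated])
  have "((\<lambda>R. (LINT x|lborel. \<psi>1 x * \<psi>2 x) / pi + ?k R / pi\<^sup>2) \<longlongrightarrow> (LINT x|lborel. \<psi>1 x * \<psi>2 x) / pi + ((LINT t|lborel. F t) * (LINT x|lborel. \<psi>1 x * \<psi>2 x)) / pi\<^sup>2) at_top"
    by (intro tendsto_intros kernel_asymptotics[OF \<psi>1 _ bnd ae cont F_int]) simp_all
  moreover have "(LINT x|lborel. \<psi>1 x * \<psi>2 x) / pi + ((LINT t|lborel. F t) * (LINT x|lborel. \<psi>1 x * \<psi>2 x)) / pi\<^sup>2 = variance_rate * (LINT x|lborel. \<psi>1 x * \<psi>2 x)"
    by (simp add: variance_rate_def distrib_right)
  ultimately show ?thesis using tendsto_cong[OF ev] by simp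
qed

section \<open>Positivity of the variance rate\<close>

lemma abs_le_1_add_square: "\<bar>x\<bar> \<le> 1 + x\<^sup>2" for x :: real
proof -
  have "0 \<le> (1 - \<bar>x\<bar>)\<^sup>2" by simp
  then show ?thesis by (simp add: power2_diff)
qed

text \<open>Centred because \<open>f\<close> and \<open>f'\<close> both have variance 1. Its
  covariances with itself and with the number of zeros are both governed by \<open>C2\<close>, which
  is the reason for this choice.\<close>

definition z :: "real \<Rightarrow> 'a \<Rightarrow> real" where
  "z y w = (f y w)\<^sup>2 - (f' y w)\<^sup>2"

lemma z_mean: "integrable M (z y)" "(LINT w|M. z y w) = 0"
proof -
  note g = gauss_rv_moments(1,4)[OF gauss[OF X_H[of y]]] gauss_rv_moments(1,4)[OF gauss[OF X'_H[of y]]]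
  show "integrable M (z y)" unfolding z_def by (intro Bochner_Integration.integrable_diff g)
  show "(LINT w|M. z y w) = 0" unfolding z_def
    using Bochner_Integration.integral_diff[OF g(1)[of 2] g(3)[of 2]] by (simp add: g var_f var_f')
qed

lemma z_cov: "integrable M (\<lambda>w. z x w * z y w)" "(LINT w|M. z x w * z y w) = 2 * C2 (y - x)"
proof -
  note a = square_square_expectation[OF X_H[of x] X_H[of y]] and b = square_square_expectation[OF X_H[of x] X'_H[of y]]
    and c = square_square_expectation[OF X'_H[of x] X_H[of y]] and d = square_square_expectation[OF X'_H[of x] X'_H[of y]]
  have e: "z x w * z y w = ((f x w)\<^sup>2 * (f y w)\<^sup>2 - (f x w)\<^sup>2 * (f' y w)\<^sup>2) - ((f' x w)\<^sup>2 * (f y w)\<^sup>2 - (f' x w)\<^sup>2 * (f' y w)\<^sup>2)" for w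
    by (simp add: z_def algebra_simps)
  show "integrable M (\<lambda>w. z x w * z y w)" unfolding e by (intro Bochner_Integration.integrable_diff a(1) b(1) c(1) d(1))
  have k: "cov (f x) (f' y) = \<kappa>' (y - x)"
    unfolding cov_commute[of "f x"] cov_f'f using \<kappa>'_odd[of "y - x"] by simp
  have "(LINT w|M. z x w * z y w) = ((LINT w|M. (f x w)\<^sup>2 * (f y w)\<^sup>2) - (LINT w|M. (f x w)\<^sup>2 * (f' y w)\<^sup>2))
    - ((LINT w|M. (f' x w)\<^sup>2 * (f y w)\<^sup>2) - (LINT w|M. (f' x w)\<^sup>2 * (f' y w)\<^sup>2))"
    unfolding e by (simp only: Bochner_Integration.integral_diff Bochner_Integration.integrable_diff a(1) b(1) c(1) d(1))
  then show "(LINT w|M. z x w * z y w) = 2 * C2 (y - x)"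
    unfolding a(2) b(2) c(2) d(2) var_f var_f' cov_ff k cov_f'f cov_f'f' C2_def by simp
qed

lemma z_joint: "(\<lambda>p. z (fst p) (snd p)) \<in> borel_measurable (borel \<Otimes>\<^sub>M M)"
proof -
  note [measurable] = X_joint[unfolded split_beta'] X'_joint[unfolded split_beta']
  show ?thesis unfolding z_def by measurable
qed

lemma C2_meas[measurable]: "C2 \<in> borel_measurable borel"
  unfolding C2_def by measurable

lemma count_stat:
  "AE w in M. ncard (zeros w \<inter> {0..<R}) = ennreal (stat (indicator {0..<R}) w)"
  "0 \<le> stat (indicator {0..<R}) w"
proof -
  have m: "(\<lambda>t. ennreal (max 0 (indicator {0..<R} t))) = indicator {0..<R}" "(\<lambda>t. ennreal (max 0 (- indicator {0..<R} t))) = (\<lambda>t. 0)"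
    by (auto simp: fun_eq_iff split: split_indicator)
  have n0: "nu w (\<lambda>t. 0) = 0" for w by (simp add: nu_def)
  have s: "stat (indicator {0..<R}) w = enn2real (ncard (zeros w \<inter> {0..<R}))" for w
    unfolding stat_def pos_stat_def m n0 nu_indicator by simp
  show "0 \<le> stat (indicator {0..<R}) w" by (simp add: s)
  have "ncard (zeros w \<inter> {0..<R}) \<noteq> \<infinity>" for w
    using finite_zeros[of w 0 R] by (simp add: emeasure_count_space)
  then show "AE w in M. ncard (zeros w \<inter> {0..<R}) = ennreal (stat (indicator {0..<R}) w)"
    by (simp add: s ennreal_enn2real less_top)
qed

lemma weighted_count:
  assumes R: "0 < R" and Y: "Y \<in> H"
    and m: "(\<lambda>t. cov Y Y - (cov Y (f t))\<^sup>2 + (cov Y (f' t))\<^sup>2) \<in> borel_measurable borel"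
  shows "integrable M (\<lambda>w. (Y w)\<^sup>2 * stat (indicator {0..<R}) w)"
    and "(LINT w|M. (Y w)\<^sup>2 * stat (indicator {0..<R}) w) = (LINT t|lborel. indicator {0..<R} t * (cov Y Y - (cov Y (f t))\<^sup>2 + (cov Y (f' t))\<^sup>2)) / pi"
    and "integrable lborel (\<lambda>t. indicator {0..<R} t * (cov Y Y - (cov Y (f t))\<^sup>2 + (cov Y (f' t))\<^sup>2))"
proof -
  let ?g = "\<lambda>t. cov Y Y - (cov Y (f t))\<^sup>2 + (cov Y (f' t))\<^sup>2"
  note [measurable] = m meas_H[OF Y]
  have cs: "(cov Y (f t))\<^sup>2 \<le> cov Y Y" "(cov Y (f' t))\<^sup>2 \<le> cov Y Y" for t
    using cauchy_schwarz[OF Y X_H[of t]] cauchy_schwarz[OF Y X'_H[of t]] by (simp_all add: var_f var_f')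
  have g0: "0 \<le> ?g t" for t using cs(1)[of t] by simp
  have g1: "?g t \<le> 2 * cov Y Y" for t using cs(2)[of t] zero_le_power2[of "cov Y (f t)"] by linarith
  have ind: "integrable lborel (indicator {0..<R} :: real \<Rightarrow> real)" using R by (simp add: integrable_indicator_iff)
  have [measurable]: "stat (indicator {0..<R}) \<in> borel_measurable M"
    by (rule stat_moments(1)[OF ind _ ind, where C=1]) (auto split: split_indicator)
  show i: "integrable lborel (\<lambda>t. indicator {0..<R} t * ?g t)"
  proof (rule Bochner_Integration.integrable_bound)
    show "integrable lborel (\<lambda>t. 2 * cov Y Y * indicator {0..<R} t)" using ind by simp
    show "AE t in lborel. norm (indicator {0..<R} t * ?g t) \<le> norm (2 * cov Y Y * indicator {0..<R} t)"
    proof (rule AE_I2)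
      fix t
      have "\<bar>?g t\<bar> \<le> \<bar>2 * cov Y Y\<bar>" using g0[of t] g1[of t] by linarith
      then show "norm (indicator {0..<R} t * ?g t) \<le> norm (2 * cov Y Y * indicator {0..<R} t)"
        by (cases "t \<in> {0..<R}") simp_all
    qed
  qed measurable
  let ?I = "LINT t|lborel. indicator {0..<R} t * ?g t"
  have "(\<integral>\<^sup>+w. ennreal ((Y w)\<^sup>2 * stat (indicator {0..<R}) w) \<partial>M) = (\<integral>\<^sup>+w. ennreal ((Y w)\<^sup>2) * ncard (zeros w \<inter> {0..<R}) \<partial>M)"
    by (rule nn_integral_cong_AE, use count_stat(1)[of R] in eventually_elim) (simp add: ennreal_mult')
  also have "\<dots> = (\<integral>\<^sup>+t. ennreal (indicator {0..<R} t * ?g t / pi) \<partial>lborel)"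
    unfolding weighted_one_point[OF R Y] by (intro nn_integral_cong) (simp split: split_indicator)
  also have "\<dots> = ennreal (?I / pi)"
    using i g0 by (subst nn_integral_eq_integral) auto
  finally have e: "(\<integral>\<^sup>+w. ennreal ((Y w)\<^sup>2 * stat (indicator {0..<R}) w) \<partial>M) = ennreal (?I / pi)" .
  have "has_bochner_integral M (\<lambda>w. (Y w)\<^sup>2 * stat (indicator {0..<R}) w) (?I / pi)"
  proof (rule has_bochner_integral_nn_integral[OF _ _ _ e])
    show "0 \<le> ?I / pi" using g0 by (intro divide_nonneg_nonneg integral_nonneg_AE AE_I2) auto
    show "AE w in M. 0 \<le> (Y w)\<^sup>2 * stat (indicator {0..<R}) w" using count_stat(2) by simp
  qed measurable
  then show "integrable M (\<lambda>w. (Y w)\<^sup>2 * stat (indicator {0..<R}) w)" "(LINT w|M. (Y w)\<^sup>2 * stat (indicator {0..<R}) w) = ?I / pi"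
    by (auto simp: has_bochner_integral_iff)
qed

text \<open>At distance \<open>t - y\<close> the weighted intensity, up to the factor
  \<open>1 / pi\<close>, is \<open>1 - \<kappa>\<^sup>2 + \<kappa>'\<^sup>2\<close> for
  \<open>f y\<close> and \<open>1 - \<kappa>'\<^sup>2 + \<kappa>''\<^sup>2\<close> for
  \<open>f' y\<close>; in the difference the constants cancel and \<open>- C2\<close>
  remains.\<close>

lemma z_count:
  assumes R: "0 < R"
  shows "(LINT w|M. z y w * stat (indicator {0..<R}) w) = - (LINT t|lborel. indicator {0..<R} t * C2 (t - y)) / pi"
proof -
  have k: "cov (f y) (f' t) = \<kappa>' (t - y)" for t
    unfolding cov_commute[of "f y"] cov_f'f using \<kappa>'_odd[of "t - y"] by simp
  have m: "(\<lambda>t. cov (f y) (f y) - (cov (f y) (f t))\<^sup>2 + (cov (f y) (f' t))\<^sup>2) \<in> borel_measurable borel"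
    "(\<lambda>t. cov (f' y) (f' y) - (cov (f' y) (f t))\<^sup>2 + (cov (f' y) (f' t))\<^sup>2) \<in> borel_measurable borel"
    unfolding cov_ff k cov_f'f cov_f'f' by measurable
  note a = weighted_count[OF R X_H m(1)] and b = weighted_count[OF R X'_H m(2)]
  have "(LINT w|M. z y w * stat (indicator {0..<R}) w) = (LINT w|M. (f y w)\<^sup>2 * stat (indicator {0..<R}) w) - (LINT w|M. (f' y w)\<^sup>2 * stat (indicator {0..<R}) w)"
    unfolding z_def left_diff_distrib by (rule Bochner_Integration.integral_diff[OF a(1) b(1)])
  also have "\<dots> = ((LINT t|lborel. indicator {0..<R} t * (cov (f y) (f y) - (cov (f y) (f t))\<^sup>2 + (cov (f y) (f' t))\<^sup>2))
    - (LINT t|lborel. indicator {0..<R} t * (cov (f' y) (f' y) - (cov (f' y) (f t))\<^sup>2 + (cov (f' y) (f' t))\<^sup>2))) / pi"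
    unfolding a(2) b(2) diff_divide_distrib ..
  also have "\<dots> = (LINT t|lborel. - (indicator {0..<R} t * C2 (t - y))) / pi"
    unfolding Bochner_Integration.integral_diff[OF a(3) b(3), symmetric]
    by (intro arg_cong2[where f="(/)"] Bochner_Integration.integral_cong) (auto simp: var_f var_f' cov_ff k cov_f'f cov_f'f' C2_def algebra_simps)
  finally show ?thesis by simp
qed

text \<open>Let \<open>I\<close> be the double integral of \<open>C2\<close> over the square. The
  centred count \<open>N\<close> and \<open>Z\<close> have mean product \<open>- I / pi\<close>, and
  \<open>Z\<close> has second moment \<open>2 * I\<close>. The second moment of
  \<open>N + l * Z\<close> is therefore a quadratic polynomial in \<open>l\<close>; its
  nonnegativity at the chosen \<open>l\<close> is the claim.\<close>

lemma variance_lower_bound: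
  assumes R: "0 < R"
  defines "\<eta> \<equiv> (indicator {0..<R} :: real \<Rightarrow> real)"
  shows "(LINT y|lborel. \<eta> y * (LINT t|lborel. \<eta> t * C2 (t - y))) / (2 * pi\<^sup>2) \<le> (LINT t|lborel. \<eta> t * \<eta> t) / pi + kernel_form \<eta> \<eta> / pi\<^sup>2"
proof -
  define T where "T = restrict_space lborel {0..<R}"
  have sT: "{0..<R} \<inter> space lborel \<in> sets (lborel :: real measure)" by simp
  have mT: "g \<in> borel_measurable T" if "g \<in> borel_measurable borel" for g :: "real \<Rightarrow> real"
    unfolding T_def using that by (intro measurable_restrict_space1) simp
  have measT: "measure T (space T) = R"
    using R by (simp add: T_def measure_restrict_space)
  have emT: "emeasure T (space T) = ennreal R"
    using R by (simp add: T_def emeasure_restrict_space)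
  interpret T: finite_measure T by (rule finite_measureI) (simp add: emT)
  interpret TM: pair_sigma_finite T M ..
  interpret TT: pair_sigma_finite T T ..
  have IT: "(LINT y|T. g y) = (LINT y|lborel. \<eta> y * g y)" for g :: "real \<Rightarrow> real"
    unfolding T_def \<eta>_def using integral_restrict_space[OF sT, of g] by simp
  have zj[measurable]: "(\<lambda>p. z (fst p) (snd p)) \<in> borel_measurable (T \<Otimes>\<^sub>M M)"
  proof -
    have "(\<lambda>p. (fst p, snd p)) \<in> T \<Otimes>\<^sub>M M \<rightarrow>\<^sub>M borel \<Otimes>\<^sub>M M"
    proof (rule measurable_Pair)
      have "(\<lambda>y. y) \<in> T \<rightarrow>\<^sub>M borel" using mT[of "\<lambda>y. y"] by simp
      then show "(\<lambda>p. fst p) \<in> T \<Otimes>\<^sub>M M \<rightarrow>\<^sub>M borel" by (rule measurable_compose[OF measurable_fst])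
    qed simp
    from measurable_compose[OF this z_joint] show ?thesis by simp
  qed
  have zm[measurable]: "z y \<in> borel_measurable M" for y using z_mean(1) by auto
  have z2_pair: "integrable (T \<Otimes>\<^sub>M M) (\<lambda>p. (z (fst p) (snd p))\<^sup>2)"
  proof (rule TM.Fubini_integrable)
    have "(LINT w|M. norm ((z (fst (x, w)) (snd (x, w)))\<^sup>2)) = 2 * C2 0" for x
      using z_cov(2)[of x x] by (simp add: power2_eq_square)
    then show "integrable T (\<lambda>x. LINT w|M. norm ((z (fst (x, w)) (snd (x, w)))\<^sup>2))" by simp
    show "AE x in T. integrable M (\<lambda>w. (z (fst (x, w)) (snd (x, w)))\<^sup>2)" using z_cov(1) by (simp add: power2_eq_square)
  qed measurable
  have G2_pair: "integrable (T \<Otimes>\<^sub>M M) (\<lambda>p. (G (snd p))\<^sup>2)" if [measurable]: "G \<in> borel_measurable M" and G: "integrable M (\<lambda>w. (G w)\<^sup>2)" for G :: "'a \<Rightarrow> real"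
  proof (rule TM.Fubini_integrable)
    show "integrable T (\<lambda>x. LINT w|M. norm ((G (snd (x, w)))\<^sup>2))" by simp
    show "AE x in T. integrable M (\<lambda>w. (G (snd (x, w)))\<^sup>2)" using G by simp
  qed measurable
  have zG_pair: "integrable (T \<Otimes>\<^sub>M M) (\<lambda>(y, w). z y w * G w)" if Gm[measurable]: "G \<in> borel_measurable M" and G: "integrable M (\<lambda>w. (G w)\<^sup>2)" for G :: "'a \<Rightarrow> real"
  proof (rule Bochner_Integration.integrable_bound[OF Bochner_Integration.integrable_add[OF z2_pair G2_pair[OF Gm G]]])
    have "\<bar>x * y\<bar> \<le> x\<^sup>2 + y\<^sup>2" for x y :: real
    proof -
      have "2 * (\<bar>x\<bar> * \<bar>y\<bar>) \<le> x\<^sup>2 + y\<^sup>2" using sum_squares_bound[of "\<bar>x\<bar>" "\<bar>y\<bar>"] by simp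
      moreover have "0 \<le> \<bar>x\<bar> * \<bar>y\<bar>" by simp
      ultimately show ?thesis unfolding abs_mult by linarith
    qed
    then show "AE p in T \<Otimes>\<^sub>M M. norm (case p of (y, w) \<Rightarrow> z y w * G w) \<le> norm ((z (fst p) (snd p))\<^sup>2 + (G (snd p))\<^sup>2)"
      by (intro AE_I2) (simp add: split_beta')
    show "(\<lambda>(y, w). z y w * G w) \<in> borel_measurable (T \<Otimes>\<^sub>M M)" unfolding split_beta' by measurable
  qed
  define Z where "Z w = (LINT y|T. z y w)" for w
  have Zm[measurable]: "Z \<in> borel_measurable M"
    unfolding Z_def by (rule T.borel_measurable_lebesgue_integral) (use measurable_pair_swap[OF zj] in \<open>simp add: split_beta'\<close>)
  have Fub: "(LINT w|M. Z w * G w) = (LINT y|T. LINT w|M. z y w * G w)" if "G \<in> borel_measurable M" "integrable M (\<lambda>w. (G w)\<^sup>2)" for G :: "'a \<Rightarrow> real"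
    using TM.Fubini_integral[OF zG_pair[OF that]] unfolding Z_def by simp
  have Z2: "integrable M (\<lambda>w. (Z w)\<^sup>2)"
  proof (rule Bochner_Integration.integrable_bound)
    show "integrable M (\<lambda>w. R * (LINT y|T. (z y w)\<^sup>2))"
      using TM.integrable_snd[of "\<lambda>y w. (z y w)\<^sup>2"] z2_pair by (simp add: split_beta')
    have "AE w in M. integrable T (\<lambda>y. (z y w)\<^sup>2)"
      using TM.AE_integrable_snd[of "\<lambda>y w. (z y w)\<^sup>2"] z2_pair by (simp add: split_beta')
    then show "AE w in M. norm ((Z w)\<^sup>2) \<le> norm (R * (LINT y|T. (z y w)\<^sup>2))"
    proof eventually_elim
      case (elim w)
      have zT[measurable]: "(\<lambda>y. z y w) \<in> borel_measurable T"
      proof (rule mT, rule borel_measurable_continuous_onI)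
        show "continuous_on UNIV (\<lambda>y. z y w)" unfolding z_def by (intro continuous_intros X_cont X'_cont)
      qed
      have i: "integrable T (\<lambda>y. z y w)"
        by (rule Bochner_Integration.integrable_bound[of _ "\<lambda>y. 1 + (z y w)\<^sup>2"]) (use elim abs_le_1_add_square in auto)
      \<comment> \<open>Subtracting the average \<open>Z w / R\<close> over \<open>T\<close>, a
        space of mass \<open>R\<close>, proves the Cauchy-Schwarz bound for
        \<open>Z w\<close>.\<close>
      have "0 \<le> (LINT y|T. (z y w - Z w / R)\<^sup>2)" by simp
      also have "(\<lambda>y. (z y w - Z w / R)\<^sup>2) = (\<lambda>y. ((z y w)\<^sup>2 - 2 * (Z w / R) * z y w) + (Z w / R)\<^sup>2)"
        by (rule ext) (simp add: power2_diff)
      also have "(LINT y|T. \<dots> y) = ((LINT y|T. (z y w)\<^sup>2) - 2 * (Z w / R) * Z w) + R * (Z w / R)\<^sup>2"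
        using i elim by (simp add: Z_def measT)
      also have "\<dots> = (LINT y|T. (z y w)\<^sup>2) - (Z w)\<^sup>2 / R"
        using R by (simp add: field_simps power2_eq_square)
      finally have "(Z w)\<^sup>2 \<le> R * (LINT y|T. (z y w)\<^sup>2)" using R by (simp add: field_simps)
      then show ?case by simp
    qed
  qed measurable
  have ind: "integrable lborel \<eta>" and indb: "\<bar>\<eta> t\<bar> \<le> 1" for t
    unfolding \<eta>_def using R by (simp_all add: integrable_indicator_iff split: split_indicator)
  define N where "N w = stat \<eta> w - (LINT w|M. stat \<eta> w)" for w
  note sm = stat_moments[OF ind indb ind indb]
  have Nm[measurable]: "N \<in> borel_measurable M" unfolding N_def using sm(1) by measurable
  have N2: "integrable M (\<lambda>w. (N w)\<^sup>2)" "(LINT w|M. (N w)\<^sup>2) = (LINT t|lborel. \<eta> t * \<eta> t) / pi + kernel_form \<eta> \<eta> / pi\<^sup>2"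
  proof -
    have sq: "(N w)\<^sup>2 = (stat \<eta> w - (LINT w|M. stat \<eta> w)) * (stat \<eta> w - (LINT w|M. stat \<eta> w))" for w
      by (simp add: N_def power2_eq_square)
    show "integrable M (\<lambda>w. (N w)\<^sup>2)" "(LINT w|M. (N w)\<^sup>2) = (LINT t|lborel. \<eta> t * \<eta> t) / pi + kernel_form \<eta> \<eta> / pi\<^sup>2"
      unfolding sq by (rule stat_covariance[OF ind indb ind indb])+
  qed
  define I where "I = (LINT y|T. LINT t|T. C2 (t - y))"
  have ZN: "(LINT w|M. Z w * N w) = - I / pi"
  proof -
    have "(LINT w|M. z y w * N w) = - (LINT t|T. C2 (t - y)) / pi" for y
    proof -
      have zs: "integrable M (\<lambda>w. z y w * stat \<eta> w)"
      proof -
        have k: "cov (f y) (f' t) = \<kappa>' (t - y)" for t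
          unfolding cov_commute[of "f y"] cov_f'f using \<kappa>'_odd[of "t - y"] by simp
        have "integrable M (\<lambda>w. (f y w)\<^sup>2 * stat \<eta> w)" unfolding \<eta>_def
          by (rule weighted_count(1)[OF R X_H]) (unfold cov_ff k, measurable)
        moreover have "integrable M (\<lambda>w. (f' y w)\<^sup>2 * stat \<eta> w)" unfolding \<eta>_def
          by (rule weighted_count(1)[OF R X'_H]) (unfold cov_f'f cov_f'f', measurable)
        ultimately show ?thesis unfolding z_def left_diff_distrib by (rule Bochner_Integration.integrable_diff)
      qed
      have "(LINT w|M. z y w * N w) = (LINT w|M. z y w * stat \<eta> w) - (LINT w|M. z y w * (LINT w|M. stat \<eta> w))"
        unfolding N_def right_diff_distrib using zs z_mean(1)[of y] by (intro Bochner_Integration.integral_diff) auto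
      also have "\<dots> = - (LINT t|T. C2 (t - y)) / pi"
        using z_count[OF R, of y] z_mean(2)[of y] unfolding IT by (simp add: \<eta>_def)
      finally show ?thesis .
    qed
    then show ?thesis using Fub[OF Nm N2(1)] by (simp add: I_def)
  qed
  have ZZ: "(LINT w|M. Z w * Z w) = 2 * I"
  proof -
    have "(LINT w|M. z y w * Z w) = 2 * (LINT t|T. C2 (t - y))" for y
    proof -
      have "(LINT w|M. Z w * z y w) = (LINT t|T. LINT w|M. z t w * z y w)"
        by (rule Fub[OF zm]) (use z_cov(1)[of y y] in \<open>simp add: power2_eq_square\<close>)
      also have "\<dots> = (LINT t|T. 2 * C2 (t - y))"
        using z_cov(2)[of y] by (simp add: mult.commute[of "z _ _" "z y _"])
      finally show ?thesis by (simp add: mult.commute)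
    qed
    then show ?thesis using Fub[OF Zm Z2] by (simp add: I_def)
  qed
  have iZN: "integrable M (\<lambda>w. Z w * N w)"
  proof (rule Bochner_Integration.integrable_bound[OF Bochner_Integration.integrable_add[OF Z2 N2(1)]])
    have "\<bar>x * y\<bar> \<le> x\<^sup>2 + y\<^sup>2" for x y :: real
    proof -
      have "2 * (\<bar>x\<bar> * \<bar>y\<bar>) \<le> x\<^sup>2 + y\<^sup>2" using sum_squares_bound[of "\<bar>x\<bar>" "\<bar>y\<bar>"] by simp
      moreover have "0 \<le> \<bar>x\<bar> * \<bar>y\<bar>" by simp
      ultimately show ?thesis unfolding abs_mult by linarith
    qed
    then show "AE w in M. norm (Z w * N w) \<le> norm ((Z w)\<^sup>2 + (N w)\<^sup>2)" by simp
  qed measurable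
  \<comment> \<open>The minimiser of the polynomial with linear coefficient
    \<open>- 2 * I / pi\<close> and quadratic coefficient \<open>2 * I\<close>; it lowers the value
    by \<open>I / (2 * pi\<^sup>2)\<close>.\<close>
  define l where "l = 1 / (2 * pi)"
  have "0 \<le> (LINT w|M. (N w + l * Z w)\<^sup>2)" by simp
  also have "(\<lambda>w. (N w + l * Z w)\<^sup>2) = (\<lambda>w. (N w)\<^sup>2 + 2 * l * (Z w * N w) + l\<^sup>2 * (Z w)\<^sup>2)"
    by (rule ext) (simp add: power2_eq_square algebra_simps)
  also have "(LINT w|M. \<dots> w) = (LINT w|M. (N w)\<^sup>2) + 2 * l * (LINT w|M. Z w * N w) + l\<^sup>2 * (LINT w|M. (Z w)\<^sup>2)"
    using N2(1) iZN Z2 by simp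
  also have "\<dots> = (LINT w|M. (N w)\<^sup>2) - I / (2 * pi\<^sup>2)"
    unfolding ZN using ZZ by (simp add: l_def power2_eq_square field_simps)
  finally show ?thesis unfolding N2(2) I_def IT by simp
qed

text \<open>The lower bound on \<open>{0..<R}\<close>, divided by \<open>R\<close>, compares two
  rescaled forms of the indicator of \<open>{0..<1}\<close>, with kernels \<open>F\<close> and
  \<open>C2\<close>, whose limits are known. The indicator is continuous off 0 and 1, as the limit
  theorem demands.\<close>

lemma variance_rate_pos: "0 < variance_rate"
proof -
  let ?\<psi> = "indicator {0..<1} :: real \<Rightarrow> real"
  have \<psi>: "integrable lborel ?\<psi>" and \<psi>m: "?\<psi> \<in> borel_measurable borel" and \<psi>b: "\<bar>?\<psi> x\<bar> \<le> 1" for x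
    by (simp_all add: integrable_indicator_iff split: split_indicator)
  have cont: "AE x in lborel. isCont ?\<psi> x"
    using AE_lborel_singleton[of 0] AE_lborel_singleton[of 1]
  proof eventually_elim
    case (elim x)
    have "frontier {0..<1::real} = {0, 1}" by (simp add: frontier_def)
    with elim show ?case by (subst isCont_indicator) auto
  qed
  have \<psi>2: "(LINT x|lborel. ?\<psi> x * ?\<psi> x) = 1"
    by (simp add: indicator_inter_arith[symmetric])
  have s: "?\<psi> (x / R) = indicator {0..<R} x" if "0 < R" for x R
    using that by (auto split: split_indicator simp: field_simps)
  let ?V = "\<lambda>R. ((LINT t|lborel. ?\<psi> (t / R) * ?\<psi> (t / R)) / pi + kernel_form (\<lambda>t. ?\<psi> (t / R)) (\<lambda>t. ?\<psi> (t / R)) / pi\<^sup>2) / R"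
  let ?k = "\<lambda>R. LINT t|lborel. C2 t * (LINT x|lborel. ?\<psi> x * ?\<psi> (x + t / R))"
  have lV: "(?V \<longlongrightarrow> variance_rate * 1) at_top"
    using covariance_asymptotics[OF \<psi> \<psi> \<psi>b _ cont] \<psi>2 by simp
  have lk: "((\<lambda>R. ?k R / (2 * pi\<^sup>2)) \<longlongrightarrow> (LINT t|lborel. C2 t) * 1 / (2 * pi\<^sup>2)) at_top"
    using kernel_asymptotics[OF \<psi> \<psi>m \<psi>b _ cont C2_int] \<psi>2 by (intro tendsto_intros) simp_all
  have "?k R / (2 * pi\<^sup>2) \<le> ?V R" if R: "0 < R" for R
  proof -
    let ?\<eta> = "indicator {0..<R} :: real \<Rightarrow> real"
    have i: "integrable (lborel \<Otimes>\<^sub>M lborel) (\<lambda>(x, y). ?\<psi> (x / R) * ?\<psi> (y / R) * C2 (y - x))"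
      by (rule kernel_change_of_variables(1)[OF \<psi> \<psi>m \<psi>b C2_int R])
    have "R * ?k R = (LINT p|(lborel \<Otimes>\<^sub>M lborel). ?\<psi> (fst p / R) * ?\<psi> (snd p / R) * C2 (snd p - fst p))"
      by (rule kernel_change_of_variables(2)[OF \<psi> \<psi>m \<psi>b C2_int R, symmetric])
    also have "\<dots> = (LINT x|lborel. LINT y|lborel. ?\<psi> (x / R) * ?\<psi> (y / R) * C2 (y - x))"
      using lborel_pair.integral_fst'[OF i] by (simp add: split_beta')
    also have "\<dots> = (LINT y|lborel. ?\<eta> y * (LINT t|lborel. ?\<eta> t * C2 (t - y)))"
      by (simp add: s[OF R] mult.assoc)
    finally have "?k R / (2 * pi\<^sup>2) = (LINT y|lborel. ?\<eta> y * (LINT t|lborel. ?\<eta> t * C2 (t - y))) / (2 * pi\<^sup>2) / R"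
      using R by (simp add: field_simps)
    also have "\<dots> \<le> ((LINT t|lborel. ?\<eta> t * ?\<eta> t) / pi + kernel_form ?\<eta> ?\<eta> / pi\<^sup>2) / R"
      using R by (intro divide_right_mono variance_lower_bound) auto
    also have "\<dots> = ?V R" unfolding s[OF R] ..
    finally show ?thesis .
  qed
  then have "\<forall>\<^sub>F R in at_top. ?k R / (2 * pi\<^sup>2) \<le> ?V R"
    using eventually_gt_at_top[of "0::real"] by (rule eventually_mono[rotated])
  from tendsto_le[OF _ lV lk this] have "(LINT t|lborel. C2 t) / (2 * pi\<^sup>2) \<le> variance_rate" by simp
  moreover have "0 < (LINT t|lborel. C2 t) / (2 * pi\<^sup>2)" using C2_integral_pos by simp
  ultimately show ?thesis by linarith
qed

end

section \<open>Regular versions of the process\<close>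

definition span_set :: "(real \<Rightarrow> 'a \<Rightarrow> real) \<Rightarrow> ('a \<Rightarrow> real) set" where
  "span_set X = {Y. \<exists>I c. finite I \<and> Y = (\<lambda>w. \<Sum>t\<in>I. c t * X t w)}"

lemma span_set_lin:
  assumes "Y \<in> span_set X" "Z \<in> span_set X"
  shows "(\<lambda>w. a * Y w + b * Z w) \<in> span_set X"
proof -
  obtain I c where I: "finite I" "Y = (\<lambda>w. \<Sum>t\<in>I. c t * X t w)" using assms(1) unfolding span_set_def by blast
  obtain J d where J: "finite J" "Z = (\<lambda>w. \<Sum>t\<in>J. d t * X t w)" using assms(2) unfolding span_set_def by blast
  have 1: "(\<Sum>t\<in>I. c t * X t w) = (\<Sum>t\<in>I \<union> J. (if t \<in> I then c t else 0) * X t w)" for w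
    by (rule sum.mono_neutral_cong_left) (use I J in auto)
  have 2: "(\<Sum>t\<in>J. d t * X t w) = (\<Sum>t\<in>I \<union> J. (if t \<in> J then d t else 0) * X t w)" for w
    by (rule sum.mono_neutral_cong_left) (use I J in auto)
  have "a * Y w + b * Z w = (\<Sum>t\<in>I \<union> J. (a * (if t \<in> I then c t else 0) + b * (if t \<in> J then d t else 0)) * X t w)" for w
    unfolding I(2) J(2) 1 2 sum_distrib_left sum.distrib[symmetric] by (rule sum.cong) (simp_all only: distrib_right mult.assoc)
  then have "(\<lambda>w. a * Y w + b * Z w) = (\<lambda>w. \<Sum>t\<in>I \<union> J. (a * (if t \<in> I then c t else 0) + b * (if t \<in> J then d t else 0)) * X t w)"
    by (rule ext)
  then show ?thesis unfolding span_set_def using I(1) J(1)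
    by (intro CollectI exI[of _ "I \<union> J"] exI[of _ "\<lambda>t. a * (if t \<in> I then c t else 0) + b * (if t \<in> J then d t else 0)"] conjI finite_UnI)
qed

lemma span_set_base: "X t \<in> span_set X"
  unfolding span_set_def by (intro CollectI exI[of _ "{t}"] exI[of _ "\<lambda>_. 1"]) simp

context prob_space
begin

definition gauss_closure :: "(real \<Rightarrow> 'a \<Rightarrow> real) \<Rightarrow> ('a \<Rightarrow> real) set" where
  "gauss_closure X = {Y \<in> borel_measurable M. \<exists>Yn. (\<forall>n. Yn n \<in> span_set X) \<and> (AE w in M. (\<lambda>n. Yn n w) \<longlonglongrightarrow> Y w)}"

text \<open>Being centred forces the constant or the mean allowed by
  \<open>gaussian_variable\<close> to be 0.\<close>

lemma span_set_gauss:
  assumes g: "gaussian_process M X" and c: "centered_process M X" and Y: "Y \<in> span_set X"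
  shows "\<exists>v. gauss_rv M Y v"
proof -
  obtain I c where I: "finite I" "Y = (\<lambda>w. \<Sum>t\<in>I. c t * X t w)" using Y unfolding span_set_def by blast
  have gv: "gaussian_variable M Y" using g I unfolding gaussian_process_def by blast
  have m: "Y \<in> borel_measurable M" using gv unfolding gaussian_variable_def by blast
  have "expectation Y = (\<Sum>t\<in>I. c t * (LINT w|M. X t w))"
    using c unfolding I(2) centered_process_def by (subst Bochner_Integration.integral_sum) auto
  then have E: "expectation Y = 0" using c unfolding centered_process_def by simp
  from gv consider (const) \<mu> where "AE w in M. Y w = \<mu>" | (normal) \<mu> \<sigma> where "0 < \<sigma>" "distributed M lborel Y (normal_density \<mu> \<sigma>)"
    unfolding gaussian_variable_def by blast
  then show ?thesis
  proof cases
    case const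
    have "expectation Y = (LINT w|M. \<mu>)" by (rule integral_cong_AE) (use const m in auto)
    then have "\<mu> = 0" using E by (simp add: prob_space)
    then have "AE w in M. 0 = Y w" using const by auto
    from gauss_rv_AE_cong[OF zero_imp_gauss_rv this m] show ?thesis by blast
  next
    case normal
    have "\<mu> = 0" using normal_distributed_expectation[OF normal] E by simp
    then show ?thesis using normal_imp_gauss_rv[of Y \<sigma>] normal by blast
  qed
qed

lemma gauss_closure_space:
  assumes g: "gaussian_process M X" and c: "centered_process M X"
  shows "gauss_space M (gauss_closure X)"
proof
  fix Y assume "Y \<in> gauss_closure X"
  then obtain Yn where Y: "Y \<in> borel_measurable M" "\<And>n. Yn n \<in> span_set X" "AE w in M. (\<lambda>n. Yn n w) \<longlonglongrightarrow> Y w"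
    unfolding gauss_closure_def by blast
  have "\<forall>n. \<exists>v. gauss_rv M (Yn n) v" using span_set_gauss[OF g c Y(2)] by blast
  then obtain v where "\<And>n. gauss_rv M (Yn n) (v n)" by metis
  from gauss_rv_limit[OF this Y(3,1)] show "\<exists>v. gauss_rv M Y v" by blast
next
  fix Y Z and a b :: real assume "Y \<in> gauss_closure X" "Z \<in> gauss_closure X"
  then obtain Yn Zn where Y: "Y \<in> borel_measurable M" "\<And>n. Yn n \<in> span_set X" "AE w in M. (\<lambda>n. Yn n w) \<longlonglongrightarrow> Y w"
    and Z: "Z \<in> borel_measurable M" "\<And>n. Zn n \<in> span_set X" "AE w in M. (\<lambda>n. Zn n w) \<longlonglongrightarrow> Z w"
    unfolding gauss_closure_def by blast
  have "AE w in M. (\<lambda>n. a * Yn n w + b * Zn n w) \<longlonglongrightarrow> a * Y w + b * Z w"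
    using Y(3) Z(3) by eventually_elim (intro tendsto_intros)
  moreover have "(\<lambda>w. a * Y w + b * Z w) \<in> borel_measurable M" using Y(1) Z(1) by measurable
  ultimately show "(\<lambda>w. a * Y w + b * Z w) \<in> gauss_closure X"
    unfolding gauss_closure_def using span_set_lin[OF Y(2) Z(2)]
    by (intro CollectI conjI exI[of _ "\<lambda>n w. a * Yn n w + b * Zn n w"]) auto
qed

lemma gauss_closure_AE:
  assumes "Y \<in> gauss_closure X" "AE w in M. Y w = Z w" "Z \<in> borel_measurable M"
  shows "Z \<in> gauss_closure X"
proof -
  obtain Yn where Y: "\<And>n. Yn n \<in> span_set X" "AE w in M. (\<lambda>n. Yn n w) \<longlonglongrightarrow> Y w"
    using assms(1) unfolding gauss_closure_def by blast
  have "AE w in M. (\<lambda>n. Yn n w) \<longlonglongrightarrow> Z w" using Y(2) assms(2) by eventually_elim simp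
  then show ?thesis unfolding gauss_closure_def using Y(1) assms(3) by blast
qed

text \<open>Paths are set to 0 on a measurable null set containing all irregular ones. The
  derivative is a limit of difference quotients, which makes it measurable and a member of the
  closure. Existence of a second derivative at 0 is handed on for the study of \<open>F\<close> near
  the origin.\<close>

lemma regular_version:
  assumes g: "gaussian_process M X" and c: "centered_process M X" and C: "class_C M 2 X"
  obtains f f' where "gauss_path M (gauss_closure X) f f'" "AE w in M. \<forall>t. X t w = f t w"
    "\<And>w. \<exists>d. ((\<lambda>t. f' t w) has_real_derivative d) (at 0)"
proof -
  interpret gs: gauss_space M "gauss_closure X" by (rule gauss_closure_space[OF g c])
  have Xm: "X t \<in> borel_measurable M" for t
    using span_set_gauss[OF g c span_set_base, of t] by (auto simp: gauss_rv_def)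
  obtain N where N: "{w \<in> space M. \<not> C_k 2 (\<lambda>t. X t w)} \<subseteq> N" "emeasure M N = 0" "N \<in> sets M"
    using C unfolding class_C_def by (rule AE_E)
  define E where "E = space M - N"
  have E: "E \<in> sets M" using N by (simp add: E_def)
  have AEE: "AE w in M. w \<in> E"
    using AE_not_in[of N M] N by (auto simp: E_def null_sets_def)
  have good: "C_k 2 (\<lambda>t. X t w)" if "w \<in> E" for w using that N by (auto simp: E_def)
  have d1: "((\<lambda>t. X t w) has_real_derivative deriv (\<lambda>t. X t w) t) (at t)"
    and d2: "(deriv (\<lambda>t. X t w) has_real_derivative deriv (deriv (\<lambda>t. X t w)) t) (at t)" if "w \<in> E" for w t
  proof -
    have "(deriv ^^ i) (\<lambda>t. X t w) differentiable (at t)" if "i < 2" for i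
      using good[OF \<open>w \<in> E\<close>] that unfolding C_k_def by blast
    from this[of 0] this[of 1] show "((\<lambda>t. X t w) has_real_derivative deriv (\<lambda>t. X t w) t) (at t)"
      "(deriv (\<lambda>t. X t w) has_real_derivative deriv (deriv (\<lambda>t. X t w)) t) (at t)"
      by (simp_all add: DERIV_deriv_iff_real_differentiable)
  qed
  define f where "f t w = (if w \<in> E then X t w else 0)" for t w
  define f' where "f' t w = (if w \<in> E then deriv (\<lambda>t. X t w) t else 0)" for t w
  have fX: "AE w in M. \<forall>t. X t w = f t w" using AEE by eventually_elim (simp add: f_def)
  have fm[measurable]: "f t \<in> borel_measurable M" for t
    unfolding f_def using Xm E by (intro measurable_If_set) auto
  have fd: "((\<lambda>t. f t w) has_real_derivative f' t w) (at t)" for w t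
    by (cases "w \<in> E") (simp_all add: f_def f'_def d1)
  define h where "h n = inverse (real (Suc n))" for n
  have h: "filterlim h (at 0) sequentially"
    unfolding h_def by (rule filterlim_atI[OF LIMSEQ_inverse_real_of_nat]) simp
  have lim: "(\<lambda>n. (f (t + h n) w - f t w) / h n) \<longlonglongrightarrow> f' t w" for t w
    using filterlim_compose[OF _ h] fd[of w t] unfolding DERIV_def by blast
  have f'm: "f' t \<in> borel_measurable M" for t
    by (rule borel_measurable_LIMSEQ_real[OF lim]) measurable
  have fH: "f t \<in> gauss_closure X" for t
  proof (rule gauss_closure_AE[OF _ _ fm])
    show "X t \<in> gauss_closure X" unfolding gauss_closure_def using Xm span_set_base
      by (intro CollectI conjI exI[of _ "\<lambda>_. X t"]) auto
    show "AE w in M. X t w = f t w" using fX by eventually_elim simp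
  qed
  have f'H: "f' t \<in> gauss_closure X" for t
  proof -
    have "(\<lambda>w. (1 / h n) * X (t + h n) w + (- 1 / h n) * X t w) \<in> span_set X" for n
      by (rule span_set_lin[OF span_set_base span_set_base])
    moreover have "AE w in M. (\<lambda>n. (1 / h n) * X (t + h n) w + (- 1 / h n) * X t w) \<longlonglongrightarrow> f' t w"
      using fX
    proof eventually_elim
      case (elim w)
      have "(1 / h n) * X (t + h n) w + (- 1 / h n) * X t w = (f (t + h n) w - f t w) / h n" for n
        using elim by (simp add: diff_divide_distrib)
      then show ?case using lim[of t w] by simp
    qed
    ultimately show ?thesis unfolding gauss_closure_def using f'm
      by (intro CollectI conjI exI[of _ "\<lambda>n w. (1 / h n) * X (t + h n) w + (- 1 / h n) * X t w"]) auto
  qed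
  have "((\<lambda>t. f' t w) has_real_derivative (if w \<in> E then deriv (deriv (\<lambda>t. X t w)) t else 0)) (at t)" for w t
    by (cases "w \<in> E") (simp_all add: f'_def d2)
  note f'd = this
  show ?thesis
  proof
    show "gauss_path M (gauss_closure X) f f'"
    proof
      show "continuous_on UNIV (\<lambda>t. f' t w)" for w
        by (rule DERIV_continuous_on[OF has_field_derivative_at_within[OF f'd]])
    qed (rule fH f'H fd)+
    show "\<exists>d. ((\<lambda>t. f' t w) has_real_derivative d) (at 0)" for w using f'd by blast
  qed (rule fX)
qed

end

section \<open>Properties of the correlation function obtained from the paths\<close>

locale stationary_path = gauss_path M H f f' for M :: "'a measure" and H f f' +
  fixes \<kappa> :: "real \<Rightarrow> real"
  assumes cov_ff: "cov (f s) (f t) = \<kappa> (t - s)"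
begin

lemma kappa_even: "\<kappa> (- x) = \<kappa> x"
  using cov_ff[of 0 x] cov_ff[of x 0] cov_commute[of "f 0" "f x"] by simp

lemma kappa_deriv: "(\<kappa> has_real_derivative deriv \<kappa> x) (at x)"
proof -
  have "((\<lambda>t. cov (f t) (f 0)) has_real_derivative cov (f' x) (f 0)) (at x)" by (rule cov_X_deriv[OF X_H])
  then have "(\<kappa> has_real_derivative cov (f' x) (f 0)) (at x)" by (simp add: cov_ff kappa_even)
  then show ?thesis using DERIV_imp_deriv by fastforce
qed

lemma cov_f'f: "cov (f' s) (f t) = - deriv \<kappa> (t - s)"
proof (rule DERIV_unique)
  show "((\<lambda>s. \<kappa> (t - s)) has_real_derivative cov (f' s) (f t)) (at s)"
    using cov_X_deriv[OF X_H, of t s] by (simp add: cov_ff)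
  have "((\<lambda>s. \<kappa> (t - s)) has_real_derivative deriv \<kappa> (t - s) * (- 1)) (at s)"
    by (rule DERIV_chain2[OF kappa_deriv]) (auto intro!: derivative_eq_intros)
  then show "((\<lambda>s. \<kappa> (t - s)) has_real_derivative - deriv \<kappa> (t - s)) (at s)" by simp
qed

text \<open>Smoothness of \<open>\<kappa>\<close> is read off from the paths:
  \<open>- deriv \<kappa> t\<close> is \<open>cov (f t) (f' 0)\<close>, which is differentiable in
  \<open>t\<close>.\<close>

lemma kappa'_deriv: "(deriv \<kappa> has_real_derivative deriv (deriv \<kappa>) x) (at x)"
proof -
  have "((\<lambda>t. cov (f t) (f' 0)) has_real_derivative cov (f' x) (f' 0)) (at x)" by (rule cov_X_deriv[OF X'_H])
  then have "((\<lambda>t. - deriv \<kappa> t) has_real_derivative cov (f' x) (f' 0)) (at x)"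
    by (simp add: cov_commute[of _ "f' 0"] cov_f'f)
  from DERIV_minus[OF this] have "(deriv \<kappa> has_real_derivative - cov (f' x) (f' 0)) (at x)" by simp
  then show ?thesis using DERIV_imp_deriv by fastforce
qed

lemma cov_f'f': "cov (f' s) (f' t) = - deriv (deriv \<kappa>) (t - s)"
proof -
  have "cov (f' t) (f' s) = - deriv (deriv \<kappa>) (t - s)"
  proof (rule DERIV_unique)
    show "((\<lambda>t. - deriv \<kappa> (t - s)) has_real_derivative cov (f' t) (f' s)) (at t)"
      using cov_X_deriv[OF X'_H, of s t] by (simp add: cov_commute[of _ "f' s"] cov_f'f)
    have "((\<lambda>t. deriv \<kappa> (t - s)) has_real_derivative deriv (deriv \<kappa>) (t - s) * 1) (at t)"
      by (rule DERIV_chain2[OF kappa'_deriv]) (auto intro!: derivative_eq_intros)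
    from DERIV_minus[OF this] show "((\<lambda>t. - deriv \<kappa> (t - s)) has_real_derivative - deriv (deriv \<kappa>) (t - s)) (at t)" by simp
  qed
  then show ?thesis by (simp add: cov_commute)
qed

lemma kappa''_cont: "continuous_on UNIV (deriv (deriv \<kappa>))"
proof -
  have "continuous_on UNIV (\<lambda>t. - cov (f' t) (f' 0))" by (intro continuous_intros cov_X'_continuous X'_H)
  moreover have "- cov (f' t) (f' 0) = deriv (deriv \<kappa>) t" for t by (simp add: cov_commute[of _ "f' 0"] cov_f'f')
  ultimately show ?thesis by simp
qed

lemma comb3_H: "Y1 \<in> H \<Longrightarrow> Y2 \<in> H \<Longrightarrow> Y3 \<in> H \<Longrightarrow> (\<lambda>w. a * Y1 w + b * Y2 w + c * Y3 w) \<in> H"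
  using lin_comb[OF lin_comb[of Y1 Y2 a b], of Y3 1 c] by simp

lemma cov_comb3: "Y1 \<in> H \<Longrightarrow> Y2 \<in> H \<Longrightarrow> Y3 \<in> H \<Longrightarrow> Z \<in> H \<Longrightarrow>
    cov (\<lambda>w. a * Y1 w + b * Y2 w + c * Y3 w) Z = a * cov Y1 Z + b * cov Y2 Z + c * cov Y3 Z"
  using cov_lin[OF lin_comb[of Y1 Y2 a b], of Y3 Z 1 c] cov_lin[of Y1 Y2 Z a b] by simp

end

locale normalized_path = stationary_path M H f f' \<kappa> for M :: "'a measure" and H f f' \<kappa> +
  assumes f'_deriv: "\<exists>d. ((\<lambda>t. f' t w) has_real_derivative d) (at 0)"
    and H_AE: "\<And>Y Z. Y \<in> H \<Longrightarrow> AE w in M. Y w = Z w \<Longrightarrow> Z \<in> borel_measurable M \<Longrightarrow> Z \<in> H"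
    and kappa_0: "\<kappa> 0 = 1" and kappa''_0: "deriv (deriv \<kappa>) 0 = - 1"
    and kappa_lim: "(\<kappa> \<longlongrightarrow> 0) at_top" "(deriv \<kappa> \<longlongrightarrow> 0) at_top" "(deriv (deriv \<kappa>) \<longlongrightarrow> 0) at_top"
    and kappa_sq: "integrable lborel (\<lambda>x. (\<kappa> x)\<^sup>2)" "integrable lborel (\<lambda>x. (deriv (deriv \<kappa>) x)\<^sup>2)"
begin

lemma kappa'_0: "deriv \<kappa> 0 = 0"
proof -
  have "((\<lambda>x. \<kappa> (- x)) has_real_derivative deriv \<kappa> (- 0) * (- 1)) (at 0)"
    by (rule DERIV_chain2[OF kappa_deriv]) (auto intro!: derivative_eq_intros)
  then have "(\<kappa> has_real_derivative - deriv \<kappa> 0) (at 0)" by (simp add: kappa_even)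
  from DERIV_unique[OF this kappa_deriv] show ?thesis by simp
qed

lemma cov_values:
  "cov (f 0) (f 0) = 1" "cov (f t) (f t) = 1" "cov (f' 0) (f' 0) = 1" "cov (f' t) (f' t) = 1"
  "cov (f 0) (f t) = \<kappa> t" "cov (f t) (f 0) = \<kappa> t"
  "cov (f' 0) (f 0) = 0" "cov (f 0) (f' 0) = 0" "cov (f' t) (f t) = 0" "cov (f t) (f' t) = 0"
  "cov (f' 0) (f t) = - deriv \<kappa> t" "cov (f t) (f' 0) = - deriv \<kappa> t" "cov (f' t) (f 0) = deriv \<kappa> t" "cov (f 0) (f' t) = deriv \<kappa> t"
  "cov (f' 0) (f' t) = - deriv (deriv \<kappa>) t" "cov (f' t) (f' 0) = - deriv (deriv \<kappa>) t"
proof -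
  have odd: "deriv \<kappa> (- t) = - deriv \<kappa> t"
  proof -
    have "((\<lambda>x. \<kappa> (- x)) has_real_derivative deriv \<kappa> (- t) * (- 1)) (at t)"
      by (rule DERIV_chain2[OF kappa_deriv]) (auto intro!: derivative_eq_intros)
    then have "(\<kappa> has_real_derivative - deriv \<kappa> (- t)) (at t)" by (simp add: kappa_even)
    from DERIV_unique[OF this kappa_deriv] show ?thesis by simp
  qed
  show "cov (f 0) (f 0) = 1" "cov (f t) (f t) = 1" "cov (f' 0) (f' 0) = 1" "cov (f' t) (f' t) = 1"
    "cov (f 0) (f t) = \<kappa> t" "cov (f t) (f 0) = \<kappa> t"
    by (simp_all add: cov_ff cov_f'f' kappa_0 kappa''_0 kappa_even)
  show "cov (f' 0) (f 0) = 0" "cov (f' t) (f t) = 0" by (simp_all add: cov_f'f kappa'_0)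
  then show "cov (f 0) (f' 0) = 0" "cov (f t) (f' t) = 0" by (simp_all add: cov_commute)
  show a: "cov (f' 0) (f t) = - deriv \<kappa> t" "cov (f' t) (f 0) = deriv \<kappa> t" by (simp_all add: cov_f'f odd)
  then show "cov (f t) (f' 0) = - deriv \<kappa> t" "cov (f 0) (f' t) = deriv \<kappa> t" by (simp_all add: cov_commute)
  show "cov (f' 0) (f' t) = - deriv (deriv \<kappa>) t" by (simp add: cov_f'f')
  then show "cov (f' t) (f' 0) = - deriv (deriv \<kappa>) t" by (simp add: cov_commute)
qed

text \<open>If the Gram determinant vanished at \<open>t\<close>, the sequence \<open>\<kappa> (n t)\<close> would satisfy the
  recursion of \<open>cos (n \<theta>)\<close>, which does not tend to \<open>0\<close>.\<close>

lemma gram_pos: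
  assumes t: "0 < t"
  shows "0 < 1 - (\<kappa> t)\<^sup>2 - (deriv \<kappa> t)\<^sup>2"
proof (rule ccontr)
  assume n: "\<not> ?thesis"
  define k k1 where "k = \<kappa> t" and "k1 = deriv \<kappa> t"
  \<comment> \<open>The regression residual of \<open>f t\<close> on the orthonormal pair
    \<open>f 0\<close>, \<open>f' 0\<close>; its variance is the Gram determinant.\<close>
  define W where "W = (\<lambda>w. 1 * f t w + (- k) * f 0 w + k1 * f' 0 w)"
  have WH: "W \<in> H" unfolding W_def by (intro comb3_H X_H X'_H)
  have WZ: "cov W Z = cov (f t) Z - k * cov (f 0) Z + k1 * cov (f' 0) Z" if "Z \<in> H" for Z
    unfolding W_def using cov_comb3[OF X_H X_H X'_H that, of 1 t "- k" 0 k1 0] by simp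
  have Wc: "cov W (f t) = 1 - k\<^sup>2 - k1\<^sup>2" "cov W (f 0) = 0" "cov W (f' 0) = 0"
    unfolding WZ[OF X_H] WZ[OF X'_H] cov_values k_def k1_def by (simp_all add: power2_eq_square)
  have "cov W W = cov (f t) W - k * cov (f 0) W + k1 * cov (f' 0) W" by (rule WZ[OF WH])
  also have "\<dots> = 1 - k\<^sup>2 - k1\<^sup>2" unfolding cov_commute[of _ W] Wc by simp
  finally have vW: "cov W W = 0" using n cov_nonneg[of W] unfolding k_def k1_def by simp
  have W0: "cov W Z = 0" if "Z \<in> H" for Z using cauchy_schwarz[OF WH that] vW by simp
  \<comment> \<open>\<open>W\<close> is orthogonal to \<open>f x\<close> and to
    \<open>f (- x)\<close>; adding the two relations eliminates the derivative of
    \<open>\<kappa>\<close>.\<close>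
  have rec: "\<kappa> (x + t) + \<kappa> (x - t) = 2 * k * \<kappa> x" for x
  proof -
    have e: "cov W (f x) = \<kappa> (x - t) - k * \<kappa> x - k1 * deriv \<kappa> x" for x
      unfolding WZ[OF X_H] by (simp add: cov_ff cov_f'f)
    have odd: "deriv \<kappa> (- x) = - deriv \<kappa> x" using cov_f'f[of x 0] cov_values(13)[of x] by simp
    have "- x - t = - (x + t)" by simp
    then have "\<kappa> (- x - t) = \<kappa> (x + t)" by (simp only: kappa_even)
    then have "\<kappa> (x + t) - k * \<kappa> x + k1 * deriv \<kappa> x = 0" using e[of "- x"] W0[OF X_H, of "- x"] by (simp add: odd kappa_even)
    moreover have "\<kappa> (x - t) - k * \<kappa> x - k1 * deriv \<kappa> x = 0" using e[of x] W0[OF X_H, of x] by simp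
    ultimately show ?thesis unfolding mult.assoc by linarith
  qed
  define x where "x n = \<kappa> (real n * t)" for n
  have x0: "x 0 = 1" "x 1 = k" by (simp_all add: x_def kappa_0 k_def)
  have xrec: "x (Suc (Suc n)) = 2 * k * x (Suc n) - x n" for n
    using rec[of "real (Suc n) * t"] by (simp add: x_def algebra_simps)
  \<comment> \<open>An invariant of the recursion with value \<open>1 - k\<^sup>2\<close>. Decay of
    \<open>x\<close> makes it 0; then \<open>x\<close> is geometric with ratio \<open>k\<close> of
    absolute value 1, which contradicts the decay.\<close>
  define Q where "Q n = (x n)\<^sup>2 + (x (Suc n))\<^sup>2 - 2 * k * x n * x (Suc n)" for n
  have Q: "Q n = 1 - k\<^sup>2" for n
  proof (induction n)
    case 0 then show ?case using x0 by (simp add: Q_def power2_eq_square)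
  next
    case (Suc n)
    have "Q (Suc n) = Q n" unfolding Q_def xrec by (simp add: power2_eq_square algebra_simps)
    then show ?case using Suc by simp
  qed
  have xl: "x \<longlonglongrightarrow> 0" unfolding x_def
  proof (rule filterlim_compose[OF kappa_lim(1)])
    show "filterlim (\<lambda>n. real n * t) at_top sequentially"
      by (rule filterlim_tendsto_pos_mult_at_top[OF tendsto_const t filterlim_real_sequentially, unfolded mult.commute[of t]])
  qed
  have "Q \<longlonglongrightarrow> 0\<^sup>2 + 0\<^sup>2 - 2 * k * 0 * 0" unfolding Q_def by (intro tendsto_intros xl LIMSEQ_Suc)
  then have k2: "k\<^sup>2 = 1" unfolding Q by (simp add: LIMSEQ_const_iff)
  have step: "x (Suc n) = k * x n" for n
  proof -
    have "(x (Suc n) - k * x n)\<^sup>2 = Q n + (k\<^sup>2 - 1) * (x n)\<^sup>2" unfolding Q_def by (simp add: power2_eq_square algebra_simps)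
    then show ?thesis using Q[of n] k2 by simp
  qed
  have "(x n)\<^sup>2 = 1" for n
    by (induction n) (simp_all add: x0 step power_mult_distrib k2)
  moreover have "(\<lambda>n. (x n)\<^sup>2) \<longlonglongrightarrow> 0\<^sup>2" by (intro tendsto_intros xl)
  ultimately show False by (simp add: LIMSEQ_const_iff)
qed

text \<open>\<open>A\<close> and \<open>B\<close> are the residuals of \<open>f' t\<close> and
  \<open>f' 0\<close> after regression on \<open>f 0\<close> and \<open>f t\<close>. Both have
  variance \<open>D / v\<close>, and the quotient in the first claim is minus their correlation. The
  second claim is the minimality of the residual variance. Both precede the locale
  \<open>correlation\<close>, whose assumptions \<open>a_bound\<close> and \<open>near_0\<close>
  rest on them.\<close>

lemma residual_bounds:
  assumes t: "0 < t"
  shows "\<bar>(\<kappa> t * (deriv \<kappa> t)\<^sup>2 - (\<kappa> t)\<^sup>2 * deriv (deriv \<kappa>) t + deriv (deriv \<kappa>) t) / (1 - (\<kappa> t)\<^sup>2 - (deriv \<kappa> t)\<^sup>2)\<bar> \<le> 1"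
    and "(1 - (\<kappa> t)\<^sup>2 - (deriv \<kappa> t)\<^sup>2) / (1 - (\<kappa> t)\<^sup>2) \<le> cov (\<lambda>w. 1 * f' 0 w + p * f 0 w + q * f t w) (\<lambda>w. 1 * f' 0 w + p * f 0 w + q * f t w)"
proof -
  define k k1 k2 v D where "k = \<kappa> t" and "k1 = deriv \<kappa> t" and "k2 = deriv (deriv \<kappa>) t" and "v = 1 - k\<^sup>2" and "D = 1 - k\<^sup>2 - k1\<^sup>2"
  have D: "0 < D" using gram_pos[OF t] by (simp add: D_def k_def k1_def)
  have v: "0 < v" using D zero_le_power2[of k1] unfolding v_def D_def by linarith
  have c: "cov (f 0) (f t) = k" "cov (f t) (f 0) = k"
    "cov (f' 0) (f t) = - k1" "cov (f t) (f' 0) = - k1" "cov (f' t) (f 0) = k1" "cov (f 0) (f' t) = k1"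
    "cov (f' 0) (f' t) = - k2" "cov (f' t) (f' 0) = - k2"
    unfolding cov_values k_def k1_def k2_def by simp_all
  define A where "A = (\<lambda>w. 1 * f' t w + (- k1 / v) * f 0 w + (k * k1 / v) * f t w)"
  define B where "B = (\<lambda>w. 1 * f' 0 w + (- k * k1 / v) * f 0 w + (k1 / v) * f t w)"
  have AH: "A \<in> H" and BH: "B \<in> H" unfolding A_def B_def by (intro comb3_H X_H X'_H)+
  have AZ: "cov A Z = cov (f' t) Z - k1 / v * cov (f 0) Z + k * k1 / v * cov (f t) Z" if "Z \<in> H" for Z
    unfolding A_def using cov_comb3[OF X'_H X_H X_H that, of 1 t "- k1 / v" 0 "k * k1 / v" t] by simp
  have BZ: "cov B Z = cov (f' 0) Z - k * k1 / v * cov (f 0) Z + k1 / v * cov (f t) Z" if "Z \<in> H" for Z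
    unfolding B_def using cov_comb3[OF X'_H X_H X_H that, of 1 0 "- k * k1 / v" 0 "k1 / v" t] by simp
  have kv: "k\<^sup>2 = 1 - v" by (simp add: v_def)
  have r: "k1 - k1 / v * 1 + k * k1 / v * k = 0"
  proof -
    have "k1 - k1 / v * 1 + k * k1 / v * k = k1 - k1 / v + k\<^sup>2 * k1 / v" by (simp add: power2_eq_square)
    also have "\<dots> = 0" unfolding kv using v by (simp add: field_simps)
    finally show ?thesis .
  qed
  have Dv: "1 - k1 / v * k1 = D / v" using v by (simp add: D_def v_def field_simps power2_eq_square)
  have A0: "cov A (f 0) = 0" "cov A (f t) = 0" unfolding AZ[OF X_H] c cov_values(1,2,9) using r v by simp_all
  have B0: "cov B (f 0) = 0" "cov B (f t) = 0" unfolding BZ[OF X_H] c cov_values(1,2,7) using r v by simp_all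
  have A1: "cov A (f' t) = D / v" "cov A (f' 0) = - (k2 * v + k * k1\<^sup>2) / v"
  proof -
    show "cov A (f' t) = D / v" unfolding AZ[OF X'_H] c cov_values(4,10) Dv[symmetric] by simp
    have "cov A (f' 0) = - k2 - k * k1\<^sup>2 / v" unfolding AZ[OF X'_H] c cov_values(8) by (simp add: power2_eq_square)
    also have "\<dots> = - (k2 * v + k * k1\<^sup>2) / v" using v by (simp add: diff_divide_distrib)
    finally show "cov A (f' 0) = - (k2 * v + k * k1\<^sup>2) / v" .
  qed
  have B1: "cov B (f' 0) = D / v" unfolding BZ[OF X'_H] c cov_values(3,8) Dv[symmetric] by simp
  have vA: "cov A A = D / v" using AZ[OF AH] A0 A1
    by (simp add: cov_commute[of "f' t" A] cov_commute[of "f 0" A] cov_commute[of "f t" A])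
  note cB = cov_commute[of "f' 0" B] cov_commute[of "f 0" B] cov_commute[of "f t" B]
  have vB: "cov B B = D / v" using BZ[OF BH] B0 B1 by (simp add: cB)
  have AB: "cov A B = - (k2 * v + k * k1\<^sup>2) / v" using BZ[OF AH] A0 A1
    by (simp add: cov_commute[of "f' 0" A] cov_commute[of "f 0" A] cov_commute[of "f t" A] cov_commute[of B A])
  have "(cov A B)\<^sup>2 \<le> (D / v)\<^sup>2" using cauchy_schwarz[OF AH BH] unfolding vA vB by (simp add: power2_eq_square)
  moreover have "0 \<le> D / v" using D v by simp
  ultimately have "\<bar>cov A B\<bar> \<le> D / v" by (metis abs_le_square_iff abs_of_nonneg)
  then have "\<bar>k2 * v + k * k1\<^sup>2\<bar> / v \<le> D / v" unfolding AB minus_divide_left[symmetric] abs_minus_cancel abs_divide using v by simp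
  then have "\<bar>k2 * v + k * k1\<^sup>2\<bar> \<le> D" using v by (simp add: divide_le_cancel)
  moreover have "k * k1\<^sup>2 - k\<^sup>2 * k2 + k2 = k2 * v + k * k1\<^sup>2" by (simp add: v_def algebra_simps)
  ultimately show "\<bar>(\<kappa> t * (deriv \<kappa> t)\<^sup>2 - (\<kappa> t)\<^sup>2 * deriv (deriv \<kappa>) t + deriv (deriv \<kappa>) t) / (1 - (\<kappa> t)\<^sup>2 - (deriv \<kappa> t)\<^sup>2)\<bar> \<le> 1"
    unfolding k_def[symmetric] k1_def[symmetric] k2_def[symmetric] D_def[symmetric] using D by (simp add: abs_divide)
  define W where "W = (\<lambda>w. 1 * f' 0 w + p * f 0 w + q * f t w)"
  have WH: "W \<in> H" unfolding W_def by (intro comb3_H X_H X'_H)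
  have "cov W B = D / v" unfolding W_def
    using cov_comb3[OF X'_H X_H X_H BH, of 1 0 p 0 q t] by (simp add: cB B0 B1)
  then have "(D / v) * (D / v) \<le> (D / v) * cov W W" using cauchy_schwarz[OF WH BH] unfolding vB by (simp add: power2_eq_square mult.commute)
  moreover have "0 < D / v" using D v by simp
  ultimately have "D / v \<le> cov W W" by (simp only: mult_le_cancel_left_pos)
  then show "(1 - (\<kappa> t)\<^sup>2 - (deriv \<kappa> t)\<^sup>2) / (1 - (\<kappa> t)\<^sup>2) \<le> cov (\<lambda>w. 1 * f' 0 w + p * f 0 w + q * f t w) (\<lambda>w. 1 * f' 0 w + p * f 0 w + q * f t w)"
    unfolding D_def v_def k_def k1_def W_def .
qed

text \<open>One application of l'Hopital's rule; the quotient that remains is a difference quotient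
  of \<open>g'\<close> at 0.\<close>

lemma taylor_second:
  fixes g g' :: "real \<Rightarrow> real"
  assumes g: "\<And>t. (g has_real_derivative g' t) (at t)" and g': "(g' has_real_derivative d) (at 0)"
  shows "((\<lambda>t. (g t - g 0 - t * g' 0) / t\<^sup>2) \<longlongrightarrow> d / 2) (at_right 0)"
proof (rule lhopital_right_0)
  have gc: "isCont g 0" using g by (rule DERIV_isCont)
  have "((\<lambda>t. g t - g 0 - t * g' 0) \<longlongrightarrow> g 0 - g 0 - 0 * g' 0) (at_right 0)"
    using gc by (intro tendsto_intros) (auto simp: isCont_def intro: tendsto_mono[OF at_le])
  then show "((\<lambda>t. g t - g 0 - t * g' 0) \<longlongrightarrow> 0) (at_right 0)" by simp
  have "((\<lambda>t::real. t\<^sup>2) \<longlongrightarrow> 0\<^sup>2) (at_right 0)" by (intro tendsto_intros)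
  then show "((\<lambda>t::real. t\<^sup>2) \<longlongrightarrow> 0) (at_right 0)" by simp
  show "\<forall>\<^sub>F t in at_right 0. (t::real)\<^sup>2 \<noteq> 0" "\<forall>\<^sub>F t in at_right 0. 2 * (t::real) \<noteq> 0"
    by (auto simp: eventually_at_right_less eventually_at_filter)
  show "\<forall>\<^sub>F t in at_right 0. ((\<lambda>t. g t - g 0 - t * g' 0) has_real_derivative g' t - g' 0) (at t)"
    by (intro always_eventually allI) (auto intro!: derivative_eq_intros g)
  show "\<forall>\<^sub>F t in at_right 0. ((\<lambda>t::real. t\<^sup>2) has_real_derivative 2 * t) (at t)"
    by (intro always_eventually allI) (auto intro!: derivative_eq_intros)
  have "((\<lambda>t. (g' t - g' 0) / (t - 0)) \<longlongrightarrow> d) (at 0)" using g' unfolding has_field_derivative_iff by simp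
  then have "((\<lambda>t. (g' t - g' 0) / (t - 0) / 2) \<longlongrightarrow> d / 2) (at_right 0)"
    by (intro tendsto_intros) (auto intro: tendsto_mono[OF at_le])
  then show "((\<lambda>t. (g' t - g' 0) / (2 * t)) \<longlongrightarrow> d / 2) (at_right 0)" by (simp add: mult.commute)
qed

text \<open>Otherwise there are \<open>t n\<close> tending to 0 with variances above
  \<open>n\<close>. Along every path, however, the quotients converge to half the second derivative
  at 0, and by \<open>gauss_rv_limit\<close> their variances converge too.\<close>

lemma second_difference_bound:
  "\<exists>C \<delta>. 0 < \<delta> \<and> (\<forall>t. 0 < t \<and> t < \<delta> \<longrightarrow>
    cov (\<lambda>u. (f t u - f 0 u - t * f' 0 u) / t\<^sup>2) (\<lambda>u. (f t u - f 0 u - t * f' 0 u) / t\<^sup>2) \<le> C)"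
proof (rule ccontr)
  let ?Z = "\<lambda>t u. (f t u - f 0 u - t * f' 0 u) / t\<^sup>2"
  define V where "V t = cov (?Z t) (?Z t)" for t
  assume "\<not> ?thesis"
  then have n: "\<not> (\<exists>C \<delta>. 0 < \<delta> \<and> (\<forall>t. 0 < t \<and> t < \<delta> \<longrightarrow> V t \<le> C))" unfolding V_def .
  have ex: "\<exists>t. 0 < t \<and> t < inverse (real (Suc n)) \<and> real n < V t" for n
  proof (rule ccontr)
    define e where "e = inverse (real (Suc n))"
    assume "\<not> (\<exists>t. 0 < t \<and> t < inverse (real (Suc n)) \<and> real n < V t)"
    then have "\<forall>t. 0 < t \<and> t < e \<longrightarrow> V t \<le> real n" unfolding e_def[symmetric] using not_le by blast
    moreover have "0 < e" by (simp add: e_def)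
    ultimately show False using n by blast
  qed
  have "\<exists>t. \<forall>n. 0 < t n \<and> t n < inverse (real (Suc n)) \<and> real n < V (t n)" by (rule choice, rule allI, rule ex)
  then obtain t where t': "\<forall>n. 0 < t n \<and> t n < inverse (real (Suc n)) \<and> real n < V (t n)" by (rule exE)
  have t: "0 < t n" "t n < inverse (real (Suc n))" "real n < V (t n)" for n using t'[THEN spec, of n] by simp_all
  have t0: "t \<longlonglongrightarrow> 0"
  proof (rule tendsto_sandwich)
    show "\<forall>\<^sub>F n in sequentially. 0 \<le> t n" using t(1) by (intro always_eventually allI less_imp_le)
    show "\<forall>\<^sub>F n in sequentially. t n \<le> inverse (real (Suc n))" using t(2) by (intro always_eventually allI less_imp_le)
  qed (rule tendsto_const, rule LIMSEQ_inverse_real_of_nat)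
  have "t n \<in> {0<..} \<and> t n \<noteq> 0" for n using t(1)[of n] by simp
  then have "\<forall>\<^sub>F n in sequentially. t n \<in> {0<..} \<and> t n \<noteq> 0" by (rule always_eventually[OF allI])
  then have tr: "filterlim t (at_right 0) sequentially"
    unfolding filterlim_at using t0 by (rule conjI)
  have "\<exists>d. \<forall>u. ((\<lambda>t. f' t u) has_real_derivative d u) (at 0)" by (rule choice, rule allI, rule f'_deriv)
  then obtain d where d': "\<forall>u. ((\<lambda>t. f' t u) has_real_derivative d u) (at 0)" by (rule exE)
  then have d: "((\<lambda>t. f' t u) has_real_derivative d u) (at 0)" for u by (rule spec)
  have lim: "(\<lambda>n. ?Z (t n) u) \<longlonglongrightarrow> d u / 2" for u
    by (rule filterlim_compose[OF taylor_second[OF X_deriv d] tr])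
  have ZH: "?Z (t n) \<in> H" for n
  proof -
    have eq: "?Z (t n) = (\<lambda>u. (1 / (t n)\<^sup>2) * f (t n) u + (- 1 / (t n)\<^sup>2) * f 0 u + (- t n / (t n)\<^sup>2) * f' 0 u)"
      by (rule ext) (simp add: diff_divide_distrib)
    show ?thesis unfolding eq by (rule comb3_H[OF X_H X_H X'_H])
  qed
  have dm: "(\<lambda>u. d u / 2) \<in> borel_measurable M"
    by (rule borel_measurable_LIMSEQ_real[OF lim meas_H[OF ZH]])
  have "\<exists>w. gauss_rv M (\<lambda>u. d u / 2) w \<and> (\<lambda>n. V (t n)) \<longlonglongrightarrow> w" unfolding V_def
    by (rule gauss_rv_limit[where Y="\<lambda>n. ?Z (t n)" and Z="\<lambda>u. d u / 2", OF gauss[OF ZH] AE_I2[OF lim] dm])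
  then obtain w where "(\<lambda>n. V (t n)) \<longlonglongrightarrow> w" by (elim exE conjE)
  then have "\<forall>\<^sub>F n in sequentially. V (t n) < w + 1" by (rule order_tendstoD) simp
  moreover have "\<forall>\<^sub>F n in sequentially. w + 1 < real n"
    using filterlim_real_sequentially unfolding filterlim_at_top_dense by blast
  ultimately have "\<forall>\<^sub>F n in sequentially. False"
  proof eventually_elim
    case (elim n)
    then show ?case using t(3)[of n] by linarith
  qed
  then show False by simp
qed

text \<open>The combination \<open>f' 0 - (f t - f 0) / t\<close> competes with the residual of
  \<open>f' 0\<close>. It is \<open>- t\<close> times the second difference quotient, so its
  variance, and with it the smaller residual variance, is at most
  \<open>C * t\<^sup>2\<close>.\<close>

lemma near_zero_bound:
  "\<exists>C \<delta>. 0 < \<delta> \<and> (\<forall>t. 0 < t \<and> t < \<delta> \<longrightarrow> 1 - (\<kappa> t)\<^sup>2 - (deriv \<kappa> t)\<^sup>2 \<le> C * t\<^sup>2 * (1 - (\<kappa> t)\<^sup>2))"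
proof -
  obtain C \<delta> where \<delta>: "0 < \<delta>" and C: "\<And>t. 0 < t \<Longrightarrow> t < \<delta> \<Longrightarrow>
    cov (\<lambda>u. (f t u - f 0 u - t * f' 0 u) / t\<^sup>2) (\<lambda>u. (f t u - f 0 u - t * f' 0 u) / t\<^sup>2) \<le> C"
    using second_difference_bound by blast
  have "1 - (\<kappa> t)\<^sup>2 - (deriv \<kappa> t)\<^sup>2 \<le> C * t\<^sup>2 * (1 - (\<kappa> t)\<^sup>2)" if t: "0 < t" "t < \<delta>" for t
  proof -
    let ?Z = "\<lambda>u. (f t u - f 0 u - t * f' 0 u) / t\<^sup>2"
    let ?W = "\<lambda>u. 1 * f' 0 u + (1 / t) * f 0 u + (- 1 / t) * f t u"
    have W: "?W = (\<lambda>u. (- t) * ?Z u)"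
    proof (rule ext)
      fix u
      have "1 * x + 1 / t * y + - 1 / t * w = - t * ((w - y - t * x) / t\<^sup>2)" for x y w
        using t by (simp add: field_simps power2_eq_square)
      then show "?W u = (- t) * ?Z u" .
    qed
    have "cov ?W ?W = (- t) * ((- t) * cov ?Z ?Z)"
      unfolding W cov_scale by (subst cov_commute, subst cov_scale, rule refl)
    then have "cov ?W ?W = t\<^sup>2 * cov ?Z ?Z" by (simp only: power2_eq_square mult_minus_left mult_minus_right minus_minus mult.assoc)
    also have "\<dots> \<le> t\<^sup>2 * C" by (intro mult_left_mono C t) simp
    finally have "(1 - (\<kappa> t)\<^sup>2 - (deriv \<kappa> t)\<^sup>2) / (1 - (\<kappa> t)\<^sup>2) \<le> C * t\<^sup>2"
      using residual_bounds(2)[OF t(1), of "1 / t" "- 1 / t"] by (simp add: mult.commute)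
    moreover have "0 < 1 - (\<kappa> t)\<^sup>2" using gram_pos[OF t(1)] zero_le_power2[of "deriv \<kappa> t"] by linarith
    ultimately show ?thesis by (simp add: pos_divide_le_eq)
  qed
  then show ?thesis using \<delta> by blast
qed

lemma correlation_kappa: "correlation \<kappa> (deriv \<kappa>) (deriv (deriv \<kappa>))"
proof
  show "(\<kappa> has_real_derivative deriv \<kappa> x) (at x)" for x by (rule kappa_deriv)
  show "(deriv \<kappa> has_real_derivative deriv (deriv \<kappa>) x) (at x)" for x by (rule kappa'_deriv)
  show "0 < 1 - (\<kappa> t)\<^sup>2 - (deriv \<kappa> t)\<^sup>2" if "0 < t" for t by (rule gram_pos[OF that])
  show "\<bar>(\<kappa> t * (deriv \<kappa> t)\<^sup>2 - (\<kappa> t)\<^sup>2 * deriv (deriv \<kappa>) t + deriv (deriv \<kappa>) t) / (1 - (\<kappa> t)\<^sup>2 - (deriv \<kappa> t)\<^sup>2)\<bar> \<le> 1" if "0 < t" for t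
    by (rule residual_bounds(1)[OF that])
qed (rule kappa''_cont kappa_even kappa_0 kappa''_0 kappa_lim kappa_sq near_zero_bound)+

lemma zero_process_path: "zero_process M H f f' \<kappa> (deriv \<kappa>) (deriv (deriv \<kappa>))"
proof -
  interpret correlation \<kappa> "deriv \<kappa>" "deriv (deriv \<kappa>)" by (rule correlation_kappa)
  show ?thesis by unfold_locales (rule cov_ff cov_f'f cov_f'f')+
qed

text \<open>\<open>one_point\<close> is available before anything is known about the zero set; the
  finite mean shows that the number of zeros in each interval around 0 is almost surely
  finite.\<close>

lemma discrete_version:
  obtains g g' where "discrete_zero_process M H g g' \<kappa> (deriv \<kappa>) (deriv (deriv \<kappa>))" "AE w in M. \<forall>t. f t w = g t w"
proof -
  interpret zp: zero_process M H f f' \<kappa> "deriv \<kappa>" "deriv (deriv \<kappa>)" by (rule zero_process_path)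
  let ?P = "\<lambda>w. \<forall>n. ncard (zp.zeros w \<inter> {- real (Suc n)..<real (Suc n)}) \<noteq> \<infinity>"
  have "AE w in M. ?P w" unfolding AE_all_countable
  proof
    fix n
    show "AE w in M. ncard (zp.zeros w \<inter> {- real (Suc n)..<real (Suc n)}) \<noteq> \<infinity>"
    proof (rule nn_integral_PInf_AE)
      show "(\<lambda>w. ncard (zp.zeros w \<inter> {- real (Suc n)..<real (Suc n)})) \<in> borel_measurable M"
        unfolding zp.zeros_Int by (rule zero_ncard_measurable) simp
      show "(\<integral>\<^sup>+w. ncard (zp.zeros w \<inter> {- real (Suc n)..<real (Suc n)}) \<partial>M) \<noteq> \<infinity>"
        by (subst zp.one_point) (simp_all add: nn_integral_multc ennreal_mult_eq_top_iff)
    qed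
  qed
  then obtain N where N: "{w \<in> space M. \<not> ?P w} \<subseteq> N" "emeasure M N = 0" "N \<in> sets M" by (rule AE_E)
  define E where "E = space M - N"
  have E: "E \<in> sets M" using N by (simp add: E_def)
  have AEE: "AE w in M. w \<in> E" using AE_not_in[of N M] N by (auto simp: E_def null_sets_def)
  \<comment> \<open>The constant 1 has no zeros, so finiteness also holds on the exceptional
    event.\<close>
  define g where "g t w = (if w \<in> E then f t w else 1)" for t w
  define g' where "g' t w = (if w \<in> E then f' t w else 0)" for t w
  have m[measurable]: "g t \<in> borel_measurable M" "g' t \<in> borel_measurable M" for t
    unfolding g_def g'_def using X_meas X'_meas E by (intro measurable_If_set; auto)+
  have ae: "AE w in M. f t w = g t w" "AE w in M. f' t w = g' t w" for t
    using AEE by (eventually_elim, simp add: g_def g'_def)+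
  note [measurable] = X_meas X'_meas
  have cov_g: "cov Y Z = cov Y' Z'" if "Y \<in> borel_measurable M" "Z \<in> borel_measurable M" "Y' \<in> borel_measurable M" "Z' \<in> borel_measurable M"
    "AE w in M. Y' w = Y w" "AE w in M. Z' w = Z w" for Y Z Y' Z'
    unfolding cov_def
  proof (rule integral_cong_AE)
    show "AE w in M. Y w * Z w = Y' w * Z' w" using that(5,6) by eventually_elim simp
  qed (use that in measurable)
  have gp: "gauss_path M H g g'"
  proof
    show "g t \<in> H" "g' t \<in> H" for t by (rule H_AE[OF X_H ae(1) m(1)], rule H_AE[OF X'_H ae(2) m(2)])
    show "((\<lambda>t. g t w) has_real_derivative g' t w) (at t)" for w t
      by (cases "w \<in> E") (simp_all add: g_def g'_def X_deriv)
    show "continuous_on UNIV (\<lambda>t. g' t w)" for w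
      by (cases "w \<in> E") (simp_all add: g'_def X'_cont)
  qed
  have zg: "zero_process M H g g' \<kappa> (deriv \<kappa>) (deriv (deriv \<kappa>))"
  proof -
    interpret gp: gauss_path M H g g' by (rule gp)
    interpret correlation \<kappa> "deriv \<kappa>" "deriv (deriv \<kappa>)" by (rule correlation_kappa)
    show ?thesis
    proof
      show "cov (g s) (g t) = \<kappa> (t - s)" for s t using cov_g[OF m(1) m(1) X_meas X_meas ae(1) ae(1)] cov_ff by simp
      show "cov (g' s) (g t) = - deriv \<kappa> (t - s)" for s t using cov_g[OF m(2) m(1) X'_meas X_meas ae(2) ae(1)] cov_f'f by simp
      show "cov (g' s) (g' t) = - deriv (deriv \<kappa>) (t - s)" for s t using cov_g[OF m(2) m(2) X'_meas X'_meas ae(2) ae(2)] cov_f'f' by simp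
    qed
  qed
  interpret zg: zero_process M H g g' \<kappa> "deriv \<kappa>" "deriv (deriv \<kappa>)" by (rule zg)
  have "finite (zg.zeros w \<inter> {a..<b})" for w a b
  proof (cases "w \<in> E")
    case True
    then have P: "?P w" using N by (auto simp: E_def)
    obtain n where n: "max \<bar>a\<bar> \<bar>b\<bar> \<le> real n" using real_arch_simple by blast
    have "finite (zp.zeros w \<inter> {- real (Suc n)..<real (Suc n)})"
      using P[THEN spec, of n] by (simp add: emeasure_count_space split: if_splits)
    then show ?thesis
    proof (rule finite_subset[rotated])
      show "zg.zeros w \<inter> {a..<b} \<subseteq> zp.zeros w \<inter> {- real (Suc n)..<real (Suc n)}"
        using n True by (auto simp: zg.zeros_def zp.zeros_def g_def)
    qed
  next
    case False
    then show ?thesis by (simp add: zg.zeros_def g_def)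
  qed
  then have "discrete_zero_process M H g g' \<kappa> (deriv \<kappa>) (deriv (deriv \<kappa>))"
    by unfold_locales
  moreover have "AE w in M. \<forall>t. f t w = g t w" using AEE by eventually_elim (simp add: g_def)
  ultimately show ?thesis by (rule that)
qed

end

section \<open>Transfer to completed measures and to general test functions\<close>

lemma completion_measurable_AE:
  fixes g h :: "'a \<Rightarrow> real"
  assumes g: "g \<in> borel_measurable M" and ae: "AE x in M. g x = h x"
  shows "h \<in> borel_measurable (completion M)"
proof (rule measurableI)
  fix A :: "real set" assume A: "A \<in> sets borel"
  show "h -` A \<inter> space (completion M) \<in> sets (completion M)"
  proof (rule completion.in_sets_AE)
    show "g -` A \<inter> space M \<in> sets (completion M)" using measurable_sets[OF g A] by auto
    show "AE x in completion M. x \<in> g -` A \<inter> space M \<longleftrightarrow> x \<in> h -` A \<inter> space (completion M)"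
      by (rule AE_completion, use ae in eventually_elim) simp
  qed simp
qed simp

text \<open>The statistics in the statement are only almost surely equal to measurable ones; this
  moves integrals between the completion and \<open>M\<close>.\<close>

lemma completion_transfer:
  fixes g h :: "'a \<Rightarrow> real"
  assumes g: "g \<in> borel_measurable M" and ae: "AE x in M. g x = h x"
  shows "integrable (completion M) h \<longleftrightarrow> integrable M g" "(LINT x|completion M. h x) = (LINT x|M. g x)"
proof -
  note hm = completion_measurable_AE[OF g ae]
  have gm: "g \<in> borel_measurable (completion M)" by (rule measurable_completion[OF g])
  have ae': "AE x in completion M. h x = g x" by (rule AE_completion, use ae in eventually_elim) simp
  show "integrable (completion M) h \<longleftrightarrow> integrable M g"
    using integrable_cong_AE[OF hm gm ae'] integrable_completion[OF g] by simp
  show "(LINT x|completion M. h x) = (LINT x|M. g x)"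
    using integral_cong_AE[OF hm gm ae'] integral_completion[OF g] by simp
qed

text \<open>Truncating the Borel representative at the essential bound makes it bounded at every
  point, as the sums over zeros evaluate it at single points.\<close>

lemma test_function_borel:
  assumes "test_function \<phi>"
  obtains \<psi> C where "integrable lborel \<psi>" "\<And>x. \<bar>\<psi> x\<bar> \<le> C" "AE x in lborel. \<psi> x = \<phi> x" "AE x in lborel. isCont \<phi> x"
proof -
  have int: "integrable lebesgue \<phi>" and cont: "AE x in lebesgue. isCont \<phi> x" using assms by (auto simp: test_function_def)
  obtain C where C: "AE x in lebesgue. \<bar>\<phi> x\<bar> \<le> C" using assms by (auto simp: test_function_def)
  obtain g where g: "g \<in> borel_measurable lborel" "AE x in lborel. \<phi> x = g x"
    using completion_ex_borel_measurable_real[of \<phi> lborel] int by auto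
  define \<psi> where "\<psi> x = max (- \<bar>C\<bar>) (min \<bar>C\<bar> (g x))" for x
  have m: "\<psi> \<in> borel_measurable lborel" unfolding \<psi>_def using g(1) by measurable
  have C': "AE x in lborel. \<bar>\<phi> x\<bar> \<le> C" using C by (simp add: AE_completion_iff)
  have ae: "AE x in lborel. \<psi> x = \<phi> x" using g(2) C' by eventually_elim (auto simp: \<psi>_def)
  have "integrable lborel \<psi>" using completion_transfer(1)[OF m ae] int by simp
  moreover have "\<bar>\<psi> x\<bar> \<le> \<bar>C\<bar>" for x by (auto simp: \<psi>_def)
  moreover have "AE x in lborel. isCont \<phi> x" using cont by (simp only: AE_completion_iff)
  ultimately show ?thesis using ae by (intro that)
qed

lemma tail_norm_tendsto:
  assumes "(tail_norm \<kappa> p \<longlongrightarrow> 0) at_top" "l \<le> p"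
  shows "((deriv ^^ l) \<kappa> \<longlongrightarrow> 0) at_top"
proof -
  have le: "ereal \<bar>(deriv ^^ l) \<kappa> x\<bar> \<le> tail_norm \<kappa> p x" for x
    unfolding tail_norm_def by (rule Sup_upper) (use assms(2) abs_ge_self in blast)
  have "((\<lambda>x. ereal \<bar>(deriv ^^ l) \<kappa> x\<bar>) \<longlongrightarrow> ereal 0) at_top"
  proof (rule tendsto_sandwich)
    show "\<forall>\<^sub>F x in at_top. ereal 0 \<le> ereal \<bar>(deriv ^^ l) \<kappa> x\<bar>" by simp
    show "\<forall>\<^sub>F x in at_top. ereal \<bar>(deriv ^^ l) \<kappa> x\<bar> \<le> tail_norm \<kappa> p x" using le by simp
    show "(tail_norm \<kappa> p \<longlongrightarrow> ereal 0) at_top" using assms(1) by (simp add: zero_ereal_def)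
  qed (rule tendsto_const)
  then have "((\<lambda>x. \<bar>(deriv ^^ l) \<kappa> x\<bar>) \<longlongrightarrow> 0) at_top" by (simp only: lim_ereal)
  then show ?thesis by (simp only: tendsto_rabs_zero_iff)
qed

text \<open>The pair of times \<open>0\<close>, \<open>t - s\<close> is shifted by \<open>s\<close>;
  taking it as a set covers \<open>t = s\<close> as well.\<close>

lemma (in prob_space) stationary_covariance:
  assumes st: "stationary_process M X" and m: "\<And>t. X t \<in> borel_measurable M"
  shows "(LINT w|M. X s w * X t w) = correlation_function M X (t - s)"
proof -
  let ?I = "{0, t - s}"
  let ?q = "\<lambda>x :: real \<Rightarrow> real. x 0 * x (t - s)"
  have q: "?q \<in> borel_measurable (PiM ?I (\<lambda>_. borel))"
    by (intro borel_measurable_times measurable_component_singleton) auto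
  have r: "(\<lambda>w. \<lambda>u\<in>?I. X (u + h) w) \<in> M \<rightarrow>\<^sub>M PiM ?I (\<lambda>_. borel)" for h
    by (intro measurable_restrict m)
  have "(LINT x|distr M (PiM ?I (\<lambda>_. borel)) (\<lambda>w. \<lambda>u\<in>?I. X (u + s) w). ?q x) = (LINT x|distr M (PiM ?I (\<lambda>_. borel)) (\<lambda>w. \<lambda>u\<in>?I. X u w). ?q x)"
    using st unfolding stationary_process_def by simp
  then show ?thesis
    unfolding integral_distr[OF r q] integral_distr[OF r[of 0, simplified] q] by (simp add: correlation_function_def)
qed

context discrete_zero_process
begin

text \<open>\<open>\<psi>\<close> and \<open>\<phi>\<close> differ only on a null set. By the mean
  formula almost surely no zero falls into its dilation by \<open>R\<close>, so the two sums over
  zeros agree term by term after the bijection \<open>x \<mapsto> R * x\<close>.\<close>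

lemma zero_statistic:
  assumes X: "AE w in M. \<forall>t. X t w = f t w" and R: "0 < R"
    and \<psi>: "integrable lborel \<psi>" and ae: "AE x in lborel. \<psi> x = \<phi> x"
  shows "AE w in M. integrable (zero_measure X R w) \<phi> \<and> stat (\<lambda>t. \<psi> (t / R)) w = linear_statistic (zero_measure X R) \<phi> w"
proof -
  have \<psi>R: "integrable lborel (\<lambda>t. \<psi> (t / R))"
    using lborel_integrable_real_affine[OF \<psi>, of "1 / R" 0] R by simp
  obtain N where N: "{x \<in> space lborel. \<not> \<psi> x = \<phi> x} \<subseteq> N" "emeasure lborel N = 0" "N \<in> sets lborel"
    using ae by (rule AE_E)
  have [measurable]: "N \<in> sets borel" using N(3) by simp
  have im: "(\<lambda>t. indicator N (t / R) :: ennreal) \<in> borel_measurable borel" by measurable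
  have "(\<integral>\<^sup>+w. nu w (\<lambda>t. indicator N (t / R)) \<partial>M) = (\<integral>\<^sup>+t. indicator N (t / R) * ennreal (1 / pi) \<partial>lborel)"
    by (rule nu_mean[OF im])
  also have "\<dots> = (\<integral>\<^sup>+t. indicator N (t / R) \<partial>lborel) * ennreal (1 / pi)"
    using im by (intro nn_integral_multc) simp
  also have "(\<integral>\<^sup>+t. indicator N (t / R) \<partial>lborel) = ennreal R * (\<integral>\<^sup>+t. indicator N t \<partial>lborel)"
    using R by (subst nn_integral_real_affine[OF im, of R 0]) auto
  also have "(\<integral>\<^sup>+t. indicator N t \<partial>lborel) = 0" using N by simp
  finally have "(\<integral>\<^sup>+w. nu w (\<lambda>t. indicator N (t / R)) \<partial>M) = 0" by simp
  then have "AE w in M. nu w (\<lambda>t. indicator N (t / R)) = 0"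
    by (subst (asm) nn_integral_0_iff_AE[OF nu_measurable[OF im]])
  then show ?thesis using X stat_AE[OF \<psi>R]
  proof eventually_elim
    case (elim w)
    have zN: "t / R \<notin> N" if "t \<in> zeros w" for t
    proof -
      have "\<forall>t\<in>zeros w. indicator N (t / R) = (0 :: ennreal)"
        using elim(1) unfolding nu_count_space by (subst (asm) nn_integral_0_iff_AE) (auto simp: AE_count_space)
      then show ?thesis using that by (auto split: split_indicator_asm)
    qed
    let ?A = "{x. X (R * x) w = 0}"
    have A: "x \<in> ?A \<longleftrightarrow> R * x \<in> zeros w" for x using elim(2) by (simp add: zeros_def)
    have bij: "bij_betw (\<lambda>x. R * x) ?A (zeros w)"
    proof (rule bij_betwI[where g="\<lambda>t. t / R"])
      show "(\<lambda>x. R * x) \<in> ?A \<rightarrow> zeros w" using A by blast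
      show "(\<lambda>t. t / R) \<in> zeros w \<rightarrow> ?A" using A[of "_ / R"] R by auto
    qed (use R in auto)
    have eq: "\<phi> x = \<psi> (R * x / R)" if "x \<in> ?A" for x
    proof -
      have "x \<notin> N" using zN[of "R * x"] A[of x] that R by simp
      have "\<psi> x = \<phi> x"
      proof (rule ccontr)
        assume "\<psi> x \<noteq> \<phi> x"
        then have "x \<in> {x \<in> space lborel. \<not> \<psi> x = \<phi> x}" by simp
        then show False using N(1) \<open>x \<notin> N\<close> by blast
      qed
      then show ?thesis using R by simp
    qed
    have "integrable (count_space ?A) \<phi> \<longleftrightarrow> integrable (count_space ?A) (\<lambda>x. \<psi> (R * x / R))"
      by (rule Bochner_Integration.integrable_cong) (use eq in auto)
    also have "\<dots> \<longleftrightarrow> integrable (count_space (zeros w)) (\<lambda>t. \<psi> (t / R))" by (rule integrable_bij_count_space[OF bij])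
    finally have 1: "integrable (count_space ?A) \<phi>" using elim(3) by simp
    have "(LINT x|count_space ?A. \<phi> x) = (LINT x|count_space ?A. \<psi> (R * x / R))"
      by (rule Bochner_Integration.integral_cong) (use eq in auto)
    also have "\<dots> = (LINT t|count_space (zeros w). \<psi> (t / R))" by (rule integral_bij_count_space[OF bij])
    finally have "(LINT x|count_space ?A. \<phi> x) = stat (\<lambda>t. \<psi> (t / R)) w" using elim(3) by simp
    then show ?case using 1 by (simp add: zero_measure_def linear_statistic_def)
  qed
qed

lemma m2_zero_measure:
  assumes X: "AE w in M. \<forall>t. X t w = f t w" and R: "0 < R"
    and \<psi>1: "integrable lborel \<psi>1" "\<And>x. \<bar>\<psi>1 x\<bar> \<le> C" "AE x in lborel. \<psi>1 x = \<phi>1 x"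
    and \<psi>2: "integrable lborel \<psi>2" "\<And>x. \<bar>\<psi>2 x\<bar> \<le> C" "AE x in lborel. \<psi>2 x = \<phi>2 x"
  shows "m2_well_defined M (zero_measure X R) \<phi>1 \<phi>2"
    and "m2 M (zero_measure X R) \<phi>1 \<phi>2 = (LINT t|lborel. \<psi>1 (t / R) * \<psi>2 (t / R)) / pi + kernel_form (\<lambda>t. \<psi>1 (t / R)) (\<lambda>t. \<psi>2 (t / R)) / pi\<^sup>2"
proof -
  let ?s1 = "stat (\<lambda>t. \<psi>1 (t / R))" and ?s2 = "stat (\<lambda>t. \<psi>2 (t / R))"
  let ?L = "linear_statistic (zero_measure X R)"
  have i: "integrable lborel (\<lambda>t. \<psi>1 (t / R))" "integrable lborel (\<lambda>t. \<psi>2 (t / R))"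
    using lborel_integrable_real_affine[OF \<psi>1(1), of "1 / R" 0] lborel_integrable_real_affine[OF \<psi>2(1), of "1 / R" 0] R by simp_all
  note z1 = zero_statistic[OF X R \<psi>1(1,3)] and z2 = zero_statistic[OF X R \<psi>2(1,3)]
  note s1 = stat_moments[OF i(1) \<psi>1(2) i(2) \<psi>2(2)] and s2 = stat_moments[OF i(2) \<psi>2(2) i(1) \<psi>1(2)]
  have a1: "AE w in M. ?s1 w = ?L \<phi>1 w" and a2: "AE w in M. ?s2 w = ?L \<phi>2 w"
    using z1 z2 by (eventually_elim, simp)+
  have m1: "mean_statistic M (zero_measure X R) \<phi>1 = (LINT w|M. ?s1 w)" and m2: "mean_statistic M (zero_measure X R) \<phi>2 = (LINT w|M. ?s2 w)"
    unfolding mean_statistic_def by (rule completion_transfer(2)[OF s1(1) a1], rule completion_transfer(2)[OF s2(1) a2])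
  let ?p = "\<lambda>w. (?s1 w - (LINT w|M. ?s1 w)) * (?s2 w - (LINT w|M. ?s2 w))"
  have pm: "?p \<in> borel_measurable M" using s1(1) s2(1) by measurable
  have pa: "AE w in M. ?p w = (?L \<phi>1 w - mean_statistic M (zero_measure X R) \<phi>1) * (?L \<phi>2 w - mean_statistic M (zero_measure X R) \<phi>2)"
    using a1 a2 unfolding m1 m2 by eventually_elim simp
  note sc = stat_covariance[OF i(1) \<psi>1(2) i(2) \<psi>2(2)]
  show "m2 M (zero_measure X R) \<phi>1 \<phi>2 = (LINT t|lborel. \<psi>1 (t / R) * \<psi>2 (t / R)) / pi + kernel_form (\<lambda>t. \<psi>1 (t / R)) (\<lambda>t. \<psi>2 (t / R)) / pi\<^sup>2"
    unfolding m2_def completion_transfer(2)[OF pm pa] by (rule sc(2))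
  have "integrable (completion M) (?L \<phi>1)" "integrable (completion M) (?L \<phi>2)"
    using completion_transfer(1)[OF s1(1) a1] s1(2) completion_transfer(1)[OF s2(1) a2] s2(2) by blast+
  moreover have "AE w in M. integrable (zero_measure X R w) \<phi>1" "AE w in M. integrable (zero_measure X R w) \<phi>2"
    using z1 z2 by (eventually_elim, simp)+
  moreover have "integrable (completion M) (\<lambda>w. (?L \<phi>1 w - mean_statistic M (zero_measure X R) \<phi>1) * (?L \<phi>2 w - mean_statistic M (zero_measure X R) \<phi>2))"
    using completion_transfer(1)[OF pm pa] sc(1) by blast
  ultimately show "m2_well_defined M (zero_measure X R) \<phi>1 \<phi>2" unfolding m2_well_defined_def by simp
qed

lemma m2_asymptotics:
  assumes X: "AE w in M. \<forall>t. X t w = f t w" and t1: "test_function \<phi>1" and t2: "test_function \<phi>2"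
  shows "\<forall>R>0. m2_well_defined M (zero_measure X R) \<phi>1 \<phi>2"
    and "(\<lambda>R. m2 M (zero_measure X R) \<phi>1 \<phi>2 - R * variance_rate * (LINT x|lebesgue. \<phi>1 x * \<phi>2 x)) \<in> o[at_top](\<lambda>R. R)"
proof -
  obtain \<psi>1 C1 where p1: "integrable lborel \<psi>1" "\<And>x. \<bar>\<psi>1 x\<bar> \<le> C1" "AE x in lborel. \<psi>1 x = \<phi>1 x"
    using test_function_borel[OF t1] by metis
  obtain \<psi>2 C2 where p2: "integrable lborel \<psi>2" "\<And>x. \<bar>\<psi>2 x\<bar> \<le> C2" "AE x in lborel. \<psi>2 x = \<phi>2 x" "AE x in lborel. isCont \<phi>2 x"
    using test_function_borel[OF t2] by metis
  have b: "\<bar>\<psi>1 x\<bar> \<le> max C1 C2" "\<bar>\<psi>2 x\<bar> \<le> max C1 C2" for x using p1(2)[of x] p2(2)[of x] by auto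
  note m = m2_zero_measure[OF X _ p1(1) b(1) p1(3) p2(1) b(2) p2(3)]
  show "\<forall>R>0. m2_well_defined M (zero_measure X R) \<phi>1 \<phi>2" using m(1) by blast
  have pm: "(\<lambda>x. \<psi>1 x * \<psi>2 x) \<in> borel_measurable lborel" using p1(1) p2(1) by measurable
  have "AE x in lborel. \<psi>1 x * \<psi>2 x = \<phi>1 x * \<phi>2 x" using p1(3) p2(3) by eventually_elim simp
  from completion_transfer(2)[OF pm this] have I: "(LINT x|lebesgue. \<phi>1 x * \<phi>2 x) = (LINT x|lborel. \<psi>1 x * \<psi>2 x)" .
  let ?V = "\<lambda>R. ((LINT t|lborel. \<psi>1 (t / R) * \<psi>2 (t / R)) / pi + kernel_form (\<lambda>t. \<psi>1 (t / R)) (\<lambda>t. \<psi>2 (t / R)) / pi\<^sup>2) / R"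
  have lim0: "((\<lambda>R. ?V R - variance_rate * (LINT x|lborel. \<psi>1 x * \<psi>2 x)) \<longlongrightarrow> variance_rate * (LINT x|lborel. \<psi>1 x * \<psi>2 x) - variance_rate * (LINT x|lborel. \<psi>1 x * \<psi>2 x)) at_top"
    by (intro tendsto_diff tendsto_const covariance_asymptotics[OF p1(1) p2(1) b(2) p2(3,4)])
  have ev: "\<forall>\<^sub>F R in at_top. ?V R - variance_rate * (LINT x|lborel. \<psi>1 x * \<psi>2 x)
      = (m2 M (zero_measure X R) \<phi>1 \<phi>2 - R * variance_rate * (LINT x|lebesgue. \<phi>1 x * \<phi>2 x)) / R"
    using eventually_gt_at_top[of "0::real"]
  proof eventually_elim
    case (elim R)
    show ?case unfolding m(2)[OF elim] I using elim by (simp add: diff_divide_distrib)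
  qed
  have lim: "((\<lambda>R. (m2 M (zero_measure X R) \<phi>1 \<phi>2 - R * variance_rate * (LINT x|lebesgue. \<phi>1 x * \<phi>2 x)) / R) \<longlongrightarrow> 0) at_top"
    using lim0 tendsto_cong[OF ev] by simp
  show "(\<lambda>R. m2 M (zero_measure X R) \<phi>1 \<phi>2 - R * variance_rate * (LINT x|lebesgue. \<phi>1 x * \<phi>2 x)) \<in> o[at_top](\<lambda>R. R)"
    by (rule smalloI_tendsto[OF lim], use eventually_gt_at_top[of "0::real"] in eventually_elim) simp
qed

end

text \<open>Several conjuncts exclude default values: \<open>m2_well_defined\<close> makes all sums
  and expectations converge, no denominator in the formula vanishes, \<open>arcsin\<close> is
  evaluated inside its domain, and the integral for \<open>\<sigma>\<^sup>2\<close> is absolutely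
  convergent.\<close>

theorem proposition1p11:
  fixes M :: "'a measure" and f :: "real \<Rightarrow> 'a \<Rightarrow> real" and \<kappa> :: "real \<Rightarrow> real"
  assumes "prob_space M"
    and "gaussian_process M f" and "centered_process M f" and "stationary_process M f"
    and "class_C M 2 f"
    and "\<kappa> = correlation_function M f"
    and "normalized \<kappa>"
    and "integrable lborel (\<lambda>x. (\<kappa> x)\<^sup>2)"
    and "integrable lborel (\<lambda>x. ((deriv ^^ 2) \<kappa> x)\<^sup>2)"
    and "(tail_norm \<kappa> 2 \<longlongrightarrow> 0) at_top"
  shows "\<exists>\<sigma>>0.
    (\<forall>\<phi>1 \<phi>2. test_function \<phi>1 \<longrightarrow> test_function \<phi>2 \<longrightarrow>
       (\<forall>R>0. m2_well_defined M (zero_measure f R) \<phi>1 \<phi>2) \<and>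
       (\<lambda>R. m2 M (zero_measure f R) \<phi>1 \<phi>2 - R * \<sigma>\<^sup>2 * (LINT x|lebesgue. \<phi>1 x * \<phi>2 x))
         \<in> o[at_top](\<lambda>R. R)) \<and>
    (\<forall>t>0. (\<kappa> t)\<^sup>2 < 1 \<and> 1 - (\<kappa> t)\<^sup>2 - (deriv \<kappa> t)\<^sup>2 \<noteq> 0 \<and> a_fun \<kappa> t \<in> {-1..1}) \<and>
    set_integrable lborel {0<..} (sigma_integrand \<kappa>) \<and>
    \<sigma>\<^sup>2 = 1 / pi + 2 / pi\<^sup>2 * (LINT t:{0<..}|lborel. sigma_integrand \<kappa> t)"
proof -
  interpret prob_space M by (rule assms(1))
  have d2: "(deriv ^^ 2) \<kappa> = deriv (deriv \<kappa>)" by (simp add: numeral_2_eq_2)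
  have fm: "f t \<in> borel_measurable M" for t
    using span_set_gauss[OF assms(2,3) span_set_base, of t] by (auto simp: gauss_rv_def)
  \<comment> \<open>Two successive modifications: \<open>f0\<close> has regular paths, and
    \<open>g\<close> below has locally finite zero sets in addition. Each agrees with
    \<open>f\<close> at all times simultaneously off a null event, so the zero sets are the same
    there.\<close>
  obtain f0 f0' where f0: "gauss_path M (gauss_closure f) f0 f0'" "AE \<omega> in M. \<forall>t. f t \<omega> = f0 t \<omega>"
    "\<And>\<omega>. \<exists>d. ((\<lambda>t. f0' t \<omega>) has_real_derivative d) (at 0)"
    using regular_version[OF assms(2,3,5)] by blast
  interpret gp: gauss_path M "gauss_closure f" f0 f0' by (rule f0(1))
  have cov: "gp.cov (f0 s) (f0 t) = \<kappa> (t - s)" for s t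
  proof -
    have "gp.cov (f0 s) (f0 t) = (LINT \<omega>|M. f s \<omega> * f t \<omega>)" unfolding gp.cov_def
    proof (rule integral_cong_AE)
      show "AE \<omega> in M. f0 s \<omega> * f0 t \<omega> = f s \<omega> * f t \<omega>" using f0(2) by eventually_elim simp
    qed (use fm gp.X_meas in measurable)
    then show ?thesis using stationary_covariance[OF assms(4) fm] assms(6) by simp
  qed
  have lims: "(\<kappa> \<longlongrightarrow> 0) at_top" "(deriv \<kappa> \<longlongrightarrow> 0) at_top" "(deriv (deriv \<kappa>) \<longlongrightarrow> 0) at_top"
    using tail_norm_tendsto[OF assms(10), of 0] tail_norm_tendsto[OF assms(10), of 1] tail_norm_tendsto[OF assms(10), of 2] by (simp_all add: d2)
  have sp: "stationary_path M (gauss_closure f) f0 f0' \<kappa>" by unfold_locales (rule cov)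
  have np: "normalized_path M (gauss_closure f) f0 f0' \<kappa>"
  proof (rule normalized_path.intro[OF sp], rule normalized_path_axioms.intro)
    show "\<kappa> 0 = 1" "deriv (deriv \<kappa>) 0 = - 1" using assms(7) unfolding normalized_def d2 by simp_all
    show "integrable lborel (\<lambda>x. (deriv (deriv \<kappa>) x)\<^sup>2)" using assms(9) unfolding d2 .
    show "Z \<in> gauss_closure f" if "Y \<in> gauss_closure f" "AE \<omega> in M. Y \<omega> = Z \<omega>" "Z \<in> borel_measurable M" for Y Z
      by (rule gauss_closure_AE[OF that])
  qed (rule f0(3) lims assms(8))+
  obtain g g' where dz: "discrete_zero_process M (gauss_closure f) g g' \<kappa> (deriv \<kappa>) (deriv (deriv \<kappa>))" and g: "AE \<omega> in M. \<forall>t. f0 t \<omega> = g t \<omega>"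
    using normalized_path.discrete_version[OF np] by blast
  interpret d: discrete_zero_process M "gauss_closure f" g g' \<kappa> "deriv \<kappa>" "deriv (deriv \<kappa>)" by (rule dz)
  have X: "AE \<omega> in M. \<forall>t. f t \<omega> = g t \<omega>" using f0(2) g by eventually_elim simp
  have a: "a_fun \<kappa> t = d.A t" for t unfolding a_fun_def d.A_def d2 ..
  have F: "sigma_integrand \<kappa> = d.F"
    by (rule ext) (simp add: sigma_integrand_def d.F_def d.pair_corr_def abs_corr_def a)
  define \<sigma> where "\<sigma> = sqrt d.variance_rate"
  have \<sigma>: "0 < \<sigma>" "\<sigma>\<^sup>2 = d.variance_rate" using d.variance_rate_pos by (simp_all add: \<sigma>_def)
  have ta: "(\<kappa> t)\<^sup>2 < 1 \<and> 1 - (\<kappa> t)\<^sup>2 - (deriv \<kappa> t)\<^sup>2 \<noteq> 0 \<and> a_fun \<kappa> t \<in> {-1..1}" if "0 < t" for t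
  proof -
    have "\<bar>d.A t\<bar> \<le> 1" unfolding d.A_def by (rule d.a_bound[OF that])
    then have "d.A t \<in> {-1..1}" by auto
    then show ?thesis using d.\<kappa>_sq_less[OF that] d.D_pos[OF that] unfolding a by simp
  qed
  have s: "\<sigma>\<^sup>2 = 1 / pi + 2 / pi\<^sup>2 * (LINT t:{0<..}|lborel. sigma_integrand \<kappa> t)"
    unfolding \<sigma>(2) d.variance_rate_def F d.F_half(2) by simp
  have si: "set_integrable lborel {0<..} (sigma_integrand \<kappa>)" unfolding F by (rule d.F_half(1))
  have m: "(\<forall>R>0. m2_well_defined M (zero_measure f R) \<phi>1 \<phi>2) \<and>
       (\<lambda>R. m2 M (zero_measure f R) \<phi>1 \<phi>2 - R * \<sigma>\<^sup>2 * (LINT x|lebesgue. \<phi>1 x * \<phi>2 x)) \<in> o[at_top](\<lambda>R. R)"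
    if "test_function \<phi>1" "test_function \<phi>2" for \<phi>1 \<phi>2
    unfolding \<sigma>(2) by (intro conjI d.m2_asymptotics[OF X that])
  show ?thesis using \<sigma>(1) m ta si s by blast
qed

end
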